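(* Let $m_1,m_2,m_3\in\mathbb N$ and $m=m_1+m_2+m_3$. Then $$|\mathcal{DB}|=|NC_2(m_1,m_2,m_3)|-|\mathcal{UC}_{2,4}|-|\mathcal T_{2,4,4}|-2|\mathcal{UL}_{2,4}|-2|\mathcal T_{2,6}|,$$ where $\mathcal T_{2,6},\mathcal T_{2,4,4},\mathcal{UL}_{2,4},\mathcal{UC}_{2,4},\mathcal{DB}$ are the sets of partitions $\pi$ of $[m]$ whose quotient graph $T^\pi_{m_1,m_2,m_3}$ is respectively of $2$-$6$ tree type, $2$-$4$-$4$ tree type, $2$-$4$ uniloop type, $2$-$4$ unicircuit type and double bicircuit type.
   Context: **Pairings.** $\gamma=\gamma_{m_1,m_2,m_3}$ is the permutation of $[m]$ with three cycles, the $j$-th being $[\![m_j]\!]=(m_1+\cdots+m_{j-1}+1,\dots,m_1+\cdots+m_j)$. With $\#$ the number of cycles/blocks and $|\tau|=m-\#(\tau)$, $NC_2(m_1,m_2,m_3)$ is the set of $\sigma\in S_m$ all of whose cycles have 2 elements, with $|\sigma|+|\sigma^{-1}\gamma|=|\gamma|+4$ and $\sigma\vee\gamma=1_m$ (join of cycle partitions equal to the one-block partition). **Graphs.** $T_{m_1,m_2,m_3}$ is the oriented graph with vertex set $[m]$ and edges $e_1,\dots,e_m$, $e_i$ going from $\gamma(i)$ to $i$; it is the disjoint union of three basic cycles $T_{m_1},T_{m_2},T_{m_3}$, and $E_j=\{e_i:i\in[\![m_j]\!]\}$. For a partition $\pi$ of $[m]$, the quotient graph $T^\pi=T^\pi_{m_1,m_2,m_3}$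 has the blocks of $\pi$ as vertices and edges $e_1,\dots,e_m$, $e_i$ going from the block of $\gamma(i)$ to the block of $i$ (loops and multiple edges allowed). For $J\subset\{1,2,3\}$, $T^\pi_{m_j,\,j\in J}$ is the quotient of $\bigcup_{j\in J}T_{m_j}$ by the restriction of $\pi$. Two edges are equivalent if they join the same unordered pair of vertices; the multiplicity of a class is its cardinality. Equivalent edges have opposite orientations if the source of each is the target of the other (two loops at a vertex satisfy this). The elementarization $\overline{T^\pi}$ is the unoriented graph with the same vertices and with edges the equivalence classes. $\overline\pi$ is the partition of $[m]$ with $u\sim v$ iff $e_u,e_v$ are equivalent. A circuit is a connected subgraph all of whose vertices have degree 2 (a loop contributes 2). *Double tree*: $T^\pi_{m_j}$ is a double tree if $\overline{T^\pi_{m_j}}$ is a tree and every edge has multiplicity 2, consisting of two edges with opposite orientations (a single vertex without edges also counts). *Double unicircuit graph*: $T^\pi_{m_j,m_k}$ is a double unicircuit graph if $\overline{T^\pi_{m_j,m_k}}$ is connected with exactly one circuit, every edge has multiplicity 2 and consists of two edges with opposite orientations, and every edge of the circuit consists of one edge from $E_j$ and one from $E_k$. *Types* (only the vertex identifications generated by the described gluing occur between the pieces; $\{i,j,k\}=\{1,2,3\}$ arbitrary): - *$2$-$6$ tree type*: $T^\pi_{m_1},T^\pi_{m_2},T^\pi_{m_3}$ are double trees and $T^\pi$ is obtained by joining the three along one and the same edge (of multiplicity 6 in $\overline{T^\pi}$). - *$2$-$4$-$4$ tree type*: $T^\pi_{m_1},T^\pi_{m_2},T^\pi_{m_3}$ are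 double trees and $T^\pi$ is obtained by joining them along two distinct edges, each of multiplicity 4 in $\overline{T^\pi}$ (an edge of one tree $T^\pi_{m_j}$ is glued to an edge of $T^\pi_{m_i}$, and a different edge of $T^\pi_{m_j}$ is glued to an edge of $T^\pi_{m_k}$). - *$2$-$4$ uniloop type*: some $T^\pi_{m_i}$ has two loops at the same vertex and removing them leaves a double tree; $T^\pi_{m_j,m_k}$ is a double unicircuit graph whose circuit is a loop; and $T^\pi$ is obtained by joining $T^\pi_{m_i}$ and $T^\pi_{m_j,m_k}$ at the vertices carrying the loops. - *$2$-$4$ unicircuit type*: some $T^\pi_{m_i}$ is a double tree, $T^\pi_{m_j,m_k}$ is a double unicircuit graph, and $T^\pi$ is obtained by joining them along some edge. - *Double bicircuit type*: $\#(\pi)-\#(\overline\pi)=-1$, $\#(\overline\pi)-m/2=0$ and $C_\pi\ne0$ (not identically zero in $N$), where $C_\pi=\sum_{i:[m]\to[N],\ \ker(i)=\pi}N^{-m/2+1}k_3(r_1,r_2,r_3)$, $r_j=\prod_{v\in[\![m_j]\!]}x_{i(v),i(\gamma(v))}$, $k_3$ is the third classical joint cumulant, $\ker(i)$ is the partition with $u\sim v$ iff $i(u)=i(v)$, and $x_{i,j}$ are the entries of a fixed complex Wigner ensemble. **Wigner ensemble.** A complex Wigner matrix is a self-adjoint $N\times N$ random matrix $\frac1{\sqrt N}(x_{i,j})$ such that: the entries are complex random variables with $x_{i,j}=\overline{x_{j,i}}$; $\{x_{i,j}\}_{i<j}\cup\{x_{i,i}\}_i$ are independent; $\{x_{i,j}\}_{i<j}$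 are identically distributed; $\{x_{i,i}\}_i$ are identically distributed; $E(x_{i,j})=0$ for all $i,j$; $E(x_{i,j}^2)=0$ for $i\ne j$; $E(|x_{i,j}|^2)=1$ for all $i,j$; $k_3(x_{i,i},x_{i,i},x_{i,i})=0$ for all $i$; all absolute moments are finite. A Wigner ensemble has one such matrix for each $N$. *)

theory Defs
  imports
    "HOL-Probability.Probability"
    "HOL-Library.Disjoint_Sets"
    "HOL-Combinatorics.Orbits"
    "HOL-Combinatorics.Cycles"
    "Graph_Theory.Digraph"
begin

section \<open>Set partitions\<close>

text \<open>The finest partition of \<open>A\<close> in which any two elements related by \<open>R\<close> lie in the same block.\<close>

definition generated_partition :: "'a set \<Rightarrow> ('a \<times> 'a) set \<Rightarrow> 'a set set" where
  "generated_partition A R =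
     A // {(a, b). a \<in> A \<and> b \<in> A \<and> (a, b) \<in> (R \<union> converse R)\<^sup>*}"

definition same_block :: "'a set set \<Rightarrow> ('a \<times> 'a) set" where
  "same_block P = {(a, b). \<exists>B\<in>P. a \<in> B \<and> b \<in> B}"

definition partition_join :: "'a set \<Rightarrow> 'a set set \<Rightarrow> 'a set set \<Rightarrow> 'a set set" where
  "partition_join A P Q = generated_partition A (same_block P \<union> same_block Q)"

definition restrict_partition :: "'a set set \<Rightarrow> 'a set \<Rightarrow> 'a set set" where
  "restrict_partition P I = (\<inter>) I ` P - {{}}"

definition block :: "'a set set \<Rightarrow> 'a \<Rightarrow> 'a set" where
  "block P a = (THE B. B \<in> P \<and> a \<in> B)"

definition kernel_partition :: "'a set \<Rightarrow> ('a \<Rightarrow> 'b) \<Rightarrow> 'a set set" where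
  "kernel_partition A f = A // {(u, v). u \<in> A \<and> v \<in> A \<and> f u = f v}"


section \<open>Cycles of permutations\<close>

definition cycle_partition :: "'a set \<Rightarrow> ('a \<Rightarrow> 'a) \<Rightarrow> 'a set set" where
  "cycle_partition A \<sigma> = orbit \<sigma> ` A"

definition perm_length :: "'a set \<Rightarrow> ('a \<Rightarrow> 'a) \<Rightarrow> int" where
  "perm_length A \<sigma> = int (card A) - int (card (cycle_partition A \<sigma>))"


section \<open>Unoriented graphs\<close>

text \<open>\<open>uends e\<close> is the set of endpoints of the edge \<open>e\<close>; it is a singleton when \<open>e\<close> is a loop.\<close>

record ('v, 'e) ugraph =
  uverts :: "'v set"
  uedges :: "'e set"
  uends :: "'e \<Rightarrow> 'v set"

definition uconnected :: "('v, 'e) ugraph \<Rightarrow> bool" where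
  "uconnected H \<longleftrightarrow> uverts H \<noteq> {} \<and>
     (\<forall>a\<in>uverts H. \<forall>b\<in>uverts H. (a, b) \<in> {(a, b). \<exists>e\<in>uedges H. uends H e = {a, b}}\<^sup>*)"

definition udegree :: "('v, 'e) ugraph \<Rightarrow> 'v \<Rightarrow> nat" where
  "udegree H v = card {e \<in> uedges H. v \<in> uends H e} + card {e \<in> uedges H. uends H e = {v}}"

definition usubgraph :: "('v, 'e) ugraph \<Rightarrow> ('v, 'e) ugraph \<Rightarrow> bool" where
  "usubgraph K H \<longleftrightarrow> uverts K \<subseteq> uverts H \<and> uedges K \<subseteq> uedges H \<and> uends K = uends H \<and>
     (\<forall>e\<in>uedges K. uends K e \<subseteq> uverts K)"

definition circuits :: "('v, 'e) ugraph \<Rightarrow> ('v, 'e) ugraph set" where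
  "circuits H = {K. usubgraph K H \<and> uconnected K \<and> (\<forall>v\<in>uverts K. udegree K v = 2)}"

definition utree :: "('v, 'e) ugraph \<Rightarrow> bool" where
  "utree H \<longleftrightarrow> uconnected H \<and> circuits H = {}"


section \<open>Oriented multigraphs and their elementarizations\<close>

definition equivalent_arcs :: "('v, 'e) pre_digraph \<Rightarrow> ('e \<times> 'e) set" where
  "equivalent_arcs G = {(a, b). a \<in> arcs G \<and> b \<in> arcs G \<and>
     {tail G a, head G a} = {tail G b, head G b}}"

definition arc_classes :: "('v, 'e) pre_digraph \<Rightarrow> 'e set set" where
  "arc_classes G = arcs G // equivalent_arcs G"

definition arc_multiplicity :: "('v, 'e) pre_digraph \<Rightarrow> 'e \<Rightarrow> nat" where
  "arc_multiplicity G a = card (equivalent_arcs G `` {a})"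

definition elementarization :: "('v, 'e) pre_digraph \<Rightarrow> ('v, 'e set) ugraph" where
  "elementarization G =
     \<lparr>uverts = verts G, uedges = arc_classes G, uends = (\<lambda>C. \<Union>a\<in>C. {tail G a, head G a})\<rparr>"

definition opposite_arcs :: "('v, 'e) pre_digraph \<Rightarrow> 'e \<Rightarrow> 'e \<Rightarrow> bool" where
  "opposite_arcs G a b \<longleftrightarrow> tail G a = head G b \<and> tail G b = head G a"

definition loop_arc :: "('v, 'e) pre_digraph \<Rightarrow> 'e \<Rightarrow> bool" where
  "loop_arc G a \<longleftrightarrow> a \<in> arcs G \<and> tail G a = head G a"

definition all_arcs_doubled :: "('v, 'e) pre_digraph \<Rightarrow> bool" where
  "all_arcs_doubled G \<longleftrightarrow>
     (\<forall>C\<in>arc_classes G. card C = 2 \<and> (\<forall>a\<in>C. \<forall>b\<in>C. a \<noteq> b \<longrightarrow> opposite_arcs G a b))"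

definition double_tree :: "('v, 'e) pre_digraph \<Rightarrow> bool" where
  "double_tree G \<longleftrightarrow> utree (elementarization G) \<and> all_arcs_doubled G"

text \<open>\<open>E\<close> and \<open>F\<close> are the arc sets of the two basic cycles of which \<open>G\<close> is a quotient.\<close>

definition double_unicircuit :: "('v, 'e) pre_digraph \<Rightarrow> 'e set \<Rightarrow> 'e set \<Rightarrow> bool" where
  "double_unicircuit G E F \<longleftrightarrow> uconnected (elementarization G) \<and> all_arcs_doubled G \<and>
     (\<exists>K. circuits (elementarization G) = {K} \<and>
       (\<forall>C\<in>uedges K. card (C \<inter> E) = 1 \<and> card (C \<inter> F) = 1))"


section \<open>Complex Wigner ensembles\<close>

definition third_cumulant ::
    "'w measure \<Rightarrow> ('w \<Rightarrow> complex) \<Rightarrow> ('w \<Rightarrow> complex) \<Rightarrow> ('w \<Rightarrow> complex) \<Rightarrow> complex" where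
  "third_cumulant M X Y Z =
     (LINT \<omega>|M. X \<omega> * Y \<omega> * Z \<omega>)
     - (LINT \<omega>|M. X \<omega>) * (LINT \<omega>|M. Y \<omega> * Z \<omega>)
     - (LINT \<omega>|M. Y \<omega>) * (LINT \<omega>|M. X \<omega> * Z \<omega>)
     - (LINT \<omega>|M. Z \<omega>) * (LINT \<omega>|M. X \<omega> * Y \<omega>)
     + 2 * (LINT \<omega>|M. X \<omega>) * (LINT \<omega>|M. Y \<omega>) * (LINT \<omega>|M. Z \<omega>)"

text \<open>The \<open>x i j\<close> with \<open>i, j \<in> {1..N}\<close> are the entries before the normalization by
  \<open>1 / sqrt N\<close>.\<close>

locale complex_wigner_matrix = prob_space M
  for M :: "'w measure" and N :: nat and x :: "nat \<Rightarrow> nat \<Rightarrow> 'w \<Rightarrow> complex" +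
  assumes entries_measurable:
      "i \<in> {1..N} \<Longrightarrow> j \<in> {1..N} \<Longrightarrow> random_variable borel (x i j)"
    and entries_selfadjoint:
      "i \<in> {1..N} \<Longrightarrow> j \<in> {1..N} \<Longrightarrow> \<omega> \<in> space M \<Longrightarrow> x i j \<omega> = cnj (x j i \<omega>)"
    and entries_indep:
      "indep_vars (\<lambda>_. borel) (\<lambda>(i, j). x i j) {(i, j). i \<in> {1..N} \<and> j \<in> {1..N} \<and> i \<le> j}"
    and offdiagonal_identically_distributed:
      "{i, j, k, l} \<subseteq> {1..N} \<Longrightarrow> i < j \<Longrightarrow> k < l \<Longrightarrow>
       distr M borel (x i j) = distr M borel (x k l)"
    and diagonal_identically_distributed:
      "i \<in> {1..N} \<Longrightarrow> k \<in> {1..N} \<Longrightarrow> distr M borel (x i i) = distr M borel (x k k)"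
    and entries_centered:
      "i \<in> {1..N} \<Longrightarrow> j \<in> {1..N} \<Longrightarrow> expectation (x i j) = 0"
    and offdiagonal_square:
      "i \<in> {1..N} \<Longrightarrow> j \<in> {1..N} \<Longrightarrow> i \<noteq> j \<Longrightarrow> expectation (\<lambda>\<omega>. (x i j \<omega>)\<^sup>2) = 0"
    and entries_variance:
      "i \<in> {1..N} \<Longrightarrow> j \<in> {1..N} \<Longrightarrow> expectation (\<lambda>\<omega>. (cmod (x i j \<omega>))\<^sup>2) = 1"
    and diagonal_third_cumulant:
      "i \<in> {1..N} \<Longrightarrow> third_cumulant M (x i i) (x i i) (x i i) = 0"
    and absolute_moments_finite:
      "i \<in> {1..N} \<Longrightarrow> j \<in> {1..N} \<Longrightarrow> integrable M (\<lambda>\<omega>. (cmod (x i j \<omega>)) ^ p)"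

text \<open>Matrices of different sizes may live on different probability spaces.\<close>

definition complex_wigner_ensemble ::
    "(nat \<Rightarrow> 'w measure) \<Rightarrow> (nat \<Rightarrow> nat \<Rightarrow> nat \<Rightarrow> 'w \<Rightarrow> complex) \<Rightarrow> bool" where
  "complex_wigner_ensemble M x \<longleftrightarrow> (\<forall>N\<ge>1. complex_wigner_matrix (M N) N (x N))"


section \<open>Three cycles\<close>

text \<open>Gluing the arc \<open>a\<close> to the arc \<open>b\<close> identifies their endpoints in one of two ways. In a
  quotient graph the endpoints of \<open>a\<close> are the blocks of \<open>\<gamma> a\<close> and \<open>a\<close>, so an identification of
  vertices is given by pairs of representatives.\<close>

definition arc_gluings :: "('a \<Rightarrow> 'a) \<Rightarrow> 'a \<Rightarrow> 'a \<Rightarrow> ('a \<times> 'a) set set" where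
  "arc_gluings \<gamma> a b = {{(\<gamma> a, \<gamma> b), (a, b)}, {(\<gamma> a, b), (a, \<gamma> b)}}"

context
  fixes m1 m2 m3 :: nat
begin

definition ground :: "nat set" where
  "ground = {1..m1 + m2 + m3}"

definition seg :: "nat \<Rightarrow> nat set" where
  "seg j = (if j = 1 then {1..m1}
            else if j = 2 then {m1 + 1..m1 + m2}
            else {m1 + m2 + 1..m1 + m2 + m3})"

definition gam :: "nat \<Rightarrow> nat" where
  "gam = cycle_of_list [1..<m1 + 1] \<circ> cycle_of_list [m1 + 1..<m1 + m2 + 1] \<circ>
         cycle_of_list [m1 + m2 + 1..<m1 + m2 + m3 + 1]"

definition NC2 :: "(nat \<Rightarrow> nat) set" where
  "NC2 = {\<sigma>. \<sigma> permutes ground \<and>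
     (\<forall>B\<in>cycle_partition ground \<sigma>. card B = 2) \<and>
     perm_length ground \<sigma> + perm_length ground (inv \<sigma> \<circ> gam) = perm_length ground gam + 4 \<and>
     partition_join ground (cycle_partition ground \<sigma>) (cycle_partition ground gam) = {ground}}"

text \<open>The quotient by \<open>\<pi>\<close> of the union of the basic cycles with arc set \<open>I\<close>, where \<open>I\<close> is a union
  of sets \<open>seg j\<close>; the arc \<open>e\<^sub>v\<close> is represented by \<open>v\<close>.\<close>

definition quotient_graph :: "nat set set \<Rightarrow> nat set \<Rightarrow> (nat set, nat) pre_digraph" where
  "quotient_graph \<pi> I =
     \<lparr>verts = restrict_partition \<pi> I, arcs = I,
      tail = (\<lambda>v. block (restrict_partition \<pi> I) (gam v)),
      head = (\<lambda>v. block (restrict_partition \<pi> I) v)\<rparr>"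

text \<open>The graph of \<open>\<pi>\<close> is obtained from its restrictions to the pieces in \<open>\<I>\<close> by performing
  the identifications \<open>R\<close>, and no others than those generated by \<open>R\<close>.\<close>

definition glued_from :: "nat set set \<Rightarrow> nat set set \<Rightarrow> (nat \<times> nat) set \<Rightarrow> bool" where
  "glued_from \<pi> \<I> R \<longleftrightarrow>
     \<pi> = generated_partition ground ((\<Union>I\<in>\<I>. same_block (restrict_partition \<pi> I)) \<union> R)"

definition tree_2_6_type :: "nat set set \<Rightarrow> bool" where
  "tree_2_6_type \<pi> \<longleftrightarrow>
     (\<forall>j\<in>{1, 2, 3}. double_tree (quotient_graph \<pi> (seg j))) \<and>
     (\<exists>a\<in>seg 1. \<exists>b\<in>seg 2. \<exists>c\<in>seg 3. \<exists>R\<in>arc_gluings gam a b. \<exists>S\<in>arc_gluings gam a c.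
        glued_from \<pi> {seg 1, seg 2, seg 3} (R \<union> S) \<and>
        arc_multiplicity (quotient_graph \<pi> ground) a = 6)"

definition tree_2_4_4_type :: "nat set set \<Rightarrow> bool" where
  "tree_2_4_4_type \<pi> \<longleftrightarrow>
     (\<forall>j\<in>{1, 2, 3}. double_tree (quotient_graph \<pi> (seg j))) \<and>
     (\<exists>i j k. {i, j, k} = {1, 2, 3} \<and>
       (\<exists>a\<in>seg j. \<exists>b\<in>seg i. \<exists>a'\<in>seg j. \<exists>c\<in>seg k.
        \<exists>R\<in>arc_gluings gam a b. \<exists>S\<in>arc_gluings gam a' c.
          (a, a') \<notin> equivalent_arcs (quotient_graph \<pi> (seg j)) \<and>
          glued_from \<pi> {seg 1, seg 2, seg 3} (R \<union> S) \<and>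
          arc_multiplicity (quotient_graph \<pi> ground) a = 4 \<and>
          arc_multiplicity (quotient_graph \<pi> ground) a' = 4))"

definition uniloop_2_4_type :: "nat set set \<Rightarrow> bool" where
  "uniloop_2_4_type \<pi> \<longleftrightarrow>
     (\<exists>i j k. {i, j, k} = {1, 2, 3} \<and>
       (let G = quotient_graph \<pi> (seg i); H = quotient_graph \<pi> (seg j \<union> seg k) in
         (\<exists>K. circuits (elementarization H) = {K} \<and>
            (\<exists>C. uedges K = {C} \<and> card (uends K C) = 1)) \<and>
         double_unicircuit H (seg j) (seg k) \<and>
         (\<exists>a b c. a \<noteq> b \<and> loop_arc G a \<and> loop_arc G b \<and> head G a = head G b \<and>
            double_tree (pre_digraph.del_arc (pre_digraph.del_arc G a) b) \<and>
            loop_arc H c \<and>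
            glued_from \<pi> {seg i, seg j \<union> seg k} {(a, c)})))"

definition unicircuit_2_4_type :: "nat set set \<Rightarrow> bool" where
  "unicircuit_2_4_type \<pi> \<longleftrightarrow>
     (\<exists>i j k. {i, j, k} = {1, 2, 3} \<and>
       double_tree (quotient_graph \<pi> (seg i)) \<and>
       double_unicircuit (quotient_graph \<pi> (seg j \<union> seg k)) (seg j) (seg k) \<and>
       (\<exists>a\<in>seg i. \<exists>b\<in>seg j \<union> seg k. \<exists>R\<in>arc_gluings gam a b.
          glued_from \<pi> {seg i, seg j \<union> seg k} R))"

definition T26 :: "nat set set set" where
  "T26 = {\<pi>. partition_on ground \<pi> \<and> tree_2_6_type \<pi>}"

definition T244 :: "nat set set set" where
  "T244 = {\<pi>. partition_on ground \<pi> \<and> tree_2_4_4_type \<pi>}"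

definition UL24 :: "nat set set set" where
  "UL24 = {\<pi>. partition_on ground \<pi> \<and> uniloop_2_4_type \<pi>}"

definition UC24 :: "nat set set set" where
  "UC24 = {\<pi>. partition_on ground \<pi> \<and> unicircuit_2_4_type \<pi>}"

definition C_coeff ::
    "(nat \<Rightarrow> 'w measure) \<Rightarrow> (nat \<Rightarrow> nat \<Rightarrow> nat \<Rightarrow> 'w \<Rightarrow> complex) \<Rightarrow> nat set set \<Rightarrow> nat \<Rightarrow> complex"
  where
  "C_coeff M x \<pi> N =
     (\<Sum>i \<in> {i \<in> ground \<rightarrow>\<^sub>E {1..N}. kernel_partition ground i = \<pi>}.
        let r = (\<lambda>j \<omega>. \<Prod>v\<in>seg j. x N (i v) (i (gam v)) \<omega>) in
        complex_of_real (real N powr (- real (m1 + m2 + m3) / 2 + 1)) *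
        third_cumulant (M N) (r 1) (r 2) (r 3))"

text \<open>\<open>arc_classes (quotient_graph \<pi> ground)\<close> is the partition written \<open>\<pi>\<close> with a bar in the
  literature.\<close>

definition double_bicircuit_type ::
    "(nat \<Rightarrow> 'w measure) \<Rightarrow> (nat \<Rightarrow> nat \<Rightarrow> nat \<Rightarrow> 'w \<Rightarrow> complex) \<Rightarrow> nat set set \<Rightarrow> bool" where
  "double_bicircuit_type M x \<pi> \<longleftrightarrow>
     int (card \<pi>) - int (card (arc_classes (quotient_graph \<pi> ground))) = - 1 \<and>
     real (card (arc_classes (quotient_graph \<pi> ground))) - real (m1 + m2 + m3) / 2 = 0 \<and>
     (\<exists>N\<ge>1. C_coeff M x \<pi> N \<noteq> 0)"

definition DB ::
    "(nat \<Rightarrow> 'w measure) \<Rightarrow> (nat \<Rightarrow> nat \<Rightarrow> nat \<Rightarrow> 'w \<Rightarrow> complex) \<Rightarrow> nat set set set" where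
  "DB M x = {\<pi>. partition_on ground \<pi> \<and> double_bicircuit_type M x \<pi>}"

end

end

theory Submission
  imports Defs
begin

text \<open>
  A pairing \<open>\<sigma>\<close> in \<open>NC2\<close> determines the partition \<open>\<pi>\<close> into the orbits of \<open>\<gamma>\<sigma>\<close>, in whose quotient
  graph the arcs paired by \<open>\<sigma>\<close> have opposite orientations. So \<open>NC2\<close> fibres over the partitions with
  \<open>m = 2 |\<pi>| + 2\<close>, the fibre of \<open>\<pi>\<close> being the set of pairings of opposite arcs that link the three
  cycles. The bound \<open>2 |\<pi>| + 2 \<le> m\<close> for any such \<open>\<pi>\<close> replaces the genus inequality: each basic cycle
  is a closed walk, the edges which it traverses an odd number of times form an even edge set, and for
  linked cycles these sets are too many for a graph with fewer than \<open>|\<pi>| + 1\<close> edges.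

  If all arc classes have two elements then the fibre is a single pairing, and such \<open>\<pi>\<close> are those with
  a nonzero cumulant. Otherwise the elementarization is a tree or has a single circuit. Parity and
  orientation of the closed walks then show that the large classes are one of 6 arcs, two of 4 arcs,
  one of 4 loops, or one of 4 arcs which are no loops. These are the four remaining types, and their
  fibres have 2, 1, 2 and 1 elements.
\<close>

section \<open>Even edge sets and circuits\<close>

text \<open>The equation m = 2 |\<pi>| + 2 has two sources. A pairing has m/2 cycles and \<gamma>
  has three, so the length condition counts the orbits of \<gamma>\<sigma>; the two numerical
  conditions on a double bicircuit partition give the same equation. As all arc classes are even,
  the numbers |C|/2 - 1 then sum to |\<pi>| + 1 minus the number of classes. Connectedness bounds
  this sum by 2, which is why only the sizes 2, 4 and 6 occur.

  Parity is handled in the cycle space over the field with two elements. For a connected graph it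
  vanishes for a tree and has one nonzero element when there are as many edges as vertices, so no
  path has to be followed. Orientations are read off from cuts that are crossed by a single class.

  A pairing knows only \<pi>, while the types describe pieces and how they are glued. Both are
  matched by vertex counts: each identification costs at most one block, overlaps of the pieces
  force the pieces to have many vertices, and connected pieces with so many vertices are trees or
  have one circuit.\<close>

definition wf_ugraph :: "('v, 'e) ugraph \<Rightarrow> bool" where
  "wf_ugraph H \<longleftrightarrow> finite (uverts H) \<and> finite (uedges H) \<and>
     (\<forall>e\<in>uedges H. \<exists>a\<in>uverts H. \<exists>b\<in>uverts H. uends H e = {a, b})"

definition crosses :: "'v set \<Rightarrow> 'v set \<Rightarrow> bool" where
  "crosses X S \<longleftrightarrow> X \<inter> S \<noteq> {} \<and> \<not> X \<subseteq> S"

text \<open>An element of the cycle space over the field with two elements. A loop never crosses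
  \<open>{v}\<close>, so a single loop is an even edge set.\<close>

definition even_edges :: "('v, 'e) ugraph \<Rightarrow> 'e set \<Rightarrow> bool" where
  "even_edges H F \<longleftrightarrow> F \<subseteq> uedges H \<and>
     (\<forall>v\<in>uverts H. even (card {e \<in> F. crosses (uends H e) {v}}))"

definition del_edge :: "('v, 'e) ugraph \<Rightarrow> 'e \<Rightarrow> ('v, 'e) ugraph" where
  "del_edge H e = H\<lparr>uedges := uedges H - {e}\<rparr>"

lemma del_edge_simps [simp]:
  "uverts (del_edge H e) = uverts H" "uedges (del_edge H e) = uedges H - {e}"
  "uends (del_edge H e) = uends H"
  by (simp_all add: del_edge_def)

lemma crosses_doubleton: "crosses {a, b} S \<longleftrightarrow> (a \<in> S) \<noteq> (b \<in> S)"
  by (auto simp: crosses_def)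

lemma wf_del_edge: "wf_ugraph H \<Longrightarrow> wf_ugraph (del_edge H e)"
  by (auto simp: wf_ugraph_def)

lemma even_edges_del_edge:
  "even_edges (del_edge H e) F \<longleftrightarrow> even_edges H F \<and> e \<notin> F"
  by (auto simp: even_edges_def)

lemma even_edges_subset: "even_edges H F \<Longrightarrow> F \<subseteq> uedges H"
  by (simp add: even_edges_def)

text \<open>Cuts are the form of connectedness that can be confronted with parity and with the
  deletion of an edge. The set reached from a vertex is a cut that nothing crosses.\<close>

lemma uconnected_iff_cut:
  assumes "wf_ugraph H"
  shows "uconnected H \<longleftrightarrow> uverts H \<noteq> {} \<and>
    (\<forall>S. S \<subset> uverts H \<longrightarrow> S \<noteq> {} \<longrightarrow> (\<exists>e\<in>uedges H. crosses (uends H e) S))"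
    (is "_ \<longleftrightarrow> _ \<and> ?cut")
proof -
  let ?R = "{(a, b). \<exists>e\<in>uedges H. uends H e = {a, b}}"
  have cut: "?cut" if conn: "\<forall>a\<in>uverts H. \<forall>b\<in>uverts H. (a, b) \<in> ?R\<^sup>*"
  proof (intro allI impI)
    fix S assume S: "S \<subset> uverts H" "S \<noteq> {}"
    then obtain a b where ab: "a \<in> S" "b \<in> uverts H" "b \<notin> S" by blast
    then have "(a, b) \<in> ?R\<^sup>*" using conn S by blast
    moreover have "x \<in> S \<Longrightarrow> (x, y) \<in> ?R\<^sup>* \<Longrightarrow> y \<notin> S \<Longrightarrow> \<exists>e\<in>uedges H. crosses (uends H e) S" for x y
    proof (rotate_tac 1, induction rule: rtrancl_induct)
      case (step y z)
      then show ?case by (cases "y \<in> S") (auto simp: crosses_def)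
    qed auto
    ultimately show "\<exists>e\<in>uedges H. crosses (uends H e) S" using ab by blast
  qed
  have conn: "(a, b) \<in> ?R\<^sup>*" if cut: ?cut and a: "a \<in> uverts H" and b: "b \<in> uverts H" for a b
  proof (rule ccontr)
    assume nb: "(a, b) \<notin> ?R\<^sup>*"
    let ?S = "{c \<in> uverts H. (a, c) \<in> ?R\<^sup>*}"
    have "?S \<subset> uverts H" using b nb by blast
    moreover have "?S \<noteq> {}" using a by blast
    ultimately obtain e where e: "e \<in> uedges H" "crosses (uends H e) ?S" using cut by blast
    obtain p q where pq: "p \<in> uverts H" "q \<in> uverts H" "uends H e = {p, q}"
      using assms e(1) unfolding wf_ugraph_def by blast
    then have "(p, q) \<in> ?R" "(q, p) \<in> ?R" using e(1) by (auto simp: insert_commute)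
    then have "(a, p) \<in> ?R\<^sup>* \<longleftrightarrow> (a, q) \<in> ?R\<^sup>*" by (meson rtrancl.rtrancl_into_rtrancl)
    then show False using e(2) pq by (auto simp: crosses_doubleton)
  qed
  show ?thesis unfolding uconnected_def
    by (intro iffI conjI ballI; (elim conjE)?) (erule cut conn | assumption)+
qed

text \<open>Some edge leaves every proper vertex set, so a subgraph can be grown that gains one
  vertex and one edge at a time.\<close>

lemma card_uverts_le_Suc_uedges:
  assumes wf: "wf_ugraph H" and conn: "uconnected H"
  shows "card (uverts H) \<le> Suc (card (uedges H))"
proof -
  have fin: "finite (uverts H)" "finite (uedges H)" using wf by (auto simp: wf_ugraph_def)
  have "\<exists>S T. S \<subseteq> uverts H \<and> T \<subseteq> uedges H \<and> (\<forall>e\<in>T. uends H e \<subseteq> S) \<and> card S = Suc n \<and> card T = n"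
    if "n < card (uverts H)" for n
    using that
  proof (induction n)
    case 0
    then obtain a where "a \<in> uverts H" by fastforce
    then show ?case by (intro exI[of _ "{a}"] exI[of _ "{}"]) auto
  next
    case (Suc n)
    then obtain S T where ST: "S \<subseteq> uverts H" "T \<subseteq> uedges H" "\<forall>e\<in>T. uends H e \<subseteq> S"
      "card S = Suc n" "card T = n" by auto
    then have "S \<subset> uverts H" "S \<noteq> {}" using Suc.prems by auto
    then obtain e where e: "e \<in> uedges H" "crosses (uends H e) S"
      using conn uconnected_iff_cut[OF wf] by blast
    obtain p q where pq: "p \<in> uverts H" "q \<in> uverts H" "uends H e = {p, q}"
      using wf e(1) unfolding wf_ugraph_def by blast
    obtain r where r: "r \<in> uverts H" "r \<notin> S" "uends H e \<subseteq> insert r S"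
      using e(2) pq by (auto simp: crosses_doubleton)
    have "e \<notin> T" using e(2) ST(3) by (auto simp: crosses_def)
    moreover have "finite S" "finite T" using ST fin finite_subset by auto
    ultimately show ?case using ST r e
      by (intro exI[of _ "insert r S"] exI[of _ "insert e T"]) auto
  qed
  from this[of "card (uverts H) - 1"] show ?thesis
    using card_mono[OF fin(2)] by (cases "card (uverts H)") auto
qed

lemma sum_card_swap:
  assumes "finite A" "finite B"
  shows "(\<Sum>a\<in>A. card {b \<in> B. P a b}) = (\<Sum>b\<in>B. card {a \<in> A. P a b})"
proof -
  have "(\<Sum>a\<in>A. card {b \<in> B. P a b}) = (\<Sum>a\<in>A. \<Sum>b\<in>B. of_bool (P a b))"
    using assms by (intro sum.cong refl) (simp add: Int_def)
  also have "\<dots> = (\<Sum>b\<in>B. \<Sum>a\<in>A. of_bool (P a b))" by (rule sum.swap)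
  also have "\<dots> = (\<Sum>b\<in>B. card {a \<in> A. P a b})"
    using assms by (intro sum.cong refl) (simp add: Int_def)
  finally show ?thesis .
qed

text \<open>In the sum of the degrees in \<open>F\<close> over the vertices of \<open>S\<close>, an
  edge counts once if it crosses \<open>S\<close>, and otherwise twice or not at all.\<close>

lemma even_crossing:
  assumes wf: "wf_ugraph H" and ev: "even_edges H F" and S: "S \<subseteq> uverts H"
  shows "even (card {e \<in> F. crosses (uends H e) S})"
proof -
  have fin: "finite F" "finite S"
    using wf ev S by (auto simp: wf_ugraph_def even_edges_def intro: finite_subset)
  let ?c = "\<lambda>e. card {v \<in> S. crosses (uends H e) {v}}"
  have par: "odd (?c e) \<longleftrightarrow> crosses (uends H e) S" if eF: "e \<in> F" for e
  proof -
    have "e \<in> uedges H" using eF ev by (auto simp: even_edges_def)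
    then obtain p q where pq: "p \<in> uverts H" "q \<in> uverts H" "uends H e = {p, q}"
      using wf unfolding wf_ugraph_def by blast
    show ?thesis
    proof (cases "p = q")
      case True
      then have "\<not> crosses (uends H e) T" for T by (auto simp: pq crosses_def)
      then show ?thesis by simp
    next
      case False
      have ends_in_S: "{v \<in> S. crosses (uends H e) {v}} = {p, q} \<inter> S"
        using False by (auto simp: pq crosses_doubleton)
      show ?thesis unfolding ends_in_S using False
        by (cases "p \<in> S"; cases "q \<in> S") (auto simp: pq crosses_doubleton)
    qed
  qed
  have "even (\<Sum>v\<in>S. card {e \<in> F. crosses (uends H e) {v}})"
    using ev S by (auto simp: even_edges_def intro!: dvd_sum)
  then have "even (\<Sum>e\<in>F. ?c e)" by (subst (asm) sum_card_swap[OF fin(2,1)])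
  then have "even (card {e \<in> F. odd (?c e)})"
    using even_sum_iff[OF fin(1), of ?c] by simp
  moreover have "{e \<in> F. odd (?c e)} = {e \<in> F. crosses (uends H e) S}"
    using par by blast
  ultimately show ?thesis by simp
qed

text \<open>An even edge set never crosses a cut in exactly one edge, so none of its edges is a
  bridge.\<close>

lemma uconnected_del_edge:
  assumes wf: "wf_ugraph H" and conn: "uconnected H" and ev: "even_edges H F" and e: "e \<in> F"
  shows "uconnected (del_edge H e)"
  unfolding uconnected_iff_cut[OF wf_del_edge[OF wf]]
proof (intro conjI allI impI)
  show "uverts (del_edge H e) \<noteq> {}" using conn by (simp add: uconnected_def)
  fix S assume S: "S \<subset> uverts (del_edge H e)" "S \<noteq> {}"
  then obtain e' where e': "e' \<in> uedges H" "crosses (uends H e') S"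
    using conn uconnected_iff_cut[OF wf] by auto
  show "\<exists>e'\<in>uedges (del_edge H e). crosses (uends (del_edge H e) e') S"
  proof (cases "e' = e")
    case True
    have "finite F" using wf ev by (auto simp: wf_ugraph_def even_edges_def intro: finite_subset)
    have "even (card {e \<in> F. crosses (uends H e) S})"
      using even_crossing[OF wf ev] S by auto
    then have "{e \<in> F. crosses (uends H e) S} \<noteq> {e}" by auto
    moreover have "e \<in> {e \<in> F. crosses (uends H e) S}" using True e' e by auto
    ultimately obtain e'' where "e'' \<in> F" "crosses (uends H e'') S" "e'' \<noteq> e" by blast
    then show ?thesis using ev by (auto simp: even_edges_def)
  qed (use e' in auto)
qed

text \<open>Deleting an edge of \<open>F\<close> would leave a connected graph with too few edges
  for its vertices.\<close>

lemma tree_no_even_edges: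
  assumes wf: "wf_ugraph H" and conn: "uconnected H"
    and card: "card (uedges H) < card (uverts H)" and ev: "even_edges H F"
  shows "F = {}"
proof (rule ccontr)
  assume "F \<noteq> {}"
  then obtain e where e: "e \<in> F" by blast
  then have eE: "e \<in> uedges H" using ev by (auto simp: even_edges_def)
  have "finite (uedges H)" using wf by (simp add: wf_ugraph_def)
  then have "card (uedges H) = Suc (card (uedges H - {e}))" using eE by (metis card_Suc_Diff1)
  moreover have "card (uverts H) \<le> Suc (card (uedges H - {e}))"
    using card_uverts_le_Suc_uedges[OF wf_del_edge[OF wf] uconnected_del_edge[OF wf conn ev e]] by simp
  ultimately show False using card by simp
qed

text \<open>If an edge of \<open>F\<close> is missing in \<open>F'\<close>, its deletion leaves a
  tree that still contains \<open>F'\<close>. So the cycle space has at most one nonzero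
  element.\<close>

lemma unicyclic_even_edges_unique:
  assumes wf: "wf_ugraph H" and conn: "uconnected H"
    and card: "card (uedges H) \<le> card (uverts H)"
    and ev: "even_edges H F" "even_edges H F'" and ne: "F \<noteq> {}" "F' \<noteq> {}"
  shows "F = F'"
proof -
  have sub: "F \<subseteq> F'" if ev: "even_edges H F" "even_edges H F'" and ne: "F' \<noteq> {}" for F F'
  proof
    fix e assume e: "e \<in> F"
    then have eE: "e \<in> uedges H" using ev by (auto simp: even_edges_def)
    have "finite (uedges H)" using wf by (simp add: wf_ugraph_def)
    then have "card (uedges (del_edge H e)) < card (uverts (del_edge H e))"
      using card card_Suc_Diff1[of "uedges H" e] eE by simp
    then show "e \<in> F'"
      using tree_no_even_edges[OF wf_del_edge[OF wf] uconnected_del_edge[OF wf conn ev(1) e]] ev ne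
      by (auto simp: even_edges_del_edge)
  qed
  show ?thesis using sub[OF ev(1,2) ne(2)] sub[OF ev(2,1) ne(1)] by blast
qed

text \<open>Boundaries, recorded at all vertices but one, take at most 2^(|V| - 1) values, which is
  less than the number 2^|E| of edge sets. Two sets with equal boundary have an even symmetric
  difference.\<close>

lemma even_edges_nonempty_exists:
  assumes wf: "wf_ugraph H" and card: "card (uverts H) \<le> card (uedges H)" and ne: "uverts H \<noteq> {}"
  shows "\<exists>F. even_edges H F \<and> F \<noteq> {}"
proof -
  have fin: "finite (uverts H)" "finite (uedges H)" using wf by (auto simp: wf_ugraph_def)
  obtain v0 where v0: "v0 \<in> uverts H" using ne by blast
  \<comment> \<open>The parity at \<open>v0\<close> follows from the others, since every edge
    contributes evenly to the sum over all vertices. Leaving it out gains the factor 2 that the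
    pigeonhole principle needs.\<close>
  define bd where "bd F = {v \<in> uverts H - {v0}. odd (card {e \<in> F. crosses (uends H e) {v}})}" for F
  have "card (bd ` Pow (uedges H)) \<le> card (Pow (uverts H - {v0}))"
    by (rule card_mono) (auto simp: bd_def fin)
  also have "\<dots> = 2 ^ (card (uverts H) - 1)" using fin v0 by (simp add: card_Pow)
  also have "\<dots> < 2 ^ card (uedges H)"
  proof (rule power_strict_increasing)
    have "card (uverts H) > 0" using fin v0 by (auto simp: card_gt_0_iff)
    then show "card (uverts H) - 1 < card (uedges H)" using card by linarith
  qed simp
  also have "\<dots> = card (Pow (uedges H))" using fin by (simp add: card_Pow)
  finally have "\<not> inj_on bd (Pow (uedges H))" by (intro pigeonhole)
  then obtain A B where AB: "A \<subseteq> uedges H" "B \<subseteq> uedges H" "bd A = bd B" "A \<noteq> B"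
    by (auto simp: inj_on_def)
  let ?F = "(A - B) \<union> (B - A)"
  have finAB: "finite A" "finite B" using AB(1,2) fin(2) by (auto intro: finite_subset)
  have symm: "even (card {e \<in> ?F. P e}) \<longleftrightarrow> (even (card {e \<in> A. P e}) \<longleftrightarrow> even (card {e \<in> B. P e}))" for P
  proof -
    have a: "card {e \<in> A. P e} = card {e \<in> A - B. P e} + card {e \<in> A \<inter> B. P e}"
      using finAB by (subst card_Un_disjoint[symmetric]) (auto intro: arg_cong[of _ _ card])
    have b: "card {e \<in> B. P e} = card {e \<in> B - A. P e} + card {e \<in> A \<inter> B. P e}"
      using finAB by (subst card_Un_disjoint[symmetric]) (auto intro: arg_cong[of _ _ card])
    have c: "card {e \<in> ?F. P e} = card {e \<in> A - B. P e} + card {e \<in> B - A. P e}"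
      using finAB by (subst card_Un_disjoint[symmetric]) (auto intro: arg_cong[of _ _ card])
    show ?thesis unfolding a b c by presburger
  qed
  let ?dg = "\<lambda>v. card {e \<in> ?F. crosses (uends H e) {v}}"
  have ev: "even (?dg v)" if "v \<in> uverts H - {v0}" for v
    using AB(3) that unfolding symm bd_def by blast
  have "even (\<Sum>v\<in>uverts H. ?dg v)"
  proof -
    have "(\<Sum>v\<in>uverts H. ?dg v) = (\<Sum>e\<in>?F. card {v \<in> uverts H. crosses (uends H e) {v}})"
      using finAB fin by (intro sum_card_swap) auto
    also have "even \<dots>"
    proof (rule dvd_sum)
      fix e assume "e \<in> ?F"
      then obtain p q where pq: "p \<in> uverts H" "q \<in> uverts H" "uends H e = {p, q}"
        using wf AB unfolding wf_ugraph_def by blast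
      have "{v \<in> uverts H. crosses (uends H e) {v}} = (if p = q then {} else {p, q})"
        using pq by (auto simp: crosses_doubleton)
      then show "even (card {v \<in> uverts H. crosses (uends H e) {v}})" by simp
    qed
    finally show ?thesis .
  qed
  moreover have "(\<Sum>v\<in>uverts H. ?dg v) = ?dg v0 + (\<Sum>v\<in>uverts H - {v0}. ?dg v)"
    by (rule sum.remove[OF fin(1) v0])
  moreover have "even (\<Sum>v\<in>uverts H - {v0}. ?dg v)" using ev by (intro dvd_sum)
  ultimately have "even (?dg v0)" by simp
  then have "even_edges H ?F" using ev AB by (auto simp: even_edges_def)
  moreover have "?F \<noteq> {}" using AB(4) by blast
  ultimately show ?thesis by blast
qed

section \<open>Circuits as minimal even edge sets\<close>

lemma udegree_eq:
  assumes "wf_ugraph H"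
  shows "udegree H v = card {e \<in> uedges H. crosses (uends H e) {v}} + 2 * card {e \<in> uedges H. uends H e = {v}}"
proof -
  have fin: "finite (uedges H)" using assms by (simp add: wf_ugraph_def)
  have "{e \<in> uedges H. v \<in> uends H e} = {e \<in> uedges H. crosses (uends H e) {v}} \<union> {e \<in> uedges H. uends H e = {v}}"
    by (auto simp: crosses_def)
  moreover have "{e \<in> uedges H. crosses (uends H e) {v}} \<inter> {e \<in> uedges H. uends H e = {v}} = {}"
    by (auto simp: crosses_def)
  ultimately have "card {e \<in> uedges H. v \<in> uends H e} = card {e \<in> uedges H. crosses (uends H e) {v}} + card {e \<in> uedges H. uends H e = {v}}"
    using fin by (simp add: card_Un_disjoint)
  then show ?thesis by (simp add: udegree_def)
qed

lemma handshake:
  assumes wf: "wf_ugraph H"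
  shows "(\<Sum>v\<in>uverts H. udegree H v) = 2 * card (uedges H)"
proof -
  have fin: "finite (uverts H)" "finite (uedges H)" using wf by (auto simp: wf_ugraph_def)
  have "(\<Sum>v\<in>uverts H. udegree H v) =
      (\<Sum>e\<in>uedges H. card {v \<in> uverts H. v \<in> uends H e} + card {v \<in> uverts H. uends H e = {v}})"
    unfolding udegree_def sum.distrib using sum_card_swap[OF fin] by (auto intro: arg_cong2[of _ _ _ _ "(+)"])
  also have "\<dots> = (\<Sum>e\<in>uedges H. 2)"
  proof (rule sum.cong)
    fix e assume "e \<in> uedges H"
    then obtain p q where pq: "p \<in> uverts H" "q \<in> uverts H" "uends H e = {p, q}"
      using wf unfolding wf_ugraph_def by blast
    have "{v \<in> uverts H. v \<in> uends H e} = {p, q}" using pq by auto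
    moreover have "{v \<in> uverts H. uends H e = {v}} = (if p = q then {p} else {})" using pq by auto
    ultimately show "card {v \<in> uverts H. v \<in> uends H e} + card {v \<in> uverts H. uends H e = {v}} = 2"
      by auto
  qed simp
  finally show ?thesis by simp
qed

lemma circuitD:
  assumes "K \<in> circuits H"
  shows "uverts K \<subseteq> uverts H" "uedges K \<subseteq> uedges H" "uends K = uends H"
    "\<forall>e\<in>uedges K. uends H e \<subseteq> uverts K" "\<forall>v\<in>uverts K. udegree K v = 2" "uconnected K"
proof -
  have K: "usubgraph K H" "uconnected K" "\<forall>v\<in>uverts K. udegree K v = 2"
    using assms by (simp_all add: circuits_def)
  then show "uverts K \<subseteq> uverts H" "uedges K \<subseteq> uedges H" "uends K = uends H"
    "\<forall>v\<in>uverts K. udegree K v = 2" "uconnected K" by (simp_all add: usubgraph_def)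
  show "\<forall>e\<in>uedges K. uends H e \<subseteq> uverts K" using K(1) unfolding usubgraph_def by metis
qed

lemma circuit_wf:
  assumes wf: "wf_ugraph H" and K: "K \<in> circuits H"
  shows "wf_ugraph K"
  unfolding wf_ugraph_def
proof (intro conjI ballI)
  note sub = circuitD(1-4)[OF K]
  show "finite (uverts K)" "finite (uedges K)"
    using wf sub by (auto simp: wf_ugraph_def intro: finite_subset)
  fix e assume e: "e \<in> uedges K"
  then obtain p q where "uends H e = {p, q}" using wf sub unfolding wf_ugraph_def by blast
  then show "\<exists>a\<in>uverts K. \<exists>b\<in>uverts K. uends K e = {a, b}" using sub e by fastforce
qed

lemma circuit_even_edges:
  assumes wf: "wf_ugraph H" and K: "K \<in> circuits H"
  shows "even_edges H (uedges K)" and "uedges K \<noteq> {}"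
proof -
  note sub = circuitD(1-4)[OF K] and deg = circuitD(5)[OF K]
  have ne: "uverts K \<noteq> {}" using circuitD(6)[OF K] by (simp add: uconnected_def)
  have "even (card {e \<in> uedges K. crosses (uends H e) {v}})" for v
  proof (cases "v \<in> uverts K")
    case True
    have "even (a::nat)" if "a + 2 * b = 2" for a b using that by presburger
    from this[OF trans[OF udegree_eq[OF circuit_wf[OF wf K], symmetric] deg[rule_format, OF True]]]
    show ?thesis by (simp add: sub(3))
  next
    case False
    then have "{e \<in> uedges K. crosses (uends H e) {v}} = {}" using sub by (auto simp: crosses_def)
    then show ?thesis by (simp only: card.empty even_zero)
  qed
  then show "even_edges H (uedges K)" using sub by (auto simp: even_edges_def)
  obtain v where "v \<in> uverts K" using ne by blast
  then have "udegree K v = 2" using deg by blast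
  then show "uedges K \<noteq> {}" by (auto simp: udegree_def)
qed

lemma circuit_uverts:
  assumes "K \<in> circuits H"
  shows "uverts K = (\<Union>e\<in>uedges K. uends H e)"
proof -
  note sub = circuitD(3,4)[OF assms] and deg = circuitD(5)[OF assms]
  have "\<exists>e\<in>uedges K. v \<in> uends H e" if "v \<in> uverts K" for v
  proof (rule ccontr)
    assume "\<not> ?thesis"
    then have "{e \<in> uedges K. v \<in> uends K e} = {}" "{e \<in> uedges K. uends K e = {v}} = {}"
      using sub by auto
    then have "udegree K v = 0" unfolding udegree_def by (simp only: card.empty)
    then show False using deg that by simp
  qed
  then show ?thesis using sub by auto
qed

lemma circuit_eqI:
  assumes "K \<in> circuits H" "K' \<in> circuits H" "uedges K = uedges K'"
  shows "K = K'"
  using assms circuit_uverts[OF assms(1)] circuit_uverts[OF assms(2)]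
  by (auto simp: circuits_def usubgraph_def intro!: ugraph.equality)

text \<open>Take a smallest nonempty even subset. It is connected, because the edges on one side of
  an uncrossed cut would form a smaller one; and a vertex of degree above 2 would leave enough edges
  for a smaller one as well.\<close>

lemma even_edges_contains_circuit:
  assumes wf: "wf_ugraph H" and ev: "even_edges H F" and ne: "F \<noteq> {}"
  shows "\<exists>K\<in>circuits H. uedges K \<subseteq> F"
proof -
  let ?P = "\<lambda>F'. even_edges H F' \<and> F' \<noteq> {} \<and> F' \<subseteq> F"
  obtain X where X: "?P X" and min: "\<And>Y. ?P Y \<Longrightarrow> card X \<le> card Y"
    using ex_has_least_nat[of ?P F card] ev ne by auto
  have XH: "X \<subseteq> uedges H" using X even_edges_subset by blast
  have finX: "finite X" by (rule finite_subset[OF XH]) (use wf in \<open>simp add: wf_ugraph_def\<close>)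
  have noproper: "Y = {}" if "even_edges H Y" "Y \<subset> X" for Y
    using min[of Y] that X psubset_card_mono[OF finX that(2)] by auto
  define K where "K = H\<lparr>uverts := \<Union>(uends H ` X), uedges := X\<rparr>"
  have K_simps: "uverts K = \<Union>(uends H ` X)" "uedges K = X" "uends K = uends H"
    by (simp_all add: K_def)
  have ends: "\<exists>p\<in>uverts H. \<exists>q\<in>uverts H. uends H e = {p, q}" if "e \<in> X" for e
    using wf XH that unfolding wf_ugraph_def by blast
  have vK: "uverts K \<subseteq> uverts H"
  proof
    fix v assume "v \<in> uverts K"
    then obtain e where "e \<in> X" "v \<in> uends H e" by (auto simp: K_simps)
    then show "v \<in> uverts H" using ends by fastforce
  qed
  have sub: "usubgraph K H" using vK XH by (auto simp: usubgraph_def K_simps)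
  have wfK: "wf_ugraph K" unfolding wf_ugraph_def
  proof (intro conjI ballI)
    show "finite (uverts K)" using vK wf by (auto simp: wf_ugraph_def intro: finite_subset)
    show "finite (uedges K)" by (simp add: K_simps finX)
    fix e assume "e \<in> uedges K"
    then have eX: "e \<in> X" by (simp add: K_simps)
    then obtain p q where "uends H e = {p, q}" using ends by blast
    moreover then have "p \<in> uverts K" "q \<in> uverts K" using eX by (auto simp: K_simps)
    ultimately show "\<exists>a\<in>uverts K. \<exists>b\<in>uverts K. uends K e = {a, b}" by (auto simp: K_simps)
  qed
  have conn: "uconnected K" unfolding uconnected_iff_cut[OF wfK]
  proof (intro conjI allI impI)
    show neK: "uverts K \<noteq> {}" using X ends by (fastforce simp: K_simps)
    fix S assume S: "S \<subset> uverts K" "S \<noteq> {}"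
    show "\<exists>e\<in>uedges K. crosses (uends K e) S"
    proof (rule ccontr)
      assume nc: "\<not> ?thesis"
      let ?Y = "{e \<in> X. uends H e \<subseteq> S}"
      have dich: "uends H e \<subseteq> S \<or> uends H e \<inter> S = {}" if "e \<in> X" for e
        using nc that by (auto simp: K_simps crosses_def)
      have "even (card {e \<in> ?Y. crosses (uends H e) {v}})" if v: "v \<in> uverts H" for v
      proof (cases "v \<in> S")
        case True
        then have "{e \<in> ?Y. crosses (uends H e) {v}} = {e \<in> X. crosses (uends H e) {v}}"
          using dich by (auto simp: crosses_def)
        then show ?thesis using X v by (simp only: even_edges_def) 
      next
        case False
        then have "{e \<in> ?Y. crosses (uends H e) {v}} = {}" by (auto simp: crosses_def)
        then show ?thesis by (simp only: card.empty even_zero)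
      qed
      then have "even_edges H ?Y" using XH by (auto simp: even_edges_def)
      moreover have "?Y \<noteq> X"
      proof -
        obtain v where v: "v \<in> uverts K" "v \<notin> S" using S by blast
        then obtain e where "e \<in> X" "v \<in> uends H e" by (auto simp: K_simps)
        then show ?thesis using v by blast
      qed
      ultimately have "?Y = {}" using noproper by blast
      moreover obtain v where v: "v \<in> S" "v \<in> uverts K" using S by blast
      then obtain e where "e \<in> X" "v \<in> uends H e" by (auto simp: K_simps)
      ultimately show False using dich v by blast
    qed
  qed
  have deg_even: "even (udegree K v)" if "v \<in> uverts K" for v
    using X vK that unfolding udegree_eq[OF wfK] by (auto simp: K_simps even_edges_def)
  have deg_pos: "udegree K v \<ge> 2" if v: "v \<in> uverts K" for v
  proof -
    obtain e where "e \<in> X" "v \<in> uends H e" using v by (auto simp: K_simps)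
    then have "e \<in> {e \<in> uedges K. v \<in> uends K e}" by (simp add: K_simps)
    moreover have "finite {e \<in> uedges K. v \<in> uends K e}" using finX by (simp add: K_simps)
    ultimately have "card {e \<in> uedges K. v \<in> uends K e} > 0" by (auto simp: card_gt_0_iff)
    then have "udegree K v > 0" by (simp add: udegree_def)
    then show ?thesis using deg_even[OF v] by (cases "udegree K v = 1") auto
  qed
  have "udegree K v = 2" if v: "v \<in> uverts K" for v
  proof (rule ccontr)
    assume "udegree K v \<noteq> 2"
    then have "udegree K v > 2" using deg_pos[OF v] by simp
    moreover have finK: "finite (uverts K)" using wfK by (simp add: wf_ugraph_def)
    ultimately have "(\<Sum>v\<in>uverts K. 2) < (\<Sum>v\<in>uverts K. udegree K v)"
      using deg_pos v by (intro sum_strict_mono_ex1) auto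
    \<comment> \<open>All degrees are at least 2 and one is larger, so edges outnumber vertices.
      Even after removing one edge there is a nonempty even set, now a proper subset of
      \<open>X\<close>.\<close>
    then have lt: "card (uverts K) < card X" using handshake[OF wfK] by (simp add: K_simps)
    obtain e where e: "e \<in> X" using X by blast
    have "card (uverts (del_edge K e)) \<le> card (uedges (del_edge K e))"
      using lt e finX by (simp add: K_simps)
    moreover have "uverts (del_edge K e) \<noteq> {}" using v by auto
    ultimately obtain Y where Y: "even_edges (del_edge K e) Y" "Y \<noteq> {}"
      using even_edges_nonempty_exists[OF wf_del_edge[OF wfK]] by blast
    then have YX: "Y \<subset> X" and evY: "even_edges K Y" using e by (auto simp: even_edges_del_edge even_edges_def K_simps)
    have "even (card {e \<in> Y. crosses (uends H e) {w}})" for w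
    proof (cases "w \<in> uverts K")
      case True
      then show ?thesis using evY by (auto simp: even_edges_def K_simps)
    next
      case False
      then have "{e \<in> Y. crosses (uends H e) {w}} = {}" using YX by (auto simp: crosses_def K_simps)
      then show ?thesis by (simp only: card.empty even_zero)
    qed
    then have "even_edges H Y" using YX XH by (auto simp: even_edges_def)
    then show False using noproper YX Y by blast
  qed
  then have "K \<in> circuits H" using sub conn by (simp add: circuits_def)
  moreover have "uedges K \<subseteq> F" using X by (simp add: K_simps)
  ultimately show ?thesis by blast
qed

text \<open>From here on, being a tree is a matter of counting.\<close>

lemma utree_iff_card:
  assumes wf: "wf_ugraph H"
  shows "utree H \<longleftrightarrow> uconnected H \<and> card (uverts H) = Suc (card (uedges H))"
proof -
  have "card (uverts H) = Suc (card (uedges H))" if c: "uconnected H" and "circuits H = {}"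
  proof (rule ccontr)
    assume "card (uverts H) \<noteq> Suc (card (uedges H))"
    then have "card (uverts H) \<le> card (uedges H)" using card_uverts_le_Suc_uedges[OF wf c] by simp
    moreover have "uverts H \<noteq> {}" using c by (simp add: uconnected_def)
    ultimately show False
      using even_edges_nonempty_exists[OF wf] even_edges_contains_circuit[OF wf] that by blast
  qed
  moreover have "circuits H = {}" if c: "uconnected H" and "card (uverts H) = Suc (card (uedges H))"
    using tree_no_even_edges[OF wf c] circuit_even_edges[OF wf] that by fastforce
  ultimately show ?thesis unfolding utree_def by blast
qed

lemma unicyclic_circuit:
  assumes wf: "wf_ugraph H" and conn: "uconnected H" and card: "card (uedges H) = card (uverts H)"
  shows "\<exists>K. circuits H = {K} \<and> (\<forall>F. even_edges H F \<longrightarrow> F \<noteq> {} \<longrightarrow> uedges K = F)"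
proof -
  have "uverts H \<noteq> {}" using conn by (simp add: uconnected_def)
  then obtain F where F: "even_edges H F" "F \<noteq> {}" using even_edges_nonempty_exists[OF wf] card by auto
  then obtain K where K: "K \<in> circuits H" using even_edges_contains_circuit[OF wf] by blast
  have eqK: "uedges K = F" if "even_edges H F" "F \<noteq> {}" for F
    using unicyclic_even_edges_unique[OF wf conn] circuit_even_edges[OF wf K] that card by simp
  have "K' = K" if K': "K' \<in> circuits H" for K'
    using circuit_eqI[OF K' K] eqK[OF circuit_even_edges[OF wf K']] by simp
  then show ?thesis using K eqK by blast
qed

text \<open>With more edges than vertices, deleting an edge of the circuit would leave a nonempty
  even set, hence a circuit that avoids this edge.\<close>

lemma unique_circuit_card:
  assumes wf: "wf_ugraph H" and K: "circuits H = {K}"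
  shows "card (uedges H) \<le> card (uverts H)"
proof (rule ccontr)
  assume gt: "\<not> ?thesis"
  have KH: "K \<in> circuits H" using K by simp
  obtain e where e: "e \<in> uedges K" using circuit_even_edges[OF wf KH] by blast
  have eH: "e \<in> uedges H" using e KH by (auto simp: circuits_def usubgraph_def)
  have "finite (uedges H)" using wf by (simp add: wf_ugraph_def)
  then have "card (uverts (del_edge H e)) \<le> card (uedges (del_edge H e))"
    using gt eH by (simp add: card_Diff_singleton)
  moreover have "uverts (del_edge H e) \<noteq> {}"
    using KH by (auto simp: circuits_def usubgraph_def uconnected_def)
  ultimately obtain F where F: "even_edges (del_edge H e) F" "F \<noteq> {}"
    using even_edges_nonempty_exists[OF wf_del_edge[OF wf]] by blast
  then obtain K' where "K' \<in> circuits H" "uedges K' \<subseteq> F"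
    using even_edges_contains_circuit[OF wf] by (auto simp: even_edges_del_edge)
  then show False using K e F by (auto simp: even_edges_del_edge)
qed

text \<open>Deleting \<open>e\<close> disconnects the graph for lack of edges, and a separating set
  is crossed by \<open>e\<close> alone. Such cuts will show in which directions a closed walk
  traverses \<open>e\<close>.\<close>

lemma tree_edge_cut:
  assumes wf: "wf_ugraph H" and conn: "uconnected H"
    and card: "card (uedges H) < card (uverts H)" and e: "e \<in> uedges H"
  shows "\<exists>S. {f \<in> uedges H. crosses (uends H f) S} = {e}"
proof -
  have "finite (uedges H)" using wf by (simp add: wf_ugraph_def)
  then have "\<not> card (uverts (del_edge H e)) \<le> Suc (card (uedges (del_edge H e)))"
    using card e card_Suc_Diff1[of "uedges H" e] by simp
  then have "\<not> uconnected (del_edge H e)"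
    using card_uverts_le_Suc_uedges[OF wf_del_edge[OF wf]] by blast
  moreover have ne: "uverts H \<noteq> {}" using conn by (simp add: uconnected_def)
  ultimately obtain S where S: "S \<subset> uverts H" "S \<noteq> {}"
    and nc: "\<forall>f\<in>uedges H - {e}. \<not> crosses (uends H f) S"
    unfolding uconnected_iff_cut[OF wf_del_edge[OF wf]] by auto
  then obtain f where "f \<in> uedges H" "crosses (uends H f) S"
    using conn uconnected_iff_cut[OF wf] by blast
  then have "{f \<in> uedges H. crosses (uends H f) S} = {e}" using nc by auto
  then show ?thesis by blast
qed

section \<open>Partitions\<close>

definition eqc :: "'a set \<Rightarrow> ('a \<times> 'a) set \<Rightarrow> ('a \<times> 'a) set" where
  "eqc A X = {(a, b). a \<in> A \<and> b \<in> A \<and> (a, b) \<in> (X \<union> converse X)\<^sup>*}"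

lemma generated_partition_eqc: "generated_partition A X = A // eqc A X"
  by (simp add: generated_partition_def eqc_def)

lemma equiv_eqc: "equiv A (eqc A X)"
proof (rule equivI)
  have "sym ((X \<union> converse X)\<^sup>*)" by (intro sym_rtrancl) (auto simp: sym_def)
  then show "sym (eqc A X)" by (auto simp: sym_def eqc_def)
  show "refl_on A (eqc A X)" by (auto simp: refl_on_def eqc_def)
  show "trans (eqc A X)" by (auto simp: trans_def eqc_def intro: rtrancl_trans)
qed (auto simp: eqc_def)

lemma partition_on_generated: "partition_on A (generated_partition A X)"
  unfolding generated_partition_eqc by (rule partition_on_quotient[OF equiv_eqc])

text \<open>Sending each block to the new block around it is injective away from the block of
  \<open>q\<close>: a new connection runs through the added pair, so one of its two ends was
  connected to \<open>q\<close> before.\<close>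

lemma card_generated_partition_insert:
  assumes A: "finite A"
  shows "card (generated_partition A X) \<le> Suc (card (generated_partition A (insert (p, q) X)))"
proof -
  let ?Y = "insert (p, q) X"
  let ?Z = "X \<union> converse X"
  have symZ: "(a, b) \<in> ?Z\<^sup>* \<Longrightarrow> (b, a) \<in> ?Z\<^sup>*" for a b
    using sym_rtrancl[of ?Z] by (auto simp: sym_def)
  have sub: "eqc A X \<subseteq> eqc A ?Y"
  proof -
    have "?Z\<^sup>* \<subseteq> (?Y \<union> converse ?Y)\<^sup>*" by (rule rtrancl_mono) auto
    then show ?thesis by (auto simp: eqc_def)
  qed
  let ?f = "\<lambda>B. eqc A ?Y `` B"
  have f_class: "?f (eqc A X `` {a}) = eqc A ?Y `` {a}" if "a \<in> A" for a
  proof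
    show "?f (eqc A X `` {a}) \<subseteq> eqc A ?Y `` {a}"
      using sub equiv_eqc[of A ?Y] by (auto elim!: equivE dest: transD)
    show "eqc A ?Y `` {a} \<subseteq> ?f (eqc A X `` {a})"
      using that equiv_eqc[of A X] by (auto elim!: equivE simp: refl_on_def)
  qed
  let ?B0 = "{a \<in> A. (a, q) \<in> ?Z\<^sup>*}"
  let ?Q = "generated_partition A X" and ?Q' = "generated_partition A ?Y"
  have inj: "inj_on ?f (?Q - {?B0})"
  proof (rule inj_onI)
    fix B C assume B: "B \<in> ?Q - {?B0}" and C: "C \<in> ?Q - {?B0}" and eq: "?f B = ?f C"
    obtain a b where a: "a \<in> A" "B = eqc A X `` {a}" and b: "b \<in> A" "C = eqc A X `` {b}"
      using B C by (auto simp: generated_partition_eqc elim!: quotientE)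
    have nq: "(c, q) \<notin> ?Z\<^sup>*" if "c \<in> A" "eqc A X `` {c} \<noteq> ?B0" for c
    proof
      assume cq: "(c, q) \<in> ?Z\<^sup>*"
      have "eqc A X `` {c} = ?B0"
        using that(1) cq by (auto simp: eqc_def intro: rtrancl_trans symZ)
      then show False using that by blast
    qed
    have naq: "(a, q) \<notin> ?Z\<^sup>*" and nbq: "(b, q) \<notin> ?Z\<^sup>*" using nq a b B C by auto
    have "eqc A ?Y `` {a} = eqc A ?Y `` {b}"
      using eq unfolding a(2) b(2) f_class[OF a(1)] f_class[OF b(1)] .
    then have "(a, b) \<in> eqc A ?Y" using eq_equiv_class[OF _ equiv_eqc b(1)] by blast
    moreover have "?Y \<union> converse ?Y = insert (q, p) (insert (p, q) ?Z)" by auto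
    ultimately have "(a, b) \<in> (insert (q, p) (insert (p, q) ?Z))\<^sup>*"
      by (simp add: eqc_def)
    then have "(a, b) \<in> ?Z\<^sup>*"
      using naq nbq unfolding rtrancl_insert Un_iff mem_Collect_eq case_prod_conv
      by (meson symZ rtrancl_trans)
    then have "(a, b) \<in> eqc A X" using a b by (simp add: eqc_def)
    then show "B = C" using a b equiv_class_eq[OF equiv_eqc] by metis
  qed
  have img: "?f ` (?Q - {?B0}) \<subseteq> ?Q'"
    by (auto simp: generated_partition_eqc f_class elim!: quotientE intro: quotientI)
  have fin: "finite ?Q'" "finite ?Q"
    using finite_quotient[OF A equiv_type[OF equiv_eqc]] by (auto simp: generated_partition_eqc)
  have "card (?Q - {?B0}) \<le> card ?Q'" by (rule card_inj_on_le[OF inj img fin(1)])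
  then show ?thesis using fin by (cases "?B0 \<in> ?Q") auto
qed

lemma card_generated_partition_Un:
  assumes "finite A" "finite R"
  shows "card (generated_partition A X) \<le> card (generated_partition A (X \<union> R)) + card R"
  using assms(2)
proof (induction R rule: finite_induct)
  case (insert r R)
  then show ?case
    using card_generated_partition_insert[OF assms(1), of "X \<union> R" "fst r" "snd r"] by simp
qed simp

section \<open>Blocks, restrictions and kernels\<close>

lemma block_in:
  assumes "partition_on A P" "a \<in> A"
  shows "block P a \<in> P" "a \<in> block P a"
proof -
  have "\<exists>!B. B \<in> P \<and> a \<in> B"
    using assms by (auto simp: partition_on_def disjoint_def)
  from theI'[OF this] show "block P a \<in> P" "a \<in> block P a" by (auto simp: block_def)
qed

lemma block_eqI:
  assumes "partition_on A P" "B \<in> P" "a \<in> B"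
  shows "block P a = B"
proof -
  have "a \<in> A" using assms by (auto simp: partition_on_def)
  from block_in[OF assms(1) this] show ?thesis using assms by (auto simp: partition_on_def disjoint_def)
qed

lemma block_image: "partition_on A P \<Longrightarrow> block P ` A = P"
proof
  assume P: "partition_on A P"
  show "block P ` A \<subseteq> P" using block_in[OF P] by auto
  show "P \<subseteq> block P ` A"
  proof
    fix B assume B: "B \<in> P"
    then have "B \<noteq> {}" using P by (auto simp: partition_on_def)
    then obtain b where "b \<in> B" by blast
    moreover then have "b \<in> A" using B P by (auto simp: partition_on_def)
    ultimately show "B \<in> block P ` A" using block_eqI[OF P B] by blast
  qed
qed

lemma block_eq_mem: "partition_on A P \<Longrightarrow> a \<in> A \<Longrightarrow> block P a = {b \<in> A. block P b = block P a}"
proof -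
  assume P: "partition_on A P" and a: "a \<in> A"
  have "block P a \<subseteq> A" using block_in[OF P a] P by (auto simp: partition_on_def)
  moreover have "block P b = block P a" if "b \<in> block P a" for b
    using block_eqI[OF P block_in(1)[OF P a] that] .
  moreover have "b \<in> block P a" if "b \<in> A" "block P b = block P a" for b
    using block_in(2)[OF P that(1)] that(2) by simp
  ultimately show ?thesis by blast
qed

lemma same_block_iff:
  assumes "partition_on A P"
  shows "(a, b) \<in> same_block P \<longleftrightarrow> a \<in> A \<and> b \<in> A \<and> block P a = block P b"
proof
  assume "(a, b) \<in> same_block P"
  then obtain B where "B \<in> P" "a \<in> B" "b \<in> B" by (auto simp: same_block_def)
  then show "a \<in> A \<and> b \<in> A \<and> block P a = block P b"
    using block_eqI[OF assms] assms by (auto simp: partition_on_def)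
next
  assume "a \<in> A \<and> b \<in> A \<and> block P a = block P b"
  then have "block P a \<in> P" "a \<in> block P a" "b \<in> block P a"
    using block_in[OF assms, of a] block_in[OF assms, of b] by auto
  then show "(a, b) \<in> same_block P" unfolding same_block_def by blast
qed

lemma partition_eqI:
  assumes P: "partition_on A P" and Q: "partition_on A Q"
    and eq: "\<And>a b. a \<in> A \<Longrightarrow> b \<in> A \<Longrightarrow> block P a = block P b \<longleftrightarrow> block Q a = block Q b"
  shows "P = Q"
proof -
  have "block P a = block Q a" if a: "a \<in> A" for a
  proof -
    have "{b \<in> A. block P b = block P a} = {b \<in> A. block Q b = block Q a}"
      using eq[OF _ a] by (intro Collect_cong conj_cong refl)
    then show ?thesis
      by (rule trans[OF block_eq_mem[OF P a] trans[OF _ block_eq_mem[OF Q a, symmetric]]])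
  qed
  then have "block P ` A = block Q ` A" by (rule image_cong[OF refl])
  then show ?thesis unfolding block_image[OF P] block_image[OF Q] .
qed

lemma block_generated:
  assumes "a \<in> A" "b \<in> A"
  shows "block (generated_partition A X) a = block (generated_partition A X) b \<longleftrightarrow> (a, b) \<in> eqc A X"
proof -
  have cls: "block (generated_partition A X) c = eqc A X `` {c}" if "c \<in> A" for c
    using that equiv_class_self[OF equiv_eqc that]
    by (intro block_eqI[OF partition_on_generated]) (auto simp: generated_partition_eqc intro: quotientI)
  show ?thesis using assms by (simp add: cls eq_equiv_class_iff[OF equiv_eqc])
qed

lemma restrict_partition_on:
  assumes "partition_on A P" "I \<subseteq> A"
  shows "partition_on I (restrict_partition P I)"
  using partition_on_restrict[OF assms(1), of I] assms(2) by (simp add: restrict_partition_def Int_absorb2)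

lemma block_restrict:
  assumes P: "partition_on A P" and "I \<subseteq> A" "a \<in> I"
  shows "block (restrict_partition P I) a = block P a \<inter> I"
proof (rule block_eqI[OF restrict_partition_on[OF assms(1,2)]])
  have "a \<in> block P a" "block P a \<in> P" using block_in[OF P] assms by auto
  then show "a \<in> block P a \<inter> I" "block P a \<inter> I \<in> restrict_partition P I"
    using assms by (auto simp: restrict_partition_def)
qed

lemma block_restrict_eq_iff:
  assumes P: "partition_on A P" and I: "I \<subseteq> A" and ab: "a \<in> I" "b \<in> I"
  shows "block (restrict_partition P I) a = block (restrict_partition P I) b \<longleftrightarrow> block P a = block P b"
proof
  assume "block (restrict_partition P I) a = block (restrict_partition P I) b"
  then have "b \<in> block P a" using block_in(2)[OF P, of b] ab I unfolding block_restrict[OF P I ab(1)] block_restrict[OF P I ab(2)] by auto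
  then show "block P a = block P b" using block_eqI[OF P block_in(1)[OF P]] ab I by auto
qed (simp add: block_restrict[OF P I ab(1)] block_restrict[OF P I ab(2)])

lemma card_image_eq_kernel:
  assumes "\<And>a b. a \<in> A \<Longrightarrow> b \<in> A \<Longrightarrow> f a = f b \<longleftrightarrow> g a = g b"
  shows "card (f ` A) = card (g ` A)"
proof -
  have "bij_betw (\<lambda>y. g (inv_into A f y)) (f ` A) (g ` A)"
  proof (rule bij_betw_imageI)
    show "inj_on (\<lambda>y. g (inv_into A f y)) (f ` A)"
      by (rule inj_onI) (metis assms f_inv_into_f inv_into_into)
    have "g (inv_into A f (f a)) = g a" if "a \<in> A" for a
      using that by (metis assms f_inv_into_f inv_into_into imageI)
    then show "(\<lambda>y. g (inv_into A f y)) ` f ` A = g ` A" by (simp add: image_image)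
  qed
  then show ?thesis by (rule bij_betw_same_card)
qed

lemma cycle_of_upt:
  assumes "a \<le> v" "v < b"
  shows "cycle_of_list [a..<b] v = (if Suc v < b then Suc v else a)"
proof -
  have "map (cycle_of_list [a..<b]) [a..<b] = rotate1 [a..<b]"
    using cyclic_rotation[of "[a..<b]" 1] by simp
  then have "map (cycle_of_list [a..<b]) [a..<b] ! (v - a) = rotate1 [a..<b] ! (v - a)" by simp
  then show ?thesis using assms by (auto simp: nth_rotate1 nth_append rotate1_hd_tl hd_upt nth_tl split: if_splits) 
qed

text \<open>From any element one climbs to \<open>b - 1\<close> and then wraps around to
  \<open>a\<close>. This makes each of the three index intervals a minimal set closed under
  \<open>gam\<close>.\<close>

lemma interval_rotation_invariant:
  assumes T: "T \<subseteq> {a..<b}" "T \<noteq> {}" and cl: "\<And>v. v \<in> T \<Longrightarrow> (if Suc v < b then Suc v else a) \<in> T"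
  shows "T = {a..<b}"
proof -
  have up: "w \<in> T" if "v \<in> T" "v \<le> w" "w < b" for v w
    using that(2,3)
  proof (induction w rule: dec_induct)
    case (step n)
    then show ?case using cl[of n] by simp
  qed (use that in simp)
  obtain v where v: "v \<in> T" using T by blast
  then have vb: "a \<le> v" "v < b" using T(1) by auto
  have last: "b - 1 \<in> T" using up[OF v, of "b - 1"] vb by simp
  have "a \<in> T" using cl[OF last] vb by simp
  then have "{a..<b} \<subseteq> T" using up[of a] by auto
  then show ?thesis using T(1) by blast
qed

section \<open>Quotients of three cycles\<close>

locale three_cycles =
  fixes m1 m2 m3 :: nat
  assumes m_pos: "1 \<le> m1" "1 \<le> m2" "1 \<le> m3"
begin

abbreviation "gr \<equiv> ground m1 m2 m3"
abbreviation "sg \<equiv> seg m1 m2 m3"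
abbreviation "\<gamma> \<equiv> gam m1 m2 m3"
abbreviation "qg \<equiv> quotient_graph m1 m2 m3"

definition "mm = m1 + m2 + m3"

lemma finite_gr: "finite gr" and card_gr: "card gr = mm"
  by (simp_all add: ground_def mm_def)

lemma seg_upt: "sg 1 = {1..<m1 + 1}" "sg 2 = {m1 + 1..<m1 + m2 + 1}" "sg 3 = {m1 + m2 + 1..<m1 + m2 + m3 + 1}"
  by (auto simp: seg_def)

lemma gam_values:
  "v \<in> sg 1 \<Longrightarrow> \<gamma> v = (if Suc v < m1 + 1 then Suc v else 1)"
  "v \<in> sg 2 \<Longrightarrow> \<gamma> v = (if Suc v < m1 + m2 + 1 then Suc v else m1 + 1)"
  "v \<in> sg 3 \<Longrightarrow> \<gamma> v = (if Suc v < m1 + m2 + m3 + 1 then Suc v else m1 + m2 + 1)"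
proof -
  have cyc: "cycle_of_list [a..<b] v = (if a \<le> v \<and> v < b then if Suc v < b then Suc v else a else v)" for a b v
    using cycle_of_upt[of a v b] id_outside_supp[of v "[a..<b]"] by auto
  show "v \<in> sg 1 \<Longrightarrow> \<gamma> v = (if Suc v < m1 + 1 then Suc v else 1)"
    "v \<in> sg 2 \<Longrightarrow> \<gamma> v = (if Suc v < m1 + m2 + 1 then Suc v else m1 + 1)"
    "v \<in> sg 3 \<Longrightarrow> \<gamma> v = (if Suc v < m1 + m2 + m3 + 1 then Suc v else m1 + m2 + 1)"
    unfolding seg_upt gam_def comp_def cyc by auto
qed

lemma gr_segs: "gr = sg 1 \<union> sg 2 \<union> sg 3"
  by (auto simp: ground_def seg_def)

lemma seg_disjoint: "sg 1 \<inter> sg 2 = {}" "sg 1 \<inter> sg 3 = {}" "sg 2 \<inter> sg 3 = {}"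
  by (auto simp: seg_def)

lemma seg_nonempty: "sg 1 \<noteq> {}" "sg 2 \<noteq> {}" "sg 3 \<noteq> {}"
  using m_pos by (auto simp: seg_def)

lemma gam_seg123: "v \<in> sg 1 \<Longrightarrow> \<gamma> v \<in> sg 1" "v \<in> sg 2 \<Longrightarrow> \<gamma> v \<in> sg 2" "v \<in> sg 3 \<Longrightarrow> \<gamma> v \<in> sg 3"
  by (simp_all add: gam_values, auto simp: seg_def split: if_splits)

lemma seg_minimal123:
  "T \<subseteq> sg 1 \<Longrightarrow> T \<noteq> {} \<Longrightarrow> \<gamma> ` T \<subseteq> T \<Longrightarrow> T = sg 1"
  "T \<subseteq> sg 2 \<Longrightarrow> T \<noteq> {} \<Longrightarrow> \<gamma> ` T \<subseteq> T \<Longrightarrow> T = sg 2"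
  "T \<subseteq> sg 3 \<Longrightarrow> T \<noteq> {} \<Longrightarrow> \<gamma> ` T \<subseteq> T \<Longrightarrow> T = sg 3"
proof -
  have inv: "T = {a..<b}" if T: "T \<subseteq> {a..<b}" "T \<noteq> {}" "\<gamma> ` T \<subseteq> T"
    and g: "\<And>v. v \<in> {a..<b} \<Longrightarrow> \<gamma> v = (if Suc v < b then Suc v else a)" for a b
  proof (rule interval_rotation_invariant[OF T(1,2)])
    fix v assume v: "v \<in> T"
    then have "\<gamma> v \<in> T" using T(3) by blast
    then show "(if Suc v < b then Suc v else a) \<in> T" using g[OF subsetD[OF T(1) v]] by (simp only:)
  qed
  show "T \<subseteq> sg 1 \<Longrightarrow> T \<noteq> {} \<Longrightarrow> \<gamma> ` T \<subseteq> T \<Longrightarrow> T = sg 1"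
    using inv[OF _ _ _ gam_values(1)[unfolded seg_upt(1)]] unfolding seg_upt(1) .
  show "T \<subseteq> sg 2 \<Longrightarrow> T \<noteq> {} \<Longrightarrow> \<gamma> ` T \<subseteq> T \<Longrightarrow> T = sg 2"
    using inv[OF _ _ _ gam_values(2)[unfolded seg_upt(2)]] unfolding seg_upt(2) .
  show "T \<subseteq> sg 3 \<Longrightarrow> T \<noteq> {} \<Longrightarrow> \<gamma> ` T \<subseteq> T \<Longrightarrow> T = sg 3"
    using inv[OF _ _ _ gam_values(3)[unfolded seg_upt(3)]] unfolding seg_upt(3) .
qed

lemma gam_permutes: "\<gamma> permutes gr"
proof -
  have cyc: "cycle_of_list [a..<b] permutes gr" if "{a..<b} \<subseteq> gr" for a b
    using permutes_subset[OF cycle_permutes[of "[a..<b]"]] that by simp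
  then show ?thesis unfolding gam_def by (intro permutes_compose cyc) (auto simp: ground_def)
qed

abbreviation "idx \<equiv> {1, 2, 3 :: nat}"

lemma gam_seg: "j \<in> idx \<Longrightarrow> v \<in> sg j \<Longrightarrow> \<gamma> v \<in> sg j"
  using gam_seg123 by auto

lemma seg_minimal: "j \<in> idx \<Longrightarrow> T \<subseteq> sg j \<Longrightarrow> T \<noteq> {} \<Longrightarrow> \<gamma> ` T \<subseteq> T \<Longrightarrow> T = sg j"
  using seg_minimal123[of T] by auto

lemma seg_ne: "j \<in> idx \<Longrightarrow> sg j \<noteq> {}"
  using seg_nonempty by auto

lemma seg_gr: "j \<in> idx \<Longrightarrow> sg j \<subseteq> gr"
  using gr_segs by auto

lemma gr_seg_ex: "v \<in> gr \<Longrightarrow> \<exists>j\<in>idx. v \<in> sg j"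
  using gr_segs by auto

lemma seg_disj: "i \<in> idx \<Longrightarrow> j \<in> idx \<Longrightarrow> i \<noteq> j \<Longrightarrow> sg i \<inter> sg j = {}"
  using seg_disjoint by auto

lemma seg_unique: "i \<in> idx \<Longrightarrow> j \<in> idx \<Longrightarrow> v \<in> sg i \<Longrightarrow> v \<in> sg j \<Longrightarrow> i = j"
  using seg_disj by blast

lemma idx_perm:
  assumes "{i, j, k} = idx"
  shows "i \<in> idx" "j \<in> idx" "k \<in> idx" "i \<noteq> j" "i \<noteq> k" "j \<noteq> k"
    "gr = sg i \<union> sg j \<union> sg k" "sg i \<inter> sg j = {}" "sg i \<inter> sg k = {}" "sg j \<inter> sg k = {}"
proof -
  show ijk: "i \<in> idx" "j \<in> idx" "k \<in> idx" using assms by blast+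
  have "card {i, j, k} = 3" unfolding assms by simp
  then show ne: "i \<noteq> j" "i \<noteq> k" "j \<noteq> k" by (auto simp: card_insert_if split: if_splits)
  have "gr = \<Union>(sg ` {i, j, k})" unfolding assms using gr_segs by auto
  then show "gr = sg i \<union> sg j \<union> sg k" by auto
  show "sg i \<inter> sg j = {}" "sg i \<inter> sg k = {}" "sg j \<inter> sg k = {}"
    using seg_disj ijk ne by blast+
qed

text \<open>These are the unions of basic cycles, so their arcs form closed walks and the flow
  lemmas apply.\<close>

definition gclosed :: "nat set \<Rightarrow> bool" where
  "gclosed I \<longleftrightarrow> I \<subseteq> gr \<and> \<gamma> ` I = I"

lemma gclosedI: "I \<subseteq> gr \<Longrightarrow> \<gamma> ` I \<subseteq> I \<Longrightarrow> gclosed I"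
  unfolding gclosed_def
  using endo_inj_surj[of I \<gamma>] finite_subset[OF _ finite_gr] permutes_inj_on[OF gam_permutes] by blast

lemma gclosed_seg: "j \<in> idx \<Longrightarrow> gclosed (sg j)"
  using gam_seg seg_gr by (intro gclosedI) auto

lemma gclosed_Un: "gclosed I \<Longrightarrow> gclosed J \<Longrightarrow> gclosed (I \<union> J)"
  by (auto simp: gclosed_def image_Un)

lemma gclosed_gr: "gclosed gr"
  using permutes_image[OF gam_permutes] by (simp add: gclosed_def)

lemma gclosed_finite: "gclosed I \<Longrightarrow> finite I"
  using finite_subset[OF _ finite_gr] by (auto simp: gclosed_def)

lemma gclosed_gam: "gclosed I \<Longrightarrow> v \<in> I \<Longrightarrow> \<gamma> v \<in> I"
  by (auto simp: gclosed_def)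

lemma gclosed_gr_sub: "gclosed I \<Longrightarrow> I \<subseteq> gr"
  by (auto simp: gclosed_def)

lemma gclosed_meets_seg:
  assumes "gclosed T" "j \<in> idx" "T \<inter> sg j \<noteq> {}"
  shows "sg j \<subseteq> T"
proof -
  have "\<gamma> ` (T \<inter> sg j) \<subseteq> T \<inter> sg j" using assms gam_seg gclosed_gam by blast
  from seg_minimal[OF assms(2) _ assms(3) this] show ?thesis by blast
qed

text \<open>\<open>\<gamma>\<close> permutes \<open>I\<close>, so \<open>P\<close> holds at as many
  sources of arcs as targets. Discarding the arcs where it holds at both ends leaves the departures
  and the arrivals.\<close>

lemma flow_balance:
  assumes I: "gclosed I"
  shows "card {u \<in> I. P (\<gamma> u) \<and> \<not> P u} = card {u \<in> I. \<not> P (\<gamma> u) \<and> P u}"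
proof -
  have fin: "finite I" using gclosed_finite[OF I] .
  have "bij_betw \<gamma> {u \<in> I. P (\<gamma> u)} {u \<in> I. P u}"
    by (rule bij_betw_imageI) (use I permutes_inj_on[OF gam_permutes] in \<open>auto simp: gclosed_def inj_on_def\<close>)
  then have "card {u \<in> I. P (\<gamma> u)} = card {u \<in> I. P u}" by (rule bij_betw_same_card)
  moreover have "card {u \<in> I. P (\<gamma> u)} = card {u \<in> I. P (\<gamma> u) \<and> \<not> P u} + card {u \<in> I. P (\<gamma> u) \<and> P u}"
    using fin by (subst card_Un_disjoint[symmetric]) (auto intro: arg_cong[of _ _ card])
  moreover have "card {u \<in> I. P u} = card {u \<in> I. \<not> P (\<gamma> u) \<and> P u} + card {u \<in> I. P (\<gamma> u) \<and> P u}"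
    using fin by (subst card_Un_disjoint[symmetric]) (auto intro: arg_cong[of _ _ card])
  ultimately show ?thesis by simp
qed

lemma flow_even:
  fixes P :: "nat \<Rightarrow> bool"
  assumes I: "gclosed I"
  shows "even (card {u \<in> I. P (\<gamma> u) \<noteq> P u})"
proof -
  have fin: "finite I" using gclosed_finite[OF I] .
  have "card {u \<in> I. P (\<gamma> u) \<noteq> P u} = card {u \<in> I. P (\<gamma> u) \<and> \<not> P u} + card {u \<in> I. \<not> P (\<gamma> u) \<and> P u}"
    using fin by (subst card_Un_disjoint[symmetric]) (auto intro: arg_cong[of _ _ card])
  then show ?thesis using flow_balance[OF I, of P] by simp
qed

text \<open>The classes in \<open>\<C>\<close> need not exhaust the arcs \<open>I\<close>: deleting arcs keeps all vertices.\<close>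

definition wgraph :: "(nat \<Rightarrow> 'v) \<Rightarrow> nat set \<Rightarrow> nat set set \<Rightarrow> ('v, nat set) ugraph" where
  "wgraph r I \<C> = \<lparr>uverts = r ` I, uedges = \<C>, uends = (\<lambda>C. \<Union>a\<in>C. {r (\<gamma> a), r a})\<rparr>"

text \<open>This is what makes \<open>uends\<close>, a union over the whole class, a pair of
  vertices. The family of classes is left open because three graphs are treated alike: the
  elementarization, the same after deleting two loops, and the graph with one edge
  \<open>{u, \<sigma> u}\<close> for each pair of a pairing.\<close>

definition homog :: "(nat \<Rightarrow> 'v) \<Rightarrow> nat set \<Rightarrow> nat set set \<Rightarrow> bool" where
  "homog r I \<C> \<longleftrightarrow> {} \<notin> \<C> \<and> disjoint \<C> \<and> \<Union>\<C> \<subseteq> I \<and>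
     (\<forall>C\<in>\<C>. \<forall>u\<in>C. \<forall>v\<in>C. {r (\<gamma> u), r u} = {r (\<gamma> v), r v})"

lemma wgraph_simps [simp]: "uverts (wgraph r I \<C>) = r ` I" "uedges (wgraph r I \<C>) = \<C>"
  by (simp_all add: wgraph_def)

lemma wgraph_ends:
  assumes "homog r I \<C>" "C \<in> \<C>" "u \<in> C"
  shows "uends (wgraph r I \<C>) C = {r (\<gamma> u), r u}"
proof -
  have "{r (\<gamma> a), r a} = {r (\<gamma> u), r u}" if "a \<in> C" for a
    using assms that unfolding homog_def by blast
  then have "(\<Union>a\<in>C. {r (\<gamma> a), r a}) = (\<Union>a\<in>C. {r (\<gamma> u), r u})" by (rule SUP_cong[OF refl])
  also have "\<dots> = {r (\<gamma> u), r u}" using assms(3) by blast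
  finally show ?thesis unfolding wgraph_def ugraph.simps .
qed

lemma homogD:
  assumes "homog r I \<C>"
  shows "{} \<notin> \<C>" "disjoint \<C>" "\<Union>\<C> \<subseteq> I"
  using assms by (simp_all add: homog_def)

lemma homog_nonempty:
  assumes "homog r I \<C>" "C \<in> \<C>"
  shows "\<exists>u. u \<in> C \<and> u \<in> I"
proof -
  have "C \<noteq> {}" using homogD(1)[OF assms(1)] assms(2) by auto
  then show ?thesis using homogD(3)[OF assms(1)] assms(2) by blast
qed

lemma homog_finite: "homog r I \<C> \<Longrightarrow> finite I \<Longrightarrow> finite \<C>"
  by (drule homogD(3)) (rule finite_UnionD, erule finite_subset)

lemma wgraph_wf:
  assumes "homog r I \<C>" "gclosed I"
  shows "wf_ugraph (wgraph r I \<C>)"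
  unfolding wf_ugraph_def
proof (intro conjI ballI)
  show "finite (uverts (wgraph r I \<C>))" "finite (uedges (wgraph r I \<C>))"
    using homog_finite[OF assms(1)] gclosed_finite[OF assms(2)] by simp_all
  fix C assume "C \<in> uedges (wgraph r I \<C>)"
  then have C: "C \<in> \<C>" by simp
  then obtain u where u: "u \<in> C" "u \<in> I" using homog_nonempty[OF assms(1)] by blast
  show "\<exists>a\<in>uverts (wgraph r I \<C>). \<exists>b\<in>uverts (wgraph r I \<C>). uends (wgraph r I \<C>) C = {a, b}"
    using u gclosed_gam[OF assms(2)] wgraph_ends[OF assms(1) C u(1)] by auto
qed

text \<open>At a vertex the closed walks in \<open>J\<close> arrive and depart equally often, so the
  arcs of \<open>J\<close> with exactly one end there are even in number; modulo 2 only the classes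
  used oddly contribute. Loops contribute nothing, hence the exception in
  \<open>cover\<close>.\<close>

lemma wgraph_parity:
  assumes h: "homog r I \<C>" and I: "gclosed I" and J: "gclosed J" "J \<subseteq> I"
    and cover: "\<And>u. u \<in> J \<Longrightarrow> r (\<gamma> u) \<noteq> r u \<Longrightarrow> u \<in> \<Union>\<C>"
  shows "even_edges (wgraph r I \<C>) {C \<in> \<C>. odd (card (C \<inter> J))}"
  unfolding even_edges_def
proof (intro conjI ballI)
  fix p assume "p \<in> uverts (wgraph r I \<C>)"
  let ?X = "{C \<in> \<C>. crosses (uends (wgraph r I \<C>) C) {p}}"
  have fin: "finite \<C>" "finite J"
    using homog_finite[OF h] gclosed_finite[OF I] gclosed_finite[OF J(1)] by auto
  have crs: "crosses (uends (wgraph r I \<C>) C) {p} \<longleftrightarrow> (r (\<gamma> u) = p) \<noteq> (r u = p)" if "C \<in> \<C>" "u \<in> C" for C u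
    using wgraph_ends[OF h that] by (auto simp: crosses_doubleton)
  have "{u \<in> J. (r (\<gamma> u) = p) \<noteq> (r u = p)} = (\<Union>C\<in>?X. C \<inter> J)"
  proof
    show "{u \<in> J. (r (\<gamma> u) = p) \<noteq> (r u = p)} \<subseteq> (\<Union>C\<in>?X. C \<inter> J)"
    proof
      fix u assume u: "u \<in> {u \<in> J. (r (\<gamma> u) = p) \<noteq> (r u = p)}"
      then have "u \<in> J" "r (\<gamma> u) \<noteq> r u" by auto
      from cover[OF this] obtain C where "C \<in> \<C>" "u \<in> C" by blast
      then show "u \<in> (\<Union>C\<in>?X. C \<inter> J)" using u crs by blast
    qed
    show "(\<Union>C\<in>?X. C \<inter> J) \<subseteq> {u \<in> J. (r (\<gamma> u) = p) \<noteq> (r u = p)}"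
      using crs by blast
  qed
  moreover have "card (\<Union>C\<in>?X. C \<inter> J) = (\<Sum>C\<in>?X. card (C \<inter> J))"
    using fin homogD(2)[OF h] by (intro card_UN_disjoint) (auto simp: disjoint_def)
  ultimately have "even (\<Sum>C\<in>?X. card (C \<inter> J))"
    using flow_even[OF J(1), of "\<lambda>u. r u = p"] by simp
  then have "even (card {C \<in> ?X. odd (card (C \<inter> J))})"
    using even_sum_iff[of ?X "\<lambda>C. card (C \<inter> J)"] fin by simp
  moreover have "{C \<in> ?X. odd (card (C \<inter> J))} =
      {C \<in> {C \<in> \<C>. odd (card (C \<inter> J))}. crosses (uends (wgraph r I \<C>) C) {p}}" by blast
  ultimately show "even (card {C \<in> {C \<in> \<C>. odd (card (C \<inter> J))}. crosses (uends (wgraph r I \<C>) C) {p}})"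
    by simp
qed auto

text \<open>The arcs with head in an uncrossed vertex set are closed under \<open>\<gamma>\<close>
  and under having a common head, and \<open>link\<close> says that such a set of arcs is
  everything.\<close>

lemma wgraph_connectedI:
  assumes h: "homog r I \<C>" and I: "gclosed I" "I \<noteq> {}"
    and cover: "\<And>u. u \<in> I \<Longrightarrow> r (\<gamma> u) \<noteq> r u \<Longrightarrow> u \<in> \<Union>\<C>"
    and link: "\<And>T. gclosed T \<Longrightarrow> T \<subseteq> I \<Longrightarrow> T \<noteq> {} \<Longrightarrow>
      (\<And>u v. u \<in> T \<Longrightarrow> v \<in> I \<Longrightarrow> r u = r v \<Longrightarrow> v \<in> T) \<Longrightarrow> T = I"
  shows "uconnected (wgraph r I \<C>)"
  unfolding uconnected_iff_cut[OF wgraph_wf[OF h I(1)]]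
proof (intro conjI allI impI)
  show "uverts (wgraph r I \<C>) \<noteq> {}" using I by simp
  fix S assume S: "S \<subset> uverts (wgraph r I \<C>)" "S \<noteq> {}"
  show "\<exists>e\<in>uedges (wgraph r I \<C>). crosses (uends (wgraph r I \<C>) e) S"
  proof (rule ccontr)
    assume nc: "\<not> ?thesis"
    let ?T = "{u \<in> I. r u \<in> S}"
    have "r (\<gamma> u) \<in> S" if u: "u \<in> ?T" for u
    proof (cases "r (\<gamma> u) = r u")
      case False
      then obtain C where C: "C \<in> \<C>" "u \<in> C" using cover u by blast
      then have "\<not> crosses (uends (wgraph r I \<C>) C) S" using nc by simp
      then show ?thesis using u unfolding wgraph_ends[OF h C] by (simp add: crosses_doubleton)
    qed (use u in simp)
    then have "gclosed ?T" using I gclosed_gam[OF I(1)] by (intro gclosedI) (auto simp: gclosed_def)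
    moreover have "?T \<noteq> {}" using S by auto
    ultimately have "?T = I" by (intro link) auto
    then show False using S by auto
  qed
qed

end

section \<open>Classes of arcs and pairings of opposite arcs\<close>

lemma even_card_involution:
  assumes "finite C" "\<And>u. u \<in> C \<Longrightarrow> f u \<in> C \<and> f u \<noteq> u \<and> f (f u) = u"
  shows "even (card C)"
  using assms
proof (induction C rule: finite_psubset_induct)
  case (psubset C)
  show ?case
  proof (cases "C = {}")
    case False
    then obtain u where u: "u \<in> C" by blast
    let ?D = "C - {u, f u}"
    have fu: "f u \<in> C" "f u \<noteq> u" "f (f u) = u" using psubset.prems[OF u] by auto
    have "even (card ?D)"
    proof (rule psubset.IH)
      show "?D \<subset> C" using u by blast
      fix v assume v: "v \<in> ?D"
      then have "f v \<in> C \<and> f v \<noteq> v \<and> f (f v) = v" using psubset.prems by blast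
      moreover have "f v \<noteq> u" "f v \<noteq> f u" using v calculation fu by auto
      ultimately show "f v \<in> ?D \<and> f v \<noteq> v \<and> f (f v) = v" by blast
    qed
    moreover have "card C = card ?D + 2"
    proof -
      have "card ?D = card C - card {u, f u}" using u fu by (intro card_Diff_subset) auto
      moreover have "card {u, f u} = 2" using fu by simp
      moreover have "card {u, f u} \<le> card C" using u fu psubset.hyps by (intro card_mono) auto
      ultimately show ?thesis by simp
    qed
    ultimately show ?thesis by simp
  qed simp
qed

context three_cycles
begin

definition ends :: "nat set set \<Rightarrow> nat \<Rightarrow> nat set set" where
  "ends \<pi> u = {block \<pi> (\<gamma> u), block \<pi> u}"

definition cls :: "nat set set \<Rightarrow> nat set \<Rightarrow> nat \<Rightarrow> nat set" where
  "cls \<pi> I u = {v \<in> I. ends \<pi> v = ends \<pi> u}"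

definition classes :: "nat set set \<Rightarrow> nat set \<Rightarrow> nat set set" where
  "classes \<pi> I = cls \<pi> I ` I"

text \<open>Any two loops at one vertex satisfy this, and a loop satisfies it with itself. Loops are
  the only arcs for which being opposite and being parallel can hold together.\<close>

definition opp :: "nat set set \<Rightarrow> nat \<Rightarrow> nat \<Rightarrow> bool" where
  "opp \<pi> u v \<longleftrightarrow> block \<pi> (\<gamma> u) = block \<pi> v \<and> block \<pi> u = block \<pi> (\<gamma> v)"

abbreviation "rb \<pi> I \<equiv> block (restrict_partition \<pi> I)"

lemma ends_eq_iff: "ends \<pi> u = ends \<pi> v \<longleftrightarrow>
    block \<pi> (\<gamma> u) = block \<pi> (\<gamma> v) \<and> block \<pi> u = block \<pi> v \<or> opp \<pi> u v"
  by (auto simp: ends_def opp_def doubleton_eq_iff)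

lemma opp_ends: "opp \<pi> u v \<Longrightarrow> ends \<pi> u = ends \<pi> v"
  by (simp add: ends_eq_iff)

lemma opp_sym: "opp \<pi> u v \<Longrightarrow> opp \<pi> v u"
  by (auto simp: opp_def)

lemma classesE:
  assumes "C \<in> classes \<pi> I"
  obtains u where "u \<in> I" "C = cls \<pi> I u"
  using assms by (auto simp: classes_def)

lemma classes_eq: "C \<in> classes \<pi> I \<Longrightarrow> u \<in> C \<Longrightarrow> C = cls \<pi> I u"
  by (auto simp: classes_def cls_def)

lemma cls_in: "u \<in> I \<Longrightarrow> cls \<pi> I u \<in> classes \<pi> I" "u \<in> I \<Longrightarrow> u \<in> cls \<pi> I u"
  by (auto simp: classes_def cls_def)

lemma classes_sub: "C \<in> classes \<pi> I \<Longrightarrow> C \<subseteq> I"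
  by (auto simp: classes_def cls_def)

lemma classes_ne: "C \<in> classes \<pi> I \<Longrightarrow> C \<noteq> {}"
  by (auto simp: classes_def cls_def)

lemma classes_ends: "C \<in> classes \<pi> I \<Longrightarrow> u \<in> C \<Longrightarrow> v \<in> C \<Longrightarrow> ends \<pi> u = ends \<pi> v"
  by (auto simp: classes_def cls_def)

lemma classes_memI: "C \<in> classes \<pi> I \<Longrightarrow> u \<in> C \<Longrightarrow> v \<in> I \<Longrightarrow> ends \<pi> v = ends \<pi> u \<Longrightarrow> v \<in> C"
  by (auto simp: classes_def cls_def)

lemma classes_eqI: "C \<in> classes \<pi> I \<Longrightarrow> D \<in> classes \<pi> I \<Longrightarrow> u \<in> C \<Longrightarrow> u \<in> D \<Longrightarrow> C = D"
  using classes_eq by metis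

lemma classes_disjoint: "disjoint (classes \<pi> I)"
  unfolding disjoint_def using classes_eqI by blast

lemma Union_classes: "\<Union>(classes \<pi> I) = I"
  by (auto simp: classes_def cls_def)

lemma finite_classes: "finite I \<Longrightarrow> finite (classes \<pi> I)"
  by (simp add: classes_def)

lemma sum_card_classes:
  assumes "finite I"
  shows "(\<Sum>C\<in>classes \<pi> I. card C) = card I"
proof -
  have "card (\<Union>C\<in>classes \<pi> I. C) = (\<Sum>C\<in>classes \<pi> I. card C)"
    using finite_classes[OF assms] finite_subset[OF classes_sub assms] classes_disjoint
    by (intro card_UN_disjoint) (auto simp: disjoint_def)
  then show ?thesis using Union_classes[of \<pi> I] by simp
qed

lemma classes_Int:
  assumes C: "C \<in> classes \<pi> gr" and I: "I \<subseteq> gr" and ne: "C \<inter> I \<noteq> {}"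
  shows "C \<inter> I \<in> classes \<pi> I"
proof -
  obtain u where u: "u \<in> C" "u \<in> I" using ne by blast
  have "C \<inter> I = cls \<pi> I u" using classes_eq[OF C u(1)] I by (auto simp: cls_def)
  then show ?thesis using cls_in(1)[OF u(2)] by simp
qed

lemma classes_lift:
  assumes C: "C \<in> classes \<pi> I" and I: "I \<subseteq> gr"
  shows "\<exists>D\<in>classes \<pi> gr. C = D \<inter> I"
proof -
  obtain u where u: "u \<in> I" "C = cls \<pi> I u" by (rule classesE[OF C])
  then have "C = cls \<pi> gr u \<inter> I" using I by (auto simp: cls_def)
  then show ?thesis using cls_in(1)[of u gr \<pi>] u I by blast
qed

lemma card_split:
  assumes "{i, j, k} = idx" "C \<subseteq> gr"
  shows "card C = card (C \<inter> sg i) + card (C \<inter> sg j) + card (C \<inter> sg k)"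
proof -
  note p = idx_perm[OF assms(1)]
  have fin: "finite C" using assms(2) finite_gr finite_subset by blast
  have "C = (C \<inter> sg i \<union> C \<inter> sg j) \<union> C \<inter> sg k" using p(7) assms(2) by blast
  then have "card C = card ((C \<inter> sg i \<union> C \<inter> sg j) \<union> C \<inter> sg k)" by simp
  also have "\<dots> = card (C \<inter> sg i \<union> C \<inter> sg j) + card (C \<inter> sg k)"
    using fin p by (intro card_Un_disjoint) auto
  also have "card (C \<inter> sg i \<union> C \<inter> sg j) = card (C \<inter> sg i) + card (C \<inter> sg j)"
    using fin p by (intro card_Un_disjoint) auto
  finally show ?thesis .
qed

lemma card_split2:
  assumes "{i, j, k} = idx" "C \<subseteq> gr"
  shows "card (C \<inter> (sg j \<union> sg k)) = card (C \<inter> sg j) + card (C \<inter> sg k)"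
proof -
  note p = idx_perm[OF assms(1)]
  have fin: "finite C" using assms(2) finite_gr finite_subset by blast
  have "C \<inter> (sg j \<union> sg k) = C \<inter> sg j \<union> C \<inter> sg k" by blast
  then show ?thesis using fin p by (subst card_Un_disjoint[symmetric]) auto
qed

section \<open>Translation of the graph notions into arc classes\<close>

lemma rb_eq_iff:
  assumes "partition_on gr \<pi>" "gclosed I" "a \<in> I" "b \<in> I"
  shows "rb \<pi> I a = rb \<pi> I b \<longleftrightarrow> block \<pi> a = block \<pi> b"
  using block_restrict_eq_iff[OF assms(1) gclosed_gr_sub[OF assms(2)] assms(3,4)] .

lemma rb_ends_eq_iff:
  assumes "partition_on gr \<pi>" "gclosed I" "a \<in> I" "b \<in> I"
  shows "{rb \<pi> I (\<gamma> a), rb \<pi> I a} = {rb \<pi> I (\<gamma> b), rb \<pi> I b} \<longleftrightarrow> ends \<pi> a = ends \<pi> b"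
  using assms gclosed_gam[OF assms(2)]
  by (simp add: ends_def doubleton_eq_iff rb_eq_iff[OF assms(1,2)])

lemma qg_simps [simp]:
  "verts (qg \<pi> I) = restrict_partition \<pi> I" "arcs (qg \<pi> I) = I"
  "tail (qg \<pi> I) a = rb \<pi> I (\<gamma> a)" "head (qg \<pi> I) a = rb \<pi> I a"
  by (simp_all add: quotient_graph_def)

lemma equivalent_arcs_qg:
  assumes "partition_on gr \<pi>" "gclosed I"
  shows "equivalent_arcs (qg \<pi> I) = {(a, b). a \<in> I \<and> b \<in> I \<and> ends \<pi> a = ends \<pi> b}"
  unfolding equivalent_arcs_def using rb_ends_eq_iff[OF assms] by auto

lemma arc_classes_qg:
  assumes "partition_on gr \<pi>" "gclosed I"
  shows "arc_classes (qg \<pi> I) = classes \<pi> I"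
proof -
  have "equivalent_arcs (qg \<pi> I) `` {u} = cls \<pi> I u" if "u \<in> I" for u
    using that by (auto simp: equivalent_arcs_qg[OF assms] cls_def)
  then show ?thesis unfolding arc_classes_def quotient_def classes_def qg_simps by auto
qed

lemma arc_multiplicity_qg:
  assumes "partition_on gr \<pi>" "gclosed I" "a \<in> I"
  shows "arc_multiplicity (qg \<pi> I) a = card (cls \<pi> I a)"
proof -
  have "equivalent_arcs (qg \<pi> I) `` {a} = cls \<pi> I a"
    using assms(3) by (auto simp: equivalent_arcs_qg[OF assms(1,2)] cls_def)
  then show ?thesis by (simp add: arc_multiplicity_def)
qed

lemma uverts_restrict:
  assumes "partition_on gr \<pi>" "gclosed I"
  shows "restrict_partition \<pi> I = rb \<pi> I ` I"
  using block_image[OF restrict_partition_on[OF assms(1) gclosed_gr_sub[OF assms(2)]]] by simp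

lemma elementarization_qg:
  assumes "partition_on gr \<pi>" "gclosed I"
  shows "elementarization (qg \<pi> I) = wgraph (rb \<pi> I) I (classes \<pi> I)"
  using uverts_restrict[OF assms]
  unfolding elementarization_def wgraph_def qg_simps arc_classes_qg[OF assms] by (intro ugraph.equality) simp_all

lemma opposite_arcs_qg:
  assumes "partition_on gr \<pi>" "gclosed I" "a \<in> I" "b \<in> I"
  shows "opposite_arcs (qg \<pi> I) a b \<longleftrightarrow> opp \<pi> a b"
  unfolding opposite_arcs_def opp_def qg_simps
  using rb_eq_iff[OF assms(1,2)] assms gclosed_gam[OF assms(2)] by auto

lemma all_arcs_doubled_qg:
  assumes "partition_on gr \<pi>" "gclosed I"
  shows "all_arcs_doubled (qg \<pi> I) \<longleftrightarrow>
    (\<forall>C\<in>classes \<pi> I. card C = 2 \<and> (\<forall>a\<in>C. \<forall>b\<in>C. a \<noteq> b \<longrightarrow> opp \<pi> a b))"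
  unfolding all_arcs_doubled_def arc_classes_qg[OF assms]
  using opposite_arcs_qg[OF assms] classes_sub by (meson subsetD)

lemma restrict_gr: "partition_on gr \<pi> \<Longrightarrow> restrict_partition \<pi> gr = \<pi>"
proof -
  assume P: "partition_on gr \<pi>"
  have "gr \<inter> B = B" if "B \<in> \<pi>" for B using P that by (auto simp: partition_on_def)
  then have "(\<inter>) gr ` \<pi> = \<pi>" by simp
  then show ?thesis using P by (simp add: restrict_partition_def partition_on_def)
qed

text \<open>The last condition stands for the join of \<sigma> and \<gamma> being the one-block
  partition: with three cycles it suffices that none of them is closed under
  \<open>\<sigma>\<close>.\<close>

definition pairings :: "nat set set \<Rightarrow> (nat \<Rightarrow> nat) set" where
  "pairings \<pi> = {\<sigma>. \<sigma> permutes gr \<and> (\<forall>u\<in>gr. \<sigma> u \<noteq> u \<and> \<sigma> (\<sigma> u) = u \<and> opp \<pi> u (\<sigma> u)) \<and>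
     (\<forall>j\<in>idx. \<exists>u\<in>sg j. \<sigma> u \<notin> sg j)}"

lemma pairingsD:
  assumes "\<sigma> \<in> pairings \<pi>"
  shows "\<sigma> permutes gr" "u \<in> gr \<Longrightarrow> \<sigma> u \<in> gr" "u \<in> gr \<Longrightarrow> \<sigma> u \<noteq> u" "u \<in> gr \<Longrightarrow> \<sigma> (\<sigma> u) = u"
    "u \<in> gr \<Longrightarrow> opp \<pi> u (\<sigma> u)" "j \<in> idx \<Longrightarrow> \<exists>u\<in>sg j. \<sigma> u \<notin> sg j"
  using assms permutes_in_image[of \<sigma> gr u] by (auto simp: pairings_def)

text \<open>This uses that there are just three cycles. A closed set contains one cycle and a second
  one linked to it; the third, not being closed itself, is linked to one of these two.\<close>

lemma linked_closed:
  assumes link: "\<And>j. j \<in> idx \<Longrightarrow> \<exists>u\<in>sg j. \<sigma> u \<notin> sg j"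
    and inv: "\<And>u. u \<in> gr \<Longrightarrow> \<sigma> u \<in> gr \<and> \<sigma> (\<sigma> u) = u"
    and T: "gclosed T" "T \<noteq> {}" "\<And>u. u \<in> T \<Longrightarrow> \<sigma> u \<in> T"
  shows "T = gr"
proof -
  have Tg: "T \<subseteq> gr" using T(1) by (simp add: gclosed_def)
  obtain i where i: "i \<in> idx" "T \<inter> sg i \<noteq> {}" using T(2) Tg gr_seg_ex by blast
  then have iT: "sg i \<subseteq> T" using gclosed_meets_seg T(1) by blast
  obtain u where u: "u \<in> sg i" "\<sigma> u \<notin> sg i" using link[OF i(1)] by blast
  then have "\<sigma> u \<in> T" using iT T(3) by blast
  then obtain j where j: "j \<in> idx" "\<sigma> u \<in> sg j" using gr_seg_ex Tg by blast
  then have jT: "sg j \<subseteq> T" using gclosed_meets_seg[OF T(1) j(1)] \<open>\<sigma> u \<in> T\<close> by blast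
  have ij: "i \<noteq> j" using u j by blast
  have "sg k \<subseteq> T" if k: "k \<in> idx" "k \<noteq> i" "k \<noteq> j" for k
  proof -
    obtain v where v: "v \<in> sg k" "\<sigma> v \<notin> sg k" using link[OF k(1)] by blast
    have vg: "v \<in> gr" using v k seg_gr by blast
    then obtain l where l: "l \<in> idx" "\<sigma> v \<in> sg l" using gr_seg_ex inv by blast
    have "l \<noteq> k" using l v by blast
    then have "l = i \<or> l = j" using l(1) i(1) j(1) k ij by auto
    then have "\<sigma> v \<in> T" using l iT jT by blast
    then have "\<sigma> (\<sigma> v) \<in> T" using T(3) by blast
    then have "v \<in> T" using inv[OF vg] by simp
    then show ?thesis using gclosed_meets_seg[OF T(1) k(1)] v by blast
  qed
  then have "sg l \<subseteq> T" if "l \<in> idx" for l using iT jT that by (cases "l = i"; cases "l = j") auto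
  then have "gr \<subseteq> T" unfolding gr_segs by (intro Un_least) auto
  then show ?thesis using Tg by blast
qed

text \<open>\<open>opp\<close> puts \<open>\<gamma> u\<close> and \<open>\<sigma> u\<close> into one
  block, so a set of arcs that is closed under \<open>\<gamma>\<close> and under having a common
  head is closed under \<open>\<sigma>\<close>.\<close>

lemma wgraph_connected_pairing:
  assumes h: "homog r gr \<C>" and cover: "\<Union>\<C> = gr" and \<sigma>: "\<sigma> \<in> pairings \<pi>"
    and r: "\<And>u v. u \<in> gr \<Longrightarrow> v \<in> gr \<Longrightarrow> block \<pi> u = block \<pi> v \<Longrightarrow> r u = r v"
  shows "uconnected (wgraph r gr \<C>)"
proof (rule wgraph_connectedI[OF h gclosed_gr])
  show "gr \<noteq> {}" using seg_nonempty gr_segs by auto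
  show "u \<in> \<Union>\<C>" if "u \<in> gr" for u using that cover by simp
  fix T assume T: "gclosed T" "T \<subseteq> gr" "T \<noteq> {}"
    and sat: "\<And>u v. u \<in> T \<Longrightarrow> v \<in> gr \<Longrightarrow> r u = r v \<Longrightarrow> v \<in> T"
  show "T = gr"
  proof (rule linked_closed[OF pairingsD(6)[OF \<sigma>] _ T(1,3)])
    show "\<sigma> u \<in> gr \<and> \<sigma> (\<sigma> u) = u" if "u \<in> gr" for u using pairingsD[OF \<sigma>] that by blast
    fix u assume u: "u \<in> T"
    then have ug: "u \<in> gr" "\<gamma> u \<in> T" "\<gamma> u \<in> gr" using T gclosed_gam[OF T(1)] by auto
    have "block \<pi> (\<gamma> u) = block \<pi> (\<sigma> u)" using pairingsD(5)[OF \<sigma> ug(1)] by (simp add: opp_def)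
    then show "\<sigma> u \<in> T" using sat[OF ug(2)] r[OF ug(3)] pairingsD(2)[OF \<sigma> ug(1)] by blast
  qed
qed

lemma disjoint_pairs:
  assumes inv: "\<And>u. u \<in> gr \<Longrightarrow> \<sigma> (\<sigma> u) = u"
  shows "disjoint ((\<lambda>u. {u, \<sigma> u}) ` gr)"
proof (rule disjointI)
  fix C D assume C: "C \<in> (\<lambda>u. {u, \<sigma> u}) ` gr" and D: "D \<in> (\<lambda>u. {u, \<sigma> u}) ` gr" and ne: "C \<noteq> D"
  obtain u where u: "u \<in> gr" "C = {u, \<sigma> u}" using C by blast
  obtain v where v: "v \<in> gr" "D = {v, \<sigma> v}" using D by blast
  show "C \<inter> D = {}"
  proof (rule ccontr)
    assume "\<not> ?thesis"
    then obtain x where "x \<in> C" "x \<in> D" by blast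
    have pair: "{w, \<sigma> w} = {x, \<sigma> x}" if "w \<in> gr" "x \<in> {w, \<sigma> w}" for w
      using that(2) inv[OF that(1)] by (elim insertE) (simp_all add: insert_commute)
    have "C = D" using u v pair[OF u(1)] pair[OF v(1)] \<open>x \<in> C\<close> \<open>x \<in> D\<close> by simp
    then show False using ne by contradiction
  qed
qed

lemma card_pairs:
  assumes inv: "\<And>u. u \<in> gr \<Longrightarrow> \<sigma> u \<in> gr \<and> \<sigma> u \<noteq> u \<and> \<sigma> (\<sigma> u) = u"
  shows "2 * card ((\<lambda>u. {u, \<sigma> u}) ` gr) = mm"
proof -
  let ?C = "(\<lambda>u. {u, \<sigma> u}) ` gr"
  have "card (\<Union>?C) = (\<Sum>C\<in>?C. card C)"
  proof (rule card_Union_disjoint)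
    show "disjoint ?C" by (rule disjoint_pairs) (simp add: inv)
  qed (auto)
  also have "\<dots> = (\<Sum>C\<in>?C. 2)" 
  proof (rule sum.cong[OF refl])
    fix C assume "C \<in> ?C"
    then obtain u where "u \<in> gr" "C = {u, \<sigma> u}" by blast
    then show "card C = 2" using inv[of u] by simp
  qed
  finally have "card (\<Union>?C) = 2 * card ?C" by simp
  moreover have "\<Union>?C = gr" using inv by blast
  ultimately show ?thesis using card_gr by simp
qed

text \<open>Take the m/2 pairs \<open>{u, \<sigma> u}\<close> as edges. A linked cycle meets some
  pair in one arc, so it gives a nonempty even edge set. With at most |\<pi>| edges the three sets
  would coincide, and a common pair would meet all three cycles oddly, although it has only two
  arcs.\<close>

lemma pairings_card_le:
  assumes P: "partition_on gr \<pi>" and \<sigma>: "\<sigma> \<in> pairings \<pi>"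
  shows "2 * card \<pi> + 2 \<le> mm"
proof -
  note s = pairingsD[OF \<sigma>]
  let ?C = "(\<lambda>u. {u, \<sigma> u}) ` gr"
  let ?W = "wgraph (block \<pi>) gr ?C"
  have h: "homog (block \<pi>) gr ?C" unfolding homog_def
  proof (intro conjI ballI)
    show "{} \<notin> ?C" by blast
    show "disjoint ?C" by (rule disjoint_pairs) (rule s(4))
    show "\<Union>?C \<subseteq> gr" using s(2) by blast
    fix C u v assume "C \<in> ?C" "u \<in> C" "v \<in> C"
    then obtain w where w: "w \<in> gr" "u \<in> {w, \<sigma> w}" "v \<in> {w, \<sigma> w}" by blast
    have "ends \<pi> w = ends \<pi> (\<sigma> w)" using opp_ends[OF s(5)[OF w(1)]] .
    then have "ends \<pi> u = ends \<pi> v" using w by auto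
    then show "{block \<pi> (\<gamma> u), block \<pi> u} = {block \<pi> (\<gamma> v), block \<pi> v}" by (simp add: ends_def)
  qed
  have cover: "\<Union>?C = gr" using s(2) by blast
  have conn: "uconnected ?W" by (rule wgraph_connected_pairing[OF h cover \<sigma>])
  note wf = wgraph_wf[OF h gclosed_gr]
  let ?F = "\<lambda>j. {C \<in> ?C. odd (card (C \<inter> sg j))}"
  have ev: "even_edges ?W (?F j)" if "j \<in> idx" for j
    using cover gclosed_seg[OF that] seg_gr[OF that] by (intro wgraph_parity[OF h gclosed_gr]) auto
  have ne: "?F j \<noteq> {}" if j: "j \<in> idx" for j
  proof -
    obtain u where u: "u \<in> sg j" "\<sigma> u \<notin> sg j" using s(6)[OF j] by blast
    then have "{u, \<sigma> u} \<inter> sg j = {u}" by blast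
    then have "odd (card ({u, \<sigma> u} \<inter> sg j))" by simp
    moreover have "{u, \<sigma> u} \<in> ?C" using u seg_gr[OF j] by blast
    ultimately show ?thesis by blast
  qed
  have "card (block \<pi> ` gr) < card ?C"
  proof (rule ccontr)
    assume "\<not> ?thesis"
    then have le: "card (uedges ?W) \<le> card (uverts ?W)" by simp
    have eq: "?F 1 = ?F j" if "j \<in> idx" for j
      by (rule unicyclic_even_edges_unique[OF wf conn le ev ev[OF that] ne ne[OF that]]) auto
    obtain C where C: "C \<in> ?F 1" using ne[of 1] by auto
    have od: "odd (card (C \<inter> sg j))" if "j \<in> idx" for j using C eq[OF that] by blast
    obtain u where u: "u \<in> gr" "C = {u, \<sigma> u}" using C by blast
    have "C \<subseteq> gr" using u s(2) by blast
    from card_split[of 1 2 3, OF _ this] have "card C = card (C \<inter> sg 1) + card (C \<inter> sg 2) + card (C \<inter> sg 3)" by simp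
    then have "odd (card C)" using od[of 1] od[of 2] od[of 3] by simp
    moreover have "card C = 2" using u s(3)[OF u(1)] by simp
    ultimately show False by simp
  qed
  then have "card \<pi> < card ?C" by (simp add: block_image[OF P])
  then show ?thesis using card_pairs[of \<sigma>] s by simp
qed

lemma pairings_class_closed:
  assumes \<sigma>: "\<sigma> \<in> pairings \<pi>" and C: "C \<in> classes \<pi> gr" and u: "u \<in> C"
  shows "\<sigma> u \<in> C"
proof -
  have ug: "u \<in> gr" using classes_sub[OF C] u by blast
  show ?thesis using classes_memI[OF C u pairingsD(2)[OF \<sigma> ug]] opp_ends[OF pairingsD(5)[OF \<sigma> ug]] by simp
qed

lemma pairings_class_even:
  assumes \<sigma>: "\<sigma> \<in> pairings \<pi>" and C: "C \<in> classes \<pi> gr"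
  shows "even (card C)"
proof (rule even_card_involution[where f = \<sigma>])
  show "finite C" using classes_sub[OF C] finite_gr finite_subset by blast
  fix u assume u: "u \<in> C"
  then have ug: "u \<in> gr" using classes_sub[OF C] by blast
  show "\<sigma> u \<in> C \<and> \<sigma> u \<noteq> u \<and> \<sigma> (\<sigma> u) = u"
    using pairings_class_closed[OF \<sigma> C u] pairingsD(3,4)[OF \<sigma> ug] by blast
qed

end

section \<open>Counting the pairings with a given partition\<close>

text \<open>Meant for arguments in \<open>{a, b, a', b'}\<close> only; everything else goes to
  \<open>a'\<close>, as \<open>b'\<close> does.\<close>

definition swap2 :: "'a \<Rightarrow> 'a \<Rightarrow> 'a \<Rightarrow> 'a \<Rightarrow> 'a \<Rightarrow> 'a" where
  "swap2 a b a' b' u = (if u = a then b else if u = b then a else if u = a' then b' else a')"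

lemma swap2_values:
  assumes "a \<noteq> a'" "a \<noteq> b'" "a' \<noteq> b" "a' \<noteq> b'" "b \<noteq> b'"
  shows "swap2 a b a' b' a = b" "swap2 a b a' b' b = a" "swap2 a b a' b' a' = b'" "swap2 a b a' b' b' = a'"
  using assms by (auto simp: swap2_def)

lemma card_4_distinct:
  assumes "card {a, a', b, b'} = 4"
  shows "a \<noteq> a'" "a \<noteq> b" "a \<noteq> b'" "a' \<noteq> b" "a' \<noteq> b'" "b \<noteq> b'"
  using assms by (auto simp: card_insert_if split: if_splits)

lemma card_2_partner:
  assumes "card C = 2" "u \<in> C"
  shows "\<exists>v. v \<noteq> u \<and> C = {u, v}"
proof -
  obtain x y where "C = {x, y}" "x \<noteq> y" using assms(1) by (auto simp: card_2_iff)
  then show ?thesis using assms(2) by (cases "u = x") auto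
qed

context three_cycles
begin

definition oppP :: "nat set set \<Rightarrow> nat set \<Rightarrow> bool" where
  "oppP \<pi> S \<longleftrightarrow> (\<forall>a\<in>S. \<forall>b\<in>S. a \<noteq> b \<longrightarrow> opp \<pi> a b)"

text \<open>The arcs of a class have the same ends, so one loop makes all of them loops.\<close>

definition loopc :: "nat set set \<Rightarrow> nat set \<Rightarrow> bool" where
  "loopc \<pi> C \<longleftrightarrow> (\<exists>u\<in>C. block \<pi> (\<gamma> u) = block \<pi> u)"

definition unsplit :: "nat set \<Rightarrow> nat set \<Rightarrow> bool" where
  "unsplit C s \<longleftrightarrow> C \<inter> s = {} \<or> C \<subseteq> s"

lemma finite_class: "C \<in> classes \<pi> gr \<Longrightarrow> finite C"
  by (rule finite_subset[OF classes_sub finite_gr])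

lemma class_ex: "u \<in> gr \<Longrightarrow> \<exists>C\<in>classes \<pi> gr. u \<in> C"
  using cls_in[of u gr] by (intro bexI[of _ "cls \<pi> gr u"])

text \<open>Two opposite arcs that form a class leave no choice, so only an involution
  \<open>\<tau>\<close> on the remaining classes \<open>\<D>\<close> has to be prescribed. A cycle
  is linked either by parity, when it meets some class oddly, or by \<open>\<tau>\<close>
  itself.\<close>

lemma pairing_exists:
  assumes D: "\<D> \<subseteq> classes \<pi> gr"
    and rest: "\<And>C. C \<in> classes \<pi> gr \<Longrightarrow> C \<notin> \<D> \<Longrightarrow> card C = 2 \<and> oppP \<pi> C"
    and \<tau>: "\<And>C u. C \<in> \<D> \<Longrightarrow> u \<in> C \<Longrightarrow> \<tau> u \<in> C \<and> \<tau> u \<noteq> u \<and> \<tau> (\<tau> u) = u \<and> opp \<pi> u (\<tau> u)"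
    and link: "\<And>j. j \<in> idx \<Longrightarrow>
      (\<exists>C\<in>classes \<pi> gr. odd (card (C \<inter> sg j))) \<or> (\<exists>C\<in>\<D>. \<exists>u\<in>C. u \<in> sg j \<and> \<tau> u \<notin> sg j)"
  shows "\<exists>\<sigma>\<in>pairings \<pi>. \<forall>u\<in>\<Union>\<D>. \<sigma> u = \<tau> u"
proof -
  have "\<forall>u\<in>gr. \<exists>v. u \<notin> \<Union>\<D> \<longrightarrow> v \<noteq> u \<and> cls \<pi> gr u = {u, v}"
  proof
    fix u assume u: "u \<in> gr"
    show "\<exists>v. u \<notin> \<Union>\<D> \<longrightarrow> v \<noteq> u \<and> cls \<pi> gr u = {u, v}"
    proof (cases "u \<in> \<Union>\<D>")
      case False
      then have "cls \<pi> gr u \<notin> \<D>" using cls_in(2)[OF u] by blast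
      then have "card (cls \<pi> gr u) = 2" using rest[OF cls_in(1)[OF u]] by blast
      from card_2_partner[OF this cls_in(2)[OF u]] show ?thesis by blast
    qed blast
  qed
  then obtain g where g: "\<And>u. u \<in> gr \<Longrightarrow> u \<notin> \<Union>\<D> \<Longrightarrow> g u \<noteq> u \<and> cls \<pi> gr u = {u, g u}"
    by (elim bchoice[THEN exE]) blast
  define \<sigma> where "\<sigma> u = (if u \<in> \<Union>\<D> then \<tau> u else if u \<in> gr then g u else u)" for u
  have Dgr: "\<Union>\<D> \<subseteq> gr" using D classes_sub by blast
  have \<sigma>: "\<sigma> u \<in> C \<and> \<sigma> u \<noteq> u \<and> \<sigma> (\<sigma> u) = u \<and> opp \<pi> u (\<sigma> u)" if C: "C \<in> classes \<pi> gr" "u \<in> C" for C u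
  proof (cases "C \<in> \<D>")
    case True
    then have "\<sigma> v = \<tau> v" if "v \<in> C" for v using that by (auto simp: \<sigma>_def)
    then show ?thesis using \<tau>[OF True C(2)] C(2) by simp
  next
    case False
    have notin: "v \<notin> \<Union>\<D>" if "v \<in> C" for v using False D C(1) that classes_eqI by blast
    have vgr: "v \<in> gr" if "v \<in> C" for v using classes_sub[OF C(1)] that by blast
    have gv: "g v \<noteq> v" "C = {v, g v}" if "v \<in> C" for v
      using g[OF vgr[OF that] notin[OF that]] classes_eq[OF C(1) that] by auto
    have sg: "\<sigma> v = g v" if "v \<in> C" for v using notin[OF that] vgr[OF that] by (simp add: \<sigma>_def)
    have guC: "g u \<in> C" using gv(2)[OF C(2)] by blast
    have "g (g u) = u"
    proof -
      have "u \<in> {g u, g (g u)}" using gv(2)[OF guC] C(2) by blast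
      then show ?thesis using gv(1)[OF C(2)] by auto
    qed
    moreover have "opp \<pi> u (g u)" using rest[OF C(1) False] guC C(2) gv(1)[OF C(2)] by (metis oppP_def)
    ultimately show ?thesis using guC gv(1)[OF C(2)] sg[OF C(2)] sg[OF guC] by simp
  qed
  have \<sigma>gr: "\<sigma> u \<in> gr \<and> \<sigma> u \<noteq> u \<and> \<sigma> (\<sigma> u) = u \<and> opp \<pi> u (\<sigma> u)" if "u \<in> gr" for u
    using \<sigma>[OF cls_in[OF that]] classes_sub[OF cls_in(1)[OF that]] by blast
  have "\<sigma> u = u" if "u \<notin> gr" for u using that Dgr by (auto simp: \<sigma>_def)
  moreover have "bij_betw \<sigma> gr gr"
    by (rule bij_betwI[where g = \<sigma>]) (use \<sigma>gr in auto)
  ultimately have perm: "\<sigma> permutes gr" by (rule bij_imp_permutes[rotated])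
  have "\<exists>u\<in>sg j. \<sigma> u \<notin> sg j" if j: "j \<in> idx" for j
    using link[OF j]
  proof
    assume "\<exists>C\<in>classes \<pi> gr. odd (card (C \<inter> sg j))"
    then obtain C where C: "C \<in> classes \<pi> gr" "odd (card (C \<inter> sg j))" by blast
    show ?thesis
    proof (rule ccontr)
      assume nl: "\<not> ?thesis"
      \<comment> \<open>If no arc of cycle \<open>j\<close> is paired outside of it, then
        \<open>\<sigma>\<close> is a fixed point free involution of
        \<open>C \<inter> sg j\<close>.\<close>
      have "even (card (C \<inter> sg j))"
        by (rule even_card_involution[where f = \<sigma>]) (use finite_class[OF C(1)] \<sigma>[OF C(1)] nl in auto)
      then show False using C(2) by contradiction
    qed
  next
    assume "\<exists>C\<in>\<D>. \<exists>u\<in>C. u \<in> sg j \<and> \<tau> u \<notin> sg j"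
    then obtain C u where "C \<in> \<D>" "u \<in> C" "u \<in> sg j" "\<tau> u \<notin> sg j" by blast
    moreover then have "\<sigma> u = \<tau> u" by (auto simp: \<sigma>_def)
    ultimately show ?thesis by (intro bexI[of _ u]) simp_all
  qed
  then have "\<sigma> \<in> pairings \<pi>" using perm \<sigma>gr unfolding pairings_def by blast
  moreover have "\<forall>u\<in>\<Union>\<D>. \<sigma> u = \<tau> u" by (simp add: \<sigma>_def)
  ultimately show ?thesis by blast
qed

lemma pairing_unique:
  assumes rest: "\<And>C. C \<in> classes \<pi> gr \<Longrightarrow> C \<notin> \<D> \<Longrightarrow> card C = 2"
    and \<sigma>: "\<sigma> \<in> pairings \<pi>" and \<sigma>': "\<sigma>' \<in> pairings \<pi>"
    and eq: "\<And>u. u \<in> \<Union>\<D> \<Longrightarrow> \<sigma> u = \<sigma>' u"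
  shows "\<sigma> = \<sigma>'"
proof
  fix u
  show "\<sigma> u = \<sigma>' u"
  proof (cases "u \<in> gr")
    case True
    then obtain C where C: "C \<in> classes \<pi> gr" "u \<in> C" using class_ex by blast
    show ?thesis
    proof (cases "C \<in> \<D>")
      case False
      then obtain v where v: "C = {u, v}" using card_2_partner[OF rest[OF C(1)] C(2)] by blast
      have "\<sigma> u = v" using pairings_class_closed[OF \<sigma> C] pairingsD(3)[OF \<sigma> True] v by auto
      moreover have "\<sigma>' u = v" using pairings_class_closed[OF \<sigma>' C] pairingsD(3)[OF \<sigma>' True] v by auto
      ultimately show ?thesis by simp
    qed (use eq C in blast)
  next
    case False
    then show ?thesis using pairingsD(1)[OF \<sigma>] pairingsD(1)[OF \<sigma>'] by (simp add: permutes_def)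
  qed
qed

text \<open>A pairing stays inside the classes, so the pair that links cycle \<open>i\<close> lies
  in a class split by this cycle.\<close>

lemma pairing_not_closed:
  assumes \<sigma>: "\<sigma> \<in> pairings \<pi>" and i: "i \<in> idx"
    and rest: "\<And>C. C \<in> classes \<pi> gr \<Longrightarrow> C \<notin> \<D> \<Longrightarrow> unsplit C (sg i)"
  shows "\<exists>u\<in>\<Union>\<D>. u \<in> sg i \<and> \<sigma> u \<notin> sg i"
proof -
  obtain u where u: "u \<in> sg i" "\<sigma> u \<notin> sg i" using pairingsD(6)[OF \<sigma> i] by blast
  have "u \<in> gr" using u seg_gr[OF i] by blast
  then obtain C where C: "C \<in> classes \<pi> gr" "u \<in> C" using class_ex by blast
  have "\<sigma> u \<in> C" using pairings_class_closed[OF \<sigma> C] .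
  then have "\<not> unsplit C (sg i)" using u C unfolding unsplit_def by blast
  then show ?thesis using rest[OF C(1)] C u by blast
qed

text \<open>The \<open>prof\<close> predicates describe \<open>\<pi>\<close> by sizes and
  orientations of its arc classes; this determines the size of the fibre, and each type is reduced
  to one of them. For a class of two arcs, an odd intersection means that it joins two
  cycles.\<close>

definition prof2 :: "nat set set \<Rightarrow> bool" where
  "prof2 \<pi> \<longleftrightarrow> (\<forall>C\<in>classes \<pi> gr. card C = 2 \<and> oppP \<pi> C) \<and>
     (\<forall>j\<in>idx. \<exists>C\<in>classes \<pi> gr. odd (card (C \<inter> sg j)))"

lemma card_pairings_prof2:
  assumes "prof2 \<pi>"
  shows "card (pairings \<pi>) = 1"
proof -
  obtain \<sigma> where \<sigma>: "\<sigma> \<in> pairings \<pi>"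
    using pairing_exists[of "{}" \<pi> id] assms unfolding prof2_def by auto
  have "pairings \<pi> = {\<sigma>}"
    using pairing_unique[of \<pi> "{}"] \<sigma> assms unfolding prof2_def by auto
  then show ?thesis by simp
qed

definition quad :: "nat set set \<Rightarrow> nat set \<Rightarrow> nat set \<Rightarrow> bool" where
  "quad \<pi> s D \<longleftrightarrow> D \<in> classes \<pi> gr \<and> card (D \<inter> s) = 2 \<and> card (D - s) = 2 \<and>
     oppP \<pi> (D \<inter> s) \<and> oppP \<pi> (D - s)"

lemma quad_card: "quad \<pi> s D \<Longrightarrow> card D = 4"
proof -
  assume q: "quad \<pi> s D"
  have "finite D" using q finite_class by (auto simp: quad_def)
  then have "card D = card (D \<inter> s) + card (D - s)"
    by (subst card_Un_disjoint[symmetric]) (auto intro: arg_cong[of _ _ card])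
  then show ?thesis using q by (simp add: quad_def)
qed

text \<open>The two arcs of each half are opposite. So if \<open>a\<close> runs parallel to
  \<open>b\<close>, it is opposite to \<open>b'\<close>, and exchanging the names \<open>b\<close>
  and \<open>b'\<close> is enough.\<close>

lemma quad_obtain:
  assumes q: "quad \<pi> s D"
  shows "\<exists>a a' b b'. D \<inter> s = {a, a'} \<and> D - s = {b, b'} \<and> a \<noteq> a' \<and> b \<noteq> b' \<and>
    opp \<pi> a b \<and> opp \<pi> a' b' \<and> opp \<pi> a a' \<and> opp \<pi> b b'"
proof -
  obtain a a' where a: "D \<inter> s = {a, a'}" "a \<noteq> a'" using q by (auto simp: quad_def card_2_iff)
  obtain b b' where b: "D - s = {b, b'}" "b \<noteq> b'" using q by (auto simp: quad_def card_2_iff)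
  have oa: "opp \<pi> a a'" and ob: "opp \<pi> b b'"
    using q a b by (auto simp: quad_def oppP_def)
  have witness: ?thesis if "D \<inter> s = {a, a'}" "D - s = {b, b'}" "a \<noteq> a'" "b \<noteq> b'"
    "opp \<pi> a b" "opp \<pi> a' b'" "opp \<pi> a a'" "opp \<pi> b b'" for a a' b b'
    by (rule exI[of _ a], rule exI[of _ a'], rule exI[of _ b], rule exI[of _ b'], intro conjI that)
  have "ends \<pi> a = ends \<pi> b"
    using classes_ends[of D \<pi> gr a b] q a b by (auto simp: quad_def)
  then consider "opp \<pi> a b" | "block \<pi> (\<gamma> a) = block \<pi> (\<gamma> b)" "block \<pi> a = block \<pi> b"
    using ends_eq_iff by blast
  then show ?thesis
  proof cases
    case 1
    then have "opp \<pi> a' b'" using oa ob by (simp add: opp_def)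
    then show ?thesis using 1 by (intro witness[OF a(1) b(1) a(2) b(2)] oa ob)
  next
    case 2
    then have "opp \<pi> a b'" "opp \<pi> a' b" using oa ob by (auto simp: opp_def)
    moreover have "D - s = {b', b}" "b' \<noteq> b" using b by auto
    moreover have "opp \<pi> b' b" by (rule opp_sym[OF ob])
    ultimately show ?thesis using witness[of a a' b' b] a oa by blast
  qed
qed

text \<open>Reversing orientation twice restores it, so a third arc opposite to both others must
  have equal source and target.\<close>

lemma opp_triangle_loop: "opp \<pi> a b \<Longrightarrow> opp \<pi> b c \<Longrightarrow> opp \<pi> a c \<Longrightarrow> block \<pi> (\<gamma> a) = block \<pi> a"
  unfolding opp_def by metis

text \<open>If \<open>a\<close> were paired with \<open>a'\<close>, the half of \<open>D\<close> in
  \<open>s\<close> would be closed under \<open>\<sigma>\<close>. One pair between the halves leaves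
  only two arcs, so the value at \<open>a\<close> determines \<open>\<sigma>\<close> on
  \<open>D\<close>.\<close>

lemma quad_pairing_values:
  assumes q: "quad \<pi> s D" and ab: "D \<inter> s = {a, a'}" "D - s = {b, b'}" "a \<noteq> a'" "b \<noteq> b'"
    and \<sigma>: "\<sigma> \<in> pairings \<pi>" and cross: "\<exists>u\<in>D. u \<in> s \<and> \<sigma> u \<notin> s"
  shows "\<sigma> a = b \<or> \<sigma> a = b'" and "\<sigma> a = b \<Longrightarrow> u \<in> D \<Longrightarrow> \<sigma> u = swap2 a b a' b' u"
proof -
  have D: "D \<in> classes \<pi> gr" using q by (simp add: quad_def)
  have Deq: "D = {a, a', b, b'}" using ab by blast
  have dist: "a \<noteq> b" "a \<noteq> b'" "a' \<noteq> b" "a' \<noteq> b'" using ab by blast+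
  have clo: "\<sigma> u \<in> D" "\<sigma> u \<noteq> u" "\<sigma> (\<sigma> u) = u" if "u \<in> D" for u
    using pairings_class_closed[OF \<sigma> D that] pairingsD(3,4)[OF \<sigma>] classes_sub[OF D] that by blast+
  obtain w where w: "w \<in> D \<inter> s" "\<sigma> w \<notin> s" using cross by blast
  have "\<sigma> a \<noteq> a'"
  proof
    assume "\<sigma> a = a'"
    then have "\<sigma> a' = a" using clo(3)[of a] Deq by simp
    then show False using w \<open>\<sigma> a = a'\<close> ab(1) by auto
  qed
  moreover have "\<sigma> a \<in> D" "\<sigma> a \<noteq> a" using clo[of a] Deq by auto
  ultimately show "\<sigma> a = b \<or> \<sigma> a = b'" using Deq by blast
  assume sab: "\<sigma> a = b" and uD: "u \<in> D"
  have sba: "\<sigma> b = a" using clo(3)[of a] sab Deq by simp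
  have a'D: "a' \<in> D" and b'D: "b' \<in> D" using Deq by auto
  have "\<sigma> a' \<noteq> a" using clo(3)[OF a'D] sab dist by auto
  moreover have "\<sigma> a' \<noteq> b" using clo(3)[OF a'D] sba ab(3) by auto
  ultimately have sa': "\<sigma> a' = b'" using clo(1,2)[OF a'D] Deq by blast
  then have "\<sigma> b' = a'" using clo(3)[OF a'D] by simp
  from uD consider "u = a" | "u = a'" | "u = b" | "u = b'" using Deq by blast
  then show "\<sigma> u = swap2 a b a' b' u"
    by cases (simp_all only: swap2_values[OF ab(3) dist(2,3,4) ab(4)] sab sba sa' \<open>\<sigma> b' = a'\<close>)
qed

lemma swap2_involution:
  assumes "D = {a, a', b, b'}" "card D = 4" "opp \<pi> a b" "opp \<pi> a' b'" "u \<in> D"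
  shows "swap2 a b a' b' u \<in> D \<and> swap2 a b a' b' u \<noteq> u \<and>
    swap2 a b a' b' (swap2 a b a' b' u) = u \<and> opp \<pi> u (swap2 a b a' b' u)"
proof -
  note d = card_4_distinct[OF assms(2)[unfolded assms(1)]]
  note v = swap2_values[OF d(1,3,4,5,6)]
  have D: "a \<in> D" "a' \<in> D" "b \<in> D" "b' \<in> D" using assms(1) by auto
  from assms(1,5) consider "u = a" | "u = a'" | "u = b" | "u = b'" by blast
  then show ?thesis
    by cases (simp_all only: v D d d[symmetric] assms(3,4) opp_sym[OF assms(3)] opp_sym[OF assms(4)]
      simp_thms not_False_eq_True)
qed

text \<open>The common shape of the 2-4 uniloop and the 2-4 unicircuit types; they differ in whether the
  class \<open>D\<close> of four arcs consists of loops.\<close>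

definition profX :: "nat set set \<Rightarrow> nat \<Rightarrow> nat set \<Rightarrow> bool" where
  "profX \<pi> i D \<longleftrightarrow> i \<in> idx \<and> quad \<pi> (sg i) D \<and>
     (\<forall>C\<in>classes \<pi> gr. C \<noteq> D \<longrightarrow> card C = 2 \<and> oppP \<pi> C \<and> unsplit C (sg i)) \<and>
     (\<forall>j\<in>idx - {i}. \<exists>C\<in>classes \<pi> gr. odd (card (C \<inter> sg j)))"

lemma profX_pairing:
  assumes X: "profX \<pi> i D" and ab: "D \<inter> sg i = {a, a'}" "D - sg i = {b, b'}" "a \<noteq> a'" "b \<noteq> b'"
    and opp: "opp \<pi> a b" "opp \<pi> a' b'"
  shows "\<exists>!\<sigma>. \<sigma> \<in> pairings \<pi> \<and> \<sigma> a = b"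
proof -
  have i: "i \<in> idx" and q: "quad \<pi> (sg i) D" using X by (auto simp: profX_def)
  have D: "D \<in> classes \<pi> gr" using q by (simp add: quad_def)
  have Deq: "D = {a, a', b, b'}" using ab by blast
  have rest: "card C = 2 \<and> oppP \<pi> C" "unsplit C (sg i)" if "C \<in> classes \<pi> gr" "C \<notin> {D}" for C
    using X that by (auto simp: profX_def)
  have "\<exists>\<sigma>\<in>pairings \<pi>. \<forall>u\<in>\<Union>{D}. \<sigma> u = swap2 a b a' b' u"
  proof (rule pairing_exists)
    show "{D} \<subseteq> classes \<pi> gr" using D by simp
    show "swap2 a b a' b' u \<in> C \<and> swap2 a b a' b' u \<noteq> u \<and>
      swap2 a b a' b' (swap2 a b a' b' u) = u \<and> opp \<pi> u (swap2 a b a' b' u)" if "C \<in> {D}" "u \<in> C" for C u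
      using swap2_involution[OF Deq quad_card[OF q] opp] that by simp
    fix j assume j: "j \<in> idx"
    show "(\<exists>C\<in>classes \<pi> gr. odd (card (C \<inter> sg j))) \<or>
      (\<exists>C\<in>{D}. \<exists>u\<in>C. u \<in> sg j \<and> swap2 a b a' b' u \<notin> sg j)"
    proof (cases "j = i")
      case True
      have "a \<in> D" "a \<in> sg i" "swap2 a b a' b' a \<notin> sg i" using ab by (auto simp: swap2_def)
      then show ?thesis using True by blast
    next
      case False
      then show ?thesis using X j unfolding profX_def by blast
    qed
  qed (use rest in blast)
  then obtain \<sigma> where \<sigma>: "\<sigma> \<in> pairings \<pi>" "\<forall>u\<in>D. \<sigma> u = swap2 a b a' b' u" by auto
  have "\<sigma> a = b" using \<sigma>(2) Deq by (auto simp: swap2_def)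
  moreover have "\<rho> = \<sigma>" if \<rho>: "\<rho> \<in> pairings \<pi>" "\<rho> a = b" for \<rho>
  proof (rule pairing_unique[of \<pi> "{D}", OF _ \<rho>(1) \<sigma>(1)])
    have cross: "\<exists>u\<in>D. u \<in> sg i \<and> \<rho> u \<notin> sg i"
      using pairing_not_closed[OF \<rho>(1) i, of "{D}"] rest by auto
    show "\<rho> u = \<sigma> u" if "u \<in> \<Union>{D}" for u
      using quad_pairing_values(2)[OF q ab \<rho>(1) cross \<rho>(2)] \<sigma>(2) that by simp
  qed (use rest in blast)
  ultimately show ?thesis using \<sigma>(1) by blast
qed

text \<open>\<open>a\<close> is paired with \<open>b\<close> or with \<open>b'\<close>. If
  \<open>D\<close> consists of loops, both choices pair opposite arcs; otherwise the second one
  would make \<open>a\<close>, \<open>b\<close>, \<open>b'\<close> pairwise opposite.\<close>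

lemma card_pairings_profX:
  assumes X: "profX \<pi> i D"
  shows "card (pairings \<pi>) = (if loopc \<pi> D then 2 else 1)"
proof -
  have i: "i \<in> idx" and q: "quad \<pi> (sg i) D" using X by (auto simp: profX_def)
  have D: "D \<in> classes \<pi> gr" using q by (simp add: quad_def)
  obtain a a' b b' where ab: "D \<inter> sg i = {a, a'}" "D - sg i = {b, b'}" "a \<noteq> a'" "b \<noteq> b'"
    and o: "opp \<pi> a b" "opp \<pi> a' b'" "opp \<pi> a a'" "opp \<pi> b b'" using quad_obtain[OF q] by blast
  have Deq: "D = {a, a', b, b'}" using ab by blast
  have rest: "unsplit C (sg i)" if "C \<in> classes \<pi> gr" "C \<notin> {D}" for C
    using X that by (auto simp: profX_def)
  have vals: "\<sigma> a = b \<or> \<sigma> a = b'" if "\<sigma> \<in> pairings \<pi>" for \<sigma>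
    using quad_pairing_values(1)[OF q ab that] pairing_not_closed[OF that i, of "{D}"] rest by auto
  obtain \<sigma>1 where \<sigma>1: "\<sigma>1 \<in> pairings \<pi>" "\<sigma>1 a = b" "\<And>\<sigma>. \<sigma> \<in> pairings \<pi> \<Longrightarrow> \<sigma> a = b \<Longrightarrow> \<sigma> = \<sigma>1"
    using profX_pairing[OF X ab o(1,2)] by blast
  show ?thesis
  proof (cases "loopc \<pi> D")
    case True
    then obtain u where u: "u \<in> D" "block \<pi> (\<gamma> u) = block \<pi> u" by (auto simp: loopc_def)
    have loop: "block \<pi> (\<gamma> v) = block \<pi> u \<and> block \<pi> v = block \<pi> u" if "v \<in> D" for v
      using classes_ends[OF D that u(1)] u(2) by (auto simp: ends_def)
    have all_opp: "opp \<pi> v w" if "v \<in> D" "w \<in> D" for v w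
      using loop[OF that(1)] loop[OF that(2)] by (simp add: opp_def)
    have ab': "D - sg i = {b', b}" using ab(2) by blast
    have o': "opp \<pi> a b'" "opp \<pi> a' b" using Deq by (auto intro!: all_opp)
    obtain \<sigma>2 where \<sigma>2: "\<sigma>2 \<in> pairings \<pi>" "\<sigma>2 a = b'" "\<And>\<sigma>. \<sigma> \<in> pairings \<pi> \<Longrightarrow> \<sigma> a = b' \<Longrightarrow> \<sigma> = \<sigma>2"
      using profX_pairing[OF X ab(1) ab' ab(3) ab(4)[symmetric] o'] by blast
    have "pairings \<pi> = {\<sigma>1, \<sigma>2}"
    proof (intro equalityI subsetI)
      fix \<sigma> assume "\<sigma> \<in> pairings \<pi>"
      then show "\<sigma> \<in> {\<sigma>1, \<sigma>2}" using vals \<sigma>1(3) \<sigma>2(3) by blast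
    qed (use \<sigma>1(1) \<sigma>2(1) in blast)
    moreover have "\<sigma>1 \<noteq> \<sigma>2" using \<sigma>1(2) \<sigma>2(2) ab(4) by auto
    ultimately show ?thesis using True by simp
  next
    case False
    have "\<sigma> a \<noteq> b'" if \<sigma>: "\<sigma> \<in> pairings \<pi>" for \<sigma>
    proof
      assume "\<sigma> a = b'"
      moreover have "a \<in> gr" using Deq classes_sub[OF D] by blast
      ultimately have "opp \<pi> a b'" using pairingsD(5)[OF \<sigma>] by metis
      then have "block \<pi> (\<gamma> a) = block \<pi> a" using opp_triangle_loop o by blast
      then show False using False Deq by (auto simp: loopc_def)
    qed
    then have "pairings \<pi> = {\<sigma>1}" using vals \<sigma>1 by blast
    then show ?thesis using False by simp
  qed
qed

end

section \<open>Fibres over the two tree types\<close>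

definition swap3 :: "'a \<Rightarrow> 'a \<Rightarrow> 'a \<Rightarrow> 'a \<Rightarrow> 'a \<Rightarrow> 'a \<Rightarrow> 'a \<Rightarrow> 'a" where
  "swap3 x x' y y' z z' u = (if u = x then x' else if u = x' then x
     else if u = y then y' else if u = y' then y else if u = z then z' else z)"

lemma swap3_values:
  assumes "distinct [x, x', y, y', z, z']"
  shows "swap3 x x' y y' z z' x = x'" "swap3 x x' y y' z z' x' = x"
    "swap3 x x' y y' z z' y = y'" "swap3 x x' y y' z z' y' = y"
    "swap3 x x' y y' z z' z = z'" "swap3 x x' y y' z z' z' = z"
  using assms by (auto simp: swap3_def)

context three_cycles
begin

lemma quad_nonloop_value:
  assumes q: "quad \<pi> s D" and ab: "D \<inter> s = {a, a'}" "D - s = {b, b'}" "a \<noteq> a'" "b \<noteq> b'"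
    and o: "opp \<pi> a b" "opp \<pi> b b'" and nl: "\<not> loopc \<pi> D"
    and \<sigma>: "\<sigma> \<in> pairings \<pi>" and cross: "\<exists>u\<in>D. u \<in> s \<and> \<sigma> u \<notin> s"
  shows "\<sigma> a = b"
proof (rule ccontr)
  assume "\<sigma> a \<noteq> b"
  then have sab: "\<sigma> a = b'" using quad_pairing_values(1)[OF q ab \<sigma> cross] by blast
  have D: "D \<in> classes \<pi> gr" using q by (simp add: quad_def)
  have aD: "a \<in> D" using ab by blast
  then have "a \<in> gr" using classes_sub[OF D] by blast
  then have "opp \<pi> a b'" using pairingsD(5)[OF \<sigma>] sab by metis
  then have "block \<pi> (\<gamma> a) = block \<pi> a" using opp_triangle_loop o by blast
  then show False using nl aD by (auto simp: loopc_def)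
qed

text \<open>\<open>j\<close> is the cycle in the middle: it shares \<open>D1\<close> with
  \<open>i\<close> and \<open>D2\<close> with \<open>k\<close>, and no other class joins two
  cycles.\<close>

definition prof44 :: "nat set set \<Rightarrow> nat \<Rightarrow> nat \<Rightarrow> nat \<Rightarrow> nat set \<Rightarrow> nat set \<Rightarrow> bool" where
  "prof44 \<pi> i j k D1 D2 \<longleftrightarrow> {i, j, k} = idx \<and> D1 \<noteq> D2 \<and>
     quad \<pi> (sg i) D1 \<and> D1 - sg i \<subseteq> sg j \<and> \<not> loopc \<pi> D1 \<and>
     quad \<pi> (sg k) D2 \<and> D2 - sg k \<subseteq> sg j \<and> \<not> loopc \<pi> D2 \<and>
     (\<forall>C\<in>classes \<pi> gr. C \<noteq> D1 \<longrightarrow> C \<noteq> D2 \<longrightarrow> card C = 2 \<and> oppP \<pi> C \<and> (\<forall>l\<in>idx. unsplit C (sg l)))"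

lemma card_pairings_prof44:
  assumes X: "prof44 \<pi> i j k D1 D2"
  shows "card (pairings \<pi>) = 1"
proof -
  have ijk: "{i, j, k} = idx" and q1: "quad \<pi> (sg i) D1" and q2: "quad \<pi> (sg k) D2"
    and sub: "D1 - sg i \<subseteq> sg j" "D2 - sg k \<subseteq> sg j" and nl: "\<not> loopc \<pi> D1" "\<not> loopc \<pi> D2"
    and D12: "D1 \<noteq> D2" using X by (simp_all add: prof44_def)
  note p = idx_perm[OF ijk]
  have D: "D1 \<in> classes \<pi> gr" "D2 \<in> classes \<pi> gr" using q1 q2 by (simp_all add: quad_def)
  have disj: "D1 \<inter> D2 = {}" using classes_eqI[OF D] D12 by blast
  have rest: "card C = 2 \<and> oppP \<pi> C" "\<And>l. l \<in> idx \<Longrightarrow> unsplit C (sg l)"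
    if "C \<in> classes \<pi> gr" "C \<notin> {D1, D2}" for C
    using X that by (auto simp: prof44_def)
  obtain a a' b b' where ab: "D1 \<inter> sg i = {a, a'}" "D1 - sg i = {b, b'}" "a \<noteq> a'" "b \<noteq> b'"
    and oab: "opp \<pi> a b" "opp \<pi> a' b'" "opp \<pi> a a'" "opp \<pi> b b'" using quad_obtain[OF q1] by blast
  obtain c c' d d' where cd: "D2 \<inter> sg k = {c, c'}" "D2 - sg k = {d, d'}" "c \<noteq> c'" "d \<noteq> d'"
    and ocd: "opp \<pi> c d" "opp \<pi> c' d'" "opp \<pi> c c'" "opp \<pi> d d'" using quad_obtain[OF q2] by blast
  have D1eq: "D1 = {a, a', b, b'}" and D2eq: "D2 = {c, c', d, d'}" using ab cd by blast+
  define \<tau> where "\<tau> u = (if u \<in> D1 then swap2 a b a' b' u else swap2 c d c' d' u)" for u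
  have \<tau>1: "\<tau> u = swap2 a b a' b' u" if "u \<in> D1" for u using that by (simp add: \<tau>_def)
  have \<tau>2: "\<tau> u = swap2 c d c' d' u" if "u \<in> D2" for u using that disj by (auto simp: \<tau>_def)
  note dab = card_4_distinct[OF quad_card[OF q1, unfolded D1eq]]
  note dcd = card_4_distinct[OF quad_card[OF q2, unfolded D2eq]]
  note vab = swap2_values[OF dab(1,3,4,5,6)] and vcd = swap2_values[OF dcd(1,3,4,5,6)]
  have "\<exists>\<sigma>\<in>pairings \<pi>. \<forall>u\<in>\<Union>{D1, D2}. \<sigma> u = \<tau> u"
  proof (rule pairing_exists)
    show "{D1, D2} \<subseteq> classes \<pi> gr" using D by simp
    show "\<tau> u \<in> C \<and> \<tau> u \<noteq> u \<and> \<tau> (\<tau> u) = u \<and> opp \<pi> u (\<tau> u)" if C: "C \<in> {D1, D2}" "u \<in> C" for C u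
    proof (cases "C = D1")
      case True
      then have u: "u \<in> D1" using C by blast
      note s = swap2_involution[OF D1eq quad_card[OF q1] oab(1,2) u]
      show ?thesis using s \<tau>1[OF u] \<tau>1[OF s[THEN conjunct1]] True by simp
    next
      case False
      then have "C = D2" using C by blast
      then have u: "u \<in> D2" using C by blast
      note s = swap2_involution[OF D2eq quad_card[OF q2] ocd(1,2) u]
      show ?thesis using s \<tau>2[OF u] \<tau>2[OF s[THEN conjunct1]] \<open>C = D2\<close> by simp
    qed
    fix l assume l: "l \<in> idx"
    then have "l = i \<or> l = j \<or> l = k" using ijk by blast
    moreover have mem: "a \<in> D1" "a \<in> sg i" "b \<in> D1" "b \<notin> sg i" "c \<in> D2" "c \<in> sg k" "d \<notin> sg k"
      using ab(1,2) cd(1,2) by blast+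
    moreover have bj: "b \<in> sg j" "a \<notin> sg j" using sub(1) mem p(8) by blast+
    moreover have "\<tau> a \<notin> sg i" "\<tau> b \<notin> sg j" "\<tau> c \<notin> sg k"
      unfolding \<tau>1[OF mem(1)] \<tau>1[OF mem(3)] \<tau>2[OF mem(5)] vab vcd by (rule mem bj)+
    ultimately show "(\<exists>C\<in>classes \<pi> gr. odd (card (C \<inter> sg l))) \<or>
      (\<exists>C\<in>{D1, D2}. \<exists>u\<in>C. u \<in> sg l \<and> \<tau> u \<notin> sg l)" by blast
  qed (use rest in blast)
  then obtain \<sigma> where \<sigma>: "\<sigma> \<in> pairings \<pi>" "\<forall>u\<in>\<Union>{D1, D2}. \<sigma> u = \<tau> u" by blast
  have "\<rho> = \<sigma>" if \<rho>: "\<rho> \<in> pairings \<pi>" for \<rho>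
  proof (rule pairing_unique[of \<pi> "{D1, D2}", OF _ \<rho> \<sigma>(1)])
    \<comment> \<open>Cycle \<open>i\<close> can be linked only in \<open>D1\<close> and cycle
      \<open>k\<close> only in \<open>D2\<close>. As neither class consists of loops, the pairing is
      forced on both.\<close>
    have "D2 \<inter> sg i = {}" using sub p by blast
    then have cr1: "\<exists>u\<in>D1. u \<in> sg i \<and> \<rho> u \<notin> sg i"
      using pairing_not_closed[OF \<rho> p(1), of "{D1, D2}", OF rest(2)[OF _ _ p(1)]] by auto
    have "D1 \<inter> sg k = {}" using sub p by blast
    then have cr2: "\<exists>u\<in>D2. u \<in> sg k \<and> \<rho> u \<notin> sg k"
      using pairing_not_closed[OF \<rho> p(3), of "{D1, D2}", OF rest(2)[OF _ _ p(3)]] by auto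
    have "\<rho> a = b" by (rule quad_nonloop_value[OF q1 ab oab(1,4) nl(1) \<rho> cr1])
    then have r1: "\<rho> u = \<tau> u" if "u \<in> D1" for u
      using quad_pairing_values(2)[OF q1 ab \<rho> cr1] that \<tau>1 by simp
    have "\<rho> c = d" by (rule quad_nonloop_value[OF q2 cd ocd(1,4) nl(2) \<rho> cr2])
    then have r2: "\<rho> u = \<tau> u" if "u \<in> D2" for u
      using quad_pairing_values(2)[OF q2 cd \<rho> cr2] that \<tau>2 by simp
    show "\<rho> u = \<sigma> u" if "u \<in> \<Union>{D1, D2}" for u using \<sigma>(2) r1 r2 that by auto
  qed (use rest in blast)
  then have "pairings \<pi> = {\<sigma>}" using \<sigma>(1) by blast
  then show ?thesis by simp
qed

definition prof6 :: "nat set set \<Rightarrow> nat set \<Rightarrow> bool" where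
  "prof6 \<pi> D \<longleftrightarrow> D \<in> classes \<pi> gr \<and> \<not> loopc \<pi> D \<and>
     (\<forall>l\<in>idx. card (D \<inter> sg l) = 2 \<and> oppP \<pi> (D \<inter> sg l)) \<and>
     (\<forall>C\<in>classes \<pi> gr. C \<noteq> D \<longrightarrow> card C = 2 \<and> oppP \<pi> C \<and> (\<forall>l\<in>idx. unsplit C (sg l)))"

text \<open>Each cycle has one arc of \<open>D\<close> in each direction between \<alpha> and
  \<beta>, and a pairing matches arcs of different directions. Since no cycle may pair its own two
  arcs, what remains is a derangement of the three cycles, determined by one value.\<close>

lemma prof6_pairing:
  assumes X: "prof6 \<pi> D" and ijk: "{i, j, k} = idx"
    and D3: "D \<inter> sg i = {x, x'}" "D \<inter> sg j = {y, y'}" "D \<inter> sg k = {z, z'}"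
    and ne: "x \<noteq> x'" "y \<noteq> y'" "z \<noteq> z'" and ab: "\<alpha> \<noteq> \<beta>"
    and pos: "\<And>u. u \<in> {x, y, z} \<Longrightarrow> block \<pi> (\<gamma> u) = \<beta> \<and> block \<pi> u = \<alpha>"
    and neg: "\<And>u. u \<in> {x', y', z'} \<Longrightarrow> block \<pi> (\<gamma> u) = \<alpha> \<and> block \<pi> u = \<beta>"
  shows "\<exists>!\<sigma>. \<sigma> \<in> pairings \<pi> \<and> \<sigma> x = y'" and "\<sigma> \<in> pairings \<pi> \<Longrightarrow> \<sigma> x = y' \<or> \<sigma> x = z'"
proof -
  note p = idx_perm[OF ijk]
  have D: "D \<in> classes \<pi> gr" using X by (simp add: prof6_def)
  have Deq: "D = {x, x', y, y', z, z'}" using D3 classes_sub[OF D] p(7) by blast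
  have rest: "card C = 2 \<and> oppP \<pi> C" "\<And>l. l \<in> idx \<Longrightarrow> unsplit C (sg l)"
    if "C \<in> classes \<pi> gr" "C \<notin> {D}" for C
    using X that by (auto simp: prof6_def)
  have opp_pn: "opp \<pi> u v" if "u \<in> {x, y, z}" "v \<in> {x', y', z'}" for u v
    using pos[OF that(1)] neg[OF that(2)] by (simp add: opp_def)
  have ix: "x \<in> sg i" "x' \<in> sg i" "y \<in> sg j" "y' \<in> sg j" "z \<in> sg k" "z' \<in> sg k" using D3 by blast+
  have sep: "u \<noteq> v" if "u \<in> sg a" "v \<in> sg b" "sg a \<inter> sg b = {}" for u v a b using that by blast
  have dist: "distinct [x, y', y, z', z, x']"
    using ne sep[OF ix(1,3) p(8)] sep[OF ix(1,4) p(8)] sep[OF ix(2,3) p(8)] sep[OF ix(2,4) p(8)]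
      sep[OF ix(1,5) p(9)] sep[OF ix(1,6) p(9)] sep[OF ix(2,5) p(9)] sep[OF ix(2,6) p(9)]
      sep[OF ix(3,5) p(10)] sep[OF ix(3,6) p(10)] sep[OF ix(4,5) p(10)] sep[OF ix(4,6) p(10)]
    by (simp only: distinct.simps list.set insert_iff empty_iff not_sym simp_thms)
  \<comment> \<open>A cyclic derangement: \<open>x\<close> goes with \<open>y'\<close>,
    \<open>y\<close> with \<open>z'\<close>, and \<open>z\<close> with \<open>x'\<close>.\<close>
  define \<tau> where "\<tau> = swap3 x y' y z' z x'"
  note v = swap3_values[OF dist, folded \<tau>_def]
  have image: "\<rho> u \<in> {x', y', z'}" if \<rho>: "\<rho> \<in> pairings \<pi>" and u: "u \<in> {x, y, z}" for \<rho> u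
  proof -
    have uD: "u \<in> D" using u Deq by blast
    then have ug: "u \<in> gr" using classes_sub[OF D] by blast
    have "block \<pi> (\<rho> u) = \<beta>" using pairingsD(5)[OF \<rho> ug] pos[OF u] by (simp add: opp_def)
    then have "\<rho> u \<notin> {x, y, z}" using pos[of "\<rho> u"] ab by auto
    then show ?thesis using pairings_class_closed[OF \<rho> D uD] Deq by blast
  qed
  have inv: "\<rho> (\<rho> u) = u" if "\<rho> \<in> pairings \<pi>" "u \<in> D" for \<rho> u
    using pairingsD(4)[OF that(1)] classes_sub[OF D] that(2) by blast
  \<comment> \<open>All other classes lie inside or outside each cycle, so a cycle that pairs its
    own two arcs in \<open>D\<close> would not be linked.\<close>
  have cross: "\<rho> u \<noteq> u'" if \<rho>: "\<rho> \<in> pairings \<pi>" and l: "l \<in> idx" and u: "D \<inter> sg l = {u, u'}" for \<rho> u u' l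
  proof
    assume "\<rho> u = u'"
    moreover have "u \<in> D" using u by blast
    ultimately have "\<rho> u' = u" using inv[OF \<rho>, of u] by simp
    moreover obtain w where "w \<in> D" "w \<in> sg l" "\<rho> w \<notin> sg l"
      using pairing_not_closed[OF \<rho> l, of "{D}", OF rest(2)[OF _ _ l]] by auto
    ultimately have "w \<in> D \<inter> sg l" "\<rho> w \<notin> sg l" "\<rho> u' \<in> sg l" "\<rho> u \<in> sg l"
      using u \<open>\<rho> u = u'\<close> by auto
    then show False unfolding u by blast
  qed
  show "\<sigma> x = y' \<or> \<sigma> x = z'" if "\<sigma> \<in> pairings \<pi>" for \<sigma>
    using image[OF that, of x] cross[OF that p(1) D3(1)] by blast
  have Dcases: "u = x \<or> u = y' \<or> u = y \<or> u = z' \<or> u = z \<or> u = x'" if "u \<in> D" for u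
    using that Deq by blast
  have "\<exists>\<sigma>\<in>pairings \<pi>. \<forall>u\<in>\<Union>{D}. \<sigma> u = \<tau> u"
  proof (rule pairing_exists)
    show "{D} \<subseteq> classes \<pi> gr" using D by simp
    show "\<tau> u \<in> C \<and> \<tau> u \<noteq> u \<and> \<tau> (\<tau> u) = u \<and> opp \<pi> u (\<tau> u)" if C: "C \<in> {D}" "u \<in> C" for C u
    proof -
      have uD: "u \<in> D" and CD: "C = D" using C by auto
      have "\<tau> u \<in> D \<and> \<tau> (\<tau> u) = u" using Dcases[OF uD]
        by (elim disjE) (simp_all only: v, simp_all add: Deq)
      moreover have "opp \<pi> u (\<tau> u)" using Dcases[OF uD]
        by (elim disjE; simp only: v) (intro opp_pn opp_sym[OF opp_pn]; blast)+
      moreover have "\<tau> u \<noteq> u"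
      proof
        assume "\<tau> u = u"
        then have "opp \<pi> u u" using \<open>opp \<pi> u (\<tau> u)\<close> by simp
        then have "block \<pi> (\<gamma> u) = block \<pi> u" unfolding opp_def by blast
        moreover have "\<not> loopc \<pi> D" using X by (simp add: prof6_def)
        ultimately show False using uD unfolding loopc_def by blast
      qed
      ultimately show ?thesis using CD by blast
    qed
    fix l assume l: "l \<in> idx"
    then have "l = i \<or> l = j \<or> l = k" using ijk by blast
    moreover have "x \<in> D" "y \<in> D" "z \<in> D" unfolding Deq by blast+
    moreover have "y' \<notin> sg i" "z' \<notin> sg j" "x' \<notin> sg k" using ix p(8-10) by blast+
    then have "\<tau> x \<notin> sg i" "\<tau> y \<notin> sg j" "\<tau> z \<notin> sg k" unfolding v .
    ultimately show "(\<exists>C\<in>classes \<pi> gr. odd (card (C \<inter> sg l))) \<or>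
      (\<exists>C\<in>{D}. \<exists>u\<in>C. u \<in> sg l \<and> \<tau> u \<notin> sg l)" using ix by blast
  qed (use rest in blast)
  then obtain \<sigma> where \<sigma>: "\<sigma> \<in> pairings \<pi>" "\<forall>u\<in>D. \<sigma> u = \<tau> u" by auto
  have "\<rho> = \<sigma>" if \<rho>: "\<rho> \<in> pairings \<pi>" "\<rho> x = y'" for \<rho>
  proof (rule pairing_unique[of \<pi> "{D}", OF _ \<rho>(1) \<sigma>(1)])
    have inD: "x \<in> D" "y \<in> D" "z \<in> D" unfolding Deq by blast+
    have ry': "\<rho> y' = x" using inv[OF \<rho>(1) inD(1)] \<rho>(2) by simp
    have inj: "\<rho> u \<noteq> \<rho> w" if "u \<in> D" "w \<in> D" "u \<noteq> w" for u w
      using inv[OF \<rho>(1) that(1)] inv[OF \<rho>(1) that(2)] that(3) by metis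
    have xyz: "x \<noteq> y" "x \<noteq> z" "y \<noteq> z" using dist by auto
    have ry: "\<rho> y \<in> {x', z'}" using image[OF \<rho>(1), of y] cross[OF \<rho>(1) p(2) D3(2)] by blast
    have rz: "\<rho> z \<in> {x', y'}" using image[OF \<rho>(1), of z] cross[OF \<rho>(1) p(3) D3(3)] by blast
    have rz: "\<rho> z = x'" using rz inj[OF inD(1,3) xyz(2)] \<rho>(2) by blast
    have ry: "\<rho> y = z'" using ry inj[OF inD(2,3) xyz(3)] rz by auto
    have "\<rho> x' = z" "\<rho> z' = y" using inv[OF \<rho>(1) inD(3)] inv[OF \<rho>(1) inD(2)] rz ry by auto
    then have "\<rho> u = \<tau> u" if "u \<in> D" for u
      using Dcases[OF that] by (elim disjE) (simp_all only: v \<rho>(2) ry' ry rz)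
    then show "\<rho> u = \<sigma> u" if "u \<in> \<Union>{D}" for u using \<sigma>(2) that by auto
  qed (use rest in blast)
  moreover have "\<sigma> x = y'" using \<sigma>(2) Deq v(1) by auto
  ultimately show "\<exists>!\<sigma>. \<sigma> \<in> pairings \<pi> \<and> \<sigma> x = y'" using \<sigma>(1) by blast
qed

lemma card_pairings_prof6:
  assumes X: "prof6 \<pi> D"
  shows "card (pairings \<pi>) = 2"
proof -
  have D: "D \<in> classes \<pi> gr" and nl: "\<not> loopc \<pi> D" using X by (simp_all add: prof6_def)
  obtain w where w: "w \<in> D" using classes_ne[OF D] by blast
  define \<alpha> where "\<alpha> = block \<pi> w"
  define \<beta> where "\<beta> = block \<pi> (\<gamma> w)"
  have ab: "\<alpha> \<noteq> \<beta>" using nl w by (auto simp: loopc_def \<alpha>_def \<beta>_def)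
  have split: "\<exists>u u'. D \<inter> sg l = {u, u'} \<and> u \<noteq> u' \<and> (block \<pi> (\<gamma> u) = \<beta> \<and> block \<pi> u = \<alpha>) \<and>
      (block \<pi> (\<gamma> u') = \<alpha> \<and> block \<pi> u' = \<beta>)" if l: "l \<in> idx" for l
  proof -
    obtain u u' where u: "D \<inter> sg l = {u, u'}" "u \<noteq> u'" using X l by (auto simp: prof6_def card_2_iff)
    have o: "opp \<pi> u u'" using X l u unfolding prof6_def oppP_def by blast
    have "ends \<pi> u = {\<beta>, \<alpha>}" using classes_ends[OF D _ w, of u] u by (auto simp: ends_def \<alpha>_def \<beta>_def)
    then consider "block \<pi> (\<gamma> u) = \<beta>" "block \<pi> u = \<alpha>" | "block \<pi> (\<gamma> u) = \<alpha>" "block \<pi> u = \<beta>"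
      unfolding ends_def doubleton_eq_iff by blast
    then show ?thesis
    proof cases
      case 1
      then show ?thesis using o u by (intro exI[of _ u] exI[of _ u']) (simp add: opp_def)
    next
      case 2
      then have "block \<pi> (\<gamma> u') = \<beta> \<and> block \<pi> u' = \<alpha>" using o by (simp add: opp_def)
      moreover have "D \<inter> sg l = {u', u}" using u by blast
      ultimately show ?thesis using 2 u(2) by blast
    qed
  qed
  obtain x x' where x: "D \<inter> sg 1 = {x, x'}" "x \<noteq> x'" "block \<pi> (\<gamma> x) = \<beta> \<and> block \<pi> x = \<alpha>"
      "block \<pi> (\<gamma> x') = \<alpha> \<and> block \<pi> x' = \<beta>" using split[of 1] by auto
  obtain y y' where y: "D \<inter> sg 2 = {y, y'}" "y \<noteq> y'" "block \<pi> (\<gamma> y) = \<beta> \<and> block \<pi> y = \<alpha>"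
      "block \<pi> (\<gamma> y') = \<alpha> \<and> block \<pi> y' = \<beta>" using split[of 2] by auto
  obtain z z' where z: "D \<inter> sg 3 = {z, z'}" "z \<noteq> z'" "block \<pi> (\<gamma> z) = \<beta> \<and> block \<pi> z = \<alpha>"
      "block \<pi> (\<gamma> z') = \<alpha> \<and> block \<pi> z' = \<beta>" using split[of 3] by auto
  have pos: "block \<pi> (\<gamma> u) = \<beta> \<and> block \<pi> u = \<alpha>" if "u \<in> {x, y, z}" for u
    using that x(3) y(3) z(3) by (elim insertE) (simp_all only: simp_thms empty_iff)
  have neg: "block \<pi> (\<gamma> u) = \<alpha> \<and> block \<pi> u = \<beta>" if "u \<in> {x', y', z'}" for u
    using that x(4) y(4) z(4) by (elim insertE) (simp_all only: simp_thms empty_iff)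
  have pos': "block \<pi> (\<gamma> u) = \<beta> \<and> block \<pi> u = \<alpha>" if "u \<in> {x, z, y}" for u using pos that by blast
  have neg': "block \<pi> (\<gamma> u) = \<alpha> \<and> block \<pi> u = \<beta>" if "u \<in> {x', z', y'}" for u using neg that by blast
  note A = prof6_pairing[OF X refl x(1) y(1) z(1) x(2) y(2) z(2) ab pos neg]
  \<comment> \<open>Exchanging the roles of cycles 2 and 3 gives the other derangement.\<close>
  have "{1, 3, 2} = idx" by blast
  note B = prof6_pairing[OF X this x(1) z(1) y(1) x(2) z(2) y(2) ab pos' neg']
  obtain \<sigma>1 where \<sigma>1: "\<sigma>1 \<in> pairings \<pi>" "\<sigma>1 x = y'" "\<And>\<sigma>. \<sigma> \<in> pairings \<pi> \<Longrightarrow> \<sigma> x = y' \<Longrightarrow> \<sigma> = \<sigma>1"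
    using A(1) by blast
  obtain \<sigma>2 where \<sigma>2: "\<sigma>2 \<in> pairings \<pi>" "\<sigma>2 x = z'" "\<And>\<sigma>. \<sigma> \<in> pairings \<pi> \<Longrightarrow> \<sigma> x = z' \<Longrightarrow> \<sigma> = \<sigma>2"
    using B(1) by blast
  have "pairings \<pi> = {\<sigma>1, \<sigma>2}"
  proof (intro equalityI subsetI)
    fix \<sigma> assume "\<sigma> \<in> pairings \<pi>"
    then show "\<sigma> \<in> {\<sigma>1, \<sigma>2}" using A(2) \<sigma>1(3) \<sigma>2(3) by blast
  qed (use \<sigma>1(1) \<sigma>2(1) in blast)
  moreover have "\<sigma>1 \<noteq> \<sigma>2"
  proof
    assume "\<sigma>1 = \<sigma>2"
    then have "y' = z'" using \<sigma>1(2) \<sigma>2(2) by simp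
    then show False using y(1) z(1) seg_disjoint(3) by blast
  qed
  ultimately show ?thesis by simp
qed

end

section \<open>From the types to the sizes of the arc classes\<close>

lemma even_edges_loop:
  assumes "e \<in> uedges H" "uends H e = {p}"
  shows "even_edges H {e}"
proof -
  have "{f \<in> {e}. crosses (uends H f) {v}} = {}" for v using assms(2) by (auto simp: crosses_def)
  then show ?thesis using assms(1) unfolding even_edges_def by (simp only: card.empty even_zero) simp
qed

lemma sum_le_others_zero:
  fixes f :: "'a \<Rightarrow> nat"
  assumes "finite A" "B \<subseteq> A" "sum f A \<le> sum f B" "c \<in> A" "c \<notin> B"
  shows "f c = 0"
proof -
  have "sum f A = sum f (A - B) + sum f B" using assms(1,2) by (metis sum.subset_diff)
  then have "sum f (A - B) = 0" using assms(3) by simp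
  then show ?thesis using assms(1,4,5) by simp
qed

context three_cycles
begin

lemma homog_subclasses:
  assumes "partition_on gr \<pi>" "gclosed I" "J \<subseteq> I"
  shows "homog (rb \<pi> I) I (classes \<pi> J)"
  unfolding homog_def
proof (intro conjI ballI)
  show "{} \<notin> classes \<pi> J" using classes_ne by blast
  show "disjoint (classes \<pi> J)" by (rule classes_disjoint)
  show "\<Union>(classes \<pi> J) \<subseteq> I" using assms(3) by (simp add: Union_classes)
  fix C u v assume C: "C \<in> classes \<pi> J" "u \<in> C" "v \<in> C"
  have "u \<in> I" "v \<in> I" using classes_sub[OF C(1)] C assms(3) by auto
  then show "{rb \<pi> I (\<gamma> u), rb \<pi> I u} = {rb \<pi> I (\<gamma> v), rb \<pi> I v}"
    using rb_ends_eq_iff[OF assms(1,2)] classes_ends[OF C] by simp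
qed

abbreviation "W \<pi> I \<equiv> wgraph (rb \<pi> I) I (classes \<pi> I)"

lemma W_wf: "partition_on gr \<pi> \<Longrightarrow> gclosed I \<Longrightarrow> wf_ugraph (W \<pi> I)"
  by (rule wgraph_wf[OF homog_subclasses]) auto

lemma W_ends: "partition_on gr \<pi> \<Longrightarrow> gclosed I \<Longrightarrow> C \<in> classes \<pi> I \<Longrightarrow> u \<in> C \<Longrightarrow>
    uends (W \<pi> I) C = {rb \<pi> I (\<gamma> u), rb \<pi> I u}"
  by (rule wgraph_ends[OF homog_subclasses]) auto

lemma W_parity:
  assumes P: "partition_on gr \<pi>" and I: "gclosed I" and j: "j \<in> idx" "sg j \<subseteq> I"
  shows "even_edges (W \<pi> I) {C \<in> classes \<pi> I. odd (card (C \<inter> sg j))}"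
  by (rule wgraph_parity[OF homog_subclasses[OF P I order_refl] I gclosed_seg[OF j(1)] j(2)])
    (use j(2) in \<open>auto simp: Union_classes\<close>)

lemma uverts_card: "partition_on gr \<pi> \<Longrightarrow> gclosed I \<Longrightarrow> card (rb \<pi> I ` I) = card (restrict_partition \<pi> I)"
  using uverts_restrict by simp

lemma W_gr_card: "partition_on gr \<pi> \<Longrightarrow> card (rb \<pi> gr ` gr) = card \<pi>"
  using uverts_card[OF _ gclosed_gr] restrict_gr by simp

definition share :: "nat set set \<Rightarrow> nat \<Rightarrow> nat \<Rightarrow> bool" where
  "share \<pi> i j \<longleftrightarrow> (\<exists>u\<in>sg i. \<exists>v\<in>sg j. block \<pi> u = block \<pi> v)"

lemma share_sym: "share \<pi> i j \<Longrightarrow> share \<pi> j i"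
  unfolding share_def by metis

lemma share_absorb:
  assumes "share \<pi> i j" "j \<in> idx" "gclosed T" "sg i \<subseteq> T" "sg j \<subseteq> I"
    and sat: "\<And>u v. u \<in> T \<Longrightarrow> v \<in> I \<Longrightarrow> block \<pi> u = block \<pi> v \<Longrightarrow> v \<in> T"
  shows "sg j \<subseteq> T"
proof -
  obtain u v where uv: "u \<in> sg i" "v \<in> sg j" "block \<pi> u = block \<pi> v" using assms(1) by (auto simp: share_def)
  then have "v \<in> T" using sat[of u v] assms(4,5) by blast
  then show ?thesis using gclosed_meets_seg[OF assms(3,2)] uv(2) by blast
qed

text \<open>One closed walk visits all vertices of its quotient. Deleting loops does not interrupt
  it, so \<open>cover\<close> asks only for arcs with distinct ends.\<close>

lemma seg_connected:
  assumes P: "partition_on gr \<pi>" and j: "j \<in> idx" and h: "homog r (sg j) \<C>"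
    and cover: "\<And>u. u \<in> sg j \<Longrightarrow> r (\<gamma> u) \<noteq> r u \<Longrightarrow> u \<in> \<Union>\<C>"
  shows "uconnected (wgraph r (sg j) \<C>)"
proof (rule wgraph_connectedI[OF h gclosed_seg[OF j] seg_ne[OF j] cover])
  fix T assume T: "gclosed T" "T \<subseteq> sg j" "T \<noteq> {}"
  then have "T \<inter> sg j \<noteq> {}" by blast
  then show "T = sg j" using gclosed_meets_seg[OF T(1) j] T(2) by blast
qed

lemma gclosed_2: "j \<in> idx \<Longrightarrow> k \<in> idx \<Longrightarrow> gclosed (sg j \<union> sg k)"
  by (intro gclosed_Un gclosed_seg)

lemma W2_connected_iff:
  assumes P: "partition_on gr \<pi>" and jk: "j \<in> idx" "k \<in> idx" "j \<noteq> k"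
  shows "uconnected (W \<pi> (sg j \<union> sg k)) \<longleftrightarrow> share \<pi> j k"
proof
  note I = gclosed_2[OF jk(1,2)]
  let ?I = "sg j \<union> sg k"
  assume sh: "share \<pi> j k"
  show "uconnected (W \<pi> ?I)"
  proof (rule wgraph_connectedI[OF homog_subclasses[OF P I order_refl] I])
    show "?I \<noteq> {}" using seg_ne[OF jk(1)] by blast
    show "u \<in> \<Union>(classes \<pi> ?I)" if "u \<in> ?I" for u using that by (simp only: Union_classes)
    fix T assume T: "gclosed T" "T \<subseteq> ?I" "T \<noteq> {}"
      and sat: "\<And>u v. u \<in> T \<Longrightarrow> v \<in> ?I \<Longrightarrow> rb \<pi> ?I u = rb \<pi> ?I v \<Longrightarrow> v \<in> T"
    have sat': "v \<in> T" if "u \<in> T" "v \<in> ?I" "block \<pi> u = block \<pi> v" for u v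
      using sat[OF that(1,2)] rb_eq_iff[OF P I subsetD[OF T(2) that(1)] that(2)] that(3) by simp
    have "T \<inter> sg j \<noteq> {} \<or> T \<inter> sg k \<noteq> {}" using T by blast
    then have "sg j \<subseteq> T \<and> sg k \<subseteq> T"
    proof
      assume "T \<inter> sg j \<noteq> {}"
      then have s: "sg j \<subseteq> T" using gclosed_meets_seg[OF T(1) jk(1)] by blast
      have "sg k \<subseteq> T" by (rule share_absorb[OF sh jk(2) T(1) s Un_upper2 sat'])
      then show ?thesis using s by (rule conjI[rotated])
    next
      assume "T \<inter> sg k \<noteq> {}"
      then have s: "sg k \<subseteq> T" using gclosed_meets_seg[OF T(1) jk(2)] by blast
      have "sg j \<subseteq> T" by (rule share_absorb[OF share_sym[OF sh] jk(1) T(1) s Un_upper1 sat'])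
      then show ?thesis using s by (rule conjI)
    qed
    then show "T = ?I" using T(2) by blast
  qed
next
  note I = gclosed_2[OF jk(1,2)]
  let ?I = "sg j \<union> sg k"
  assume conn: "uconnected (W \<pi> ?I)"
  show "share \<pi> j k"
  proof (rule ccontr)
    assume ns: "\<not> share \<pi> j k"
    let ?S = "rb \<pi> ?I ` sg j"
    have nb: "rb \<pi> ?I v \<notin> ?S" if v: "v \<in> sg k" for v
    proof
      assume "rb \<pi> ?I v \<in> ?S"
      then obtain u where u: "u \<in> sg j" "rb \<pi> ?I v = rb \<pi> ?I u" by blast
      then have "block \<pi> v = block \<pi> u" using rb_eq_iff[OF P I, of v u] v by simp
      then have "block \<pi> u = block \<pi> v" by simp
      then show False using ns u(1) v unfolding share_def by blast
    qed
    obtain w where "w \<in> sg k" using seg_ne[OF jk(2)] by blast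
    then have "rb \<pi> ?I w \<in> rb \<pi> ?I ` ?I" "rb \<pi> ?I w \<notin> ?S" using nb by (blast, blast)
    then have sub: "?S \<subset> uverts (W \<pi> ?I)" unfolding wgraph_simps by blast
    have ne: "?S \<noteq> {}" using seg_ne[OF jk(1)] by blast
    have "\<exists>C\<in>classes \<pi> ?I. crosses (uends (W \<pi> ?I) C) ?S"
      using conn[unfolded uconnected_iff_cut[OF W_wf[OF P I]], THEN conjunct2, rule_format, OF sub ne]
      unfolding wgraph_simps .
    then obtain C where C: "C \<in> classes \<pi> ?I" "crosses (uends (W \<pi> ?I) C) ?S" by blast
    obtain u where u: "u \<in> C" using classes_ne[OF C(1)] by blast
    have "u \<in> ?I" using classes_sub[OF C(1)] u by blast
    then show False
    proof
      assume "u \<in> sg j"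
      then have "rb \<pi> ?I u \<in> ?S" "rb \<pi> ?I (\<gamma> u) \<in> ?S" by (auto intro: gam_seg[OF jk(1)])
      then show False using C(2) unfolding W_ends[OF P I C(1) u] crosses_doubleton by simp
    next
      assume "u \<in> sg k"
      then have "rb \<pi> ?I u \<notin> ?S" "rb \<pi> ?I (\<gamma> u) \<notin> ?S" by (rule nb, rule nb[OF gam_seg[OF jk(2)]])
      then show False using C(2) unfolding W_ends[OF P I C(1) u] crosses_doubleton by simp
    qed
  qed
qed

lemma W_gr_connected:
  assumes P: "partition_on gr \<pi>" and ijk: "{i, j, k} = idx" and sh: "share \<pi> i j" "share \<pi> j k"
  shows "uconnected (W \<pi> gr)"
proof (rule wgraph_connectedI[OF homog_subclasses[OF P gclosed_gr order_refl] gclosed_gr])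
  note p = idx_perm[OF ijk]
  show "gr \<noteq> {}" using seg_nonempty gr_segs by auto
  show "u \<in> \<Union>(classes \<pi> gr)" if "u \<in> gr" for u using that by (simp only: Union_classes)
  fix T assume T: "gclosed T" "T \<subseteq> gr" "T \<noteq> {}"
    and sat: "\<And>u v. u \<in> T \<Longrightarrow> v \<in> gr \<Longrightarrow> rb \<pi> gr u = rb \<pi> gr v \<Longrightarrow> v \<in> T"
  have sat': "v \<in> T" if "u \<in> T" "v \<in> gr" "block \<pi> u = block \<pi> v" for u v
    using sat[OF that(1,2)] rb_eq_iff[OF P gclosed_gr subsetD[OF T(2) that(1)] that(2)] that(3) by simp
  have absorb: "sg b \<subseteq> T" if "share \<pi> a b" "b \<in> idx" "sg a \<subseteq> T" for a b
    using share_absorb[OF that(1,2) T(1) that(3) seg_gr[OF that(2)] sat'] .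
  have meet: "sg a \<subseteq> T" if "a \<in> idx" "T \<inter> sg a \<noteq> {}" for a
    using gclosed_meets_seg[OF T(1) that] .
  have "T \<inter> sg i \<noteq> {} \<or> T \<inter> sg j \<noteq> {} \<or> T \<inter> sg k \<noteq> {}" using T(2,3) p(7) by blast
  then have "sg j \<subseteq> T"
    using meet p(1-3) absorb[OF sh(1) p(2)] absorb[OF share_sym[OF sh(2)] p(2)] by blast
  then have "sg i \<subseteq> T" "sg k \<subseteq> T"
    using absorb[OF share_sym[OF sh(1)] p(1)] absorb[OF sh(2) p(3)] by blast+
  then show "T = gr" using T(2) p(7) \<open>sg j \<subseteq> T\<close> by blast
qed

text \<open>The quotient of one cycle is always connected, so once the classes are doubled, being a
  tree means having one vertex more than \<open>card (sg j) / 2\<close>.\<close>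

lemma double_tree_seg:
  assumes P: "partition_on gr \<pi>" and j: "j \<in> idx"
  shows "double_tree (qg \<pi> (sg j)) \<longleftrightarrow>
    (\<forall>C\<in>classes \<pi> (sg j). card C = 2 \<and> oppP \<pi> C) \<and> 2 * card (restrict_partition \<pi> (sg j)) = card (sg j) + 2"
proof -
  note I = gclosed_seg[OF j]
  have conn: "uconnected (W \<pi> (sg j))"
    by (rule seg_connected[OF P j homog_subclasses[OF P I order_refl]]) (simp only: Union_classes)
  have "2 * card (classes \<pi> (sg j)) = card (sg j)" if "\<forall>C\<in>classes \<pi> (sg j). card C = 2"
    using sum_card_classes[OF gclosed_finite[OF I], of \<pi>] that by simp
  then show ?thesis
    unfolding double_tree_def all_arcs_doubled_qg[OF P I] elementarization_qg[OF P I]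
      utree_iff_card[OF W_wf[OF P I]] wgraph_simps uverts_card[OF P I] oppP_def
    using conn by auto
qed

text \<open>A loop would be a nonempty even edge set in a tree.\<close>

lemma double_tree_no_loop:
  assumes P: "partition_on gr \<pi>" and j: "j \<in> idx" and dt: "double_tree (qg \<pi> (sg j))" and u: "u \<in> sg j"
  shows "block \<pi> (\<gamma> u) \<noteq> block \<pi> u"
proof
  note I = gclosed_seg[OF j]
  assume "block \<pi> (\<gamma> u) = block \<pi> u"
  then have "rb \<pi> (sg j) (\<gamma> u) = rb \<pi> (sg j) u"
    using rb_eq_iff[OF P I gam_seg[OF j u] u] by simp
  then have "uends (W \<pi> (sg j)) (cls \<pi> (sg j) u) = {rb \<pi> (sg j) u}"
    using W_ends[OF P I cls_in[OF u]] by simp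
  then have ev: "even_edges (W \<pi> (sg j)) {cls \<pi> (sg j) u}"
    using cls_in(1)[OF u] by (intro even_edges_loop) auto
  have "utree (W \<pi> (sg j))" using dt by (simp add: double_tree_def elementarization_qg[OF P I])
  then have "uconnected (W \<pi> (sg j))" "card (uedges (W \<pi> (sg j))) < card (uverts (W \<pi> (sg j)))"
    unfolding utree_iff_card[OF W_wf[OF P I]] by auto
  from tree_no_even_edges[OF W_wf[OF P I] this ev] show False by simp
qed

section \<open>Block counts under gluing\<close>

lemma arc_gluings_card: "R \<in> arc_gluings \<gamma> a b \<Longrightarrow> finite R \<and> card R \<le> 2"
  by (auto simp: arc_gluings_def card_insert_if)

text \<open>The relations inside the pieces never leave a piece, so without \<open>R\<close> the
  generated partition contains all restrictions side by side; each pair in \<open>R\<close> then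
  costs at most one block.\<close>

lemma glued_card:
  assumes P: "partition_on gr \<pi>" and glued: "glued_from m1 m2 m3 \<pi> \<I> R" and R: "finite R"
    and I: "finite \<I>" "\<And>I. I \<in> \<I> \<Longrightarrow> I \<subseteq> gr" "disjoint \<I>" "\<Union>\<I> = gr"
  shows "(\<Sum>I\<in>\<I>. card (restrict_partition \<pi> I)) \<le> card \<pi> + card R"
proof -
  let ?X = "\<Union>I\<in>\<I>. same_block (restrict_partition \<pi> I)"
  have step: "b \<in> I \<and> rb \<pi> I a = rb \<pi> I b" if "(a, b) \<in> (?X \<union> converse ?X)\<^sup>*" "a \<in> I" "I \<in> \<I>" for a b I
    using that(1)
  proof (induction rule: rtrancl_induct)
    case base
    then show ?case using that by simp
  next
    case (step y z)
    then obtain J where J: "J \<in> \<I>" "(y, z) \<in> same_block (restrict_partition \<pi> J) \<or> (z, y) \<in> same_block (restrict_partition \<pi> J)"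
      by blast
    then have yz: "y \<in> J" "z \<in> J" "rb \<pi> J y = rb \<pi> J z"
      using same_block_iff[OF restrict_partition_on[OF P I(2)[OF J(1)]]] by auto
    then have "J = I" using step.IH J(1) that(3) I(3) unfolding disjoint_def by blast
    then show ?case using yz step.IH by simp
  qed
  have sub: "restrict_partition \<pi> I \<subseteq> generated_partition gr ?X" if I': "I \<in> \<I>" for I
  proof
    note RP = restrict_partition_on[OF P I(2)[OF I']]
    fix B assume "B \<in> restrict_partition \<pi> I"
    then obtain a where a: "a \<in> I" "B = rb \<pi> I a" using block_image[OF RP] by blast
    have agr: "a \<in> gr" using a I(2)[OF I'] by blast
    have "B = eqc gr ?X `` {a}"
    proof
      show "B \<subseteq> eqc gr ?X `` {a}"
      proof
        fix b assume "b \<in> B"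
        then have b: "b \<in> I" "rb \<pi> I b = rb \<pi> I a" using block_eq_mem[OF RP a(1)] a(2) by auto
        then have "(a, b) \<in> same_block (restrict_partition \<pi> I)"
          using same_block_iff[OF RP] a(1) by simp
        then have "(a, b) \<in> (?X \<union> converse ?X)\<^sup>*" using I' by blast
        then show "b \<in> eqc gr ?X `` {a}" using agr b(1) I(2)[OF I'] by (auto simp: eqc_def)
      qed
      show "eqc gr ?X `` {a} \<subseteq> B"
      proof
        fix b assume "b \<in> eqc gr ?X `` {a}"
        then have "(a, b) \<in> (?X \<union> converse ?X)\<^sup>*" by (simp add: eqc_def)
        then have "b \<in> I" "rb \<pi> I a = rb \<pi> I b" using step[OF _ a(1) I'] by auto
        then show "b \<in> B" using block_in(2)[OF RP] a(2) by simp
      qed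
    qed
    then show "B \<in> generated_partition gr ?X"
      using agr by (auto simp: generated_partition_eqc intro: quotientI)
  qed
  have fin: "finite (generated_partition gr ?X)"
    by (rule finite_elements[OF finite_gr partition_on_generated])
  have "(\<Sum>I\<in>\<I>. card (restrict_partition \<pi> I)) = card (\<Union>I\<in>\<I>. restrict_partition \<pi> I)"
  proof (rule card_UN_disjoint[symmetric, OF I(1)])
    show "\<forall>I\<in>\<I>. finite (restrict_partition \<pi> I)" using sub fin finite_subset by blast
    show "\<forall>I\<in>\<I>. \<forall>J\<in>\<I>. I \<noteq> J \<longrightarrow> restrict_partition \<pi> I \<inter> restrict_partition \<pi> J = {}"
    proof (intro ballI impI)
      fix I J assume IJ: "I \<in> \<I>" "J \<in> \<I>" "I \<noteq> J"
      then have "I \<inter> J = {}" using I(3) unfolding disjoint_def by blast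
      then show "restrict_partition \<pi> I \<inter> restrict_partition \<pi> J = {}"
        by (auto simp: restrict_partition_def)
    qed
  qed
  also have "\<dots> \<le> card (generated_partition gr ?X)"
    using sub by (intro card_mono[OF fin]) blast
  also have "\<dots> \<le> card (generated_partition gr (?X \<union> R)) + card R"
    by (rule card_generated_partition_Un[OF finite_gr R])
  also have "generated_partition gr (?X \<union> R) = \<pi>" using glued by (simp add: glued_from_def)
  finally show ?thesis .
qed

lemma glued_block:
  assumes glued: "glued_from m1 m2 m3 \<pi> \<I> R" and "(a, b) \<in> R" "a \<in> gr" "b \<in> gr"
  shows "block \<pi> a = block \<pi> b"
proof -
  let ?Y = "(\<Union>I\<in>\<I>. same_block (restrict_partition \<pi> I)) \<union> R"
  have "\<pi> = generated_partition gr ?Y" using glued by (simp add: glued_from_def)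
  moreover have "(a, b) \<in> eqc gr ?Y" using assms by (auto simp: eqc_def)
  ultimately show ?thesis using block_generated[OF assms(3,4)] by metis
qed

lemma glued_ends:
  assumes glued: "glued_from m1 m2 m3 \<pi> \<I> R'" and R: "R \<in> arc_gluings \<gamma> a b" "R \<subseteq> R'"
    and ab: "a \<in> gr" "b \<in> gr"
  shows "ends \<pi> a = ends \<pi> b"
proof -
  have g: "\<gamma> a \<in> gr" "\<gamma> b \<in> gr" using gclosed_gam[OF gclosed_gr] ab by auto
  from R(1) consider "R = {(\<gamma> a, \<gamma> b), (a, b)}" | "R = {(\<gamma> a, b), (a, \<gamma> b)}"
    by (auto simp: arc_gluings_def)
  then show ?thesis
  proof cases
    case 1
    then have "(\<gamma> a, \<gamma> b) \<in> R'" "(a, b) \<in> R'" using R(2) by auto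
    then have "block \<pi> (\<gamma> a) = block \<pi> (\<gamma> b)" "block \<pi> a = block \<pi> b"
      using glued_block[OF glued _ g] glued_block[OF glued _ ab] by blast+
    then show ?thesis by (simp add: ends_def)
  next
    case 2
    then have "(\<gamma> a, b) \<in> R'" "(a, \<gamma> b) \<in> R'" using R(2) by auto
    then have "block \<pi> (\<gamma> a) = block \<pi> b" "block \<pi> a = block \<pi> (\<gamma> b)"
      using glued_block[OF glued _ g(1) ab(2)] glued_block[OF glued _ ab(1) g(2)] by blast+
    then show ?thesis by (simp add: ends_def insert_commute)
  qed
qed

lemma ends_share:
  assumes "ends \<pi> a = ends \<pi> b" "a \<in> sg i" "b \<in> sg j" "i \<in> idx" "j \<in> idx"
  shows "share \<pi> i j"
proof -
  have "block \<pi> a = block \<pi> b \<or> block \<pi> a = block \<pi> (\<gamma> b)" using assms(1) by (auto simp: ends_def doubleton_eq_iff)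
  then show ?thesis using assms(2,3) gam_seg[OF assms(5,3)] unfolding share_def by blast
qed

lemma excess_sum:
  assumes ge: "\<And>C. C \<in> classes \<pi> gr \<Longrightarrow> card C \<ge> 2"
  shows "(\<Sum>C\<in>classes \<pi> gr. card C - 2) + 2 * card (classes \<pi> gr) = mm"
proof -
  have "(\<Sum>C\<in>classes \<pi> gr. card C - 2) + (\<Sum>C\<in>classes \<pi> gr. 2) = (\<Sum>C\<in>classes \<pi> gr. card C)"
    unfolding sum.distrib[symmetric]
  proof (intro sum.cong refl)
    fix C assume "C \<in> classes \<pi> gr"
    from ge[OF this] show "card C - 2 + 2 = card C" by simp
  qed
  then show ?thesis using sum_card_classes[OF finite_gr, of \<pi>] card_gr by simp
qed

text \<open>Connectedness provides at least |\<pi>| - 1 classes, so of at most 2 |\<pi>| + 2 arcs no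
  more than 4 are left after assigning two to each class. A nonempty even edge set excludes a tree,
  hence there is one more class and the bound drops by two.\<close>

lemma excess_le:
  assumes P: "partition_on gr \<pi>" and conn: "uconnected (W \<pi> gr)" and mm: "mm \<le> 2 * card \<pi> + 2"
    and ge: "\<And>C. C \<in> classes \<pi> gr \<Longrightarrow> card C \<ge> 2"
  shows "(\<Sum>C\<in>classes \<pi> gr. card C - 2) \<le> 4"
    and "even_edges (W \<pi> gr) F \<Longrightarrow> F \<noteq> {} \<Longrightarrow> (\<Sum>C\<in>classes \<pi> gr. card C - 2) \<le> 2"
proof -
  note wf = W_wf[OF P gclosed_gr]
  have v: "card (uverts (W \<pi> gr)) = card \<pi>" "card (uedges (W \<pi> gr)) = card (classes \<pi> gr)"
    using W_gr_card[OF P] by simp_all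
  show "(\<Sum>C\<in>classes \<pi> gr. card C - 2) \<le> 4"
    using card_uverts_le_Suc_uedges[OF wf conn] excess_sum[of \<pi>, OF ge] mm unfolding v by linarith
  assume "even_edges (W \<pi> gr) F" "F \<noteq> {}"
  then have "\<not> card (classes \<pi> gr) < card \<pi>" using tree_no_even_edges[OF wf conn] unfolding v by blast
  then show "(\<Sum>C\<in>classes \<pi> gr. card C - 2) \<le> 2" using excess_sum[of \<pi>, OF ge] mm by linarith
qed

definition dbl :: "nat set set \<Rightarrow> nat set \<Rightarrow> bool" where
  "dbl \<pi> S \<longleftrightarrow> card S = 2 \<and> oppP \<pi> S"

lemma dbl_parts:
  assumes "\<And>C. C \<in> classes \<pi> I \<Longrightarrow> dbl \<pi> C" "I \<subseteq> gr" "C \<in> classes \<pi> gr"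
  shows "C \<inter> I = {} \<or> dbl \<pi> (C \<inter> I)"
  using classes_Int[OF assms(3,2)] assms(1) by blast

lemma dbl_unsplit:
  assumes "C \<in> classes \<pi> gr" "card C = 2" "C \<inter> I = {} \<or> dbl \<pi> (C \<inter> I)"
  shows "unsplit C I" "C \<inter> I \<noteq> {} \<Longrightarrow> oppP \<pi> C"
proof -
  have "C \<inter> I = C" if "dbl \<pi> (C \<inter> I)"
    using that assms(2) finite_class[OF assms(1)] by (intro card_subset_eq) (auto simp: dbl_def)
  then show "unsplit C I" "C \<inter> I \<noteq> {} \<Longrightarrow> oppP \<pi> C" using assms(3) by (auto simp: unsplit_def dbl_def)
qed

lemma seg_family:
  assumes "{i, j, k} = idx"
  shows "disjoint {sg i, sg j \<union> sg k}" "\<Union>{sg i, sg j \<union> sg k} = gr" "sg i \<noteq> sg j \<union> sg k"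
proof -
  note p = idx_perm[OF assms]
  have "sg i \<inter> (sg j \<union> sg k) = {}" using p by blast
  then show "disjoint {sg i, sg j \<union> sg k}" by (auto simp: disjoint_def)
  show "\<Union>{sg i, sg j \<union> sg k} = gr" using p(7) by blast
  show "sg i \<noteq> sg j \<union> sg k" using seg_ne[OF p(1)] \<open>sg i \<inter> (sg j \<union> sg k) = {}\<close> by blast
qed

lemma seg_family3:
  shows "disjoint {sg 1, sg 2, sg 3}" "\<Union>{sg 1, sg 2, sg 3} = gr" "finite {sg 1, sg 2, sg 3}"
    "(\<Sum>I\<in>{sg 1, sg 2, sg 3}. f I) = f (sg 1) + f (sg 2) + (f (sg 3) :: nat)"
proof -
  show "disjoint {sg 1, sg 2, sg 3}" using seg_disjoint by (auto simp: disjoint_def)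
  show "\<Union>{sg 1, sg 2, sg 3} = gr" using gr_segs by auto
  have "sg 1 \<noteq> sg 2" "sg 1 \<noteq> sg 3" "sg 2 \<noteq> sg 3" using seg_disjoint seg_nonempty by blast+
  then show "(\<Sum>I\<in>{sg 1, sg 2, sg 3}. f I) = f (sg 1) + f (sg 2) + (f (sg 3) :: nat)" by simp
qed simp

lemma card_gr_segs:
  assumes "{i, j, k} = idx"
  shows "mm = card (sg i) + card (sg j) + card (sg k)"
  using card_split[OF assms order_refl]
  unfolding card_gr Int_absorb1[OF seg_gr[OF idx_perm(1)[OF assms]]]
    Int_absorb1[OF seg_gr[OF idx_perm(2)[OF assms]]] Int_absorb1[OF seg_gr[OF idx_perm(3)[OF assms]]] .

lemma card_gr_segs2:
  assumes "{i, j, k} = idx"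
  shows "mm = card (sg i) + card (sg j \<union> sg k)"
proof -
  note p = idx_perm[OF assms]
  have "card (sg j \<union> sg k) = card (sg j) + card (sg k)"
    using gclosed_finite gclosed_seg p by (intro card_Un_disjoint) auto
  then show ?thesis using card_gr_segs[OF assms] by simp
qed

text \<open>\<open>E\<close> makes an even edge set nonempty, so the excess over two arcs per class
  is at most 2. The class \<open>D\<close>, with two arcs from each side of the gluing, exhausts
  it.\<close>

lemma profX_intro:
  assumes P: "partition_on gr \<pi>" and ijk: "{i, j, k} = idx"
    and parts: "\<And>C. C \<in> classes \<pi> gr \<Longrightarrow> C \<inter> sg i = {} \<or> dbl \<pi> (C \<inter> sg i)"
      "\<And>C. C \<in> classes \<pi> gr \<Longrightarrow> C \<inter> (sg j \<union> sg k) = {} \<or> dbl \<pi> (C \<inter> (sg j \<union> sg k))"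
    and D: "D \<in> classes \<pi> gr" "D \<inter> sg i \<noteq> {}" "D \<inter> (sg j \<union> sg k) \<noteq> {}"
    and mm: "mm \<le> 2 * card \<pi> + 2" and conn: "uconnected (W \<pi> gr)"
    and odd: "E \<in> classes \<pi> gr" "odd (card (E \<inter> sg j))" "odd (card (E \<inter> sg k))"
  shows "profX \<pi> i D"
proof -
  note p = idx_perm[OF ijk]
  have compl: "C - sg i = C \<inter> (sg j \<union> sg k)" if "C \<in> classes \<pi> gr" for C
    using classes_sub[OF that] p(7-9) by blast
  have card2: "card C = card (C \<inter> sg i) + card (C \<inter> (sg j \<union> sg k))" if "C \<in> classes \<pi> gr" for C
    using card_split[OF ijk classes_sub[OF that]] card_split2[OF ijk classes_sub[OF that]] by simp
  have ge: "card C \<ge> 2" if C: "C \<in> classes \<pi> gr" for C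
  proof -
    have "C \<inter> sg i \<noteq> {} \<or> C \<inter> (sg j \<union> sg k) \<noteq> {}" using classes_ne[OF C] classes_sub[OF C] p(7) by blast
    then show ?thesis using parts[OF C] card2[OF C] by (auto simp: dbl_def)
  qed
  have Ddbl: "dbl \<pi> (D \<inter> sg i)" "dbl \<pi> (D - sg i)" using parts[OF D(1)] D(2,3) compl[OF D(1)] by auto
  then have q: "quad \<pi> (sg i) D" using D(1) by (simp add: quad_def dbl_def)
  have "even_edges (W \<pi> gr) {C \<in> classes \<pi> gr. odd (card (C \<inter> sg j))}"
    by (rule W_parity[OF P gclosed_gr p(2) seg_gr[OF p(2)]])
  then have "(\<Sum>C\<in>classes \<pi> gr. card C - 2) \<le> 2"
    using excess_le(2)[OF P conn mm ge] odd by blast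
  also have "\<dots> = (\<Sum>C\<in>{D}. card C - 2)" using quad_card[OF q] by simp
  finally have others: "card C - 2 = 0" if "C \<in> classes \<pi> gr" "C \<noteq> D" for C
    using sum_le_others_zero[where f = "\<lambda>C. card C - 2", OF finite_classes[OF finite_gr] _ _ that(1), of "{D}"] D(1) that(2) by simp
  have rest: "card C = 2 \<and> oppP \<pi> C \<and> unsplit C (sg i)" if C: "C \<in> classes \<pi> gr" "C \<noteq> D" for C
  proof -
    have c2: "card C = 2" using others[OF C] ge[OF C(1)] by simp
    have "C \<inter> sg i \<noteq> {} \<or> C \<inter> (sg j \<union> sg k) \<noteq> {}"
      using classes_ne[OF C(1)] classes_sub[OF C(1)] p(7) by blast
    then have "oppP \<pi> C" using dbl_unsplit(2)[OF C(1) c2 parts(1)[OF C(1)]]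
      dbl_unsplit(2)[OF C(1) c2 parts(2)[OF C(1)]] by blast
    then show ?thesis using c2 dbl_unsplit(1)[OF C(1) c2 parts(1)[OF C(1)]] by blast
  qed
  have "\<exists>C\<in>classes \<pi> gr. odd (card (C \<inter> sg l))" if "l \<in> idx - {i}" for l
  proof -
    have "l = j \<or> l = k" using that ijk by blast
    then show ?thesis using odd by blast
  qed
  then show ?thesis using p(1) q rest by (simp add: profX_def)
qed

section \<open>Profiles of the 2-4 unicircuit and 2-4 uniloop types\<close>

lemma double_unicircuit_facts:
  assumes P: "partition_on gr \<pi>" and ijk: "{i, j, k} = idx"
    and du: "double_unicircuit (qg \<pi> (sg j \<union> sg k)) (sg j) (sg k)"
  shows "share \<pi> j k" "\<And>C. C \<in> classes \<pi> (sg j \<union> sg k) \<Longrightarrow> dbl \<pi> C"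
    "card (sg j \<union> sg k) \<le> 2 * card (restrict_partition \<pi> (sg j \<union> sg k))"
    "\<exists>E\<in>classes \<pi> gr. odd (card (E \<inter> sg j)) \<and> odd (card (E \<inter> sg k))"
proof -
  note p = idx_perm[OF ijk]
  let ?I = "sg j \<union> sg k"
  note I = gclosed_2[OF p(2,3)]
  note el = elementarization_qg[OF P I] and wf = W_wf[OF P I]
  show "share \<pi> j k" using du W2_connected_iff[OF P p(2,3,6)] by (simp add: double_unicircuit_def el)
  show d: "dbl \<pi> C" if "C \<in> classes \<pi> ?I" for C
    using du that unfolding double_unicircuit_def all_arcs_doubled_qg[OF P I] dbl_def oppP_def by blast
  obtain K where K: "circuits (W \<pi> ?I) = {K}"
    "\<forall>C\<in>uedges K. card (C \<inter> sg j) = 1 \<and> card (C \<inter> sg k) = 1"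
    using du unfolding double_unicircuit_def el by blast
  have "card (classes \<pi> ?I) \<le> card (restrict_partition \<pi> ?I)"
    using unique_circuit_card[OF wf K(1)] uverts_card[OF P I] by simp
  moreover have "2 * card (classes \<pi> ?I) = card ?I"
    using sum_card_classes[OF gclosed_finite[OF I], of \<pi>] d by (simp add: dbl_def)
  ultimately show "card ?I \<le> 2 * card (restrict_partition \<pi> ?I)" by simp
  have KW: "K \<in> circuits (W \<pi> ?I)" using K(1) by simp
  obtain C where C: "C \<in> uedges K" using circuit_even_edges(2)[OF wf KW] by blast
  have CI: "C \<in> classes \<pi> ?I" using circuitD(2)[OF KW] C by auto
  obtain E where E: "E \<in> classes \<pi> gr" "C = E \<inter> ?I" using classes_lift[OF CI gclosed_gr_sub[OF I]] by blast
  have "E \<inter> sg j = C \<inter> sg j" "E \<inter> sg k = C \<inter> sg k" using E(2) by blast+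
  then have "card (E \<inter> sg j) = 1" "card (E \<inter> sg k) = 1" using K(2) C by auto
  then show "\<exists>E\<in>classes \<pi> gr. odd (card (E \<inter> sg j)) \<and> odd (card (E \<inter> sg k))"
    using E(1) by (intro bexI[of _ E]) simp_all
qed

lemma W_gr_connected_mixed:
  assumes P: "partition_on gr \<pi>" and ijk: "{i, j, k} = idx" and sh: "share \<pi> j k"
    and ab: "ends \<pi> a = ends \<pi> b" "a \<in> sg i" "b \<in> sg j \<union> sg k"
  shows "uconnected (W \<pi> gr)"
proof -
  note p = idx_perm[OF ijk]
  show ?thesis using ab(3)
  proof
    assume "b \<in> sg j"
    then show ?thesis using W_gr_connected[OF P ijk ends_share[OF ab(1,2) _ p(1,2)] sh] by blast
  next
    assume "b \<in> sg k"
    moreover have "{i, k, j} = idx" using ijk by blast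
    ultimately show ?thesis using W_gr_connected[OF P _ ends_share[OF ab(1,2) _ p(1,3)] share_sym[OF sh]] by blast
  qed
qed

lemma dbl_double_tree:
  assumes "partition_on gr \<pi>" "j \<in> idx" "double_tree (qg \<pi> (sg j))"
  shows "C \<in> classes \<pi> (sg j) \<Longrightarrow> dbl \<pi> C" "2 * card (restrict_partition \<pi> (sg j)) = card (sg j) + 2"
  using assms(3) unfolding double_tree_seg[OF assms(1,2)] dbl_def by auto

lemma unicircuit_prof:
  assumes P: "partition_on gr \<pi>" and ty: "unicircuit_2_4_type m1 m2 m3 \<pi>"
  shows "mm \<le> 2 * card \<pi> + 2 \<and> (\<exists>i D. profX \<pi> i D \<and> \<not> loopc \<pi> D)"
proof -
  obtain i j k a b R where ijk: "{i, j, k} = idx" and dt: "double_tree (qg \<pi> (sg i))"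
    and du: "double_unicircuit (qg \<pi> (sg j \<union> sg k)) (sg j) (sg k)"
    and ab: "a \<in> sg i" "b \<in> sg j \<union> sg k" and R: "R \<in> arc_gluings \<gamma> a b"
    and glued: "glued_from m1 m2 m3 \<pi> {sg i, sg j \<union> sg k} R"
    using ty unfolding unicircuit_2_4_type_def by blast
  note p = idx_perm[OF ijk] and sf = seg_family[OF ijk]
  note u = double_unicircuit_facts[OF P ijk du]
  note t = dbl_double_tree[OF P p(1) dt]
  have sub: "I \<subseteq> gr" if "I \<in> {sg i, sg j \<union> sg k}" for I using that sf(2) by blast
  have abgr: "a \<in> gr" "b \<in> gr" using ab p(7) by blast+
  have eab: "ends \<pi> a = ends \<pi> b" by (rule glued_ends[OF glued R order_refl abgr])
  have fR: "finite R" "card R \<le> 2" using arc_gluings_card[OF R] by auto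
  have "(\<Sum>I\<in>{sg i, sg j \<union> sg k}. card (restrict_partition \<pi> I)) \<le> card \<pi> + card R"
    by (rule glued_card[OF P glued fR(1) _ sub sf(1,2)]) auto
  then have "card (restrict_partition \<pi> (sg i)) + card (restrict_partition \<pi> (sg j \<union> sg k)) \<le> card \<pi> + 2"
    using fR(2) sf(3) by simp
  \<comment> \<open>Twice the vertex number is \<open>card (sg i) + 2\<close> for the tree and at
    least \<open>card (sg j \<union> sg k)\<close> for the other piece. Gluing along an edge costs
    at most two vertices, so 2 |\<pi>| is at least m + 2 - 4.\<close>
  then have mm: "mm \<le> 2 * card \<pi> + 2" using t(2) u(3) card_gr_segs2[OF ijk] by linarith
  obtain E where E: "E \<in> classes \<pi> gr" "odd (card (E \<inter> sg j))" "odd (card (E \<inter> sg k))" using u(4) by blast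
  let ?D = "cls \<pi> gr a"
  have D: "?D \<in> classes \<pi> gr" "a \<in> ?D" using cls_in[OF abgr(1)] by auto
  have "b \<in> ?D" using classes_memI[OF D abgr(2)] eab by simp
  then have "profX \<pi> i ?D"
    using profX_intro[OF P ijk dbl_parts[OF t(1) seg_gr[OF p(1)]] dbl_parts[OF u(2) gclosed_gr_sub[OF gclosed_2[OF p(2,3)]]]
        D(1) _ _ mm W_gr_connected_mixed[OF P ijk u(1) eab ab] E] D(2) ab by blast
  moreover have "\<not> loopc \<pi> ?D"
  proof
    assume "loopc \<pi> ?D"
    then obtain w where w: "w \<in> ?D" "block \<pi> (\<gamma> w) = block \<pi> w" unfolding loopc_def by blast
    have "ends \<pi> a = {block \<pi> w}" using classes_ends[OF D w(1)] w(2) by (simp add: ends_def)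
    then have "block \<pi> (\<gamma> a) = block \<pi> a" unfolding ends_def by blast
    then show False using double_tree_no_loop[OF P p(1) dt ab(1)] by contradiction
  qed
  ultimately show ?thesis using mm by blast
qed

text \<open>Deleting arcs keeps the vertices: the labels still range over all of
  \<open>sg i\<close>, while classes are formed from the remaining arcs.\<close>

lemma double_tree_deleted:
  assumes P: "partition_on gr \<pi>" and i: "i \<in> idx"
  shows "double_tree (pre_digraph.del_arc (pre_digraph.del_arc (qg \<pi> (sg i)) a) b) \<longleftrightarrow>
    uconnected (wgraph (rb \<pi> (sg i)) (sg i) (classes \<pi> (sg i - {a, b}))) \<and>
    card (restrict_partition \<pi> (sg i)) = Suc (card (classes \<pi> (sg i - {a, b}))) \<and>
    (\<forall>C\<in>classes \<pi> (sg i - {a, b}). dbl \<pi> C)"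
proof -
  let ?I = "sg i" and ?J = "sg i - {a, b}"
  note I = gclosed_seg[OF i]
  let ?G = "pre_digraph.del_arc (pre_digraph.del_arc (qg \<pi> ?I) a) b"
  have G: "verts ?G = restrict_partition \<pi> ?I" "arcs ?G = ?J" "tail ?G = tail (qg \<pi> ?I)" "head ?G = head (qg \<pi> ?I)"
    by (auto simp: pre_digraph.del_arc_def)
  have eqv: "equivalent_arcs ?G `` {v} = cls \<pi> ?J v" if "v \<in> ?J" for v
  proof -
    have key: "{tail ?G v, head ?G v} = {tail ?G w, head ?G w} \<longleftrightarrow> ends \<pi> v = ends \<pi> w" if w: "w \<in> ?J" for w
    proof -
      have vw: "v \<in> ?I" "w \<in> ?I" using w \<open>v \<in> ?J\<close> by blast+
      show ?thesis unfolding G qg_simps by (rule rb_ends_eq_iff[OF P I vw])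
    qed
    have "equivalent_arcs ?G `` {v} = {w \<in> ?J. {tail ?G v, head ?G v} = {tail ?G w, head ?G w}}"
      using that unfolding equivalent_arcs_def G(2) by blast
    also have "\<dots> = {w \<in> ?J. ends \<pi> v = ends \<pi> w}" by (intro Collect_cong conj_cong refl key)
    also have "\<dots> = cls \<pi> ?J v" unfolding cls_def by (intro Collect_cong conj_cong refl eq_commute)
    finally show ?thesis .
  qed
  have ac: "arc_classes ?G = classes \<pi> ?J"
    unfolding arc_classes_def quotient_def classes_def G(2) using eqv by auto
  let ?W = "wgraph (rb \<pi> ?I) ?I (classes \<pi> ?J)"
  have el: "elementarization ?G = ?W"
    using uverts_restrict[OF P I] unfolding elementarization_def wgraph_def ac G qg_simps
    by (intro ugraph.equality) simp_all
  have h: "homog (rb \<pi> ?I) ?I (classes \<pi> ?J)" by (rule homog_subclasses[OF P I]) blast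
  note wf = wgraph_wf[OF h I]
  have "(\<forall>C\<in>classes \<pi> ?J. card C = 2 \<and> (\<forall>x\<in>C. \<forall>y\<in>C. x \<noteq> y \<longrightarrow> opposite_arcs ?G x y)) \<longleftrightarrow>
      (\<forall>C\<in>classes \<pi> ?J. dbl \<pi> C)"
  proof (intro ball_cong refl)
    fix C assume C: "C \<in> classes \<pi> ?J"
    have "opposite_arcs ?G x y \<longleftrightarrow> opp \<pi> x y" if "x \<in> C" "y \<in> C" for x y
      using opposite_arcs_qg[OF P I, of x y] classes_sub[OF C] that unfolding opposite_arcs_def G by blast
    then show "(card C = 2 \<and> (\<forall>x\<in>C. \<forall>y\<in>C. x \<noteq> y \<longrightarrow> opposite_arcs ?G x y)) \<longleftrightarrow> dbl \<pi> C"
      unfolding dbl_def oppP_def by simp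
  qed
  then show ?thesis
    unfolding double_tree_def all_arcs_doubled_def ac el utree_iff_card[OF wf] wgraph_simps uverts_card[OF P I]
    by blast
qed

lemma uniloop_prof:
  assumes P: "partition_on gr \<pi>" and ty: "uniloop_2_4_type m1 m2 m3 \<pi>"
  shows "mm \<le> 2 * card \<pi> + 2 \<and> (\<exists>i D. profX \<pi> i D \<and> loopc \<pi> D)"
proof -
  obtain i j k a b c where ijk: "{i, j, k} = idx"
    and du: "double_unicircuit (qg \<pi> (sg j \<union> sg k)) (sg j) (sg k)"
    and ab: "a \<noteq> b" "loop_arc (qg \<pi> (sg i)) a" "loop_arc (qg \<pi> (sg i)) b"
      "head (qg \<pi> (sg i)) a = head (qg \<pi> (sg i)) b"
    and dt: "double_tree (pre_digraph.del_arc (pre_digraph.del_arc (qg \<pi> (sg i)) a) b)"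
    and c: "loop_arc (qg \<pi> (sg j \<union> sg k)) c"
    and glued: "glued_from m1 m2 m3 \<pi> {sg i, sg j \<union> sg k} {(a, c)}"
    using ty unfolding uniloop_2_4_type_def Let_def by (elim exE conjE) (rule that; assumption)
  note p = idx_perm[OF ijk] and sf = seg_family[OF ijk]
  note u = double_unicircuit_facts[OF P ijk du]
  let ?I = "sg i" and ?J = "sg i - {a, b}"
  note I = gclosed_seg[OF p(1)]
  note I2 = gclosed_2[OF p(2,3)]
  have abI: "a \<in> ?I" "b \<in> ?I" "c \<in> sg j \<union> sg k" using ab c by (auto simp: loop_arc_def)
  have loops: "block \<pi> (\<gamma> a) = block \<pi> a" "block \<pi> (\<gamma> b) = block \<pi> b" "block \<pi> (\<gamma> c) = block \<pi> c"
    using ab(2,3) c unfolding loop_arc_def qg_simps rb_eq_iff[OF P I gclosed_gam[OF I abI(1)] abI(1)]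
      rb_eq_iff[OF P I gclosed_gam[OF I abI(2)] abI(2)] rb_eq_iff[OF P I2 gclosed_gam[OF I2 abI(3)] abI(3)]
    by blast+
  have bab: "block \<pi> a = block \<pi> b" using ab(4) rb_eq_iff[OF P I abI(1,2)] by simp
  have abgr: "a \<in> gr" "b \<in> gr" "c \<in> gr" using abI p(7) by blast+
  have bac: "block \<pi> a = block \<pi> c" by (rule glued_block[OF glued _ abgr(1,3)]) simp
  have eab: "ends \<pi> b = ends \<pi> a" and eac: "ends \<pi> a = ends \<pi> c" using loops bab bac by (simp_all add: ends_def)
  let ?W = "wgraph (rb \<pi> ?I) ?I (classes \<pi> ?J)"
  have h: "homog (rb \<pi> ?I) ?I (classes \<pi> ?J)" by (rule homog_subclasses[OF P I]) blast
  note wf = wgraph_wf[OF h I]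
  have tree: "uconnected ?W" "card (restrict_partition \<pi> ?I) = Suc (card (classes \<pi> ?J))"
    and dJ: "\<And>C. C \<in> classes \<pi> ?J \<Longrightarrow> dbl \<pi> C"
    using dt unfolding double_tree_deleted[OF P p(1)] by blast+
  have cJ: "2 * card (classes \<pi> ?J) + 2 = card ?I"
  proof -
    have "2 * card (classes \<pi> ?J) = card ?J"
      using sum_card_classes[of ?J \<pi>] dJ gclosed_finite[OF I] by (simp add: dbl_def)
    moreover have "card ?J = card ?I - card {a, b}" using abI by (intro card_Diff_subset) auto
    moreover have "card {a, b} \<le> card ?I" using abI gclosed_finite[OF I] by (intro card_mono) auto
    ultimately show ?thesis using ab(1) by simp
  qed
  have noloop: "block \<pi> (\<gamma> v) \<noteq> block \<pi> v" if v: "v \<in> ?J" for v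
  proof
    assume l: "block \<pi> (\<gamma> v) = block \<pi> v"
    have vI: "v \<in> ?I" using v by blast
    have "uends ?W (cls \<pi> ?J v) = {rb \<pi> ?I v}"
      using wgraph_ends[OF h cls_in[OF v]] rb_eq_iff[OF P I gclosed_gam[OF I vI] vI] l by simp
    then have "even_edges ?W {cls \<pi> ?J v}" using cls_in(1)[OF v] by (intro even_edges_loop) auto
    moreover have "card (uedges ?W) < card (uverts ?W)" using tree(2) uverts_card[OF P I] by simp
    ultimately show False using tree_no_even_edges[OF wf tree(1)] by blast
  qed
  have sub: "I' \<subseteq> gr" if "I' \<in> {sg i, sg j \<union> sg k}" for I' using that sf(2) by blast
  have "(\<Sum>I\<in>{sg i, sg j \<union> sg k}. card (restrict_partition \<pi> I)) \<le> card \<pi> + card {(a, c)}"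
    by (rule glued_card[OF P glued _ _ sub sf(1,2)]) auto
  then have "card (restrict_partition \<pi> (sg i)) + card (restrict_partition \<pi> (sg j \<union> sg k)) \<le> card \<pi> + 1"
    using sf(3) by simp
  \<comment> \<open>The tree has half of \<open>card (sg i) - 2\<close> edges, so twice its vertex
    number is \<open>card (sg i)\<close>. Gluing at one vertex costs at most one block, and 2
    |\<pi>| is again at least m - 2.\<close>
  then have mm: "mm \<le> 2 * card \<pi> + 2" using tree(2) cJ u(3) card_gr_segs2[OF ijk] by linarith
  obtain E where E: "E \<in> classes \<pi> gr" "odd (card (E \<inter> sg j))" "odd (card (E \<inter> sg k))" using u(4) by blast
  let ?D = "cls \<pi> gr a"
  have D: "?D \<in> classes \<pi> gr" "a \<in> ?D" using cls_in[OF abgr(1)] by auto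
  have cD: "c \<in> ?D" using classes_memI[OF D abgr(3)] eac by simp
  have bD: "b \<in> ?D" using classes_memI[OF D abgr(2)] eab by simp
  have loopD: "block \<pi> (\<gamma> v) = block \<pi> v" if "v \<in> ?D" for v
  proof -
    have "ends \<pi> v = {block \<pi> a}" using classes_ends[OF D(1) that D(2)] loops(1) by (simp add: ends_def)
    then show ?thesis unfolding ends_def by blast
  qed
  \<comment> \<open>The other arcs of cycle \<open>i\<close> form a tree, so \<open>a\<close> and
    \<open>b\<close> are its only loops.\<close>
  have DI: "?D \<inter> ?I = {a, b}" using loopD noloop D(2) bD abI by blast
  have parts: "C \<inter> ?I = {} \<or> dbl \<pi> (C \<inter> ?I)" if C: "C \<in> classes \<pi> gr" for C
  proof (cases "C = ?D")
    case True
    have "opp \<pi> a b" "opp \<pi> b a" using loops bab by (simp_all add: opp_def)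
    then show ?thesis unfolding True DI dbl_def oppP_def using ab(1) by simp
  next
    case False
    then have "a \<notin> C" "b \<notin> C" using classes_eqI[OF C D(1)] D(2) bD by blast+
    then have "C \<inter> ?I = C \<inter> ?J" by blast
    moreover have "?J \<subseteq> gr" using seg_gr[OF p(1)] by blast
    ultimately show ?thesis using dbl_parts[OF dJ _ C] by metis
  qed
  have "profX \<pi> i ?D"
    using profX_intro[OF P ijk parts dbl_parts[OF u(2) gclosed_gr_sub[OF I2]]
        D(1) _ _ mm W_gr_connected_mixed[OF P ijk u(1) eac abI(1,3)] E] D(2) cD abI by blast
  moreover have "loopc \<pi> ?D" using D(2) loops(1) unfolding loopc_def by blast
  ultimately show ?thesis using mm by blast
qed

section \<open>Profiles of the two tree types\<close>

lemma three_trees: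
  assumes P: "partition_on gr \<pi>" and dt: "\<forall>l\<in>idx. double_tree (qg \<pi> (sg l))"
    and glued: "glued_from m1 m2 m3 \<pi> {sg 1, sg 2, sg 3} (R \<union> S)"
    and RS: "R \<in> arc_gluings \<gamma> a b" "S \<in> arc_gluings \<gamma> a' c"
  shows "mm \<le> 2 * card \<pi> + 2"
    and "C \<in> classes \<pi> gr \<Longrightarrow> l \<in> idx \<Longrightarrow> C \<inter> sg l = {} \<or> dbl \<pi> (C \<inter> sg l)"
    and "C \<in> classes \<pi> gr \<Longrightarrow> \<not> loopc \<pi> C" and "C \<in> classes \<pi> gr \<Longrightarrow> card C \<ge> 2"
    and "C \<in> classes \<pi> gr \<Longrightarrow> card C = 2 \<Longrightarrow> oppP \<pi> C \<and> (\<forall>l\<in>idx. unsplit C (sg l))"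
proof -
  have t: "C \<in> classes \<pi> (sg l) \<Longrightarrow> dbl \<pi> C" "2 * card (restrict_partition \<pi> (sg l)) = card (sg l) + 2"
    if "l \<in> idx" for l C using dbl_double_tree[OF P that] dt that by blast+
  have f: "finite (R \<union> S)" "card (R \<union> S) \<le> 4"
    using arc_gluings_card[OF RS(1)] arc_gluings_card[OF RS(2)] card_Un_le[of R S] by auto
  have sub: "I \<subseteq> gr" if "I \<in> {sg 1, sg 2, sg 3}" for I using that gr_segs by auto
  have "(\<Sum>I\<in>{sg 1, sg 2, sg 3}. card (restrict_partition \<pi> I)) \<le> card \<pi> + card (R \<union> S)"
    by (rule glued_card[OF P glued f(1) seg_family3(3) sub seg_family3(1,2)])
  then have "card (restrict_partition \<pi> (sg 1)) + card (restrict_partition \<pi> (sg 2)) + card (restrict_partition \<pi> (sg 3))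
      \<le> card \<pi> + 4" unfolding seg_family3(4) using f(2) by linarith
  \<comment> \<open>Three double trees have m/2 + 3 vertices together, and gluing along two edges
    costs at most four of them.\<close>
  then show "mm \<le> 2 * card \<pi> + 2"
    using t(2)[of 1] t(2)[of 2] t(2)[of 3] card_gr_segs[of 1 2 3] by simp
  show parts: "C \<inter> sg l = {} \<or> dbl \<pi> (C \<inter> sg l)" if "C \<in> classes \<pi> gr" "l \<in> idx" for C l
    using dbl_parts[OF t(1)[OF that(2)] seg_gr[OF that(2)] that(1)] .
  have meets: "\<exists>l\<in>idx. C \<inter> sg l \<noteq> {}" if C: "C \<in> classes \<pi> gr" for C
  proof -
    obtain v where v: "v \<in> C" using classes_ne[OF C] by blast
    then have "v \<in> gr" using classes_sub[OF C] by blast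
    then show ?thesis using gr_seg_ex v by blast
  qed
  show "\<not> loopc \<pi> C" if C: "C \<in> classes \<pi> gr"
  proof
    assume "loopc \<pi> C"
    then obtain v where v: "v \<in> C" "block \<pi> (\<gamma> v) = block \<pi> v" unfolding loopc_def by blast
    have "v \<in> gr" using v classes_sub[OF C] by blast
    then obtain l where "l \<in> idx" "v \<in> sg l" using gr_seg_ex by blast
    then show False using double_tree_no_loop[OF P _ _] dt v by blast
  qed
  show "card C \<ge> 2" if C: "C \<in> classes \<pi> gr"
  proof -
    obtain l where l: "l \<in> idx" "C \<inter> sg l \<noteq> {}" using meets[OF C] by blast
    then have "card (C \<inter> sg l) = 2" using parts[OF C l(1)] by (simp add: dbl_def)
    moreover have "card (C \<inter> sg l) \<le> card C" using finite_class[OF C] by (intro card_mono) auto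
    ultimately show ?thesis by simp
  qed
  show "oppP \<pi> C \<and> (\<forall>l\<in>idx. unsplit C (sg l))" if C: "C \<in> classes \<pi> gr" "card C = 2"
  proof
    obtain l where l: "l \<in> idx" "C \<inter> sg l \<noteq> {}" using meets[OF C(1)] by blast
    show "oppP \<pi> C" using dbl_unsplit(2)[OF C parts[OF C(1) l(1)]] l(2) by blast
    show "\<forall>l\<in>idx. unsplit C (sg l)"
    proof
      fix l assume l: "l \<in> idx"
      show "unsplit C (sg l)" by (rule dbl_unsplit(1)[OF C parts[OF C(1) l]])
    qed
  qed
qed

lemma tree_2_6_prof:
  assumes P: "partition_on gr \<pi>" and ty: "tree_2_6_type m1 m2 m3 \<pi>"
  shows "mm \<le> 2 * card \<pi> + 2 \<and> (\<exists>D. prof6 \<pi> D)"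
proof -
  obtain a b c R S where dt: "\<forall>l\<in>idx. double_tree (qg \<pi> (sg l))"
    and abc: "a \<in> sg 1" "b \<in> sg 2" "c \<in> sg 3" and RS: "R \<in> arc_gluings \<gamma> a b" "S \<in> arc_gluings \<gamma> a c"
    and glued: "glued_from m1 m2 m3 \<pi> {sg 1, sg 2, sg 3} (R \<union> S)"
    and mult: "arc_multiplicity (qg \<pi> gr) a = 6"
    using ty unfolding tree_2_6_type_def by blast
  note t = three_trees[OF P dt glued RS]
  have gr: "a \<in> gr" "b \<in> gr" "c \<in> gr" using abc gr_segs by auto
  have eab: "ends \<pi> a = ends \<pi> b" by (rule glued_ends[OF glued RS(1) _ gr(1,2)]) blast
  have eac: "ends \<pi> a = ends \<pi> c" by (rule glued_ends[OF glued RS(2) _ gr(1,3)]) blast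
  have sh: "share \<pi> 2 1" "share \<pi> 1 3"
    using share_sym[OF ends_share[OF eab abc(1,2)]] ends_share[OF eac abc(1,3)] by auto
  have conn: "uconnected (W \<pi> gr)" by (rule W_gr_connected[OF P _ sh]) blast
  let ?D = "cls \<pi> gr a"
  have D: "?D \<in> classes \<pi> gr" "a \<in> ?D" using cls_in[OF gr(1)] by auto
  have c6: "card ?D = 6" using mult arc_multiplicity_qg[OF P gclosed_gr gr(1)] by simp
  have "b \<in> ?D" "c \<in> ?D" using classes_memI[OF D] gr eab eac by auto
  then have ne: "?D \<inter> sg 1 \<noteq> {}" "?D \<inter> sg 2 \<noteq> {}" "?D \<inter> sg 3 \<noteq> {}" using D(2) abc by blast+
  have parts: "dbl \<pi> (?D \<inter> sg l)" if "l \<in> idx" for l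
    using t(2)[OF D(1) that] ne that by auto
  have "(\<Sum>C\<in>classes \<pi> gr. card C - 2) \<le> 4" by (rule excess_le(1)[OF P conn t(1,4)])
  \<comment> \<open>A class of six arcs uses up the whole excess, so every other class has exactly
    two arcs.\<close>
  also have "4 = (\<Sum>C\<in>{?D}. card C - 2)" using c6 by simp
  finally have others: "card C - 2 = 0" if "C \<in> classes \<pi> gr" "C \<noteq> ?D" for C
    using sum_le_others_zero[where f = "\<lambda>C. card C - 2", OF finite_classes[OF finite_gr] _ _ that(1), of "{?D}"] D(1) that(2) by simp
  have rest: "card C = 2" if "C \<in> classes \<pi> gr" "C \<noteq> ?D" for C
    using others[OF that] t(4)[OF that(1)] by simp
  have "prof6 \<pi> ?D" unfolding prof6_def
  proof (intro conjI ballI impI)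
    show "?D \<in> classes \<pi> gr" by (rule D(1))
    show "\<not> loopc \<pi> ?D" by (rule t(3)[OF D(1)])
    show "card (?D \<inter> sg l) = 2" "oppP \<pi> (?D \<inter> sg l)" if "l \<in> idx" for l using parts[OF that] by (simp_all add: dbl_def)
    fix C assume C: "C \<in> classes \<pi> gr" "C \<noteq> ?D"
    show c2: "card C = 2" by (rule rest[OF C])
    show "oppP \<pi> C" using t(5)[OF C(1) c2] by blast
    show "unsplit C (sg l)" if "l \<in> idx" for l using t(5)[OF C(1) c2] that by blast
  qed
  then show ?thesis using t(1) by blast
qed

lemma tree_2_4_4_prof:
  assumes P: "partition_on gr \<pi>" and ty: "tree_2_4_4_type m1 m2 m3 \<pi>"
  shows "mm \<le> 2 * card \<pi> + 2 \<and> (\<exists>i j k D1 D2. prof44 \<pi> i j k D1 D2)"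
proof -
  obtain i j k a b a' c R S where dt: "\<forall>l\<in>idx. double_tree (qg \<pi> (sg l))" and ijk: "{i, j, k} = idx"
    and abc: "a \<in> sg j" "b \<in> sg i" "a' \<in> sg j" "c \<in> sg k"
    and RS: "R \<in> arc_gluings \<gamma> a b" "S \<in> arc_gluings \<gamma> a' c"
    and neq: "(a, a') \<notin> equivalent_arcs (qg \<pi> (sg j))"
    and glued: "glued_from m1 m2 m3 \<pi> {sg 1, sg 2, sg 3} (R \<union> S)"
    and mult: "arc_multiplicity (qg \<pi> gr) a = 4" "arc_multiplicity (qg \<pi> gr) a' = 4"
    using ty unfolding tree_2_4_4_type_def by blast
  note p = idx_perm[OF ijk]
  note t = three_trees[OF P dt glued RS]
  have gr: "a \<in> gr" "b \<in> gr" "a' \<in> gr" "c \<in> gr" using abc p(7) by blast+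
  have eab: "ends \<pi> a = ends \<pi> b" by (rule glued_ends[OF glued RS(1) _ gr(1,2)]) blast
  have eac: "ends \<pi> a' = ends \<pi> c" by (rule glued_ends[OF glued RS(2) _ gr(3,4)]) blast
  have conn: "uconnected (W \<pi> gr)"
    by (rule W_gr_connected[OF P ijk share_sym[OF ends_share[OF eab abc(1,2) p(2,1)]] ends_share[OF eac abc(3,4) p(2,3)]])
  let ?D1 = "cls \<pi> gr a" and ?D2 = "cls \<pi> gr a'"
  have D1: "?D1 \<in> classes \<pi> gr" "a \<in> ?D1" "b \<in> ?D1" using cls_in[OF gr(1)] classes_memI[OF cls_in[OF gr(1)] gr(2)] eab by auto
  have D2: "?D2 \<in> classes \<pi> gr" "a' \<in> ?D2" "c \<in> ?D2" using cls_in[OF gr(3)] classes_memI[OF cls_in[OF gr(3)] gr(4)] eac by auto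
  have D12: "?D1 \<noteq> ?D2"
  proof
    assume "?D1 = ?D2"
    then have "ends \<pi> a = ends \<pi> a'" using classes_ends[OF D1(1,2)] D2(2) by blast
    then show False using neq abc unfolding equivalent_arcs_qg[OF P gclosed_seg[OF p(2)]] by blast
  qed
  have c4: "card ?D1 = 4" "card ?D2 = 4" using mult arc_multiplicity_qg[OF P gclosed_gr] gr by auto
  \<comment> \<open>Inside a double tree each nonempty part of \<open>D\<close> has two arcs. The
    parts in the cycles \<open>x\<close> and \<open>j\<close> thus account for all four, and the
    third cycle misses \<open>D\<close>.\<close>
  have quads: "quad \<pi> (sg x) D \<and> D - sg x \<subseteq> sg j"
    if D: "D \<in> classes \<pi> gr" "card D = 4" "D \<inter> sg x \<noteq> {}" "D \<inter> sg j \<noteq> {}" and xy: "{x, j, y} = idx" for D x y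
  proof -
    note q = idx_perm[OF xy]
    have dx: "dbl \<pi> (D \<inter> sg x)" "dbl \<pi> (D \<inter> sg j)"
      using t(2)[OF D(1) q(1)] t(2)[OF D(1) q(2)] D(3,4) by auto
    then have "card (D \<inter> sg y) = 0" using card_split[OF xy classes_sub[OF D(1)]] D(2) by (simp add: dbl_def)
    then have "D \<inter> sg y = {}" using finite_class[OF D(1)] by simp
    then have "D - sg x = D \<inter> sg j" using classes_sub[OF D(1)] q by blast
    then show ?thesis using dx D(1) by (simp add: quad_def dbl_def)
  qed
  have q1: "quad \<pi> (sg i) ?D1 \<and> ?D1 - sg i \<subseteq> sg j"
    by (rule quads[OF D1(1) c4(1) _ _ ijk]) (use D1 abc in blast)+
  have kji: "{k, j, i} = idx" using ijk by blast
  have q2: "quad \<pi> (sg k) ?D2 \<and> ?D2 - sg k \<subseteq> sg j"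
    by (rule quads[OF D2(1) c4(2) _ _ kji]) (use D2 abc in blast)+
  have "(\<Sum>C\<in>classes \<pi> gr. card C - 2) \<le> 4" by (rule excess_le(1)[OF P conn t(1,4)])
  also have "4 = (\<Sum>C\<in>{?D1, ?D2}. card C - 2)" using c4 D12 by simp
  finally have others: "card C - 2 = 0" if "C \<in> classes \<pi> gr" "C \<noteq> ?D1" "C \<noteq> ?D2" for C
    using sum_le_others_zero[where f = "\<lambda>C. card C - 2", OF finite_classes[OF finite_gr] _ _ that(1), of "{?D1, ?D2}"] D1(1) D2(1) that(2,3) by simp
  have rest: "card C = 2 \<and> oppP \<pi> C \<and> (\<forall>l\<in>idx. unsplit C (sg l))" if "C \<in> classes \<pi> gr" "C \<noteq> ?D1" "C \<noteq> ?D2" for C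
  proof -
    have c2: "card C = 2" using others[OF that] t(4)[OF that(1)] by simp
    then show ?thesis using t(5)[OF that(1) c2] by blast
  qed
  have "prof44 \<pi> i j k ?D1 ?D2" unfolding prof44_def
    using rest by (intro conjI ballI impI ijk D12 conjunct1[OF q1] conjunct2[OF q1] conjunct1[OF q2] conjunct2[OF q2]
      t(3)[OF D1(1)] t(3)[OF D2(1)]) blast+
  then show ?thesis using t(1) by blast
qed

end

section \<open>From pairings to the types\<close>

lemma sum_eq_2_cases:
  fixes h :: "'a \<Rightarrow> nat"
  assumes "finite A" "sum h A = 2"
  shows "(\<exists>D\<in>A. h D = 2 \<and> (\<forall>C\<in>A. C \<noteq> D \<longrightarrow> h C = 0)) \<or>
    (\<exists>D\<in>A. \<exists>E\<in>A. D \<noteq> E \<and> h D = 1 \<and> h E = 1 \<and> (\<forall>C\<in>A. C \<noteq> D \<longrightarrow> C \<noteq> E \<longrightarrow> h C = 0))"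
proof -
  have "\<not> (\<forall>D\<in>A. h D = 0)"
  proof
    assume "\<forall>D\<in>A. h D = 0"
    then have "sum h A = 0" by simp
    then show False using assms(2) by simp
  qed
  then obtain D where D: "D \<in> A" "h D \<noteq> 0" by blast
  have s: "h D + sum h (A - {D}) = 2" using assms sum.remove[OF assms(1) D(1), of h] by simp
  then have "h D = 2 \<or> h D = 1" using D(2) by linarith
  then show ?thesis
  proof
    assume h: "h D = 2"
    then have "sum h (A - {D}) = 0" using s by simp
    then have "\<forall>C\<in>A. C \<noteq> D \<longrightarrow> h C = 0" using assms(1) by simp
    then show ?thesis using D(1) h by blast
  next
    assume h: "h D = 1"
    then have "sum h (A - {D}) = 1" using s by simp
    moreover have "(sum h (A - {D}) = 1) = (\<exists>E\<in>A - {D}. h E = 1 \<and> (\<forall>C\<in>A - {D}. E \<noteq> C \<longrightarrow> h C = 0))"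
      by (rule sum_eq_1_iff) (use assms(1) in simp)
    ultimately obtain E where E: "E \<in> A - {D}" "h E = 1" "\<forall>C\<in>A - {D}. E \<noteq> C \<longrightarrow> h C = 0" by blast
    then show ?thesis using D(1) h by (intro disjI2 bexI[of _ D] bexI[of _ E]) auto
  qed
qed

text \<open>Sending a block of \<open>Q\<close> to the block of \<open>P\<close> around it is onto,
  hence a bijection when \<open>Q\<close> has no more blocks than \<open>P\<close>. Cardinality
  bounds become equalities of partitions in this way.\<close>

lemma coarser_partition_eq:
  assumes A: "finite A" and P: "partition_on A P" and Q: "partition_on A Q"
    and finer: "\<And>a b. a \<in> A \<Longrightarrow> b \<in> A \<Longrightarrow> block Q a = block Q b \<Longrightarrow> block P a = block P b"
    and card: "card Q \<le> card P"
  shows "P = Q"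
proof -
  define f where "f B = block P (SOME b. b \<in> B)" for B
  have f: "f (block Q a) = block P a" if a: "a \<in> A" for a
  proof -
    define b where "b = (SOME b. b \<in> block Q a)"
    have b: "b \<in> block Q a" unfolding b_def using block_in(2)[OF Q a] by (rule someI)
    have bA: "b \<in> A" using b block_in(1)[OF Q a] Q by (auto simp: partition_on_def)
    have "block Q b = block Q a" by (rule block_eqI[OF Q block_in(1)[OF Q a] b])
    then show ?thesis using finer[OF bA a] unfolding f_def b_def by simp
  qed
  have "f ` Q = f ` block Q ` A" using block_image[OF Q] by simp
  also have "\<dots> = block P ` A" using f by (simp add: image_image)
  finally have img: "f ` Q = P" using block_image[OF P] by simp
  have "finite Q" by (rule finite_elements[OF A Q])
  then have inj: "inj_on f Q" using card img by (intro eq_card_imp_inj_on) (auto intro: antisym card_image_le)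
  show ?thesis
  proof (rule partition_eqI[OF P Q])
    fix a b assume ab: "a \<in> A" "b \<in> A"
    show "block P a = block P b \<longleftrightarrow> block Q a = block Q b"
    proof
      assume "block P a = block P b"
      then have "f (block Q a) = f (block Q b)" using f ab by simp
      then show "block Q a = block Q b" using inj_onD[OF inj] block_in(1)[OF Q] ab by blast
    qed (rule finer[OF ab])
  qed
qed

context three_cycles
begin

section \<open>Recovering a partition from the gluing of its pieces\<close>

abbreviation "X0 \<pi> \<I> R \<equiv> (\<Union>I\<in>\<I>. same_block (restrict_partition \<pi> I)) \<union> R"
abbreviation "X1 \<pi> \<I> R \<equiv> (X0 \<pi> \<I> R \<union> converse (X0 \<pi> \<I> R))\<^sup>*"

text \<open>The pairing also pairs opposite arcs in the glued partition, so the bound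
  \<open>pairings_card_le\<close> leaves no room for it to be strictly finer than \<open>\<pi>\<close>.\<close>

lemma glued_intro:
  assumes P: "partition_on gr \<pi>" and \<sigma>: "\<sigma> \<in> pairings \<pi>" and mm: "mm \<le> 2 * card \<pi> + 2"
    and I: "\<And>I. I \<in> \<I> \<Longrightarrow> I \<subseteq> gr"
    and R: "\<And>a b. (a, b) \<in> R \<Longrightarrow> a \<in> gr \<and> b \<in> gr \<and> block \<pi> a = block \<pi> b"
    and gen: "\<And>u. u \<in> gr \<Longrightarrow> (u, \<gamma> (\<sigma> u)) \<in> X1 \<pi> \<I> R"
  shows "glued_from m1 m2 m3 \<pi> \<I> R"
proof -
  let ?X = "X0 \<pi> \<I> R"
  let ?Q = "generated_partition gr ?X"
  note s = pairingsD[OF \<sigma>]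
  have Q: "partition_on gr ?Q" by (rule partition_on_generated)
  have g: "\<gamma> u \<in> gr" if "u \<in> gr" for u using gclosed_gam[OF gclosed_gr that] .
  have step: "block ?Q u = block ?Q (\<gamma> (\<sigma> u))" if u: "u \<in> gr" for u
    unfolding block_generated[OF u g[OF s(2)[OF u]]] using gen[OF u] u g[OF s(2)[OF u]] by (simp add: eqc_def)
  have "opp ?Q u (\<sigma> u)" if u: "u \<in> gr" for u
    using step[OF u] step[OF s(2)[OF u]] s(4)[OF u] by (simp add: opp_def)
  then have "\<sigma> \<in> pairings ?Q" using \<sigma> unfolding pairings_def by blast
  then have "card ?Q \<le> card \<pi>" using pairings_card_le[OF Q] mm by fastforce
  moreover have "block \<pi> a = block \<pi> b" if ab: "a \<in> gr" "b \<in> gr" "block ?Q a = block ?Q b" for a b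
  proof -
    have X: "block \<pi> x = block \<pi> y" if xy: "(x, y) \<in> ?X" for x y
    proof (cases "(x, y) \<in> R")
      case False
      then obtain I' where I': "I' \<in> \<I>" "(x, y) \<in> same_block (restrict_partition \<pi> I')" using xy by blast
      then have "x \<in> I'" "y \<in> I'" "rb \<pi> I' x = rb \<pi> I' y"
        using same_block_iff[OF restrict_partition_on[OF P I[OF I'(1)]]] by blast+
      then show ?thesis using block_restrict_eq_iff[OF P I[OF I'(1)]] by blast
    qed (use R in blast)
    have "(a, b) \<in> X1 \<pi> \<I> R" using ab block_generated[OF ab(1,2)] by (simp add: eqc_def)
    then show ?thesis
    proof (induction rule: rtrancl_induct)
      case (step y z)
      then have "block \<pi> y = block \<pi> z" using X[of y z] X[of z y] by auto
      then show ?case using step.IH by simp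
    qed simp
  qed
  ultimately have "\<pi> = ?Q" by (intro coarser_partition_eq[OF finite_gr P Q])
  then show ?thesis by (simp add: glued_from_def)
qed

lemma X1_sym: "(a, b) \<in> X1 \<pi> \<I> R \<Longrightarrow> (b, a) \<in> X1 \<pi> \<I> R"
proof -
  have "sym (X1 \<pi> \<I> R)" by (rule sym_rtrancl) (auto simp: sym_def)
  then show "(a, b) \<in> X1 \<pi> \<I> R \<Longrightarrow> (b, a) \<in> X1 \<pi> \<I> R" by (rule symD)
qed

lemma X1_piece:
  assumes P: "partition_on gr \<pi>" and I: "I \<in> \<I>" "gclosed I" and xy: "x \<in> I" "y \<in> I" "block \<pi> x = block \<pi> y"
  shows "(x, y) \<in> X1 \<pi> \<I> R"
proof -
  have "(x, y) \<in> same_block (restrict_partition \<pi> I)"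
    using same_block_iff[OF restrict_partition_on[OF P gclosed_gr_sub[OF I(2)]]] rb_eq_iff[OF P I(2) xy(1,2)] xy by simp
  then have "(x, y) \<in> X0 \<pi> \<I> R" using I(1) by blast
  then show ?thesis by blast
qed

text \<open>The piece \<open>I\<close> hangs on the arc \<open>a\<close>: by the prescribed
  identifications alone, each end of \<open>a\<close> is related to every index of its block that
  lies in \<open>I\<close>.\<close>

definition attached :: "nat set set \<Rightarrow> nat set set \<Rightarrow> (nat \<times> nat) set \<Rightarrow> nat \<Rightarrow> nat set \<Rightarrow> bool" where
  "attached \<pi> \<I> R a I \<longleftrightarrow> (\<forall>x\<in>{a, \<gamma> a}. \<forall>y\<in>I. block \<pi> y = block \<pi> x \<longrightarrow> (x, y) \<in> X1 \<pi> \<I> R)"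

lemma attached_self:
  assumes P: "partition_on gr \<pi>" and I: "I \<in> \<I>" "gclosed I" "a \<in> I"
  shows "attached \<pi> \<I> R a I"
  unfolding attached_def
proof (intro ballI impI)
  fix x y assume x: "x \<in> {a, \<gamma> a}" and y: "y \<in> I" "block \<pi> y = block \<pi> x"
  have "x \<in> I" using x I(3) gclosed_gam[OF I(2,3)] by blast
  then show "(x, y) \<in> X1 \<pi> \<I> R" using y by (intro X1_piece[OF P I(1,2)]) simp_all
qed

lemma attached_glued:
  assumes P: "partition_on gr \<pi>" and I: "I \<in> \<I>" "gclosed I" "b \<in> I"
    and R: "R0 \<in> arc_gluings \<gamma> a b" "R0 \<subseteq> R" "\<And>x y. (x, y) \<in> R0 \<Longrightarrow> block \<pi> x = block \<pi> y"
  shows "attached \<pi> \<I> R a I"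
  unfolding attached_def
proof (intro ballI impI)
  fix x y assume x: "x \<in> {a, \<gamma> a}" and y: "y \<in> I" "block \<pi> y = block \<pi> x"
  have "\<exists>z\<in>{b, \<gamma> b}. (x, z) \<in> R0" using R(1) x unfolding arc_gluings_def by blast
  then obtain z where z: "z \<in> {b, \<gamma> b}" "(x, z) \<in> R0" by blast
  have zI: "z \<in> I" using z(1) I(3) gclosed_gam[OF I(2,3)] by blast
  have "(x, z) \<in> X1 \<pi> \<I> R" using z(2) R(2) by blast
  moreover have "(z, y) \<in> X1 \<pi> \<I> R" using R(3)[OF z(2)] y zI by (intro X1_piece[OF P I(1,2)]) simp_all
  ultimately show "(x, y) \<in> X1 \<pi> \<I> R" by (rule rtrancl_trans)
qed

text \<open>The connection from \<open>u\<close> to \<open>v\<close> runs through the end of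
  \<open>a\<close> that lies in their common block.\<close>

lemma attached_cross:
  assumes att: "attached \<pi> \<I> R a I" "attached \<pi> \<I> R a J"
    and u: "u \<in> I" "v \<in> J" "block \<pi> u = block \<pi> v" "ends \<pi> a = ends \<pi> u"
  shows "(u, v) \<in> X1 \<pi> \<I> R"
proof -
  have "block \<pi> u \<in> ends \<pi> a" unfolding u(4) by (simp add: ends_def)
  then have "\<exists>x\<in>{a, \<gamma> a}. block \<pi> u = block \<pi> x" by (auto simp: ends_def)
  then obtain x where x: "x \<in> {a, \<gamma> a}" "block \<pi> u = block \<pi> x" by blast
  have xu: "(x, u) \<in> X1 \<pi> \<I> R" using att(1) x u(1) unfolding attached_def by blast
  have "block \<pi> v = block \<pi> x" using u(3) x(2) by simp
  then have "(x, v) \<in> X1 \<pi> \<I> R" using att(2) x(1) u(2) unfolding attached_def by blast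
  then show ?thesis by (rule rtrancl_trans[OF X1_sym[OF xu]])
qed

text \<open>Equal end sets match either in parallel or crosswise, and these are the two
  gluings.\<close>

lemma gluing_exists:
  assumes "ends \<pi> a = ends \<pi> b"
  shows "\<exists>R\<in>arc_gluings \<gamma> a b. \<forall>x y. (x, y) \<in> R \<longrightarrow> block \<pi> x = block \<pi> y"
  using assms unfolding ends_eq_iff opp_def arc_gluings_def by auto

lemma gluing_gr:
  assumes "R \<in> arc_gluings \<gamma> a b" "a \<in> gr" "b \<in> gr" "(x, y) \<in> R"
  shows "x \<in> gr \<and> y \<in> gr"
  using assms gclosed_gam[OF gclosed_gr] unfolding arc_gluings_def by auto

section \<open>Vertex numbers of overlapping pieces\<close>

lemma card_restrict:
  assumes "partition_on gr \<pi>" "gclosed I"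
  shows "card (restrict_partition \<pi> I) = card (block \<pi> ` I)"
  using uverts_card[OF assms] card_image_eq_kernel[of I "rb \<pi> I" "block \<pi>", OF rb_eq_iff[OF assms]] by simp

lemma overlap:
  assumes P: "partition_on gr \<pi>" and "gclosed I" "gclosed J"
    and B: "B \<subseteq> block \<pi> ` I" "B \<subseteq> block \<pi> ` J"
  shows "card (block \<pi> ` (I \<union> J)) + card B \<le> card (block \<pi> ` I) + card (block \<pi> ` J)"
proof -
  have fin: "finite (block \<pi> ` I)" "finite (block \<pi> ` J)" using gclosed_finite assms(2,3) by auto
  have "card (block \<pi> ` I) + card (block \<pi> ` J) =
      card (block \<pi> ` I \<union> block \<pi> ` J) + card (block \<pi> ` I \<inter> block \<pi> ` J)"
    using card_Un_Int[OF fin] .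
  moreover have "card B \<le> card (block \<pi> ` I \<inter> block \<pi> ` J)" using B fin by (intro card_mono) auto
  ultimately show ?thesis by (simp add: image_Un)
qed

lemma ends_sub: "gclosed I \<Longrightarrow> a \<in> I \<Longrightarrow> ends \<pi> a \<subseteq> block \<pi> ` I"
  using gclosed_gam unfolding ends_def by blast

lemma card_ends: "block \<pi> (\<gamma> a) \<noteq> block \<pi> a \<Longrightarrow> card (ends \<pi> a) = 2"
  by (simp add: ends_def)

text \<open>A closed walk uses the only class crossing a cut equally often in both directions.\<close>

lemma balanced_dbl:
  assumes P: "partition_on gr \<pi>" and C: "C \<in> classes \<pi> gr" and l: "l \<in> idx" and c2: "card (C \<inter> sg l) = 2"
    and cut: "\<And>u. u \<in> sg l \<Longrightarrow> (rb \<pi> gr (\<gamma> u) \<in> S) \<noteq> (rb \<pi> gr u \<in> S) \<Longrightarrow> u \<in> C"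
    and cross: "\<And>u. u \<in> C \<Longrightarrow> (rb \<pi> gr (\<gamma> u) \<in> S) \<noteq> (rb \<pi> gr u \<in> S)"
  shows "dbl \<pi> (C \<inter> sg l)"
proof -
  let ?p = "\<lambda>u. rb \<pi> gr u \<in> S"
  let ?A = "{u \<in> sg l. ?p (\<gamma> u) \<and> \<not> ?p u}" and ?B = "{u \<in> sg l. \<not> ?p (\<gamma> u) \<and> ?p u}"
  have AB: "C \<inter> sg l = ?A \<union> ?B" using cut cross by blast
  have fin: "finite ?A" "finite ?B" using gclosed_finite[OF gclosed_seg[OF l]] by auto
  have eq: "card ?A = card ?B" by (rule flow_balance[OF gclosed_seg[OF l]])
  have "card ?A + card ?B = 2" using c2 unfolding AB using fin by (subst card_Un_disjoint[symmetric]) auto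
  then have "card ?A = 1" "card ?B = 1" using eq by simp_all
  then obtain u v where uv: "?A = {u}" "?B = {v}" by (auto simp: card_1_singleton_iff)
  have u: "u \<in> sg l" "?p (\<gamma> u)" "\<not> ?p u" and v: "v \<in> sg l" "\<not> ?p (\<gamma> v)" "?p v" using uv by blast+
  have Cuv: "C \<inter> sg l = {u, v}" using AB uv by blast
  have gr: "u \<in> gr" "v \<in> gr" "\<gamma> u \<in> gr" "\<gamma> v \<in> gr"
    using u v seg_gr[OF l] gam_seg[OF l u(1)] gam_seg[OF l v(1)] by blast+
  have "ends \<pi> u = ends \<pi> v" using classes_ends[OF C] Cuv by blast
  moreover have "block \<pi> u \<noteq> block \<pi> v"
    using rb_eq_iff[OF P gclosed_gr gr(1,2)] u v by metis
  ultimately have "opp \<pi> u v" unfolding ends_eq_iff by blast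
  then have "opp \<pi> u v" "opp \<pi> v u" using opp_sym by blast+
  then show ?thesis using c2 unfolding dbl_def oppP_def Cuv by blast
qed

lemma card_block_seg_le:
  assumes P: "partition_on gr \<pi>" and j: "j \<in> idx" and dbl: "\<And>C. C \<in> classes \<pi> (sg j) \<Longrightarrow> dbl \<pi> C"
  shows "2 * card (block \<pi> ` sg j) \<le> card (sg j) + 2"
proof -
  note I = gclosed_seg[OF j]
  have conn: "uconnected (W \<pi> (sg j))"
    by (rule seg_connected[OF P j homog_subclasses[OF P I order_refl]]) (simp only: Union_classes)
  have "2 * card (classes \<pi> (sg j)) = card (sg j)"
    using sum_card_classes[OF gclosed_finite[OF I], of \<pi>] dbl by (simp add: dbl_def)
  then show ?thesis using card_uverts_le_Suc_uedges[OF W_wf[OF P I] conn] uverts_card[OF P I] card_restrict[OF P I] by simp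
qed

lemma double_tree_intro:
  assumes P: "partition_on gr \<pi>" and j: "j \<in> idx" and dbl: "\<And>C. C \<in> classes \<pi> (sg j) \<Longrightarrow> dbl \<pi> C"
    and ge: "card (sg j) + 2 \<le> 2 * card (block \<pi> ` sg j)"
  shows "double_tree (qg \<pi> (sg j))"
  unfolding double_tree_seg[OF P j] card_restrict[OF P gclosed_seg[OF j]]
  using ge card_block_seg_le[OF P j dbl] dbl by (auto simp: dbl_def)

text \<open>Adding the pieces one at a time, each of the two overlaps contains the two ends of an
  edge, so the vertex numbers sum to at least |\<pi>| + 4, which is at least m/2 + 3. A connected
  doubled piece has at most \<open>card (sg l) / 2 + 1\<close> vertices; all three must attain this
  bound and are trees.\<close>

lemma three_double_trees:
  assumes P: "partition_on gr \<pi>" and mm: "mm \<le> 2 * card \<pi> + 2" and ijk: "{i, j, k} = idx"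
    and dbl: "\<And>l C. l \<in> idx \<Longrightarrow> C \<in> classes \<pi> (sg l) \<Longrightarrow> dbl \<pi> C"
    and ab: "a \<in> sg j" "b \<in> sg i" "ends \<pi> a = ends \<pi> b" "block \<pi> (\<gamma> a) \<noteq> block \<pi> a"
    and ac: "a' \<in> sg j" "c \<in> sg k" "ends \<pi> a' = ends \<pi> c" "block \<pi> (\<gamma> a') \<noteq> block \<pi> a'"
  shows "\<forall>l\<in>idx. double_tree (qg \<pi> (sg l))"
proof -
  note p = idx_perm[OF ijk]
  note gc = gclosed_seg[OF p(1)] gclosed_seg[OF p(2)] gclosed_seg[OF p(3)]
  have 1: "card (block \<pi> ` (sg j \<union> sg i)) + 2 \<le> card (block \<pi> ` sg j) + card (block \<pi> ` sg i)"
    using overlap[OF P gc(2,1) ends_sub[OF gc(2) ab(1)]] ends_sub[OF gc(1) ab(2)] ab(3) card_ends[OF ab(4)] by simp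
  have "ends \<pi> a' \<subseteq> block \<pi> ` (sg j \<union> sg i)" using ends_sub[OF gc(2) ac(1)] by blast
  then have 2: "card (block \<pi> ` (sg j \<union> sg i \<union> sg k)) + 2 \<le> card (block \<pi> ` (sg j \<union> sg i)) + card (block \<pi> ` sg k)"
    using overlap[OF P gclosed_Un[OF gc(2,1)] gc(3)] ends_sub[OF gc(3) ac(2)] ac(3) card_ends[OF ac(4)] by metis
  have "block \<pi> ` (sg j \<union> sg i \<union> sg k) = \<pi>" using block_image[OF P] p(7) by (simp add: Un_commute)
  then have tot: "card \<pi> + 4 \<le> card (block \<pi> ` sg j) + card (block \<pi> ` sg i) + card (block \<pi> ` sg k)"
    using 1 2 by simp
  have le: "2 * card (block \<pi> ` sg l) \<le> card (sg l) + 2" if "l \<in> idx" for l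
    by (rule card_block_seg_le[OF P that dbl[OF that]])
  have m: "mm = card (sg i) + card (sg j) + card (sg k)" by (rule card_gr_segs[OF ijk])
  have "card (sg i) + 2 \<le> 2 * card (block \<pi> ` sg i)" "card (sg j) + 2 \<le> 2 * card (block \<pi> ` sg j)"
    "card (sg k) + 2 \<le> 2 * card (block \<pi> ` sg k)"
    using tot mm m le[OF p(1)] le[OF p(2)] le[OF p(3)] by linarith+
  then have "double_tree (qg \<pi> (sg i))" "double_tree (qg \<pi> (sg j))" "double_tree (qg \<pi> (sg k))"
    using double_tree_intro[OF P p(1) dbl[OF p(1)]] double_tree_intro[OF P p(2) dbl[OF p(2)]]
      double_tree_intro[OF P p(3) dbl[OF p(3)]] by simp_all
  then show ?thesis unfolding ijk[symmetric] by simp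
qed

text \<open>The odd class gives a nonempty even edge set, so this connected piece is no tree and has
  at most as many vertices as edges.\<close>

lemma card_block_pair_le:
  assumes P: "partition_on gr \<pi>" and jk: "j \<in> idx" "k \<in> idx" "j \<noteq> k" and sh: "share \<pi> j k"
    and dbl: "\<And>C. C \<in> classes \<pi> (sg j \<union> sg k) \<Longrightarrow> dbl \<pi> C"
    and odd: "C \<in> classes \<pi> (sg j \<union> sg k)" "odd (card (C \<inter> sg j))"
  shows "2 * card (block \<pi> ` (sg j \<union> sg k)) \<le> card (sg j \<union> sg k)"
proof -
  note I = gclosed_2[OF jk(1,2)]
  let ?I = "sg j \<union> sg k"
  have conn: "uconnected (W \<pi> ?I)" using W2_connected_iff[OF P jk] sh by simp
  have ev: "even_edges (W \<pi> ?I) {C \<in> classes \<pi> ?I. odd (card (C \<inter> sg j))}" by (rule W_parity[OF P I jk(1)]) blast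
  have "\<not> card (uedges (W \<pi> ?I)) < card (uverts (W \<pi> ?I))"
    using tree_no_even_edges[OF W_wf[OF P I] conn _ ev] odd by blast
  moreover have "2 * card (classes \<pi> ?I) = card ?I"
    using sum_card_classes[OF gclosed_finite[OF I], of \<pi>] dbl by (simp add: dbl_def)
  ultimately show ?thesis using uverts_card[OF P I] card_restrict[OF P I] by simp
qed

text \<open>With as many vertices as edges, the circuit is the unique nonempty even edge set, so it
  consists of the classes that cycle \<open>j\<close> meets oddly. A class of two arcs among them
  has one arc in each cycle.\<close>

lemma double_unicircuit_intro:
  assumes P: "partition_on gr \<pi>" and jk: "j \<in> idx" "k \<in> idx" "j \<noteq> k" and sh: "share \<pi> j k"
    and dbl: "\<And>C. C \<in> classes \<pi> (sg j \<union> sg k) \<Longrightarrow> dbl \<pi> C"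
    and odd: "C0 \<in> classes \<pi> (sg j \<union> sg k)" "odd (card (C0 \<inter> sg j))"
    and card: "card (sg j \<union> sg k) \<le> 2 * card (block \<pi> ` (sg j \<union> sg k))"
  shows "double_unicircuit (qg \<pi> (sg j \<union> sg k)) (sg j) (sg k)"
    and "\<exists>K. circuits (W \<pi> (sg j \<union> sg k)) = {K} \<and>
      (\<forall>F. even_edges (W \<pi> (sg j \<union> sg k)) F \<longrightarrow> F \<noteq> {} \<longrightarrow> uedges K = F)"
proof -
  note I = gclosed_2[OF jk(1,2)]
  let ?I = "sg j \<union> sg k"
  have conn: "uconnected (W \<pi> ?I)" using W2_connected_iff[OF P jk] sh by simp
  have ev: "even_edges (W \<pi> ?I) {C \<in> classes \<pi> ?I. odd (card (C \<inter> sg j))}" by (rule W_parity[OF P I jk(1)]) blast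
  have c: "2 * card (classes \<pi> ?I) = card ?I"
    using sum_card_classes[OF gclosed_finite[OF I], of \<pi>] dbl by (simp add: dbl_def)
  have "card (uedges (W \<pi> ?I)) = card (uverts (W \<pi> ?I))"
    using c card card_block_pair_le[OF P jk sh dbl odd] uverts_card[OF P I] card_restrict[OF P I] by simp
  then obtain K where K: "circuits (W \<pi> ?I) = {K}"
    "\<And>F. even_edges (W \<pi> ?I) F \<Longrightarrow> F \<noteq> {} \<Longrightarrow> uedges K = F"
    using unicyclic_circuit[OF W_wf[OF P I] conn] by blast
  then show "\<exists>K. circuits (W \<pi> ?I) = {K} \<and> (\<forall>F. even_edges (W \<pi> ?I) F \<longrightarrow> F \<noteq> {} \<longrightarrow> uedges K = F)" by blast
  have Kodd: "uedges K = {C \<in> classes \<pi> ?I. odd (card (C \<inter> sg j))}" using K(2)[OF ev] odd by blast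
  have one: "card (C \<inter> sg j) = 1 \<and> card (C \<inter> sg k) = 1" if C: "C \<in> classes \<pi> ?I" "odd (card (C \<inter> sg j))" for C
  proof -
    have fin: "finite C" using classes_sub[OF C(1)] gclosed_finite[OF I] finite_subset by blast
    have "C = C \<inter> sg j \<union> C \<inter> sg k" using classes_sub[OF C(1)] by blast
    moreover have "card (C \<inter> sg j \<union> C \<inter> sg k) = card (C \<inter> sg j) + card (C \<inter> sg k)"
      using fin seg_disj[OF jk] by (intro card_Un_disjoint) auto
    ultimately have "card (C \<inter> sg j) + card (C \<inter> sg k) = 2" using dbl[OF C(1)] by (simp add: dbl_def)
    moreover have "x = 1 \<and> y = 1" if "x + y = 2" "odd x" for x y :: nat using that by presburger
    ultimately show ?thesis using C(2) by blast
  qed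
  show "double_unicircuit (qg \<pi> ?I) (sg j) (sg k)"
    unfolding double_unicircuit_def elementarization_qg[OF P I] all_arcs_doubled_qg[OF P I]
  proof (intro conjI exI[of _ K] ballI)
    show "uconnected (W \<pi> ?I)" by (rule conn)
    show "circuits (W \<pi> ?I) = {K}" by (rule K(1))
    show "card (C \<inter> sg j) = 1" "card (C \<inter> sg k) = 1" if "C \<in> uedges K" for C
      using one that unfolding Kodd by blast+
    show "card C = 2" if "C \<in> classes \<pi> ?I" for C using dbl[OF that] by (simp add: dbl_def)
    show "a \<noteq> b \<longrightarrow> opp \<pi> a b" if "C \<in> classes \<pi> ?I" "a \<in> C" "b \<in> C" for C a b
      using dbl[OF that(1)] that(2,3) unfolding dbl_def oppP_def by blast
  qed
qed

lemma class_size_cases: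
  fixes e1 e2 e3 :: nat
  assumes "even e1" "even e2" "even e3" "e1 + e2 + e3 = 4"
  shows "e1 = 0 \<and> (e2 = 2 \<and> e3 = 2) \<or> e2 = 0 \<and> (e1 = 2 \<and> e3 = 2) \<or> e3 = 0 \<and> (e1 = 2 \<and> e2 = 2) \<or>
    e1 = 4 \<or> e2 = 4 \<or> e3 = 4"
  using assms by presburger

end

section \<open>Classification of the partitions that carry a pairing\<close>

locale balanced_pairing = three_cycles +
  fixes \<pi> :: "nat set set" and \<sigma> :: "nat \<Rightarrow> nat"
  assumes P: "partition_on (ground m1 m2 m3) \<pi>"
    and \<sigma>: "\<sigma> \<in> pairings \<pi>"
    and mm_card: "mm = 2 * card \<pi> + 2"
begin

abbreviation "CL \<equiv> classes \<pi> gr"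

lemma conn: "uconnected (W \<pi> gr)"
  by (rule wgraph_connected_pairing[OF homog_subclasses[OF P gclosed_gr order_refl] Union_classes \<sigma>])
    (simp add: rb_eq_iff[OF P gclosed_gr])

lemma wf: "wf_ugraph (W \<pi> gr)"
  by (rule W_wf[OF P gclosed_gr])

lemma card_graph: "card (uverts (W \<pi> gr)) = card \<pi>" "card (uedges (W \<pi> gr)) = card CL"
  using W_gr_card[OF P] by simp_all

lemma class_even: "C \<in> CL \<Longrightarrow> even (card C)"
  by (rule pairings_class_even[OF \<sigma>])

lemma class_ge2: assumes "C \<in> CL" shows "2 \<le> card C"
proof -
  have "card C \<noteq> 0" using classes_ne[OF assms] finite_class[OF assms] by simp
  then show ?thesis using class_even[OF assms] by (cases "card C = 1") auto
qed

text \<open>Class sizes are even, so the arcs beyond two per class can be counted in pairs;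
  connectedness will bound their number by 2.\<close>

lemma excess: "(\<Sum>C\<in>CL. card C div 2 - 1) + card CL = card \<pi> + 1"
proof -
  have "(\<Sum>C\<in>CL. card C - 2) = (\<Sum>C\<in>CL. 2 * (card C div 2 - 1))"
  proof (rule sum.cong[OF refl])
    fix C assume C: "C \<in> CL"
    obtain n where "card C = 2 * n" using class_even[OF C] by (rule evenE)
    then show "card C - 2 = 2 * (card C div 2 - 1)" by simp
  qed
  then have "(\<Sum>C\<in>CL. card C - 2) = 2 * (\<Sum>C\<in>CL. card C div 2 - 1)" by (simp add: sum_distrib_left)
  then show ?thesis using excess_sum[of \<pi>, OF class_ge2] mm_card by simp
qed

lemma excess_zero: "C \<in> CL \<Longrightarrow> card C div 2 - 1 = 0 \<Longrightarrow> card C = 2"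
  using class_ge2[of C] class_even[of C] by (auto elim!: evenE)

lemma excess_pos: "C \<in> CL \<Longrightarrow> card C div 2 - 1 = Suc n \<Longrightarrow> card C = 2 * n + 4"
  using class_ge2[of C] class_even[of C] by (auto elim!: evenE)

lemma \<sigma>_class: assumes "C \<in> CL" "u \<in> C"
  shows "u \<in> gr" "\<sigma> u \<in> C" "\<sigma> u \<noteq> u" "\<sigma> (\<sigma> u) = u" "opp \<pi> u (\<sigma> u)"
proof -
  show u: "u \<in> gr" using classes_sub[OF assms(1)] assms(2) by blast
  show "\<sigma> u \<in> C" by (rule pairings_class_closed[OF \<sigma> assms])
  show "\<sigma> u \<noteq> u" "\<sigma> (\<sigma> u) = u" "opp \<pi> u (\<sigma> u)" using pairingsD(3-5)[OF \<sigma> u] by blast+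
qed

lemma class2: assumes "C \<in> CL" "card C = 2" shows "dbl \<pi> C"
proof -
  obtain u where u: "u \<in> C" using classes_ne[OF assms(1)] by blast
  obtain v where v: "v \<noteq> u" "C = {u, v}" using card_2_partner[OF assms(2) u] by blast
  have "\<sigma> u = v" using \<sigma>_class(2,3)[OF assms(1) u] v by blast
  then have "opp \<pi> u v" "opp \<pi> v u" using \<sigma>_class(5)[OF assms(1) u] opp_sym by blast+
  then show ?thesis using assms(2) unfolding dbl_def oppP_def v(2) by blast
qed

lemma even_unsplit: assumes "C \<in> CL" "card C = 2" "even (card (C \<inter> I))" shows "unsplit C I"
proof -
  have fin: "finite C" by (rule finite_class[OF assms(1)])
  have le: "card (C \<inter> I) \<le> 2" using card_mono[OF fin, of "C \<inter> I"] assms(2) by simp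
  then have "card (C \<inter> I) = 0 \<or> card (C \<inter> I) = 2" using assms(3) by (cases "card (C \<inter> I) = 1") auto
  then show ?thesis
  proof
    assume "card (C \<inter> I) = 0"
    then have "C \<inter> I = {}" using fin by simp
    then show ?thesis by (simp add: unsplit_def)
  next
    assume "card (C \<inter> I) = 2"
    then have "C \<inter> I = C" using fin assms(2) by (intro card_subset_eq) auto
    then show ?thesis unfolding unsplit_def by blast
  qed
qed

abbreviation "F l \<equiv> {C \<in> CL. odd (card (C \<inter> sg l))}"

lemma F_even: "l \<in> idx \<Longrightarrow> even_edges (W \<pi> gr) (F l)"
  by (rule W_parity[OF P gclosed_gr _ seg_gr])

lemma crossing_class:
  assumes "l \<in> idx" "\<And>C. C \<in> CL \<Longrightarrow> C \<notin> \<D> \<Longrightarrow> unsplit C (sg l)"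
  shows "\<exists>D\<in>\<D>. \<exists>u\<in>D. u \<in> sg l \<and> \<sigma> u \<notin> sg l"
  using pairing_not_closed[OF \<sigma> assms] by blast

text \<open>If no cycle meets a class oddly, the classes of two arcs split no cycle. So every cycle
  is linked inside one of the large classes, where evenness gives it at least two arcs.\<close>

lemma no_odd_two_classes:
  assumes "\<And>l C. l \<in> idx \<Longrightarrow> C \<in> CL \<Longrightarrow> even (card (C \<inter> sg l))"
    and "\<And>C. C \<in> CL \<Longrightarrow> C \<notin> \<D> \<Longrightarrow> card C = 2" and "l \<in> idx" and "\<D> \<subseteq> CL"
  shows "\<exists>D\<in>\<D>. 2 \<le> card (D \<inter> sg l) \<and> \<not> D \<subseteq> sg l"
proof -
  obtain D u where D: "D \<in> \<D>" "u \<in> D" "u \<in> sg l" "\<sigma> u \<notin> sg l"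
    using crossing_class[OF assms(3), of \<D>] even_unsplit assms(1)[OF assms(3)] assms(2) by blast
  have DC: "D \<in> CL" using D(1) assms(4) by blast
  have "card (D \<inter> sg l) \<noteq> 0" using D(2,3) finite_class[OF DC] by auto
  moreover have "even (card (D \<inter> sg l))" by (rule assms(1)[OF assms(3) DC])
  ultimately have "2 \<le> card (D \<inter> sg l)" by (cases "card (D \<inter> sg l) = 1") auto
  moreover have "\<not> D \<subseteq> sg l" using \<sigma>_class(2)[OF DC D(2)] D(4) by blast
  ultimately show ?thesis using D(1) by blast
qed

text \<open>Pairs within one piece are covered by the relation of that piece; what has to be
  supplied is an arc to which both pieces of a crossing pair are attached.\<close>

lemma glue:
  assumes I: "\<And>I. I \<in> \<I> \<Longrightarrow> gclosed I" "\<Union>\<I> = gr"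
    and R: "\<And>a b. (a, b) \<in> R \<Longrightarrow> a \<in> gr \<and> b \<in> gr \<and> block \<pi> a = block \<pi> b"
    and cross: "\<And>u I J. u \<in> I \<Longrightarrow> I \<in> \<I> \<Longrightarrow> J \<in> \<I> \<Longrightarrow> I \<noteq> J \<Longrightarrow> u \<notin> J \<Longrightarrow> \<sigma> u \<in> J \<Longrightarrow>
      \<exists>a. attached \<pi> \<I> R a I \<and> attached \<pi> \<I> R a J \<and> ends \<pi> a = ends \<pi> u"
  shows "glued_from m1 m2 m3 \<pi> \<I> R"
proof (rule glued_intro[OF P \<sigma> _ _ R])
  show "mm \<le> 2 * card \<pi> + 2" using mm_card by simp
  show "I \<subseteq> gr" if "I \<in> \<I>" for I using I(1)[OF that] by (rule gclosed_gr_sub)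
  fix u assume u: "u \<in> gr"
  have su: "\<sigma> u \<in> gr" by (rule pairingsD(2)[OF \<sigma> u])
  obtain I' where I': "I' \<in> \<I>" "u \<in> I'" using u I(2) by blast
  obtain J' where J': "J' \<in> \<I>" "\<sigma> u \<in> J'" using su I(2) by blast
  have b: "block \<pi> u = block \<pi> (\<gamma> (\<sigma> u))" using pairingsD(5)[OF \<sigma> u] by (simp add: opp_def)
  show "(u, \<gamma> (\<sigma> u)) \<in> X1 \<pi> \<I> R"
  proof (cases "u \<in> J'")
    case True
    show ?thesis by (rule X1_piece[OF P J'(1) I(1)[OF J'(1)] True gclosed_gam[OF I(1)[OF J'(1)] J'(2)] b])
  next
    case False
    then have "I' \<noteq> J'" using I'(2) by blast
    then obtain a where a: "attached \<pi> \<I> R a I'" "attached \<pi> \<I> R a J'" "ends \<pi> a = ends \<pi> u"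
      using cross[OF I'(2,1) J'(1) _ False J'(2)] by blast
    show ?thesis by (rule attached_cross[OF a(1,2) I'(2) gclosed_gam[OF I(1)[OF J'(1)] J'(2)] b a(3)])
  qed
qed

text \<open>A tree has no nonempty even edge set, so no cycle uses a class oddly and there are no
  loops. Each class is alone in some cut, so a cycle that traverses it twice does so in both
  directions.\<close>

lemma tree_case_facts:
  assumes tree: "card CL < card \<pi>"
  shows "l \<in> idx \<Longrightarrow> C \<in> CL \<Longrightarrow> even (card (C \<inter> sg l))"
    and "C \<in> CL \<Longrightarrow> u \<in> C \<Longrightarrow> block \<pi> (\<gamma> u) \<noteq> block \<pi> u"
    and "l \<in> idx \<Longrightarrow> C \<in> CL \<Longrightarrow> card (C \<inter> sg l) = 2 \<Longrightarrow> dbl \<pi> (C \<inter> sg l)"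
proof -
  have lt: "card (uedges (W \<pi> gr)) < card (uverts (W \<pi> gr))" using tree card_graph by simp
  show "even (card (C \<inter> sg l))" if "l \<in> idx" "C \<in> CL"
    using tree_no_even_edges[OF wf conn lt F_even[OF that(1)]] that(2) by blast
  show "block \<pi> (\<gamma> u) \<noteq> block \<pi> u" if C: "C \<in> CL" "u \<in> C" for C u
  proof
    assume l: "block \<pi> (\<gamma> u) = block \<pi> u"
    have u: "u \<in> gr" using classes_sub[OF C(1)] C(2) by blast
    have "uends (W \<pi> gr) C = {rb \<pi> gr u}"
      using W_ends[OF P gclosed_gr C] rb_eq_iff[OF P gclosed_gr gclosed_gam[OF gclosed_gr u] u] l by simp
    then have "even_edges (W \<pi> gr) {C}" using C(1) by (intro even_edges_loop) auto
    then show False using tree_no_even_edges[OF wf conn lt] by blast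
  qed
  show "dbl \<pi> (C \<inter> sg l)" if "l \<in> idx" and C: "C \<in> CL" and "card (C \<inter> sg l) = 2"
  proof -
    have "C \<in> uedges (W \<pi> gr)" using C by simp
    from tree_edge_cut[OF wf conn lt this] obtain S
      where S: "{f \<in> CL. crosses (uends (W \<pi> gr) f) S} = {C}" by auto
    have crs: "crosses (uends (W \<pi> gr) E) S \<longleftrightarrow> (rb \<pi> gr (\<gamma> u) \<in> S) \<noteq> (rb \<pi> gr u \<in> S)"
      if "E \<in> CL" "u \<in> E" for E u unfolding W_ends[OF P gclosed_gr that] crosses_doubleton ..
    show ?thesis
    proof (rule balanced_dbl[OF P C \<open>l \<in> idx\<close> \<open>card (C \<inter> sg l) = 2\<close>, where S = S])
      fix u assume "u \<in> sg l" and d: "(rb \<pi> gr (\<gamma> u) \<in> S) \<noteq> (rb \<pi> gr u \<in> S)"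
      then have "u \<in> gr" using seg_gr[OF \<open>l \<in> idx\<close>] by blast
      then obtain E where E: "E \<in> CL" "u \<in> E" using class_ex by blast
      then have "E \<in> {f \<in> CL. crosses (uends (W \<pi> gr) f) S}" using crs d by blast
      then have "E = C" unfolding S by simp
      then show "u \<in> C" using E(2) by simp
    next
      fix u assume "u \<in> C"
      moreover have "crosses (uends (W \<pi> gr) C) S" using S by blast
      ultimately show "(rb \<pi> gr (\<gamma> u) \<in> S) \<noteq> (rb \<pi> gr u \<in> S)" using crs[OF C] by blast
    qed
  qed
qed

lemma seg_classes_dbl:
  assumes "\<And>C. C \<in> CL \<Longrightarrow> C \<inter> I \<noteq> {} \<Longrightarrow> dbl \<pi> (C \<inter> I)" "I \<subseteq> gr" "C \<in> classes \<pi> I"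
  shows "dbl \<pi> C"
proof -
  obtain E where E: "E \<in> CL" "C = E \<inter> I" using classes_lift[OF assms(3,2)] by blast
  then show ?thesis using assms(1)[OF E(1)] classes_ne[OF assms(3)] by blast
qed

lemma unsplit_dbl: "C \<in> CL \<Longrightarrow> card C = 2 \<Longrightarrow> unsplit C I \<Longrightarrow> C \<inter> I \<noteq> {} \<Longrightarrow> dbl \<pi> (C \<inter> I)"
  using class2[of C] unfolding unsplit_def by (metis Int_absorb2)

lemma two_edge_types:
  assumes ijk: "{i, j, k} = idx" and a: "a \<in> sg j" "b \<in> sg i" "a' \<in> sg j" "c \<in> sg k"
    and e: "ends \<pi> a = ends \<pi> b" "ends \<pi> a' = ends \<pi> c"
    and tree: "card CL < card \<pi>"
    and dbl: "\<And>l C. l \<in> idx \<Longrightarrow> C \<in> CL \<Longrightarrow> C \<inter> sg l \<noteq> {} \<Longrightarrow> dbl \<pi> (C \<inter> sg l)"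
  shows "\<forall>l\<in>idx. double_tree (qg \<pi> (sg l))"
proof -
  note p = idx_perm[OF ijk]
  have gr: "a \<in> gr" "a' \<in> gr" using a seg_gr p by blast+
  show ?thesis
  proof (rule three_double_trees[OF P _ ijk _ a(1,2) e(1) _ a(3,4) e(2)])
    show "mm \<le> 2 * card \<pi> + 2" using mm_card by simp
    show "dbl \<pi> C" if "l \<in> idx" "C \<in> classes \<pi> (sg l)" for l C
      by (rule seg_classes_dbl[OF dbl[OF that(1)] seg_gr[OF that(1)] that(2)])
    show "block \<pi> (\<gamma> a) \<noteq> block \<pi> a" by (rule tree_case_facts(2)[OF tree cls_in[OF gr(1)]])
    show "block \<pi> (\<gamma> a') \<noteq> block \<pi> a'" by (rule tree_case_facts(2)[OF tree cls_in[OF gr(2)]])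
  qed
qed

lemma gluing_R:
  assumes "R \<in> arc_gluings \<gamma> a b" "\<forall>x y. (x, y) \<in> R \<longrightarrow> block \<pi> x = block \<pi> y" "a \<in> gr" "b \<in> gr" "(x, y) \<in> R"
  shows "x \<in> gr \<and> y \<in> gr \<and> block \<pi> x = block \<pi> y"
  using gluing_gr[OF assms(1,3,4,5)] assms(2,5) by blast

lemma case_2_6:
  assumes tree: "card CL < card \<pi>" and D: "D \<in> CL" "card D = 6"
    and rest: "\<And>C. C \<in> CL \<Longrightarrow> C \<noteq> D \<Longrightarrow> card C = 2"
  shows "tree_2_6_type m1 m2 m3 \<pi>"
proof -
  note t = tree_case_facts[OF tree]
  have ge: "2 \<le> card (D \<inter> sg l)" if "l \<in> idx" for l
    using no_odd_two_classes[OF t(1), of "{D}" l] rest D(1) that by blast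
  have "card (D \<inter> sg 1) + card (D \<inter> sg 2) + card (D \<inter> sg 3) = 6"
    using card_split[of 1 2 3, OF refl classes_sub[OF D(1)]] D(2) by simp
  \<comment> \<open>Every cycle is linked inside \<open>D\<close> and has at least two arcs there,
    so six arcs leave exactly two for each.\<close>
  then have two: "card (D \<inter> sg l) = 2" if "l \<in> idx" for l using ge[of 1] ge[of 2] ge[of 3] that by auto
  have dblD: "dbl \<pi> (C \<inter> sg l)" if "l \<in> idx" "C \<in> CL" "C \<inter> sg l \<noteq> {}" for l C
  proof (cases "C = D")
    case True
    then show ?thesis using t(3)[OF that(1) D(1) two[OF that(1)]] by simp
  next
    case False
    note c2 = rest[OF that(2) False]
    show ?thesis by (rule unsplit_dbl[OF that(2) c2 even_unsplit[OF that(2) c2 t(1)[OF that(1,2)]] that(3)])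
  qed
  have ne: "D \<inter> sg l \<noteq> {}" if "l \<in> idx" for l using two[OF that] by auto
  obtain a where a: "a \<in> D" "a \<in> sg 1" using ne[of 1] by blast
  obtain b where b: "b \<in> D" "b \<in> sg 2" using ne[of 2] by blast
  obtain c where c: "c \<in> D" "c \<in> sg 3" using ne[of 3] by blast
  have gr: "a \<in> gr" "b \<in> gr" "c \<in> gr" using a b c gr_segs by auto
  have eab: "ends \<pi> a = ends \<pi> b" and eac: "ends \<pi> a = ends \<pi> c" using classes_ends[OF D(1)] a b c by blast+
  obtain R where R: "R \<in> arc_gluings \<gamma> a b" "\<forall>x y. (x, y) \<in> R \<longrightarrow> block \<pi> x = block \<pi> y" using gluing_exists[OF eab] by blast
  obtain S where S: "S \<in> arc_gluings \<gamma> a c" "\<forall>x y. (x, y) \<in> S \<longrightarrow> block \<pi> x = block \<pi> y" using gluing_exists[OF eac] by blast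
  have "{2, 1, 3} = idx" by blast
  then have dt: "\<forall>l\<in>idx. double_tree (qg \<pi> (sg l))"
    by (rule two_edge_types[OF _ a(2) b(2) a(2) c(2) eab eac tree dblD])
  let ?I = "{sg 1, sg 2, sg 3}"
  have gc: "gclosed I" if "I \<in> ?I" for I using that gclosed_seg by auto
  have att: "attached \<pi> ?I (R \<union> S) a I" if "I \<in> ?I" for I
  proof -
    have "attached \<pi> ?I (R \<union> S) a (sg 1)" by (rule attached_self[OF P _ gclosed_seg a(2)]) simp_all
    moreover have "attached \<pi> ?I (R \<union> S) a (sg 2)"
      by (rule attached_glued[OF P _ gclosed_seg b(2) R(1)]) (use R(2) in auto)
    moreover have "attached \<pi> ?I (R \<union> S) a (sg 3)"
      by (rule attached_glued[OF P _ gclosed_seg c(2) S(1)]) (use S(2) in auto)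
    ultimately show ?thesis using that by blast
  qed
  have glued: "glued_from m1 m2 m3 \<pi> ?I (R \<union> S)"
  proof (rule glue[OF gc seg_family3(2)])
    show "x \<in> gr \<and> y \<in> gr \<and> block \<pi> x = block \<pi> y" if "(x, y) \<in> R \<union> S" for x y
      using gluing_R[OF R gr(1,2)] gluing_R[OF S gr(1,3)] that by blast
    fix u I J assume u: "u \<in> I" "I \<in> ?I" "J \<in> ?I" "I \<noteq> J" "u \<notin> J" "\<sigma> u \<in> J"
    obtain l where l: "l \<in> idx" "I = sg l" using u(2) by blast
    have "u \<in> gr" using u(1) l seg_gr by blast
    then obtain C where C: "C \<in> CL" "u \<in> C" using class_ex by blast
    have "C = D"
    proof (rule ccontr)
      assume "C \<noteq> D"
      then have "unsplit C I" using even_unsplit[OF C(1) rest[OF C(1)] t(1)[OF l(1) C(1)]] l(2) by simp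
      then have "\<sigma> u \<in> I" using u(1) C \<sigma>_class(2)[OF C] unfolding unsplit_def by blast
      moreover have "I \<inter> J = {}" using seg_family3(1) u(2-4) unfolding disjoint_def by blast
      ultimately show False using u(6) by blast
    qed
    then have "ends \<pi> a = ends \<pi> u" using classes_ends[OF D(1) a(1)] C(2) by blast
    then show "\<exists>a. attached \<pi> ?I (R \<union> S) a I \<and> attached \<pi> ?I (R \<union> S) a J \<and> ends \<pi> a = ends \<pi> u"
      using att[OF u(2)] att[OF u(3)] by blast
  qed
  have "arc_multiplicity (qg \<pi> gr) a = 6"
    using arc_multiplicity_qg[OF P gclosed_gr gr(1)] classes_eq[OF D(1) a(1)] D(2) by simp
  then show ?thesis unfolding tree_2_6_type_def using dt a(2) b(2) c(2) R(1) S(1) glued by blast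
qed

text \<open>Three even numbers with sum 4 are 2, 2, 0 or 4, 0, 0 in some order.\<close>

lemma class_4_split:
  assumes ev: "\<And>l. l \<in> idx \<Longrightarrow> even (card (D \<inter> sg l))" and D: "D \<in> CL" "card D = 4"
  shows "(\<exists>z\<in>idx. D \<inter> sg z = {} \<and> (\<forall>l\<in>idx. l \<noteq> z \<longrightarrow> card (D \<inter> sg l) = 2)) \<or> (\<exists>z\<in>idx. D \<subseteq> sg z)"
proof -
  have fin: "finite D" by (rule finite_class[OF D(1)])
  have sum: "card (D \<inter> sg 1) + card (D \<inter> sg 2) + card (D \<inter> sg 3) = 4"
    using card_split[of 1 2 3, OF refl classes_sub[OF D(1)]] D(2) by simp
  have full: "D \<subseteq> sg z" if "card (D \<inter> sg z) = 4" for z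
  proof -
    have "D \<inter> sg z = D" using that D(2) fin by (intro card_subset_eq) auto
    then show ?thesis by blast
  qed
  from class_size_cases[OF ev[of 1] ev[of 2] ev[of 3] sum] show ?thesis
  proof (simp, elim disjE conjE)
  qed (use fin full[of 1] full[of 2] full[of 3] in auto)
qed

lemma case_2_4_4:
  assumes tree: "card CL < card \<pi>" and D: "D1 \<in> CL" "D2 \<in> CL" "D1 \<noteq> D2" "card D1 = 4" "card D2 = 4"
    and rest: "\<And>C. C \<in> CL \<Longrightarrow> C \<noteq> D1 \<Longrightarrow> C \<noteq> D2 \<Longrightarrow> card C = 2"
  shows "tree_2_4_4_type m1 m2 m3 \<pi>"
proof -
  note t = tree_case_facts[OF tree]
  have link: "\<exists>D\<in>{D1, D2}. 2 \<le> card (D \<inter> sg l) \<and> \<not> D \<subseteq> sg l" if "l \<in> idx" for l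
    by (rule no_odd_two_classes[OF t(1) _ that]) (use rest D in auto)
  \<comment> \<open>A class inside a single cycle links nothing. The other class, with four arcs,
    would then have to give two arcs to each of the three cycles.\<close>
  have not_contained: False
    if E: "E \<in> CL" "E' \<in> CL" "card E' = 4" "\<And>l. l \<in> idx \<Longrightarrow> \<exists>D\<in>{E, E'}. 2 \<le> card (D \<inter> sg l) \<and> \<not> D \<subseteq> sg l"
      and z: "z \<in> idx" "E \<subseteq> sg z" for E E' z
  proof -
    have "2 \<le> card (E' \<inter> sg l)" if l: "l \<in> idx" for l
    proof (rule ccontr)
      assume "\<not> ?thesis"
      then have e: "2 \<le> card (E \<inter> sg l)" "\<not> E \<subseteq> sg l" using E(4)[OF l] by auto
      then have "E \<inter> sg l \<noteq> {}" by auto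
      then have "l = z" using seg_unique[OF l z(1)] z(2) by blast
      then show False using e z by blast
    qed
    from this[of 1] this[of 2] this[of 3] show False
      using card_split[of 1 2 3, OF refl classes_sub[OF E(2)]] E(3) by simp
  qed
  obtain z1 where z1: "z1 \<in> idx" "D1 \<inter> sg z1 = {}" "\<And>l. l \<in> idx \<Longrightarrow> l \<noteq> z1 \<Longrightarrow> card (D1 \<inter> sg l) = 2"
  proof -
    from class_4_split[OF t(1)[OF _ D(1)] D(1,4)] have "\<exists>z\<in>idx. D1 \<inter> sg z = {} \<and> (\<forall>l\<in>idx. l \<noteq> z \<longrightarrow> card (D1 \<inter> sg l) = 2)"
    proof
      assume "\<exists>z\<in>idx. D1 \<subseteq> sg z"
      then obtain z where z: "z \<in> idx" "D1 \<subseteq> sg z" by (elim bexE)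
      have False by (rule not_contained[OF D(1,2,5) _ z]) (rule link)
      then show ?thesis ..
    qed
    then obtain z where z: "z \<in> idx"
      "D1 \<inter> sg z = {} \<and> (\<forall>l\<in>idx. l \<noteq> z \<longrightarrow> card (D1 \<inter> sg l) = 2)" by (elim bexE)
    show ?thesis by (rule that[OF z(1) conjunct1[OF z(2)] mp[OF bspec[OF conjunct2[OF z(2)]]]])
  qed
  have link': "\<exists>D\<in>{D2, D1}. 2 \<le> card (D \<inter> sg l) \<and> \<not> D \<subseteq> sg l" if "l \<in> idx" for l using link[OF that] by blast
  obtain z2 where z2: "z2 \<in> idx" "D2 \<inter> sg z2 = {}" "\<And>l. l \<in> idx \<Longrightarrow> l \<noteq> z2 \<Longrightarrow> card (D2 \<inter> sg l) = 2"
  proof -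
    from class_4_split[OF t(1)[OF _ D(2)] D(2,5)] have "\<exists>z\<in>idx. D2 \<inter> sg z = {} \<and> (\<forall>l\<in>idx. l \<noteq> z \<longrightarrow> card (D2 \<inter> sg l) = 2)"
    proof
      assume "\<exists>z\<in>idx. D2 \<subseteq> sg z"
      then obtain z where z: "z \<in> idx" "D2 \<subseteq> sg z" by (elim bexE)
      have False by (rule not_contained[OF D(2,1,4) _ z]) (rule link')
      then show ?thesis ..
    qed
    then obtain z where z: "z \<in> idx"
      "D2 \<inter> sg z = {} \<and> (\<forall>l\<in>idx. l \<noteq> z \<longrightarrow> card (D2 \<inter> sg l) = 2)" by (elim bexE)
    show ?thesis by (rule that[OF z(1) conjunct1[OF z(2)] mp[OF bspec[OF conjunct2[OF z(2)]]]])
  qed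
  \<comment> \<open>A cycle missed by both large classes would not be linked.\<close>
  have z12: "z1 \<noteq> z2"
  proof
    assume "z1 = z2"
    then have "\<exists>D\<in>{D1, D2}. 2 \<le> card (D \<inter> sg z1) \<and> D \<inter> sg z1 = {}" using link[OF z1(1)] z1(2) z2(2) by blast
    then show False by auto
  qed
  \<comment> \<open>The third index, because 1 + 2 + 3 = 6. It belongs to the middle cycle:
    \<open>D1\<close> joins it to cycle \<open>z2\<close>, and \<open>D2\<close> joins it to cycle
    \<open>z1\<close>.\<close>
  define j where "j = 6 - z1 - z2"
  have ijk: "{z2, j, z1} = idx"
    using z1(1) z2(1) z12 unfolding j_def by (elim insertE emptyE) auto
  note p = idx_perm[OF ijk]
  have jz: "j \<noteq> z1" "j \<noteq> z2" using p(4,6) by auto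
  have ne: "D1 \<inter> sg j \<noteq> {}" "D1 \<inter> sg z2 \<noteq> {}" "D2 \<inter> sg j \<noteq> {}" "D2 \<inter> sg z1 \<noteq> {}"
    using z1(3)[OF p(2) jz(1)] z1(3)[OF p(1) p(5)] z2(3)[OF p(2) jz(2)] z2(3)[OF p(3) p(5)[symmetric]] by auto
  obtain a where a: "a \<in> D1" "a \<in> sg j" using ne(1) by blast
  obtain b where b: "b \<in> D1" "b \<in> sg z2" using ne(2) by blast
  obtain a' where a': "a' \<in> D2" "a' \<in> sg j" using ne(3) by blast
  obtain c where c: "c \<in> D2" "c \<in> sg z1" using ne(4) by blast
  have gr: "a \<in> gr" "b \<in> gr" "a' \<in> gr" "c \<in> gr" using a b a' c p(7) by blast+
  have eab: "ends \<pi> a = ends \<pi> b" using classes_ends[OF D(1) a(1) b(1)] .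
  have eac: "ends \<pi> a' = ends \<pi> c" using classes_ends[OF D(2) a'(1) c(1)] .
  have dblD: "dbl \<pi> (C \<inter> sg l)" if "l \<in> idx" "C \<in> CL" "C \<inter> sg l \<noteq> {}" for l C
  proof (cases "C = D1 \<or> C = D2")
    case True
    then have "card (C \<inter> sg l) = 2" using z1(2,3) z2(2,3) that(1,3) by metis
    then show ?thesis using t(3)[OF that(1,2)] by simp
  next
    case False
    then have c2: "card C = 2" using rest[OF that(2)] by blast
    show ?thesis by (rule unsplit_dbl[OF that(2) c2 even_unsplit[OF that(2) c2 t(1)[OF that(1,2)]] that(3)])
  qed
  obtain R where R: "R \<in> arc_gluings \<gamma> a b" "\<forall>x y. (x, y) \<in> R \<longrightarrow> block \<pi> x = block \<pi> y" using gluing_exists[OF eab] by blast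
  obtain S where S: "S \<in> arc_gluings \<gamma> a' c" "\<forall>x y. (x, y) \<in> S \<longrightarrow> block \<pi> x = block \<pi> y" using gluing_exists[OF eac] by blast
  have dt: "\<forall>l\<in>idx. double_tree (qg \<pi> (sg l))"
    by (rule two_edge_types[OF ijk a(2) b(2) a'(2) c(2) eab eac tree dblD])
  let ?I = "{sg 1, sg 2, sg 3}"
  have I_idx: "sg l \<in> ?I" if "l \<in> idx" for l using that by auto
  have gc: "gclosed I" if "I \<in> ?I" for I using that gclosed_seg by auto
  have att1: "attached \<pi> ?I (R \<union> S) a (sg j)" by (rule attached_self[OF P I_idx[OF p(2)] gclosed_seg[OF p(2)] a(2)])
  have att2: "attached \<pi> ?I (R \<union> S) a (sg z2)"
    by (rule attached_glued[OF P I_idx[OF p(1)] gclosed_seg[OF p(1)] b(2) R(1)]) (use R(2) in auto)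
  have att3: "attached \<pi> ?I (R \<union> S) a' (sg j)" by (rule attached_self[OF P I_idx[OF p(2)] gclosed_seg[OF p(2)] a'(2)])
  have att4: "attached \<pi> ?I (R \<union> S) a' (sg z1)"
    by (rule attached_glued[OF P I_idx[OF p(3)] gclosed_seg[OF p(3)] c(2) S(1)]) (use S(2) in auto)
  have glued: "glued_from m1 m2 m3 \<pi> ?I (R \<union> S)"
  proof (rule glue[OF gc seg_family3(2)])
    show "x \<in> gr \<and> y \<in> gr \<and> block \<pi> x = block \<pi> y" if "(x, y) \<in> R \<union> S" for x y
      using gluing_R[OF R gr(1,2)] gluing_R[OF S gr(3,4)] that by blast
    fix u I J assume u: "u \<in> I" "I \<in> ?I" "J \<in> ?I" "I \<noteq> J" "u \<notin> J" "\<sigma> u \<in> J"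
    obtain l where l: "l \<in> idx" "I = sg l" using u(2) by blast
    obtain l' where l': "l' \<in> idx" "J = sg l'" using u(3) by blast
    have lj: "l = z2 \<or> l = j \<or> l = z1" "l' = z2 \<or> l' = j \<or> l' = z1" using l(1) l'(1) ijk by blast+
    have "u \<in> gr" using u(1) l seg_gr by blast
    then obtain C where C: "C \<in> CL" "u \<in> C" using class_ex by blast
    note sC = \<sigma>_class(2)[OF C]
    have "C = D1 \<or> C = D2"
    proof (rule ccontr)
      assume "\<not> ?thesis"
      then have "card C = 2" using rest[OF C(1)] by blast
      then have "unsplit C I" using even_unsplit[OF C(1) _ t(1)[OF l(1) C(1)]] l(2) by simp
      then have "\<sigma> u \<in> I" using u(1) C(2) sC unfolding unsplit_def by blast
      moreover have "I \<inter> J = {}" using pairwiseD[OF seg_family3(1) u(2,3,4)] by (simp add: disjnt_def)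
      ultimately show False using u(6) by blast
    qed
    then show "\<exists>a. attached \<pi> ?I (R \<union> S) a I \<and> attached \<pi> ?I (R \<union> S) a J \<and> ends \<pi> a = ends \<pi> u"
    proof
      assume CD: "C = D1"
      have "l \<noteq> z1" "l' \<noteq> z1" using z1(2) u(1,6) C(2) sC l(2) l'(2) CD by blast+
      then have "attached \<pi> ?I (R \<union> S) a I" "attached \<pi> ?I (R \<union> S) a J" using lj l(2) l'(2) att1 att2 by blast+
      moreover have "ends \<pi> a = ends \<pi> u" using classes_ends[OF D(1) a(1)] C(2) CD by blast
      ultimately show ?thesis by blast
    next
      assume CD: "C = D2"
      have "l \<noteq> z2" "l' \<noteq> z2" using z2(2) u(1,6) C(2) sC l(2) l'(2) CD by blast+
      then have "attached \<pi> ?I (R \<union> S) a' I" "attached \<pi> ?I (R \<union> S) a' J" using lj l(2) l'(2) att3 att4 by blast+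
      moreover have "ends \<pi> a' = ends \<pi> u" using classes_ends[OF D(2) a'(1)] C(2) CD by blast
      ultimately show ?thesis by blast
    qed
  qed
  have mult: "arc_multiplicity (qg \<pi> gr) a = 4" "arc_multiplicity (qg \<pi> gr) a' = 4"
    using arc_multiplicity_qg[OF P gclosed_gr gr(1)] classes_eq[OF D(1) a(1)] D(4)
      arc_multiplicity_qg[OF P gclosed_gr gr(3)] classes_eq[OF D(2) a'(1)] D(5) by simp_all
  have "(a, a') \<notin> equivalent_arcs (qg \<pi> (sg j))"
  proof
    assume "(a, a') \<in> equivalent_arcs (qg \<pi> (sg j))"
    then have "ends \<pi> a = ends \<pi> a'" unfolding equivalent_arcs_qg[OF P gclosed_seg[OF p(2)]] by blast
    then have "a' \<in> D1" using classes_memI[OF D(1) a(1) gr(3)] by simp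
    then show False using classes_eqI[OF D(1,2) _ a'(1)] D(3) by blast
  qed
  then have "\<exists>a\<in>sg j. \<exists>b\<in>sg z2. \<exists>a'\<in>sg j. \<exists>c\<in>sg z1. \<exists>R\<in>arc_gluings \<gamma> a b. \<exists>S\<in>arc_gluings \<gamma> a' c.
      (a, a') \<notin> equivalent_arcs (qg \<pi> (sg j)) \<and> glued_from m1 m2 m3 \<pi> ?I (R \<union> S) \<and>
      arc_multiplicity (qg \<pi> gr) a = 4 \<and> arc_multiplicity (qg \<pi> gr) a' = 4"
    by (intro bexI[OF _ a(2)] bexI[OF _ b(2)] bexI[OF _ a'(2)] bexI[OF _ c(2)] bexI[OF _ R(1)] bexI[OF _ S(1)]
      conjI glued mult)
  then show ?thesis unfolding tree_2_4_4_type_def using dt ijk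
    by (intro conjI exI[of _ z2] exI[of _ j] exI[of _ z1])
qed

text \<open>A class of two arcs that a cycle meets evenly lies inside or outside this cycle, so a
  linked cycle meets some class oddly.\<close>

lemma case_all_2:
  assumes "\<And>C. C \<in> CL \<Longrightarrow> card C = 2"
  shows "prof2 \<pi>"
  unfolding prof2_def
proof (intro conjI ballI)
  show "card C = 2" "oppP \<pi> C" if "C \<in> CL" for C
    using assms[OF that] class2[OF that] by (simp_all add: dbl_def)
  fix l assume l: "l \<in> idx"
  show "\<exists>C\<in>CL. odd (card (C \<inter> sg l))"
  proof (rule ccontr)
    assume "\<not> ?thesis"
    then have "unsplit C (sg l)" if "C \<in> CL" for C using even_unsplit[OF that assms[OF that]] that by blast
    then show False using crossing_class[OF l, of "{}"] by blast
  qed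
qed

lemma odd_class_pattern:
  assumes C: "C \<in> CL" and l: "l \<in> idx" "odd (card (C \<inter> sg l))"
  shows "\<exists>i j k. {i, j, k} = idx \<and> even (card (C \<inter> sg i)) \<and> odd (card (C \<inter> sg j)) \<and> odd (card (C \<inter> sg k))"
proof -
  have "even (card (C \<inter> sg 1) + card (C \<inter> sg 2) + card (C \<inter> sg 3))"
    using card_split[of 1 2 3, OF refl classes_sub[OF C]] class_even[OF C] by simp
  moreover have "odd (card (C \<inter> sg 1)) \<or> odd (card (C \<inter> sg 2)) \<or> odd (card (C \<inter> sg 3))" using l by auto
  ultimately consider "even (card (C \<inter> sg 1)) \<and> odd (card (C \<inter> sg 2)) \<and> odd (card (C \<inter> sg 3))" |
    "even (card (C \<inter> sg 2)) \<and> odd (card (C \<inter> sg 1)) \<and> odd (card (C \<inter> sg 3))" |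
    "even (card (C \<inter> sg 3)) \<and> odd (card (C \<inter> sg 1)) \<and> odd (card (C \<inter> sg 2))"
    unfolding even_add by blast
  then show ?thesis
  proof cases
    case 1
    then show ?thesis by (intro exI[of _ 1] exI[of _ 2] exI[of _ 3] conjI) simp_all
  next
    case 2
    have "{2, 1, 3} = idx" by blast
    then show ?thesis using 2 by blast
  next
    case 3
    have "{3, 1, 2} = idx" by blast
    then show ?thesis using 3 by blast
  qed
qed

text \<open>The nonempty even edge set is unique here. Two cycles \<open>j\<close> and
  \<open>k\<close> traverse its classes oddly, while the third cycle \<open>i\<close> hangs on
  \<open>D\<close>. The two types differ in whether this edge set is \<open>{D}\<close>, which
  happens exactly if \<open>D\<close> consists of loops.\<close>

lemma unicyclic_case:
  assumes uni: "card CL = card \<pi>" and D: "D \<in> CL" "card D = 4"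
    and rest: "\<And>C. C \<in> CL \<Longrightarrow> C \<noteq> D \<Longrightarrow> card C = 2"
  shows "unicircuit_2_4_type m1 m2 m3 \<pi> \<or> uniloop_2_4_type m1 m2 m3 \<pi>"
proof -
  have finD: "finite D" by (rule finite_class[OF D(1)])
  have le: "card (uedges (W \<pi> gr)) \<le> card (uverts (W \<pi> gr))" using uni card_graph by simp
  \<comment> \<open>Without an odd class all three cycles would be linked inside \<open>D\<close>,
    which takes six arcs.\<close>
  have "\<exists>l\<in>idx. \<exists>C\<in>CL. odd (card (C \<inter> sg l))"
  proof (rule ccontr)
    assume no: "\<not> ?thesis"
    have "2 \<le> card (D \<inter> sg l)" if "l \<in> idx" for l
      using no_odd_two_classes[of "{D}" l] no rest D(1) that by blast
    from this[of 1] this[of 2] this[of 3] show False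
      using card_split[of 1 2 3, OF refl classes_sub[OF D(1)]] D(2) by simp
  qed
  then obtain l0 C0 where C0: "l0 \<in> idx" "C0 \<in> CL" "odd (card (C0 \<inter> sg l0))" by blast
  obtain i j k where ijk: "{i, j, k} = idx" and par: "even (card (C0 \<inter> sg i))" "odd (card (C0 \<inter> sg j))" "odd (card (C0 \<inter> sg k))"
    using odd_class_pattern[OF C0(2,1,3)] by blast
  note p = idx_perm[OF ijk]
  let ?H = "sg j \<union> sg k"
  note IH = gclosed_2[OF p(2,3)] and Ii = gclosed_seg[OF p(1)]
  have uniq: "A = B" if "even_edges (W \<pi> gr) A" "even_edges (W \<pi> gr) B" "A \<noteq> {}" "B \<noteq> {}" for A B
    by (rule unicyclic_even_edges_unique[OF wf conn le that])
  have Fjk: "F j \<noteq> {}" "F k \<noteq> {}" using C0(2) par by blast+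
  \<comment> \<open>The nonempty ones among the sets \<open>F l\<close> coincide, but
    \<open>C0\<close> belongs to \<open>F j\<close> and not to \<open>F i\<close>.\<close>
  have Fi: "F i = {}"
  proof (rule ccontr)
    assume "F i \<noteq> {}"
    then have "F i = F j" using uniq[OF F_even[OF p(1)] F_even[OF p(2)] _ Fjk(1)] by blast
    then have "C0 \<in> F i" using C0(2) par(2) by blast
    then show False using par(1) by blast
  qed
  have evi: "even (card (C \<inter> sg i))" if "C \<in> CL" for C using Fi that by blast
  have uns: "unsplit C (sg i)" if "C \<in> CL" "C \<noteq> D" for C
    by (rule even_unsplit[OF that(1) rest[OF that] evi[OF that(1)]])
  have compl: "C - sg i = C \<inter> ?H" if "C \<in> CL" for C using classes_sub[OF that] p(7-9) by blast
  have unsH: "unsplit C ?H" if "C \<in> CL" "C \<noteq> D" for C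
    using uns[OF that] compl[OF that(1)] p(8,9) unfolding unsplit_def by blast
  obtain a where a: "a \<in> D" "a \<in> sg i" "\<sigma> a \<notin> sg i" using crossing_class[OF p(1), of "{D}"] uns by blast
  define b where "b = \<sigma> a"
  note sa = \<sigma>_class[OF D(1) a(1), folded b_def]
  \<comment> \<open>The part of \<open>D\<close> in cycle \<open>i\<close> is even in number,
    nonempty and not all of \<open>D\<close>.\<close>
  have Di2: "card (D \<inter> sg i) = 2"
  proof -
    have "D \<inter> sg i \<subset> D" using sa(2) a(3) b_def by blast
    then have "card (D \<inter> sg i) < 4" using psubset_card_mono[OF finD] D(2) by metis
    moreover have "card (D \<inter> sg i) \<noteq> 0" using a finD by auto
    moreover have "x = 2" if "x < 4" "x \<noteq> 0" "even x" for x :: nat using that by presburger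
    ultimately show ?thesis using evi[OF D(1)] by blast
  qed
  have DH2: "card (D - sg i) = 2" using card_Diff_subset_Int[of D "sg i"] finD Di2 D(2) by simp
  have aDi: "a \<in> D \<inter> sg i" using a by blast
  obtain a' where a': "a' \<noteq> a" "D \<inter> sg i = {a, a'}" using card_2_partner[OF Di2 aDi] by blast
  have a'D: "a' \<in> D" "a' \<in> sg i" using a' by blast+
  define b' where "b' = \<sigma> a'"
  note sa' = \<sigma>_class[OF D(1) a'D(1), folded b'_def]
  have "b' \<noteq> a" using sa'(4) a(3) a'D(2) by blast
  then have b'i: "b' \<notin> sg i" using sa'(2,3) a'(2) by blast
  have bi: "b \<notin> sg i" using a(3) by (simp add: b_def)
  have "b \<noteq> b'" using sa(4) sa'(4) a'(1) by metis
  moreover have "{b, b'} \<subseteq> D - sg i" using sa(2) sa'(2) bi b'i by blast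
  ultimately have DH: "D - sg i = {b, b'}" using DH2 finD by (intro card_subset_eq[symmetric]) auto
  have bH: "b \<in> ?H" using sa(2) bi compl[OF D(1)] by blast
  have gr: "a \<in> gr" "a' \<in> gr" "b \<in> gr" "b' \<in> gr" using classes_sub[OF D(1)] a(1) a'D(1) sa(2) sa'(2) by blast+
  have eab: "ends \<pi> a = ends \<pi> b" by (rule classes_ends[OF D(1) a(1) sa(2)])
  have parts_intro: "dbl \<pi> (D \<inter> sg i) \<and> dbl \<pi> (D \<inter> ?H)" if o: "opp \<pi> a a'"
  proof -
    have "opp \<pi> b b'" using o sa(5) sa'(5) by (simp add: opp_def)
    then have "oppP \<pi> {a, a'}" "oppP \<pi> {b, b'}" using o opp_sym unfolding oppP_def by blast+
    then show ?thesis using Di2 DH2 a'(2) DH compl[OF D(1)] unfolding dbl_def by simp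
  qed
  have C0H: "C0 \<inter> ?H \<inter> sg j = C0 \<inter> sg j" "C0 \<inter> ?H \<inter> sg k = C0 \<inter> sg k" by blast+
  have ne0: "C0 \<inter> sg j \<noteq> {}" "C0 \<inter> sg k \<noteq> {}" using par by auto
  then have C0cl: "C0 \<inter> ?H \<in> classes \<pi> ?H" by (intro classes_Int[OF C0(2) gclosed_gr_sub[OF IH]]) blast
  have odd0: "odd (card (C0 \<inter> ?H \<inter> sg j))" using par(2) by (simp add: C0H)
  have share: "share \<pi> j k"
  proof -
    obtain x y where "x \<in> C0" "x \<in> sg j" "y \<in> C0" "y \<in> sg k" using ne0 by blast
    then show ?thesis using ends_share[OF classes_ends[OF C0(2)] _ _ p(2,3)] by blast
  qed
  have tot: "block \<pi> ` (sg i \<union> ?H) = \<pi>" using block_image[OF P] p(7) by (simp add: Un_assoc)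
  have mm2: "card (sg i) + card ?H = 2 * card \<pi> + 2" using card_gr_segs2[OF ijk] mm_card by simp
  let ?I = "{sg i, ?H}"
  have gc: "gclosed I" if "I \<in> ?I" for I using that Ii IH by blast
  have cross: "\<exists>a. attached \<pi> ?I R a I \<and> attached \<pi> ?I R a J \<and> ends \<pi> a = ends \<pi> u"
    if att: "attached \<pi> ?I R a (sg i)" "attached \<pi> ?I R a ?H"
      and u: "u \<in> I" "I \<in> ?I" "J \<in> ?I" "I \<noteq> J" "u \<notin> J" "\<sigma> u \<in> J" for R u I J
  proof -
    have "u \<in> gr" using u(1,2) gclosed_gr_sub[OF gc] by blast
    then obtain C where C: "C \<in> CL" "u \<in> C" using class_ex by blast
    note sC = \<sigma>_class(2)[OF C]
    have "C = D"
    proof (rule ccontr)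
      assume "C \<noteq> D"
      then have "unsplit C I" using uns[OF C(1)] unsH[OF C(1)] u(2) by blast
      then have "\<sigma> u \<in> I" using u(1) C(2) sC unfolding unsplit_def by blast
      moreover have "I \<inter> J = {}" using pairwiseD[OF seg_family(1)[OF ijk] u(2,3,4)] by (simp add: disjnt_def)
      ultimately show False using u(6) by blast
    qed
    then have "ends \<pi> a = ends \<pi> u" using classes_ends[OF D(1) a(1)] C(2) by blast
    moreover have "attached \<pi> ?I R a I" "attached \<pi> ?I R a J" using att u(2,3) by blast+
    ultimately show ?thesis by blast
  qed
  have dblH: "dbl \<pi> C" if dd: "dbl \<pi> (D \<inter> ?H)" and C: "C \<in> classes \<pi> ?H" for C
  proof (rule seg_classes_dbl[OF _ gclosed_gr_sub[OF IH] C])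
    fix E assume E: "E \<in> CL" "E \<inter> ?H \<noteq> {}"
    show "dbl \<pi> (E \<inter> ?H)"
      using dd unsplit_dbl[OF E(1) rest[OF E(1)] unsH[OF E(1)] E(2)] by (cases "E = D") auto
  qed
  show ?thesis
  proof (cases "loopc \<pi> D")
    case False
    have nl: "block \<pi> (\<gamma> u) \<noteq> block \<pi> u" if "u \<in> D" for u using False that unfolding loopc_def by blast
    have rbnl: "rb \<pi> gr (\<gamma> a) \<noteq> rb \<pi> gr a"
      using rb_eq_iff[OF P gclosed_gr gclosed_gam[OF gclosed_gr gr(1)] gr(1)] nl[OF a(1)] by simp
    \<comment> \<open>A single class that is no loop is not an even edge set, so the circuit
      contains another class \<open>e\<close>. It misses cycle \<open>i\<close>, and deleting it
      leaves a tree in which \<open>D\<close> is alone in a cut. Cycle \<open>i\<close> crosses this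
      cut only in \<open>D\<close>, so its two arcs there are opposite.\<close>
    have "\<not> F j \<subseteq> {D}"
    proof
      assume "F j \<subseteq> {D}"
      then have "F j = {D}" using Fjk(1) by blast
      then have "even_edges (W \<pi> gr) {D}" using F_even[OF p(2)] by simp
      moreover have "rb \<pi> gr a \<in> uverts (W \<pi> gr)" using gr(1) by simp
      ultimately have "even (card {e \<in> {D}. crosses (uends (W \<pi> gr) e) {rb \<pi> gr a}})"
        unfolding even_edges_def by blast
      moreover have "{e \<in> {D}. crosses (uends (W \<pi> gr) e) {rb \<pi> gr a}} = {D}"
        using rbnl W_ends[OF P gclosed_gr D(1) a(1)] by (auto simp: crosses_doubleton)
      ultimately show False by simp
    qed
    then obtain e where e: "e \<in> F j" "e \<noteq> D" by blast
    have eCL: "e \<in> CL" using e(1) by blast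
    have "e \<inter> sg j \<noteq> {}" using e(1) by auto
    then have ei: "e \<inter> sg i = {}" using uns[OF eCL e(2)] p(8) unfolding unsplit_def by blast
    let ?T = "del_edge (W \<pi> gr) e"
    have connT: "uconnected ?T" by (rule uconnected_del_edge[OF wf conn F_even[OF p(2)] e(1)])
    have finCL: "finite CL" by (rule finite_classes[OF finite_gr])
    have "card (CL - {e}) < card CL" using finCL eCL by (intro card_Diff1_less)
    then have ltT: "card (uedges ?T) < card (uverts ?T)" using uni card_graph by simp
    have "D \<in> uedges ?T" using D(1) e(2) by simp
    from tree_edge_cut[OF wf_del_edge[OF wf] connT ltT this] obtain S
      where S: "{f \<in> CL - {e}. crosses (uends (W \<pi> gr) f) S} = {D}" by auto
    have crs: "crosses (uends (W \<pi> gr) E) S \<longleftrightarrow> (rb \<pi> gr (\<gamma> u) \<in> S) \<noteq> (rb \<pi> gr u \<in> S)"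
      if "E \<in> CL" "u \<in> E" for E u unfolding W_ends[OF P gclosed_gr that] crosses_doubleton ..
    have "dbl \<pi> (D \<inter> sg i)"
    proof (rule balanced_dbl[OF P D(1) p(1) Di2, where S = S])
      fix u assume ui: "u \<in> sg i" and d: "(rb \<pi> gr (\<gamma> u) \<in> S) \<noteq> (rb \<pi> gr u \<in> S)"
      then have "u \<in> gr" using seg_gr[OF p(1)] by blast
      then obtain E where E: "E \<in> CL" "u \<in> E" using class_ex by blast
      have "E \<noteq> e" using E(2) ui ei by blast
      then have "E \<in> {f \<in> CL - {e}. crosses (uends (W \<pi> gr) f) S}" using crs[OF E] d E(1) by blast
      then have "E = D" unfolding S by simp
      then show "u \<in> D" using E(2) by simp
    next
      fix u assume "u \<in> D"
      moreover have "crosses (uends (W \<pi> gr) D) S" using S by blast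
      ultimately show "(rb \<pi> gr (\<gamma> u) \<in> S) \<noteq> (rb \<pi> gr u \<in> S)" using crs[OF D(1)] by blast
    qed
    then have "oppP \<pi> {a, a'}" unfolding dbl_def a'(2) by (rule conjunct2)
    then have "opp \<pi> a a'" unfolding oppP_def using a'(1) by simp
    then have dd: "dbl \<pi> (D \<inter> sg i)" "dbl \<pi> (D \<inter> ?H)" using parts_intro by blast+
    have dbli: "dbl \<pi> C" if C: "C \<in> classes \<pi> (sg i)" for C
    proof (rule seg_classes_dbl[OF _ seg_gr[OF p(1)] C])
      fix E assume E: "E \<in> CL" "E \<inter> sg i \<noteq> {}"
      show "dbl \<pi> (E \<inter> sg i)"
        using dd unsplit_dbl[OF E(1) rest[OF E(1)] uns[OF E(1)] E(2)] by (cases "E = D") auto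
    qed
    have "ends \<pi> a \<subseteq> block \<pi> ` ?H" using ends_sub[OF IH bH] eab by simp
    \<comment> \<open>The pieces share both ends of \<open>a\<close>. Together with the bounds
      \<open>ui\<close> and \<open>uH\<close> this turns all the inequalities into
      equalities.\<close>
    then have ov: "card \<pi> + 2 \<le> card (block \<pi> ` sg i) + card (block \<pi> ` ?H)"
      using overlap[OF P Ii IH ends_sub[OF Ii a(2)]] card_ends[OF nl[OF a(1)]] tot by simp
    have ui: "2 * card (block \<pi> ` sg i) \<le> card (sg i) + 2" by (rule card_block_seg_le[OF P p(1) dbli])
    have uH: "2 * card (block \<pi> ` ?H) \<le> card ?H"
      by (rule card_block_pair_le[OF P p(2,3,6) share dblH[OF dd(2)] C0cl odd0])
    have gei: "card (sg i) + 2 \<le> 2 * card (block \<pi> ` sg i)" using ov ui uH mm2 by linarith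
    have dt: "double_tree (qg \<pi> (sg i))" by (rule double_tree_intro[OF P p(1) dbli gei])
    have geH: "card ?H \<le> 2 * card (block \<pi> ` ?H)" using ov ui uH mm2 by linarith
    have du: "double_unicircuit (qg \<pi> ?H) (sg j) (sg k)"
      by (rule double_unicircuit_intro(1)[OF P p(2,3,6) share dblH[OF dd(2)] C0cl odd0 geH])
    obtain R where R: "R \<in> arc_gluings \<gamma> a b" "\<forall>x y. (x, y) \<in> R \<longrightarrow> block \<pi> x = block \<pi> y" using gluing_exists[OF eab] by blast
    have att: "attached \<pi> ?I R a (sg i)" "attached \<pi> ?I R a ?H"
    proof -
      show "attached \<pi> ?I R a (sg i)" by (rule attached_self[OF P _ Ii a(2)]) simp
      show "attached \<pi> ?I R a ?H" by (rule attached_glued[OF P _ IH bH R(1)]) (use R(2) in auto)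
    qed
    have "glued_from m1 m2 m3 \<pi> ?I R"
      by (rule glue[OF gc seg_family(2)[OF ijk] gluing_R[OF R gr(1,3)] cross[OF att]])
    then have "\<exists>a\<in>sg i. \<exists>b\<in>?H. \<exists>R\<in>arc_gluings \<gamma> a b. glued_from m1 m2 m3 \<pi> ?I R"
      by (intro bexI[OF _ a(2)] bexI[OF _ bH] bexI[OF _ R(1)])
    then have "unicircuit_2_4_type m1 m2 m3 \<pi>" unfolding unicircuit_2_4_type_def
      using ijk dt du by (intro exI[of _ i] exI[of _ j] exI[of _ k] conjI)
    then show ?thesis by blast
  next
    case True
    then obtain w where w: "w \<in> D" "block \<pi> (\<gamma> w) = block \<pi> w" unfolding loopc_def by blast
    define q where "q = block \<pi> w"
    have loop: "block \<pi> (\<gamma> x) = q" "block \<pi> x = q" if "x \<in> D" for x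
    proof -
      have "ends \<pi> x = {q}" using classes_ends[OF D(1) that w(1)] w(2) by (simp add: ends_def q_def)
      then show "block \<pi> (\<gamma> x) = q" "block \<pi> x = q" unfolding ends_def by blast+
    qed
    have "uends (W \<pi> gr) D = {rb \<pi> gr a}"
      using W_ends[OF P gclosed_gr D(1) a(1)] rb_eq_iff[OF P gclosed_gr gclosed_gam[OF gclosed_gr gr(1)] gr(1)]
        loop[OF a(1)] by simp
    then have "even_edges (W \<pi> gr) {D}" using D(1) by (intro even_edges_loop) auto
    \<comment> \<open>A class of loops is even by itself, so it is the unique even edge set, and
      cycle \<open>j\<close> uses it oddly. This makes the circuit of the other piece a
      loop.\<close>
    then have "F j = {D}" using uniq[OF F_even[OF p(2)] _ Fjk(1)] by blast
    then have Dj: "odd (card (D \<inter> sg j))" by blast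
    have "opp \<pi> a a'" using loop[OF a(1)] loop[OF a'D(1)] by (simp add: opp_def)
    then have dd: "dbl \<pi> (D \<inter> sg i)" "dbl \<pi> (D \<inter> ?H)" using parts_intro by blast+
    have "D \<inter> sg j \<noteq> {}" using Dj by auto
    then obtain c where c: "c \<in> D" "c \<in> sg j" by blast
    have cH: "c \<in> ?H" using c by blast
    have cgr: "c \<in> gr" using classes_sub[OF D(1)] c(1) by blast
    let ?J = "sg i - {a, a'}"
    have dJ: "dbl \<pi> C" if C: "C \<in> classes \<pi> ?J" for C
    proof -
      have "?J \<subseteq> gr" using seg_gr[OF p(1)] by blast
      then obtain E where E: "E \<in> CL" "C = E \<inter> ?J" using classes_lift[OF C] by blast
      have ne: "C \<noteq> {}" by (rule classes_ne[OF C])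
      have ED: "E \<noteq> D" using E(2) ne a'(2) by blast
      then have "a \<notin> E" "a' \<notin> E" using classes_eqI[OF E(1) D(1)] a(1) a'D(1) by blast+
      then have "C = E \<inter> sg i" using E(2) by blast
      then show ?thesis using unsplit_dbl[OF E(1) rest[OF E(1) ED] uns[OF E(1) ED]] ne by simp
    qed
    let ?WJ = "wgraph (rb \<pi> (sg i)) (sg i) (classes \<pi> ?J)"
    have h: "homog (rb \<pi> (sg i)) (sg i) (classes \<pi> ?J)" by (rule homog_subclasses[OF P Ii]) blast
    have rba: "rb \<pi> (sg i) (\<gamma> x) = rb \<pi> (sg i) x" if "x \<in> D" "x \<in> sg i" for x
      using rb_eq_iff[OF P Ii gclosed_gam[OF Ii that(2)] that(2)] loop[OF that(1)] by simp
    have connJ: "uconnected ?WJ"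
    proof (rule seg_connected[OF P p(1) h])
      fix u assume "u \<in> sg i" "rb \<pi> (sg i) (\<gamma> u) \<noteq> rb \<pi> (sg i) u"
      then have "u \<in> ?J" using rba a a'D by blast
      then show "u \<in> \<Union>(classes \<pi> ?J)" unfolding Union_classes .
    qed
    have cJ: "2 * card (classes \<pi> ?J) + 2 = card (sg i)"
    proof -
      have "2 * card (classes \<pi> ?J) = card ?J"
        using sum_card_classes[of ?J \<pi>] dJ gclosed_finite[OF Ii] by (simp add: dbl_def)
      moreover have "card ?J = card (sg i) - card {a, a'}" using a(2) a'D(2) by (intro card_Diff_subset) auto
      moreover have "card {a, a'} \<le> card (sg i)" using a(2) a'D(2) gclosed_finite[OF Ii] by (intro card_mono) auto
      ultimately show ?thesis using a'(1) by simp
    qed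
    have ui: "card (block \<pi> ` sg i) \<le> Suc (card (classes \<pi> ?J))"
      using card_uverts_le_Suc_uedges[OF wgraph_wf[OF h Ii] connJ] uverts_card[OF P Ii] card_restrict[OF P Ii] by simp
    have uH: "2 * card (block \<pi> ` ?H) \<le> card ?H"
      by (rule card_block_pair_le[OF P p(2,3,6) share dblH[OF dd(2)] C0cl odd0])
    have "{q} \<subseteq> block \<pi> ` sg i" "{q} \<subseteq> block \<pi> ` ?H" using loop(2)[OF a(1)] loop(2)[OF c(1)] a(2) cH by blast+
    \<comment> \<open>One common vertex is enough in this case: without its two loops, cycle
      \<open>i\<close> has at most \<open>card (sg i) / 2\<close> vertices, one fewer than a double
      tree on \<open>sg i\<close> would have.\<close>
    from overlap[OF P Ii IH this] have ov: "card \<pi> + 1 \<le> card (block \<pi> ` sg i) + card (block \<pi> ` ?H)"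
      unfolding tot by simp
    have eqi: "card (block \<pi> ` sg i) = Suc (card (classes \<pi> ?J))" using ov ui uH mm2 cJ by linarith
    then have dt: "double_tree (pre_digraph.del_arc (pre_digraph.del_arc (qg \<pi> (sg i)) a) a')"
      unfolding double_tree_deleted[OF P p(1)] card_restrict[OF P Ii] using connJ dJ by blast
    have leH: "card ?H \<le> 2 * card (block \<pi> ` ?H)" using ov ui uH mm2 cJ by linarith
    have du1: "double_unicircuit (qg \<pi> ?H) (sg j) (sg k)"
      by (rule double_unicircuit_intro(1)[OF P p(2,3,6) share dblH[OF dd(2)] C0cl odd0 leH])
    have du2: "\<exists>K. circuits (W \<pi> ?H) = {K} \<and> (\<forall>F. even_edges (W \<pi> ?H) F \<longrightarrow> F \<noteq> {} \<longrightarrow> uedges K = F)"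
      by (rule double_unicircuit_intro(2)[OF P p(2,3,6) share dblH[OF dd(2)] C0cl odd0 leH])
    obtain K where K: "circuits (W \<pi> ?H) = {K}"
      "\<And>E. even_edges (W \<pi> ?H) E \<Longrightarrow> E \<noteq> {} \<Longrightarrow> uedges K = E" using du2 by blast
    have DH_cl: "D \<inter> ?H \<in> classes \<pi> ?H" using c(1) cH by (intro classes_Int[OF D(1) gclosed_gr_sub[OF IH]]) blast
    have rbc: "rb \<pi> ?H (\<gamma> c) = rb \<pi> ?H c"
      using rb_eq_iff[OF P IH gclosed_gam[OF IH cH] cH] loop[OF c(1)] by simp
    have uDH: "uends (W \<pi> ?H) (D \<inter> ?H) = {rb \<pi> ?H c}"
      using W_ends[OF P IH DH_cl, of c] c(1) cH rbc by simp
    then have "even_edges (W \<pi> ?H) {D \<inter> ?H}" using DH_cl by (intro even_edges_loop) auto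
    then have K1: "uedges K = {D \<inter> ?H}" using K(2) by blast
    have "K \<in> circuits (W \<pi> ?H)" using K(1) by simp
    then have "uends K = uends (W \<pi> ?H)" by (rule circuitD(3))
    then have K2: "card (uends K (D \<inter> ?H)) = 1" using uDH by simp
    have circ: "\<exists>K. circuits (elementarization (qg \<pi> ?H)) = {K} \<and> (\<exists>C. uedges K = {C} \<and> card (uends K C) = 1)"
      unfolding elementarization_qg[OF P IH] using K(1) K1 K2 by blast
    have att: "attached \<pi> ?I {(a, c)} a (sg i)" "attached \<pi> ?I {(a, c)} a ?H"
    proof -
      show att1: "attached \<pi> ?I {(a, c)} a (sg i)" by (rule attached_self[OF P _ Ii a(2)]) simp
      show "attached \<pi> ?I {(a, c)} a ?H" unfolding attached_def
      proof (intro ballI impI)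
        fix x y assume x: "x \<in> {a, \<gamma> a}" and y: "y \<in> ?H" "block \<pi> y = block \<pi> x"
        have bx: "block \<pi> x = q" "x \<in> sg i" using x loop[OF a(1)] a(2) gclosed_gam[OF Ii a(2)] by auto
        have "(x, a) \<in> X1 \<pi> ?I {(a, c)}"
          by (rule X1_piece[OF P _ Ii bx(2) a(2)]) (use bx loop(2)[OF a(1)] in simp_all)
        moreover have "(a, c) \<in> X1 \<pi> ?I {(a, c)}" by blast
        moreover have "(c, y) \<in> X1 \<pi> ?I {(a, c)}"
          by (rule X1_piece[OF P _ IH cH y(1)]) (use y(2) bx(1) loop(2)[OF c(1)] in simp_all)
        ultimately show "(x, y) \<in> X1 \<pi> ?I {(a, c)}" by (meson rtrancl_trans)
      qed
    qed
    have Rac: "x \<in> gr \<and> y \<in> gr \<and> block \<pi> x = block \<pi> y" if "(x, y) \<in> {(a, c)}" for x y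
      using that gr(1) cgr loop(2)[OF a(1)] loop(2)[OF c(1)] by simp
    have glued: "glued_from m1 m2 m3 \<pi> ?I {(a, c)}"
      by (rule glue[OF gc seg_family(2)[OF ijk] Rac cross[OF att]])
    have la: "loop_arc (qg \<pi> (sg i)) a" "loop_arc (qg \<pi> (sg i)) a'"
      using rba[OF a(1,2)] rba[OF a'D] a(2) a'D(2) by (simp_all add: loop_arc_def)
    have lc: "loop_arc (qg \<pi> ?H) c" using rbc cH by (simp add: loop_arc_def)
    have hd: "head (qg \<pi> (sg i)) a = head (qg \<pi> (sg i)) a'"
      using rb_eq_iff[OF P Ii a(2) a'D(2)] loop(2)[OF a(1)] loop(2)[OF a'D(1)] by simp
    have "uniloop_2_4_type m1 m2 m3 \<pi>" unfolding uniloop_2_4_type_def Let_def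
      by (rule exI[of _ i], rule exI[of _ j], rule exI[of _ k], intro conjI ijk circ du1,
        rule exI[of _ a], rule exI[of _ a'], rule exI[of _ c], intro conjI la hd dt lc glued)
        (rule a'(1)[symmetric])
    then show ?thesis by blast
  qed
qed

text \<open>Connectedness bounds the excess by 2. The value 1 means as many classes as blocks and
  one class of four arcs; the value 2 means a tree with one class of six arcs or two classes of
  four.\<close>

lemma pairing_type:
  "prof2 \<pi> \<or> tree_2_6_type m1 m2 m3 \<pi> \<or> tree_2_4_4_type m1 m2 m3 \<pi> \<or>
    unicircuit_2_4_type m1 m2 m3 \<pi> \<or> uniloop_2_4_type m1 m2 m3 \<pi>"
proof -
  let ?h = "\<lambda>C. card C div 2 - 1"
  have fin: "finite CL" by (rule finite_classes[OF finite_gr])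
  have "card \<pi> \<le> Suc (card CL)" using card_uverts_le_Suc_uedges[OF wf conn] card_graph by simp
  then have "sum ?h CL \<le> 2" using excess by linarith
  then consider "sum ?h CL = 0" | "sum ?h CL = 1" | "sum ?h CL = 2" by linarith
  then show ?thesis
  proof cases
    case 1
    then have h0: "?h C = 0" if "C \<in> CL" for C using fin that by simp
    have "card C = 2" if "C \<in> CL" for C by (rule excess_zero[OF that h0[OF that]])
    then show ?thesis using case_all_2 by blast
  next
    case 2
    then have uni: "card CL = card \<pi>" using excess by linarith
    have "\<exists>D\<in>CL. ?h D = 1 \<and> (\<forall>C\<in>CL. D \<noteq> C \<longrightarrow> ?h C = 0)" using 2 sum_eq_1_iff[OF fin, of ?h] by blast
    then obtain D where D: "D \<in> CL" "?h D = 1" "\<And>C. C \<in> CL \<Longrightarrow> D \<noteq> C \<Longrightarrow> ?h C = 0" by blast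
    have "card D = 4" using excess_pos[OF D(1), of 0] D(2) by simp
    moreover have "card C = 2" if "C \<in> CL" "C \<noteq> D" for C using excess_zero[OF that(1) D(3)[OF that(1) that(2)[symmetric]]] .
    ultimately show ?thesis using unicyclic_case[OF uni D(1)] by blast
  next
    case 3
    then have tree: "card CL < card \<pi>" using excess by linarith
    from sum_eq_2_cases[OF fin 3] show ?thesis
    proof
      assume "\<exists>D\<in>CL. ?h D = 2 \<and> (\<forall>C\<in>CL. C \<noteq> D \<longrightarrow> ?h C = 0)"
      then obtain D where D: "D \<in> CL" "?h D = 2" "\<And>C. C \<in> CL \<Longrightarrow> C \<noteq> D \<Longrightarrow> ?h C = 0" by blast
      have "card D = 6" using excess_pos[OF D(1), of 1] D(2) by simp
      moreover have "card C = 2" if "C \<in> CL" "C \<noteq> D" for C using excess_zero[OF that(1) D(3)[OF that]] .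
      ultimately show ?thesis using case_2_6[OF tree D(1)] by blast
    next
      assume "\<exists>D\<in>CL. \<exists>E\<in>CL. D \<noteq> E \<and> ?h D = 1 \<and> ?h E = 1 \<and> (\<forall>C\<in>CL. C \<noteq> D \<longrightarrow> C \<noteq> E \<longrightarrow> ?h C = 0)"
      then obtain D E where D: "D \<in> CL" "E \<in> CL" "D \<noteq> E" "?h D = 1" "?h E = 1"
        "\<And>C. C \<in> CL \<Longrightarrow> C \<noteq> D \<Longrightarrow> C \<noteq> E \<Longrightarrow> ?h C = 0" by blast
      have "card D = 4" "card E = 4" using excess_pos[OF D(1), of 0] excess_pos[OF D(2), of 0] D(4,5) by simp_all
      moreover have "card C = 2" if "C \<in> CL" "C \<noteq> D" "C \<noteq> E" for C using excess_zero[OF that(1) D(6)[OF that]] .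
      ultimately show ?thesis using case_2_4_4[OF tree D(1-3)] by blast
    qed
  qed
qed

end

section \<open>Planar pairings\<close>

lemma orbit_perm_self: "f permutes A \<Longrightarrow> finite A \<Longrightarrow> u \<in> orbit f u"
  by (rule permutation_self_in_orbit) (auto simp: permutation_permutes)

lemma orbit_perm_eq: 
  assumes "f permutes A" "finite A" "v \<in> orbit f u"
  shows "orbit f v = orbit f u"
  using cyclic_on_orbit[OF assms(1,2)] orbit_cyclic_eq3 assms(3) by metis

lemma partition_on_orbits:
  assumes "f permutes A" "finite A"
  shows "partition_on A (orbit f ` A)"
proof (rule partition_onI)
  show "\<Union>(orbit f ` A) = A"
    using permutes_orbit_subset[OF assms(1)] orbit_perm_self[OF assms] by blast
  show "disjnt p q" if pq: "p \<in> orbit f ` A" "q \<in> orbit f ` A" "p \<noteq> q" for p q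
  proof (rule ccontr)
    assume "\<not> disjnt p q"
    then obtain w where w: "w \<in> p" "w \<in> q" unfolding disjnt_def by blast
    obtain u where u: "p = orbit f u" using pq(1) by blast
    obtain v where v: "q = orbit f v" using pq(2) by blast
    have "p = q" using orbit_perm_eq[OF assms, of w u] orbit_perm_eq[OF assms, of w v] w u v by simp
    then show False using pq(3) by contradiction
  qed
  show "{} \<notin> orbit f ` A" using orbit_perm_self[OF assms] by blast
qed

lemma block_orbits:
  assumes "f permutes A" "finite A" "u \<in> A"
  shows "block (orbit f ` A) u = orbit f u"
  by (rule block_eqI[OF partition_on_orbits[OF assms(1,2)] imageI[OF assms(3)] orbit_perm_self[OF assms(1,2)]])

lemma orbit_conjugate:
  "orbit (g \<circ> f) (g u) = g ` orbit (f \<circ> g) u"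
proof -
  have "((g \<circ> f) ^^ n) (g u) = g (((f \<circ> g) ^^ n) u)" for n by (induction n) simp_all
  then show ?thesis unfolding orbit_altdef by auto
qed

text \<open>The two compositions are conjugate by \<open>g\<close>. This replaces \<sigma>\<gamma>,
  which occurs in the length condition, by \<gamma>\<sigma>, whose orbits will be the
  blocks.\<close>

lemma card_orbits_commute:
  assumes "g permutes A"
  shows "card (orbit (f \<circ> g) ` A) = card (orbit (g \<circ> f) ` A)"
proof -
  have "orbit (g \<circ> f) ` A = orbit (g \<circ> f) ` g ` A" using permutes_image[OF assms] by simp
  also have "\<dots> = (`) g ` orbit (f \<circ> g) ` A" by (simp add: image_image orbit_conjugate)
  finally have "card (orbit (g \<circ> f) ` A) = card ((`) g ` orbit (f \<circ> g) ` A)" by simp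
  also have "\<dots> = card (orbit (f \<circ> g) ` A)"
    using inj_image_eq_iff[OF permutes_inj[OF assms]] by (intro card_image) (simp add: inj_on_def)
  finally show ?thesis by simp
qed

lemma orbit_involution: 
  assumes "f (f u) = u"
  shows "orbit f u = {u, f u}"
proof
  show "orbit f u \<subseteq> {u, f u}"
  proof
    fix v assume "v \<in> orbit f u"
    then show "v \<in> {u, f u}" by induction (use assms in auto)
  qed
  have "f u \<in> orbit f u" by (rule orbit.base)
  then have "f (f u) \<in> orbit f u" by (rule orbit.step)
  then show "{u, f u} \<subseteq> orbit f u" using assms orbit.base[of f u] by auto
qed

lemma orbits_card_2_iff:
  assumes "f permutes A" "finite A"
  shows "(\<forall>B\<in>orbit f ` A. card B = 2) \<longleftrightarrow> (\<forall>u\<in>A. f u \<noteq> u \<and> f (f u) = u)"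
proof
  assume c: "\<forall>B\<in>orbit f ` A. card B = 2"
  show "\<forall>u\<in>A. f u \<noteq> u \<and> f (f u) = u"
  proof
    fix u assume u: "u \<in> A"
    then have c2: "card (orbit f u) = 2" using c by blast
    have fu: "f u \<noteq> u"
    proof
      assume "f u = u"
      then have "orbit f u = {u}" by (simp add: orbit_eq_singleton_iff)
      then show False using c2 by simp
    qed
    obtain v where v: "orbit f u = {u, v}" using card_2_partner[OF c2 orbit_perm_self[OF assms]] by blast
    have "f u \<in> orbit f u" by (rule orbit.base)
    moreover then have "f (f u) \<in> orbit f u" by (rule orbit.step)
    moreover have "f (f u) \<noteq> f u" using fu permutes_inj[OF assms(1)] by (simp add: inj_eq)
    ultimately show "f u \<noteq> u \<and> f (f u) = u" using v fu by blast
  qed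
next
  assume i: "\<forall>u\<in>A. f u \<noteq> u \<and> f (f u) = u"
  show "\<forall>B\<in>orbit f ` A. card B = 2"
  proof
    fix B assume "B \<in> orbit f ` A"
    then obtain u where u: "u \<in> A" "B = orbit f u" by blast
    have "f u \<noteq> u" "f (f u) = u" using i u(1) by blast+
    then show "card B = 2" unfolding u(2) by (subst orbit_involution) auto
  qed
qed

context three_cycles
begin

section \<open>Fibring the pairings over the partitions\<close>

lemma orbit_gam: assumes j: "j \<in> idx" and u: "u \<in> sg j" shows "orbit \<gamma> u = sg j"
proof (rule seg_minimal[OF j])
  show "orbit \<gamma> u \<subseteq> sg j"
  proof
    fix v assume "v \<in> orbit \<gamma> u"
    then show "v \<in> sg j" by induction (use u gam_seg[OF j] in auto)
  qed
  show "orbit \<gamma> u \<noteq> {}" using orbit.base[of \<gamma> u] by blast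
  show "\<gamma> ` orbit \<gamma> u \<subseteq> orbit \<gamma> u" by (auto intro: orbit.step)
qed

lemma cycle_partition_gam: "cycle_partition gr \<gamma> = {sg 1, sg 2, sg 3}"
proof
  show "cycle_partition gr \<gamma> \<subseteq> {sg 1, sg 2, sg 3}"
  proof
    fix B assume "B \<in> cycle_partition gr \<gamma>"
    then obtain u where u: "u \<in> gr" "B = orbit \<gamma> u" unfolding cycle_partition_def by blast
    obtain j where "j \<in> idx" "u \<in> sg j" using gr_seg_ex[OF u(1)] by blast
    then show "B \<in> {sg 1, sg 2, sg 3}" using orbit_gam u(2) by auto
  qed
  have "sg j \<in> cycle_partition gr \<gamma>" if j: "j \<in> idx" for j
  proof -
    obtain u where u: "u \<in> sg j" using seg_ne[OF j] by blast
    then have "u \<in> gr" using seg_gr[OF j] by blast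
    then show ?thesis unfolding cycle_partition_def using orbit_gam[OF j u] by blast
  qed
  then show "{sg 1, sg 2, sg 3} \<subseteq> cycle_partition gr \<gamma>" by simp
qed

lemma card_cycle_partition_gam: "card (cycle_partition gr \<gamma>) = 3"
proof -
  have "sg 1 \<noteq> sg 2" "sg 1 \<noteq> sg 3" "sg 2 \<noteq> sg 3" using seg_disjoint seg_nonempty by blast+
  then show ?thesis unfolding cycle_partition_gam by simp
qed

lemma same_block_orbits:
  assumes f: "f permutes gr"
  shows "(u, v) \<in> same_block (cycle_partition gr f) \<longleftrightarrow> u \<in> gr \<and> v \<in> gr \<and> orbit f u = orbit f v"
  unfolding cycle_partition_def same_block_iff[OF partition_on_orbits[OF f finite_gr]]
  using block_orbits[OF f finite_gr] by auto

text \<open>A cycle closed under \<open>\<sigma>\<close> cannot be left by the generated relation.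
  Conversely, the blocks of the join are closed under both permutations, so
  \<open>linked_closed\<close> applies.\<close>

lemma join_iff_linked:
  assumes \<sigma>: "\<sigma> permutes gr" and inv: "\<And>u. u \<in> gr \<Longrightarrow> \<sigma> (\<sigma> u) = u"
  shows "partition_join gr (cycle_partition gr \<sigma>) (cycle_partition gr \<gamma>) = {gr} \<longleftrightarrow>
    (\<forall>j\<in>idx. \<exists>u\<in>sg j. \<sigma> u \<notin> sg j)"
proof -
  let ?X = "same_block (cycle_partition gr \<sigma>) \<union> same_block (cycle_partition gr \<gamma>)"
  have sgr: "\<sigma> u \<in> gr" if "u \<in> gr" for u using permutes_in_image[OF \<sigma>] that by simp
  have X: "partition_join gr (cycle_partition gr \<sigma>) (cycle_partition gr \<gamma>) = gr // eqc gr ?X"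
    by (simp add: partition_join_def generated_partition_eqc)
  show ?thesis unfolding X
  proof
    assume q: "gr // eqc gr ?X = {gr}"
    show "\<forall>j\<in>idx. \<exists>u\<in>sg j. \<sigma> u \<notin> sg j"
    proof (rule ballI, rule ccontr)
      fix j assume j: "j \<in> idx" and "\<not> (\<exists>u\<in>sg j. \<sigma> u \<notin> sg j)"
      then have cl: "\<sigma> u \<in> sg j" if "u \<in> sg j" for u using that by blast
      obtain u where u: "u \<in> sg j" using seg_ne[OF j] by blast
      have ugr: "u \<in> gr" using u seg_gr[OF j] by blast
      have step: "v \<in> sg j \<longleftrightarrow> w \<in> sg j" if vw: "(v, w) \<in> ?X" for v w
        using vw
      proof
        assume "(v, w) \<in> same_block (cycle_partition gr \<sigma>)"
        then have o: "v \<in> gr" "w \<in> gr" "orbit \<sigma> v = orbit \<sigma> w" using same_block_orbits[OF \<sigma>] by blast+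
        have "{v, \<sigma> v} = {w, \<sigma> w}" using o(3) orbit_involution[of \<sigma> v, OF inv[OF o(1)]] orbit_involution[of \<sigma> w, OF inv[OF o(2)]] by simp
        then have "w = v \<or> w = \<sigma> v" "v = w \<or> v = \<sigma> w" by blast+
        then show ?thesis using cl by metis
      next
        assume "(v, w) \<in> same_block (cycle_partition gr \<gamma>)"
        then have o: "v \<in> gr" "w \<in> gr" "orbit \<gamma> v = orbit \<gamma> w" using same_block_orbits[OF gam_permutes] by blast+
        then have "v \<in> orbit \<gamma> w" "w \<in> orbit \<gamma> v" using orbit_perm_self[OF gam_permutes finite_gr] by blast+
        then show ?thesis using orbit_gam[OF j] by blast
      qed
      have "v \<in> sg j" if "(u, v) \<in> (?X \<union> converse ?X)\<^sup>*" for v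
        using that by induction (use u step in blast)+
      then have "eqc gr ?X `` {u} \<subseteq> sg j" by (auto simp: eqc_def)
      moreover have "eqc gr ?X `` {u} = gr" using q quotientI[OF ugr, of "eqc gr ?X"] by simp
      ultimately have grj: "gr \<subseteq> sg j" by simp
      obtain l where "l \<in> idx" "l \<noteq> j" using j by (metis insertI1 insertI2 n_not_Suc_n numeral_2_eq_2 One_nat_def)
      then show False using seg_ne[of l] seg_gr[of l] seg_disj[OF _ j, of l] grj by blast
    qed
  next
    assume link: "\<forall>j\<in>idx. \<exists>u\<in>sg j. \<sigma> u \<notin> sg j"
    have "eqc gr ?X `` {u} = gr" if u: "u \<in> gr" for u
    proof (rule linked_closed[of \<sigma>])
      show "\<exists>u\<in>sg j. \<sigma> u \<notin> sg j" if "j \<in> idx" for j using link that by blast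
      show "\<sigma> u \<in> gr \<and> \<sigma> (\<sigma> u) = u" if "u \<in> gr" for u using sgr inv that by blast
      have sub: "eqc gr ?X `` {u} \<subseteq> gr" by (auto simp: eqc_def)
      have ext: "w \<in> eqc gr ?X `` {u}" if "v \<in> eqc gr ?X `` {u}" "(v, w) \<in> ?X" "w \<in> gr" for v w
      proof -
        have "(u, v) \<in> (?X \<union> converse ?X)\<^sup>*" using that(1) by (simp add: eqc_def)
        then have "(u, w) \<in> (?X \<union> converse ?X)\<^sup>*" using that(2) by (meson UnI1 rtrancl.rtrancl_into_rtrancl)
        then show ?thesis using u that(3) by (simp add: eqc_def)
      qed
      have g: "(v, \<gamma> v) \<in> ?X" if "v \<in> gr" for v
        using same_block_orbits[OF gam_permutes, of v "\<gamma> v"] gclosed_gam[OF gclosed_gr that] that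
          orbit_perm_eq[OF gam_permutes finite_gr orbit.base, of v] by simp
      have s: "(v, \<sigma> v) \<in> ?X" if "v \<in> gr" for v
        using same_block_orbits[OF \<sigma>, of v "\<sigma> v"] sgr[OF that] that
          orbit_perm_eq[OF \<sigma> finite_gr orbit.base, of v] by simp
      show "gclosed (eqc gr ?X `` {u})"
        using sub ext g gclosed_gam[OF gclosed_gr] by (intro gclosedI) blast+
      show "eqc gr ?X `` {u} \<noteq> {}" using equiv_class_self[OF equiv_eqc u] by blast
      show "\<sigma> v \<in> eqc gr ?X `` {u}" if "v \<in> eqc gr ?X `` {u}" for v
        using ext[OF that s sgr] sub that by blast
    qed
    moreover have "gr \<noteq> {}" using seg_nonempty gr_segs by auto
    ultimately show "gr // eqc gr ?X = {gr}" unfolding quotient_def by auto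
  qed
qed

lemma NC2_iff: "\<sigma> \<in> NC2 m1 m2 m3 \<longleftrightarrow> \<sigma> permutes gr \<and> (\<forall>u\<in>gr. \<sigma> u \<noteq> u \<and> \<sigma> (\<sigma> u) = u) \<and>
    (\<forall>j\<in>idx. \<exists>u\<in>sg j. \<sigma> u \<notin> sg j) \<and> mm = 2 * card (orbit (\<gamma> \<circ> \<sigma>) ` gr) + 2"
proof (cases "\<sigma> permutes gr \<and> (\<forall>u\<in>gr. \<sigma> u \<noteq> u \<and> \<sigma> (\<sigma> u) = u)")
  case True
  then have \<sigma>: "\<sigma> permutes gr" and inv: "\<And>u. u \<in> gr \<Longrightarrow> \<sigma> u \<noteq> u \<and> \<sigma> (\<sigma> u) = u" by blast+
  have sgr: "\<sigma> u \<in> gr" if "u \<in> gr" for u using permutes_in_image[OF \<sigma>] that by simp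
  have "\<sigma> (\<sigma> u) = u" for u using inv \<sigma> by (cases "u \<in> gr") (auto simp: permutes_def)
  then have "inv \<sigma> = \<sigma>" by (intro inv_unique_comp) (auto simp: fun_eq_iff)
  then have c: "card (cycle_partition gr (inv \<sigma> \<circ> \<gamma>)) = card (orbit (\<gamma> \<circ> \<sigma>) ` gr)"
    unfolding cycle_partition_def using card_orbits_commute[OF gam_permutes] by simp
  have "cycle_partition gr \<sigma> = (\<lambda>u. {u, \<sigma> u}) ` gr"
    unfolding cycle_partition_def by (rule image_cong[OF refl], rule orbit_involution) (use inv in blast)
  then have s: "2 * card (cycle_partition gr \<sigma>) = mm" using card_pairs[of \<sigma>] inv sgr by simp
  \<comment> \<open>With c the number of orbits of \<gamma>\<sigma>, the condition reads m/2 + (m -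
    c) = (m - 3) + 4.\<close>
  have len: "perm_length gr \<sigma> + perm_length gr (inv \<sigma> \<circ> \<gamma>) = perm_length gr \<gamma> + 4 \<longleftrightarrow>
      mm = 2 * card (orbit (\<gamma> \<circ> \<sigma>) ` gr) + 2"
    unfolding perm_length_def c card_cycle_partition_gam card_gr using s by linarith
  have c2: "\<forall>B\<in>cycle_partition gr \<sigma>. card B = 2"
    unfolding cycle_partition_def orbits_card_2_iff[OF \<sigma> finite_gr] using inv by blast
  have invA: "\<forall>u\<in>gr. \<sigma> u \<noteq> u \<and> \<sigma> (\<sigma> u) = u" using inv by blast
  show ?thesis
    by (simp only: NC2_def mem_Collect_eq \<sigma> c2 invA join_iff_linked[OF \<sigma> conjunct2[OF inv]] len simp_thms)
      (use c2 invA in blast)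
next
  case False
  then show ?thesis unfolding NC2_def mem_Collect_eq
    using orbits_card_2_iff[OF _ finite_gr, of \<sigma>] unfolding cycle_partition_def by blast
qed

definition planar_parts :: "nat set set set" where
  "planar_parts = {\<pi>. partition_on gr \<pi> \<and> mm = 2 * card \<pi> + 2}"

lemma finite_planar_parts: "finite planar_parts"
  unfolding planar_parts_def by (rule finite_subset[OF _ finitely_many_partition_on[OF finite_gr]]) blast

text \<open>That a pair is opposite means that \<open>u\<close> and
  \<open>\<gamma> (\<sigma> u)\<close> share a block for both of its members, and the orbits of
  \<gamma>\<sigma> form the finest partition with this property.\<close>

lemma orbit_partition:
  assumes \<sigma>: "\<sigma> permutes gr" and inv: "\<And>u. u \<in> gr \<Longrightarrow> \<sigma> u \<noteq> u \<and> \<sigma> (\<sigma> u) = u"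
    and link: "\<forall>j\<in>idx. \<exists>u\<in>sg j. \<sigma> u \<notin> sg j"
  shows "partition_on gr (orbit (\<gamma> \<circ> \<sigma>) ` gr)" "\<sigma> \<in> pairings (orbit (\<gamma> \<circ> \<sigma>) ` gr)"
proof -
  have f: "(\<gamma> \<circ> \<sigma>) permutes gr" by (rule permutes_compose[OF \<sigma> gam_permutes])
  show "partition_on gr (orbit (\<gamma> \<circ> \<sigma>) ` gr)" by (rule partition_on_orbits[OF f finite_gr])
  have step: "block (orbit (\<gamma> \<circ> \<sigma>) ` gr) u = block (orbit (\<gamma> \<circ> \<sigma>) ` gr) (\<gamma> (\<sigma> u))" if u: "u \<in> gr" for u
  proof -
    have "\<gamma> (\<sigma> u) \<in> gr" using permutes_in_image[OF f] u by simp
    moreover have "\<gamma> (\<sigma> u) \<in> orbit (\<gamma> \<circ> \<sigma>) u" using orbit.base[of "\<gamma> \<circ> \<sigma>" u] by simp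
    ultimately show ?thesis
      using block_orbits[OF f finite_gr] u orbit_perm_eq[OF f finite_gr] by simp
  qed
  have "opp (orbit (\<gamma> \<circ> \<sigma>) ` gr) u (\<sigma> u)" if u: "u \<in> gr" for u
  proof -
    have "\<sigma> u \<in> gr" using permutes_in_image[OF \<sigma>] u by simp
    from step[OF this] step[OF u] show ?thesis using inv[OF u] by (simp add: opp_def)
  qed
  then show "\<sigma> \<in> pairings (orbit (\<gamma> \<circ> \<sigma>) ` gr)" using \<sigma> inv link unfolding pairings_def by blast
qed

text \<open>Pairs being opposite makes \<open>\<pi>\<close> coarser than the orbit partition, and
  \<open>pairings_card_le\<close>, applied to the orbits, shows that these are no more numerous than
  the blocks of \<open>\<pi>\<close>.\<close>

lemma pairings_orbits:
  assumes pi: "\<pi> \<in> planar_parts" and \<sigma>: "\<sigma> \<in> pairings \<pi>"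
  shows "\<pi> = orbit (\<gamma> \<circ> \<sigma>) ` gr"
proof -
  let ?f = "\<gamma> \<circ> \<sigma>"
  note s = pairingsD[OF \<sigma>]
  have P: "partition_on gr \<pi>" and mm: "mm = 2 * card \<pi> + 2" using pi by (simp_all add: planar_parts_def)
  have inv: "\<And>u. u \<in> gr \<Longrightarrow> \<sigma> u \<noteq> u \<and> \<sigma> (\<sigma> u) = u" and link: "\<forall>j\<in>idx. \<exists>u\<in>sg j. \<sigma> u \<notin> sg j"
    using s(3,4,6) by blast+
  note op = orbit_partition[OF s(1) inv link]
  have f: "?f permutes gr" by (rule permutes_compose[OF s(1) gam_permutes])
  have "card (orbit ?f ` gr) \<le> card \<pi>" using pairings_card_le[OF op] mm by simp
  moreover have "block \<pi> a = block \<pi> b"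
    if ab: "a \<in> gr" "b \<in> gr" "block (orbit ?f ` gr) a = block (orbit ?f ` gr) b" for a b
  proof -
    have "b \<in> orbit ?f a" using ab block_orbits[OF f finite_gr] orbit_perm_self[OF f finite_gr, of b] by simp
    moreover have "v \<in> orbit ?f a \<Longrightarrow> v \<in> gr \<and> block \<pi> v = block \<pi> a" for v
    proof (induction rule: orbit.induct)
      case base
      then show ?case using s(5)[OF ab(1)] permutes_in_image[OF f] ab(1) by (simp add: opp_def)
    next
      case (step v)
      then have v: "v \<in> gr" "block \<pi> v = block \<pi> a" by blast+
      then show ?case using s(5)[OF v(1)] permutes_in_image[OF f, of v] by (simp add: opp_def)
    qed
    ultimately show ?thesis by simp
  qed
  ultimately show ?thesis by (intro coarser_partition_eq[OF finite_gr P op(1)])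
qed

lemma card_NC2: "card (NC2 m1 m2 m3) = (\<Sum>\<pi>\<in>planar_parts. card (pairings \<pi>))"
proof -
  have "NC2 m1 m2 m3 = (\<Union>\<pi>\<in>planar_parts. pairings \<pi>)"
  proof (intro equalityI subsetI)
    fix \<sigma> assume "\<sigma> \<in> NC2 m1 m2 m3"
    then have n: "\<sigma> permutes gr" "\<And>u. u \<in> gr \<Longrightarrow> \<sigma> u \<noteq> u \<and> \<sigma> (\<sigma> u) = u"
      "\<forall>j\<in>idx. \<exists>u\<in>sg j. \<sigma> u \<notin> sg j" "mm = 2 * card (orbit (\<gamma> \<circ> \<sigma>) ` gr) + 2"
      unfolding NC2_iff by blast+
    note op = orbit_partition[OF n(1-3)]
    have "orbit (\<gamma> \<circ> \<sigma>) ` gr \<in> planar_parts" using op(1) n(4) by (simp add: planar_parts_def)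
    then show "\<sigma> \<in> (\<Union>\<pi>\<in>planar_parts. pairings \<pi>)" using op(2) by blast
  next
    fix \<sigma> assume "\<sigma> \<in> (\<Union>\<pi>\<in>planar_parts. pairings \<pi>)"
    then obtain \<pi> where pi: "\<pi> \<in> planar_parts" "\<sigma> \<in> pairings \<pi>" by blast
    note s = pairingsD[OF pi(2)]
    have "mm = 2 * card (orbit (\<gamma> \<circ> \<sigma>) ` gr) + 2" using pi(1) unfolding pairings_orbits[OF pi, symmetric] by (simp add: planar_parts_def)
    then show "\<sigma> \<in> NC2 m1 m2 m3" unfolding NC2_iff using s(1,3,4,6) by blast
  qed
  moreover have "card (\<Union>\<pi>\<in>planar_parts. pairings \<pi>) = (\<Sum>\<pi>\<in>planar_parts. card (pairings \<pi>))"
  proof (rule card_UN_disjoint[OF finite_planar_parts])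
    show "\<forall>\<pi>\<in>planar_parts. finite (pairings \<pi>)"
    proof
      fix \<pi>
      have "pairings \<pi> \<subseteq> {\<sigma>. \<sigma> permutes gr}" unfolding pairings_def by blast
      then show "finite (pairings \<pi>)" by (rule finite_subset[OF _ finite_permutations[OF finite_gr]])
    qed
    show "\<forall>\<pi>\<in>planar_parts. \<forall>\<rho>\<in>planar_parts. \<pi> \<noteq> \<rho> \<longrightarrow> pairings \<pi> \<inter> pairings \<rho> = {}"
    proof (intro ballI impI, rule ccontr)
      fix \<pi> \<rho> assume pr: "\<pi> \<in> planar_parts" "\<rho> \<in> planar_parts" "\<pi> \<noteq> \<rho>" "pairings \<pi> \<inter> pairings \<rho> \<noteq> {}"
      then obtain \<sigma> where "\<sigma> \<in> pairings \<pi>" "\<sigma> \<in> pairings \<rho>" by blast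
      then have "\<pi> = \<rho>" using pairings_orbits[OF pr(1), of \<sigma>] pairings_orbits[OF pr(2), of \<sigma>] by simp
      then show False using pr(3) by contradiction
    qed
  qed
  ultimately show ?thesis by simp
qed

section \<open>Cumulants\<close>

lemma kernel_partition_facts:
  assumes "kernel_partition gr i = \<pi>"
  shows "partition_on gr \<pi>" "\<And>u v. u \<in> gr \<Longrightarrow> v \<in> gr \<Longrightarrow> block \<pi> u = block \<pi> v \<longleftrightarrow> i u = i v"
proof -
  let ?r = "{(u, v). u \<in> gr \<and> v \<in> gr \<and> i u = i v}"
  have eq: "equiv gr ?r" by (rule equivI) (auto simp: refl_on_def sym_def trans_def)
  have pi: "\<pi> = gr // ?r" using assms by (simp add: kernel_partition_def)
  show P: "partition_on gr \<pi>" unfolding pi by (rule partition_on_quotient[OF eq])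
  have b: "block \<pi> u = ?r `` {u}" if "u \<in> gr" for u
  proof (rule block_eqI[OF P])
    show "?r `` {u} \<in> \<pi>" unfolding pi by (rule quotientI[OF that])
    show "u \<in> ?r `` {u}" using that by simp
  qed
  show "block \<pi> u = block \<pi> v \<longleftrightarrow> i u = i v" if "u \<in> gr" "v \<in> gr" for u v
    unfolding b[OF that(1)] b[OF that(2)] eq_equiv_class_iff[OF eq that] using that by simp
qed

end

text \<open>One summand of \<open>C_coeff\<close>: a matrix of fixed size and an index function
  \<open>i\<close> with kernel \<open>\<pi>\<close>.\<close>

locale wigner_kernel = three_cycles + complex_wigner_matrix M N x
  for M :: "'w measure" and N :: nat and x :: "nat \<Rightarrow> nat \<Rightarrow> 'w \<Rightarrow> complex" +
  fixes i :: "nat \<Rightarrow> nat" and \<pi> :: "nat set set"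
  assumes i_range: "u \<in> ground m1 m2 m3 \<Longrightarrow> i u \<in> {1..N}"
    and kernel: "kernel_partition (ground m1 m2 m3) i = \<pi>"
begin

lemmas P = kernel_partition_facts(1)[OF kernel]
lemmas block_iff = kernel_partition_facts(2)[OF kernel]

lemma g_gr: "u \<in> gr \<Longrightarrow> \<gamma> u \<in> gr"
  by (rule gclosed_gam[OF gclosed_gr])

abbreviation "X v \<equiv> x (i v) (i (\<gamma> v))"

text \<open>Only the entries on and above the diagonal are assumed independent, so an entry below the
  diagonal is treated as the conjugate of the one with index \<open>key\<close>.\<close>

definition key :: "nat \<Rightarrow> nat \<times> nat" where
  "key v = (min (i v) (i (\<gamma> v)), max (i v) (i (\<gamma> v)))"

definition tw :: "nat \<Rightarrow> complex \<Rightarrow> complex" where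
  "tw v z = (if i v \<le> i (\<gamma> v) then z else cnj z)"

lemma X_key: "v \<in> gr \<Longrightarrow> \<omega> \<in> space M \<Longrightarrow> X v \<omega> = tw v (x (fst (key v)) (snd (key v)) \<omega>)"
  using entries_selfadjoint[OF i_range i_range[OF g_gr], of v v \<omega>] by (auto simp: tw_def key_def)

text \<open>Here independence meets the graph: an arc class collects the factors that come from one
  entry up to conjugation.\<close>

lemma key_eq_iff: "u \<in> gr \<Longrightarrow> v \<in> gr \<Longrightarrow> key u = key v \<longleftrightarrow> ends \<pi> u = ends \<pi> v"
proof -
  assume uv: "u \<in> gr" "v \<in> gr"
  have "key u = key v \<longleftrightarrow> i (\<gamma> u) = i (\<gamma> v) \<and> i u = i v \<or> i (\<gamma> u) = i v \<and> i u = i (\<gamma> v)"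
    unfolding key_def by (auto simp: min_def max_def split: if_splits)
  then show ?thesis unfolding ends_def doubleton_eq_iff using block_iff uv g_gr by simp
qed

lemma fiber: "u \<in> gr \<Longrightarrow> {v \<in> gr. key v = key u} = cls \<pi> gr u"
  unfolding cls_def using key_eq_iff by blast

definition e :: "nat set \<Rightarrow> complex" where
  "e I = (LINT \<omega>|M. (\<Prod>v\<in>I. X v \<omega>))"

text \<open>Grouping the factors by \<open>key\<close> leaves functions of distinct independent
  entries. A class that misses \<open>I\<close> contributes the empty product, of mean 1.\<close>

lemma moment_factor:
  assumes I: "I \<subseteq> gr"
  shows "e I = (\<Prod>C\<in>classes \<pi> gr. e (C \<inter> I))"
proof -
  have finI: "finite I" using I finite_gr finite_subset by blast
  let ?K = "key ` gr"
  let ?Z = "\<lambda>q \<omega>. x (fst q) (snd q) \<omega>"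
  define Y where "Y q z = (\<Prod>v\<in>{v \<in> I. key v = q}. tw v z)" for q z
  have Ksub: "?K \<subseteq> {(p, q). p \<in> {1..N} \<and> q \<in> {1..N} \<and> p \<le> q}"
  proof
    fix q assume "q \<in> ?K"
    then obtain v where v: "v \<in> gr" "q = key v" by blast
    have "i v \<in> {1..N}" "i (\<gamma> v) \<in> {1..N}" using i_range v(1) g_gr by blast+
    then show "q \<in> {(p, q). p \<in> {1..N} \<and> q \<in> {1..N} \<and> p \<le> q}" unfolding v(2) key_def by auto
  qed
  have tw_meas: "tw v \<in> borel_measurable borel" for v
    unfolding tw_def by (cases "i v \<le> i (\<gamma> v)") (auto intro!: borel_measurable_continuous_onI continuous_intros)
  have Y_meas: "Y q \<in> borel_measurable borel" for q
    unfolding Y_def by (intro borel_measurable_prod tw_meas)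
  have "indep_vars (\<lambda>_. borel) (\<lambda>(i, j). x i j) ?K" by (rule indep_vars_subset[OF entries_indep Ksub])
  then have ind: "indep_vars (\<lambda>_. borel) ?Z ?K" by (simp add: case_prod_beta')
  have indY: "indep_vars (\<lambda>_. borel) (\<lambda>q \<omega>. Y q (?Z q \<omega>)) ?K"
    by (rule indep_vars_compose2[OF ind]) (rule Y_meas)
  have norm_tw: "cmod (tw v z) = cmod z" for v z by (simp add: tw_def)
  have int: "integrable M (\<lambda>\<omega>. Y q (?Z q \<omega>))" if q: "q \<in> ?K" for q
  proof -
    have qr: "fst q \<in> {1..N}" "snd q \<in> {1..N}" using q Ksub by auto
    have meas: "(\<lambda>\<omega>. Y q (?Z q \<omega>)) \<in> borel_measurable M"
      using measurable_compose[OF entries_measurable[OF qr] Y_meas] .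
    \<comment> \<open>Conjugation preserves absolute values, so integrability of a group is the
      finiteness of one absolute moment.\<close>
    have "cmod (Y q (?Z q \<omega>)) = cmod (?Z q \<omega>) ^ card {v \<in> I. key v = q}" for \<omega>
      by (simp add: Y_def prod_norm[symmetric] norm_tw)
    then have "integrable M (\<lambda>\<omega>. cmod (Y q (?Z q \<omega>)))"
      using absolute_moments_finite[OF qr, of "card {v \<in> I. key v = q}"] by simp
    then show ?thesis using integrable_norm_iff[OF meas] by simp
  qed
  have Yprod: "Y q (?Z q \<omega>) = (\<Prod>v\<in>{v \<in> I. key v = q}. X v \<omega>)" if \<omega>: "\<omega> \<in> space M" for q \<omega>
    unfolding Y_def
  proof (rule prod.cong[OF refl])
    fix v assume "v \<in> {v \<in> I. key v = q}"
    then have v: "v \<in> gr" "key v = q" using I by auto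
    show "tw v (?Z q \<omega>) = X v \<omega>" using X_key[OF v(1) \<omega>] v(2) by simp
  qed
  have "e I = (LINT \<omega>|M. (\<Prod>q\<in>?K. Y q (?Z q \<omega>)))"
    unfolding e_def
  proof (rule Bochner_Integration.integral_cong[OF refl])
    fix \<omega> assume \<omega>: "\<omega> \<in> space M"
    have "(\<Prod>v\<in>I. X v \<omega>) = (\<Prod>q\<in>?K. \<Prod>v\<in>{v \<in> I. key v = q}. X v \<omega>)"
    proof (rule prod.group[symmetric, OF finI])
      show "finite ?K" using finite_gr by simp
      show "key ` I \<subseteq> ?K" using I by (rule image_mono)
    qed
    then show "(\<Prod>v\<in>I. X v \<omega>) = (\<Prod>q\<in>?K. Y q (?Z q \<omega>))" using Yprod[OF \<omega>] by simp
  qed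
  also have "\<dots> = (\<Prod>q\<in>?K. LINT \<omega>|M. Y q (?Z q \<omega>))"
    by (rule indep_vars_lebesgue_integral[OF _ indY int]) (use finite_gr in simp)
  also have "\<dots> = (\<Prod>q\<in>?K. e {v \<in> I. key v = q})"
    unfolding e_def by (intro prod.cong Bochner_Integration.integral_cong refl) (rule Yprod)
  also have "\<dots> = (\<Prod>C\<in>classes \<pi> gr. e (C \<inter> I))"
  proof (rule prod.reindex_bij_witness[where i = "\<lambda>C. key (SOME u. u \<in> C)" and j = "\<lambda>q. {v \<in> gr. key v = q}"])
    have key_some: "key (SOME u. u \<in> cls \<pi> gr u0) = key u0" if u0: "u0 \<in> gr" for u0
    proof -
      have "(SOME u. u \<in> cls \<pi> gr u0) \<in> cls \<pi> gr u0" using cls_in(2)[OF u0] by (rule someI)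
      then show ?thesis unfolding fiber[OF u0, symmetric] by blast
    qed
    show "key (SOME u. u \<in> {v \<in> gr. key v = q}) = q" if q: "q \<in> ?K" for q
    proof -
      obtain u where u: "u \<in> gr" "q = key u" using q by blast
      show ?thesis unfolding u(2) fiber[OF u(1)] by (rule key_some[OF u(1)])
    qed
    show "{v \<in> gr. key v = q} \<in> classes \<pi> gr" if q: "q \<in> ?K" for q
    proof -
      obtain u where u: "u \<in> gr" "q = key u" using q by blast
      show ?thesis unfolding u(2) fiber[OF u(1)] by (rule cls_in(1)[OF u(1)])
    qed
    show "{v \<in> gr. key v = key (SOME u. u \<in> C)} = C" if C: "C \<in> classes \<pi> gr" for C
    proof -
      obtain u where u: "u \<in> gr" "C = cls \<pi> gr u" by (rule classesE[OF C])
      show ?thesis unfolding u(2) key_some[OF u(1)] by (rule fiber[OF u(1)])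
    qed
    show "key (SOME u. u \<in> C) \<in> ?K" if C: "C \<in> classes \<pi> gr" for C
    proof -
      obtain u where u: "u \<in> gr" "C = cls \<pi> gr u" by (rule classesE[OF C])
      show ?thesis unfolding u(2) key_some[OF u(1)] by (rule imageI[OF u(1)])
    qed
    show "e ({v \<in> gr. key v = q} \<inter> I) = e {v \<in> I. key v = q}" for q
      using I by (intro arg_cong[of _ _ e]) blast
  qed
  finally show ?thesis .
qed

lemma e_empty: "e {} = 1"
  by (simp add: e_def prob_space)

lemma e_single: "v \<in> gr \<Longrightarrow> e {v} = 0"
  using entries_centered[OF i_range i_range[OF g_gr]] by (simp add: e_def)

lemma e_opp:
  assumes "u \<in> gr" "v \<in> gr" "u \<noteq> v" "opp \<pi> u v"
  shows "e {u, v} = 1"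
proof -
  have iv: "i (\<gamma> u) = i v" "i u = i (\<gamma> v)" using assms block_iff g_gr by (auto simp: opp_def)
  have "e {u, v} = (LINT \<omega>|M. complex_of_real ((cmod (X u \<omega>))\<^sup>2))"
    unfolding e_def
  proof (rule Bochner_Integration.integral_cong[OF refl])
    fix \<omega> assume \<omega>: "\<omega> \<in> space M"
    have "X v \<omega> = cnj (X u \<omega>)" using entries_selfadjoint[OF i_range i_range, OF assms(2) g_gr[OF assms(2)] \<omega>] iv by simp
    then show "(\<Prod>v\<in>{u, v}. X v \<omega>) = complex_of_real ((cmod (X u \<omega>))\<^sup>2)"
      using assms(3) by (simp add: complex_norm_square[symmetric])
  qed
  also have "\<dots> = complex_of_real (LINT \<omega>|M. (cmod (X u \<omega>))\<^sup>2)" by (rule integral_complex_of_real)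
  also have "\<dots> = 1" using entries_variance[OF i_range i_range[OF g_gr], OF assms(1,1)] by simp
  finally show ?thesis .
qed

text \<open>Equivalent arcs that are not opposite are parallel and no loops, so both carry the same
  off-diagonal entry, whose square has mean 0.\<close>

lemma e_not_opp:
  assumes "u \<in> gr" "v \<in> gr" "u \<noteq> v" "ends \<pi> u = ends \<pi> v" "\<not> opp \<pi> u v"
  shows "e {u, v} = 0"
proof -
  have b: "block \<pi> (\<gamma> u) = block \<pi> (\<gamma> v)" "block \<pi> u = block \<pi> v" using assms(4,5) by (auto simp: ends_eq_iff)
  then have iv: "i (\<gamma> u) = i (\<gamma> v)" "i u = i v" using block_iff assms(1,2) g_gr by auto
  have "block \<pi> (\<gamma> u) \<noteq> block \<pi> u" using b assms(5) by (auto simp: opp_def)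
  then have ne: "i u \<noteq> i (\<gamma> u)" using block_iff[OF g_gr[OF assms(1)] assms(1)] by auto
  have "e {u, v} = (LINT \<omega>|M. (X u \<omega>)\<^sup>2)"
    unfolding e_def using assms(3) iv by (simp add: power2_eq_square)
  then show ?thesis using offdiagonal_square[OF i_range i_range[OF g_gr], OF assms(1,1) ne] by simp
qed

lemma e_zero:
  assumes "C \<in> classes \<pi> gr" "I \<subseteq> gr" "e (C \<inter> I) = 0"
  shows "e I = 0"
  unfolding moment_factor[OF assms(2)] using assms finite_classes[OF finite_gr] by (intro prod_zero) auto

abbreviation "r j \<equiv> (\<lambda>\<omega>. \<Prod>v\<in>sg j. X v \<omega>)"

lemma cumulant_eq: "third_cumulant M (r 1) (r 2) (r 3) =
    e gr - e (sg 1) * e (sg 2 \<union> sg 3) - e (sg 2) * e (sg 1 \<union> sg 3) - e (sg 3) * e (sg 1 \<union> sg 2)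
    + 2 * e (sg 1) * e (sg 2) * e (sg 3)"
proof -
  have fin: "finite (sg 1)" "finite (sg 2)" "finite (sg 3)" by (simp_all add: seg_def)
  have u: "r 1 \<omega> * r 2 \<omega> = (\<Prod>v\<in>sg 1 \<union> sg 2. X v \<omega>)" "r 1 \<omega> * r 3 \<omega> = (\<Prod>v\<in>sg 1 \<union> sg 3. X v \<omega>)"
    "r 2 \<omega> * r 3 \<omega> = (\<Prod>v\<in>sg 2 \<union> sg 3. X v \<omega>)" for \<omega>
    using fin seg_disjoint by (simp_all only: prod.union_disjoint)
  have "r 1 \<omega> * r 2 \<omega> * r 3 \<omega> = (\<Prod>v\<in>gr. X v \<omega>)" for \<omega>
    unfolding u gr_segs using fin seg_disjoint by (subst prod.union_disjoint) auto
  then show ?thesis unfolding third_cumulant_def e_def u by simp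
qed

text \<open>Every product in the cumulant has as a factor the moment of a union of cycles that
  includes cycle \<open>j\<close>.\<close>

lemma cumulant_killed:
  assumes "j \<in> idx" "\<And>I. sg j \<subseteq> I \<Longrightarrow> I \<subseteq> gr \<Longrightarrow> e I = 0"
  shows "third_cumulant M (r 1) (r 2) (r 3) = 0"
proof -
  have s: "sg 1 \<subseteq> gr" "sg 2 \<subseteq> gr" "sg 3 \<subseteq> gr" using gr_segs by auto
  have "j = 1 \<or> j = 2 \<or> j = 3" using assms(1) by blast
  then show ?thesis unfolding cumulant_eq
  proof (elim disjE)
    assume j: "j = 1"
    show "e gr - e (sg 1) * e (sg 2 \<union> sg 3) - e (sg 2) * e (sg 1 \<union> sg 3) - e (sg 3) * e (sg 1 \<union> sg 2)
      + 2 * e (sg 1) * e (sg 2) * e (sg 3) = 0"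
      using assms(2)[of gr] assms(2)[of "sg 1"] assms(2)[of "sg 1 \<union> sg 3"] assms(2)[of "sg 1 \<union> sg 2"] s unfolding j by simp
  next
    assume j: "j = 2"
    show "e gr - e (sg 1) * e (sg 2 \<union> sg 3) - e (sg 2) * e (sg 1 \<union> sg 3) - e (sg 3) * e (sg 1 \<union> sg 2)
      + 2 * e (sg 1) * e (sg 2) * e (sg 3) = 0"
      using assms(2)[of gr] assms(2)[of "sg 2"] assms(2)[of "sg 2 \<union> sg 3"] assms(2)[of "sg 1 \<union> sg 2"] s unfolding j by simp
  next
    assume j: "j = 3"
    show "e gr - e (sg 1) * e (sg 2 \<union> sg 3) - e (sg 2) * e (sg 1 \<union> sg 3) - e (sg 3) * e (sg 1 \<union> sg 2)
      + 2 * e (sg 1) * e (sg 2) * e (sg 3) = 0"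
      using assms(2)[of gr] assms(2)[of "sg 3"] assms(2)[of "sg 2 \<union> sg 3"] assms(2)[of "sg 1 \<union> sg 3"] s unfolding j by simp
  qed
qed

lemma killed_by_class:
  assumes C: "C \<in> classes \<pi> gr" and v: "v \<in> C" and k: "\<And>I. v \<in> I \<Longrightarrow> I \<subseteq> gr \<Longrightarrow> e (C \<inter> I) = 0"
  shows "third_cumulant M (r 1) (r 2) (r 3) = 0"
proof -
  have "v \<in> gr" using classes_sub[OF C] v by blast
  then obtain j where j: "j \<in> idx" "v \<in> sg j" using gr_seg_ex by blast
  show ?thesis
  proof (rule cumulant_killed[OF j(1)])
    fix I assume I: "sg j \<subseteq> I" "I \<subseteq> gr"
    then have "v \<in> I" using j(2) by blast
    then show "e I = 0" using e_zero[OF C I(2)] k I(2) by blast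
  qed
qed

section \<open>Kernels with a nonzero cumulant\<close>

lemma cumulant_nonzero_size:
  assumes nz: "third_cumulant M (r 1) (r 2) (r 3) \<noteq> 0" and C: "C \<in> classes \<pi> gr"
  shows "2 \<le> card C"
proof (rule ccontr)
  assume "\<not> ?thesis"
  moreover have "card C \<noteq> 0" using classes_ne[OF C] finite_class[OF C] by simp
  ultimately have "card C = 1" by linarith
  then obtain v where v: "C = {v}" by (auto simp: card_1_singleton_iff)
  have vg: "v \<in> gr" using classes_sub[OF C] v by blast
  have "third_cumulant M (r 1) (r 2) (r 3) = 0"
  proof (rule killed_by_class[OF C])
    show "v \<in> C" using v by blast
    show "e (C \<inter> I) = 0" if "v \<in> I" for I using that e_single[OF vg] by (simp add: v)
  qed
  then show False using nz by contradiction
qed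

lemma cumulant_nonzero_opp:
  assumes nz: "third_cumulant M (r 1) (r 2) (r 3) \<noteq> 0" and C: "C \<in> classes \<pi> gr" "card C = 2"
  shows "oppP \<pi> C"
proof -
  obtain u where u: "u \<in> C" using classes_ne[OF C(1)] by blast
  obtain v where v: "v \<noteq> u" "C = {u, v}" using card_2_partner[OF C(2) u] by blast
  have g: "u \<in> gr" "v \<in> gr" using classes_sub[OF C(1)] v by blast+
  have en: "ends \<pi> u = ends \<pi> v" using classes_ends[OF C(1)] v by blast
  have "opp \<pi> u v"
  proof (rule ccontr)
    assume no: "\<not> opp \<pi> u v"
    have "third_cumulant M (r 1) (r 2) (r 3) = 0"
    proof (rule killed_by_class[OF C(1) u])
      fix I assume I: "u \<in> I"
      show "e (C \<inter> I) = 0"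
      proof (cases "v \<in> I")
        case True
        then have "C \<inter> I = {u, v}" using I v(2) by blast
        then show ?thesis using e_not_opp[OF g v(1)[symmetric] en no] by simp
      next
        case False
        then have "C \<inter> I = {u}" using I v(2) by blast
        then show ?thesis using e_single[OF g(1)] by simp
      qed
    qed
    then show False using nz by contradiction
  qed
  then have "opp \<pi> u v" "opp \<pi> v u" using opp_sym by blast+
  then show ?thesis unfolding oppP_def v(2) by blast
qed

lemma e_dbl: assumes "C \<in> classes \<pi> gr" "card C = 2" "oppP \<pi> C" shows "e C = 1"
proof -
  obtain u where u: "u \<in> C" using classes_ne[OF assms(1)] by blast
  obtain v where v: "v \<noteq> u" "C = {u, v}" using card_2_partner[OF assms(2) u] by blast
  have g: "u \<in> gr" "v \<in> gr" using classes_sub[OF assms(1)] v by blast+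
  have "opp \<pi> u v" using assms(3) v unfolding oppP_def by simp
  then show ?thesis using e_opp[OF g v(1)[symmetric]] v(2) by simp
qed

lemma unsplit_absorb:
  assumes all: "\<And>C. C \<in> classes \<pi> gr \<Longrightarrow> card C = 2 \<and> oppP \<pi> C"
    and uns: "\<And>C. C \<in> classes \<pi> gr \<Longrightarrow> unsplit C J" and J: "J \<subseteq> gr" "I \<subseteq> gr" "J \<inter> I = {}"
  shows "e (J \<union> I) = e I"
proof -
  have JI: "J \<union> I \<subseteq> gr" using J by blast
  show ?thesis unfolding moment_factor[OF JI] moment_factor[OF J(2)]
  proof (rule prod.cong[OF refl])
    fix C assume C: "C \<in> classes \<pi> gr"
    show "e (C \<inter> (J \<union> I)) = e (C \<inter> I)"
    proof (cases "C \<subseteq> J")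
      case True
      then have "C \<inter> (J \<union> I) = C" "C \<inter> I = {}" using J(3) by blast+
      then show ?thesis using e_dbl[OF C] all[OF C] e_empty by simp
    next
      case False
      then have "C \<inter> (J \<union> I) = C \<inter> I" using uns[OF C] unfolding unsplit_def by blast
      then show ?thesis by simp
    qed
  qed
qed

text \<open>If cycle \<open>j\<close> splits no class, its factor acts in all these moments like the
  constant 1, and a cumulant with a constant argument vanishes.\<close>

lemma cumulant_nonzero_linked:
  assumes nz: "third_cumulant M (r 1) (r 2) (r 3) \<noteq> 0"
    and all: "\<And>C. C \<in> classes \<pi> gr \<Longrightarrow> card C = 2 \<and> oppP \<pi> C" and j: "j \<in> idx"
  shows "\<exists>C\<in>classes \<pi> gr. \<not> unsplit C (sg j)"
proof (rule ccontr)
  assume "\<not> ?thesis"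
  then have uns: "unsplit C (sg j)" if "C \<in> classes \<pi> gr" for C using that by blast
  have ab: "e (sg j \<union> I) = e I" if "I \<subseteq> gr" "sg j \<inter> I = {}" for I
    by (rule unsplit_absorb[OF all uns seg_gr[OF j] that])
  have e1: "e (sg j) = 1" using ab[of "{}"] e_empty by simp
  have s: "sg 1 \<subseteq> gr" "sg 2 \<subseteq> gr" "sg 3 \<subseteq> gr" "sg 2 \<union> sg 3 \<subseteq> gr" "sg 1 \<union> sg 3 \<subseteq> gr" "sg 1 \<union> sg 2 \<subseteq> gr" using gr_segs by auto
  have g: "gr = sg 1 \<union> (sg 2 \<union> sg 3)" "gr = sg 2 \<union> (sg 1 \<union> sg 3)" "gr = sg 3 \<union> (sg 1 \<union> sg 2)" using gr_segs by auto
  have d: "sg 1 \<inter> sg 2 = {}" "sg 1 \<inter> sg 3 = {}" "sg 2 \<inter> sg 1 = {}" "sg 2 \<inter> sg 3 = {}" "sg 3 \<inter> sg 1 = {}" "sg 3 \<inter> sg 2 = {}"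
    "sg 1 \<inter> (sg 2 \<union> sg 3) = {}" "sg 2 \<inter> (sg 1 \<union> sg 3) = {}" "sg 3 \<inter> (sg 1 \<union> sg 2) = {}" using seg_disjoint by auto
  have "j = 1 \<or> j = 2 \<or> j = 3" using j by blast
  then have "third_cumulant M (r 1) (r 2) (r 3) = 0" unfolding cumulant_eq
  proof (elim disjE)
    assume j: "j = 1"
    show "e gr - e (sg 1) * e (sg 2 \<union> sg 3) - e (sg 2) * e (sg 1 \<union> sg 3) - e (sg 3) * e (sg 1 \<union> sg 2)
      + 2 * e (sg 1) * e (sg 2) * e (sg 3) = 0"
      using ab[unfolded j, OF s(2) d(1)] ab[unfolded j, OF s(3) d(2)] ab[unfolded j, OF s(4) d(7)] e1[unfolded j]
      unfolding g(1)[symmetric] by simp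
  next
    assume j: "j = 2"
    show "e gr - e (sg 1) * e (sg 2 \<union> sg 3) - e (sg 2) * e (sg 1 \<union> sg 3) - e (sg 3) * e (sg 1 \<union> sg 2)
      + 2 * e (sg 1) * e (sg 2) * e (sg 3) = 0"
      using ab[unfolded j, OF s(1) d(3)] ab[unfolded j, OF s(3) d(4)] ab[unfolded j, OF s(5) d(8)] e1[unfolded j]
      unfolding g(2)[symmetric] Un_commute[of "sg 2" "sg 1"] by simp
  next
    assume j: "j = 3"
    show "e gr - e (sg 1) * e (sg 2 \<union> sg 3) - e (sg 2) * e (sg 1 \<union> sg 3) - e (sg 3) * e (sg 1 \<union> sg 2)
      + 2 * e (sg 1) * e (sg 2) * e (sg 3) = 0"
      using ab[unfolded j, OF s(1) d(5)] ab[unfolded j, OF s(2) d(6)] ab[unfolded j, OF s(6) d(9)] e1[unfolded j]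
      unfolding g(3)[symmetric] Un_commute[of "sg 3" "sg 1"] Un_commute[of "sg 3" "sg 2"] by simp
  qed
  then show False using nz by contradiction
qed

lemma card_Int_1_iff:
  assumes "C \<in> classes \<pi> gr" "card C = 2"
  shows "odd (card (C \<inter> I)) \<longleftrightarrow> \<not> unsplit C I"
proof -
  have fin: "finite C" by (rule finite_class[OF assms(1)])
  obtain u where u: "u \<in> C" using classes_ne[OF assms(1)] by blast
  obtain v where v: "v \<noteq> u" "C = {u, v}" using card_2_partner[OF assms(2) u] by blast
  show ?thesis using v(1) unfolding v(2) unsplit_def by (cases "u \<in> I"; cases "v \<in> I") auto
qed

text \<open>Classes have at least two arcs, and m/2 classes leave no room for more.\<close>

lemma cumulant_nonzero_prof2:
  assumes nz: "third_cumulant M (r 1) (r 2) (r 3) \<noteq> 0" and card: "2 * card (classes \<pi> gr) = mm"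
  shows "prof2 \<pi>"
proof -
  note ge = cumulant_nonzero_size[OF nz]
  have "(\<Sum>C\<in>classes \<pi> gr. card C - 2) = 0" using excess_sum[of \<pi>, OF ge] card by simp
  then have "card C - 2 = 0" if "C \<in> classes \<pi> gr" for C using that finite_classes[OF finite_gr] by simp
  then have two: "card C = 2" if "C \<in> classes \<pi> gr" for C using ge[OF that] that by fastforce
  have all: "card C = 2 \<and> oppP \<pi> C" if "C \<in> classes \<pi> gr" for C
    using two[OF that] cumulant_nonzero_opp[OF nz that two[OF that]] by blast
  show ?thesis unfolding prof2_def
  proof (intro conjI ballI)
    show "card C = 2" "oppP \<pi> C" if "C \<in> classes \<pi> gr" for C using all[OF that] by blast+
    fix j assume j: "j \<in> idx"
    obtain C where C: "C \<in> classes \<pi> gr" "\<not> unsplit C (sg j)" using cumulant_nonzero_linked[OF nz all j] by blast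
    then show "\<exists>C\<in>classes \<pi> gr. odd (card (C \<inter> sg j))" using card_Int_1_iff[OF C(1) two[OF C(1)]] by blast
  qed
qed

text \<open>Every cycle meets some class in a single arc, whose entry is centred, so only
  \<open>e gr\<close> survives; it is a product of variances.\<close>

lemma cumulant_prof2:
  assumes pr: "prof2 \<pi>"
  shows "third_cumulant M (r 1) (r 2) (r 3) = 1"
proof -
  have all: "card C = 2" "oppP \<pi> C" if "C \<in> classes \<pi> gr" for C using pr that unfolding prof2_def by blast+
  have z: "e (sg j) = 0" if j: "j \<in> idx" for j
  proof -
    obtain C where C: "C \<in> classes \<pi> gr" "odd (card (C \<inter> sg j))" using pr j unfolding prof2_def by blast
    have fin: "finite C" by (rule finite_class[OF C(1)])
    have "card (C \<inter> sg j) \<le> 2" using card_mono[OF fin, of "C \<inter> sg j"] all(1)[OF C(1)] by simp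
    moreover have "card (C \<inter> sg j) \<noteq> 2" by (rule notI) (use C(2) in simp)
    moreover have "card (C \<inter> sg j) > 0" by (rule odd_pos[OF C(2)])
    ultimately have "card (C \<inter> sg j) = 1" by linarith
    then obtain v where v: "C \<inter> sg j = {v}" by (auto simp: card_1_singleton_iff)
    then have "v \<in> gr" using classes_sub[OF C(1)] by blast
    then show ?thesis using e_zero[OF C(1) seg_gr[OF j]] e_single v by simp
  qed
  have "e (C \<inter> gr) = 1" if C: "C \<in> classes \<pi> gr" for C
    using e_dbl[OF C all[OF C]] classes_sub[OF C] by (simp add: Int_absorb2)
  then have "e gr = 1" unfolding moment_factor[OF order_refl] by simp
  then show ?thesis unfolding cumulant_eq using z[of 1] z[of 2] z[of 3] by simp
qed

end

section \<open>Double bicircuit partitions and the final count\<close>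

context three_cycles
begin

lemma DB_eq:
  fixes M :: "nat \<Rightarrow> 'w measure"
  assumes ens: "complex_wigner_ensemble M x"
  shows "DB m1 m2 m3 M x = {\<pi> \<in> planar_parts. prof2 \<pi>}"
proof -
  have k3: "wigner_kernel m1 m2 m3 (M N) N (x N) i \<pi>"
    if "N \<ge> 1" "i \<in> gr \<rightarrow>\<^sub>E {1..N}" "kernel_partition gr i = \<pi>" for N i \<pi>
  proof -
    have "complex_wigner_matrix (M N) N (x N)" using ens that(1) by (simp add: complex_wigner_ensemble_def)
    then show ?thesis
      unfolding wigner_kernel_def wigner_kernel_axioms_def
      using three_cycles_axioms that(2,3) by (auto dest: PiE_mem)
  qed
  show ?thesis
  proof (intro equalityI subsetI)
    fix \<pi> assume "\<pi> \<in> DB m1 m2 m3 M x"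
    then have P: "partition_on gr \<pi>" and ty: "double_bicircuit_type m1 m2 m3 M x \<pi>" by (simp_all add: DB_def)
    have "int (card \<pi>) - int (card (classes \<pi> gr)) = - 1"
      and r: "real (card (classes \<pi> gr)) - real (m1 + m2 + m3) / 2 = 0"
      using ty unfolding double_bicircuit_type_def arc_classes_qg[OF P gclosed_gr] by blast+
    moreover have "real (2 * card (classes \<pi> gr)) = real mm" using r unfolding mm_def by simp
    ultimately have c: "card (classes \<pi> gr) = card \<pi> + 1" "2 * card (classes \<pi> gr) = mm"
      unfolding of_nat_eq_iff by linarith+
    obtain N where N: "N \<ge> 1" "C_coeff m1 m2 m3 M x \<pi> N \<noteq> 0" using ty unfolding double_bicircuit_type_def by blast
    then obtain i where i: "i \<in> gr \<rightarrow>\<^sub>E {1..N}" "kernel_partition gr i = \<pi>"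
      and nz: "third_cumulant (M N) (\<lambda>\<omega>. \<Prod>v\<in>sg 1. x N (i v) (i (\<gamma> v)) \<omega>)
        (\<lambda>\<omega>. \<Prod>v\<in>sg 2. x N (i v) (i (\<gamma> v)) \<omega>) (\<lambda>\<omega>. \<Prod>v\<in>sg 3. x N (i v) (i (\<gamma> v)) \<omega>) \<noteq> 0"
      unfolding C_coeff_def Let_def by (auto elim!: sum.not_neutral_contains_not_neutral)
    have "prof2 \<pi>" by (rule wigner_kernel.cumulant_nonzero_prof2[OF k3[OF N(1) i] nz c(2)])
    then show "\<pi> \<in> {\<pi> \<in> planar_parts. prof2 \<pi>}" using P c by (simp add: planar_parts_def)
  next
    fix \<pi> assume "\<pi> \<in> {\<pi> \<in> planar_parts. prof2 \<pi>}"
    then have P: "partition_on gr \<pi>" and mm: "mm = 2 * card \<pi> + 2" and pr: "prof2 \<pi>" by (simp_all add: planar_parts_def)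
    have "(\<Sum>C\<in>classes \<pi> gr. card C) = 2 * card (classes \<pi> gr)" using pr by (simp add: prof2_def)
    then have c: "2 * card (classes \<pi> gr) = mm" using sum_card_classes[OF finite_gr, of \<pi>] card_gr by simp
    have finpi: "finite \<pi>" by (rule finite_elements[OF finite_gr P])
    have "gr \<noteq> {}" using seg_nonempty gr_segs by auto
    then have "\<pi> \<noteq> {}" using P by (auto simp: partition_on_def)
    then have N: "card \<pi> \<ge> 1" using finpi by (simp add: Suc_le_eq card_gt_0_iff)
    obtain h where h: "bij_betw h \<pi> {1..card \<pi>}" using finite_same_card_bij[OF finpi, of "{1..card \<pi>}"] by auto
    \<comment> \<open>Size \<open>card \<pi>\<close> is the least that admits an index function with
      kernel \<open>\<pi>\<close>: number the blocks. All summands of the coefficient then equal the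
      same positive constant, so nothing cancels.\<close>
    define i where "i = restrict (h \<circ> block \<pi>) gr"
    have i: "i \<in> gr \<rightarrow>\<^sub>E {1..card \<pi>}"
      using block_in(1)[OF P] bij_betwE[OF h] by (auto simp: i_def)
    have "i u = i v \<longleftrightarrow> block \<pi> u = block \<pi> v" if "u \<in> gr" "v \<in> gr" for u v
      using that inj_on_eq_iff[OF bij_betw_imp_inj_on[OF h] block_in(1)[OF P that(1)] block_in(1)[OF P that(2)]]
      by (simp add: i_def)
    then have ker: "kernel_partition gr i = \<pi>"
      using kernel_partition_facts[where i = i, OF refl] by (intro partition_eqI[OF _ P]) auto
    let ?S = "{i \<in> gr \<rightarrow>\<^sub>E {1..card \<pi>}. kernel_partition gr i = \<pi>}"
    have finS: "finite ?S" using finite_PiE[OF finite_gr, of "\<lambda>_. {1..card \<pi>}"] by simp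
    let ?c = "complex_of_real (real (card \<pi>) powr (- real (m1 + m2 + m3) / 2 + 1))"
    have "C_coeff m1 m2 m3 M x \<pi> (card \<pi>) = (\<Sum>i\<in>?S. ?c)"
      unfolding C_coeff_def Let_def
    proof (rule sum.cong[OF refl])
      fix i assume "i \<in> ?S"
      then have "wigner_kernel m1 m2 m3 (M (card \<pi>)) (card \<pi>) (x (card \<pi>)) i \<pi>" using k3[OF N] by blast
      from wigner_kernel.cumulant_prof2[OF this pr]
      show "?c * third_cumulant (M (card \<pi>)) (\<lambda>\<omega>. \<Prod>v\<in>sg 1. x (card \<pi>) (i v) (i (\<gamma> v)) \<omega>)
        (\<lambda>\<omega>. \<Prod>v\<in>sg 2. x (card \<pi>) (i v) (i (\<gamma> v)) \<omega>) (\<lambda>\<omega>. \<Prod>v\<in>sg 3. x (card \<pi>) (i v) (i (\<gamma> v)) \<omega>) = ?c"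
        by simp
    qed
    also have "\<dots> = of_nat (card ?S) * ?c" by simp
    also have "\<dots> \<noteq> 0"
    proof -
      have "card ?S \<noteq> 0" using finS i ker by auto
      moreover have "?c \<noteq> 0" using N by simp
      ultimately show ?thesis by simp
    qed
    finally have "\<exists>N\<ge>1. C_coeff m1 m2 m3 M x \<pi> N \<noteq> 0" using N by blast
    moreover have "int (card \<pi>) - int (card (classes \<pi> gr)) = - 1" using c mm by linarith
    moreover have "real (2 * card (classes \<pi> gr)) = real mm" using c by (simp only:)
    then have "real (card (classes \<pi> gr)) - real (m1 + m2 + m3) / 2 = 0" unfolding mm_def by simp
    ultimately have "double_bicircuit_type m1 m2 m3 M x \<pi>"
      unfolding double_bicircuit_type_def arc_classes_qg[OF P gclosed_gr] by blast
    then show "\<pi> \<in> DB m1 m2 m3 M x" using P by (simp add: DB_def)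
  qed
qed

text \<open>These exceptional classes tell the profiles apart: none, one of four arcs, two of them,
  or one of six. For a single class of four, \<open>loopc\<close> decides.\<close>

lemma profile_signatures:
  shows "prof2 \<pi> \<Longrightarrow> {C \<in> classes \<pi> gr. card C \<noteq> 2} = {}"
    and "profX \<pi> i D \<Longrightarrow> {C \<in> classes \<pi> gr. card C \<noteq> 2} = {D} \<and> card D = 4"
    and "prof44 \<pi> i j k D1 D2 \<Longrightarrow> {C \<in> classes \<pi> gr. card C \<noteq> 2} = {D1, D2} \<and> D1 \<noteq> D2"
    and "prof6 \<pi> E \<Longrightarrow> {C \<in> classes \<pi> gr. card C \<noteq> 2} = {E} \<and> card E = 6"
proof -
  show "prof2 \<pi> \<Longrightarrow> {C \<in> classes \<pi> gr. card C \<noteq> 2} = {}" unfolding prof2_def by blast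
  show "{C \<in> classes \<pi> gr. card C \<noteq> 2} = {D} \<and> card D = 4" if X: "profX \<pi> i D"
  proof -
    have q: "quad \<pi> (sg i) D" and r: "\<And>C. C \<in> classes \<pi> gr \<Longrightarrow> C \<noteq> D \<Longrightarrow> card C = 2"
      using X unfolding profX_def by blast+
    have D: "D \<in> classes \<pi> gr" "card D = 4" using q quad_card[OF q] by (simp_all add: quad_def)
    have "card C \<noteq> 2 \<longleftrightarrow> C = D" if "C \<in> classes \<pi> gr" for C using r[OF that] D(2) by auto
    then show ?thesis using D by blast
  qed
  show "{C \<in> classes \<pi> gr. card C \<noteq> 2} = {D1, D2} \<and> D1 \<noteq> D2" if X: "prof44 \<pi> i j k D1 D2"
  proof -
    have q: "quad \<pi> (sg i) D1" "quad \<pi> (sg k) D2" "D1 \<noteq> D2"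
      and r: "\<And>C. C \<in> classes \<pi> gr \<Longrightarrow> C \<noteq> D1 \<Longrightarrow> C \<noteq> D2 \<Longrightarrow> card C = 2"
      using X unfolding prof44_def by blast+
    have D: "D1 \<in> classes \<pi> gr" "card D1 = 4" "D2 \<in> classes \<pi> gr" "card D2 = 4"
      using q quad_card[OF q(1)] quad_card[OF q(2)] by (simp_all add: quad_def)
    have "card C \<noteq> 2 \<longleftrightarrow> C = D1 \<or> C = D2" if "C \<in> classes \<pi> gr" for C using r[OF that] D(2,4) by auto
    then show ?thesis using D q(3) by blast
  qed
  show "{C \<in> classes \<pi> gr. card C \<noteq> 2} = {E} \<and> card E = 6" if X: "prof6 \<pi> E"
  proof -
    have E: "E \<in> classes \<pi> gr" and two: "\<And>l. l \<in> idx \<Longrightarrow> card (E \<inter> sg l) = 2"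
      and r: "\<And>C. C \<in> classes \<pi> gr \<Longrightarrow> C \<noteq> E \<Longrightarrow> card C = 2" using X unfolding prof6_def by blast+
    have c: "card E = 6" using card_split[of 1 2 3, OF refl classes_sub[OF E]] two[of 1] two[of 2] two[of 3] by simp
    have "card C \<noteq> 2 \<longleftrightarrow> C = E" if "C \<in> classes \<pi> gr" for C using r[OF that] c by auto
    then show ?thesis using E c by blast
  qed
qed

text \<open>The block count of a gluing gives one inequality, and the existence of a pairing gives
  the reverse one.\<close>

lemma planar_partsI:
  assumes P: "partition_on gr \<pi>" and mm: "mm \<le> 2 * card \<pi> + 2" and c: "card (pairings \<pi>) \<noteq> 0"
  shows "\<pi> \<in> planar_parts"
proof -
  obtain \<sigma> where "\<sigma> \<in> pairings \<pi>" using c by (metis card.empty equals0I)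
  then show ?thesis using pairings_card_le[OF P] mm P by (auto simp: planar_parts_def)
qed

lemma type_profiles:
  "\<pi> \<in> T26 m1 m2 m3 \<Longrightarrow> \<pi> \<in> planar_parts \<and> (\<exists>D. prof6 \<pi> D)"
  "\<pi> \<in> T244 m1 m2 m3 \<Longrightarrow> \<pi> \<in> planar_parts \<and> (\<exists>i j k D1 D2. prof44 \<pi> i j k D1 D2)"
  "\<pi> \<in> UL24 m1 m2 m3 \<Longrightarrow> \<pi> \<in> planar_parts \<and> (\<exists>i D. profX \<pi> i D \<and> loopc \<pi> D)"
  "\<pi> \<in> UC24 m1 m2 m3 \<Longrightarrow> \<pi> \<in> planar_parts \<and> (\<exists>i D. profX \<pi> i D \<and> \<not> loopc \<pi> D)"
proof -
  show "\<pi> \<in> planar_parts \<and> (\<exists>D. prof6 \<pi> D)" if "\<pi> \<in> T26 m1 m2 m3"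
  proof -
    have t: "partition_on gr \<pi>" "tree_2_6_type m1 m2 m3 \<pi>" using that by (simp_all add: T26_def)
    note pr = tree_2_6_prof[OF t]
    then obtain D where D: "prof6 \<pi> D" by blast
    have "\<pi> \<in> planar_parts" by (rule planar_partsI[OF t(1) conjunct1[OF pr]]) (simp add: card_pairings_prof6[OF D])
    then show ?thesis using D by blast
  qed
  show "\<pi> \<in> planar_parts \<and> (\<exists>i j k D1 D2. prof44 \<pi> i j k D1 D2)" if "\<pi> \<in> T244 m1 m2 m3"
  proof -
    have t: "partition_on gr \<pi>" "tree_2_4_4_type m1 m2 m3 \<pi>" using that by (simp_all add: T244_def)
    note pr = tree_2_4_4_prof[OF t]
    then obtain i j k D1 D2 where D: "prof44 \<pi> i j k D1 D2" by blast
    have "\<pi> \<in> planar_parts" by (rule planar_partsI[OF t(1) conjunct1[OF pr]]) (simp add: card_pairings_prof44[OF D])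
    then show ?thesis using D by blast
  qed
  show "\<pi> \<in> planar_parts \<and> (\<exists>i D. profX \<pi> i D \<and> loopc \<pi> D)" if "\<pi> \<in> UL24 m1 m2 m3"
  proof -
    have t: "partition_on gr \<pi>" "uniloop_2_4_type m1 m2 m3 \<pi>" using that by (simp_all add: UL24_def)
    note pr = uniloop_prof[OF t]
    then obtain i D where D: "profX \<pi> i D" "loopc \<pi> D" by blast
    have "\<pi> \<in> planar_parts" by (rule planar_partsI[OF t(1) conjunct1[OF pr]]) (simp add: card_pairings_profX[OF D(1)])
    then show ?thesis using D by blast
  qed
  show "\<pi> \<in> planar_parts \<and> (\<exists>i D. profX \<pi> i D \<and> \<not> loopc \<pi> D)" if "\<pi> \<in> UC24 m1 m2 m3"
  proof -
    have t: "partition_on gr \<pi>" "unicircuit_2_4_type m1 m2 m3 \<pi>" using that by (simp_all add: UC24_def)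
    note pr = unicircuit_prof[OF t]
    then obtain i D where D: "profX \<pi> i D" "\<not> loopc \<pi> D" by blast
    have "\<pi> \<in> planar_parts" by (rule planar_partsI[OF t(1) conjunct1[OF pr]]) (simp add: card_pairings_profX[OF D(1)])
    then show ?thesis using D by blast
  qed
qed

text \<open>The five alternatives exclude one another by their exceptional classes. Outside of them
  the fibre is empty, as a pairing would put \<open>\<pi>\<close> into one of the types or make it
  satisfy \<open>prof2\<close>.\<close>

lemma pairings_classification:
  assumes planar_parts: "\<pi> \<in> planar_parts"
  shows "card (pairings \<pi>) = of_bool (prof2 \<pi>) + of_bool (\<pi> \<in> UC24 m1 m2 m3) + of_bool (\<pi> \<in> T244 m1 m2 m3)
    + 2 * of_bool (\<pi> \<in> UL24 m1 m2 m3) + 2 * of_bool (\<pi> \<in> T26 m1 m2 m3)"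
proof -
  have P: "partition_on gr \<pi>" and mm: "mm = 2 * card \<pi> + 2" using planar_parts by (simp_all add: planar_parts_def)
  let ?s = "{C \<in> classes \<pi> gr. card C \<noteq> 2}"
  have s2: "?s = {}" if "prof2 \<pi>" by (rule profile_signatures(1)[OF that])
  have sUC: "\<exists>D. ?s = {D} \<and> card D = 4 \<and> \<not> loopc \<pi> D" if "\<pi> \<in> UC24 m1 m2 m3"
    using type_profiles(4)[OF that] profile_signatures(2) by blast
  have sUL: "\<exists>D. ?s = {D} \<and> card D = 4 \<and> loopc \<pi> D" if "\<pi> \<in> UL24 m1 m2 m3"
    using type_profiles(3)[OF that] profile_signatures(2) by blast
  have s44: "\<exists>D E. ?s = {D, E} \<and> D \<noteq> E" if "\<pi> \<in> T244 m1 m2 m3"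
    using type_profiles(2)[OF that] by (elim conjE exE) (drule profile_signatures(3), blast)
  have s6: "\<exists>D. ?s = {D} \<and> card D = 6" if "\<pi> \<in> T26 m1 m2 m3"
    using type_profiles(1)[OF that] profile_signatures(4) by blast
  have ns44: "card ?s = 2" if "\<pi> \<in> T244 m1 m2 m3" using s44[OF that] by (elim exE conjE) simp
  have ns1: "card ?s = 1" if "\<pi> \<in> UC24 m1 m2 m3 \<or> \<pi> \<in> UL24 m1 m2 m3 \<or> \<pi> \<in> T26 m1 m2 m3"
    using that sUC sUL s6 by (elim disjE) (auto simp: card_1_singleton_iff)
  have ns0: "card ?s = 0" if "prof2 \<pi>" unfolding s2[OF that] by simp
  have x1: "\<not> (\<pi> \<in> UC24 m1 m2 m3 \<and> \<pi> \<in> UL24 m1 m2 m3)"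
  proof
    assume a: "\<pi> \<in> UC24 m1 m2 m3 \<and> \<pi> \<in> UL24 m1 m2 m3"
    obtain D where D: "?s = {D}" "\<not> loopc \<pi> D" using sUC a by blast
    obtain E where E: "?s = {E}" "loopc \<pi> E" using sUL a by blast
    have "D = E" using D(1) unfolding E(1) by simp
    then show False using D E by blast
  qed
  have x2: "\<not> (\<pi> \<in> T26 m1 m2 m3 \<and> (\<pi> \<in> UC24 m1 m2 m3 \<or> \<pi> \<in> UL24 m1 m2 m3))"
  proof
    assume a: "\<pi> \<in> T26 m1 m2 m3 \<and> (\<pi> \<in> UC24 m1 m2 m3 \<or> \<pi> \<in> UL24 m1 m2 m3)"
    obtain D where D: "?s = {D}" "card D = 6" using s6 a by blast
    obtain E where E: "?s = {E}" "card E = 4" using sUL sUC a by blast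
    have "D = E" using D(1) unfolding E(1) by simp
    then show False using D E by simp
  qed
  consider "prof2 \<pi>" | "\<pi> \<in> UC24 m1 m2 m3" | "\<pi> \<in> UL24 m1 m2 m3" | "\<pi> \<in> T244 m1 m2 m3" | "\<pi> \<in> T26 m1 m2 m3" |
    "\<not> prof2 \<pi>" "\<pi> \<notin> UC24 m1 m2 m3" "\<pi> \<notin> UL24 m1 m2 m3" "\<pi> \<notin> T244 m1 m2 m3" "\<pi> \<notin> T26 m1 m2 m3" by blast
  then show ?thesis
  proof cases
    case 1
    then have "\<pi> \<notin> UC24 m1 m2 m3" "\<pi> \<notin> UL24 m1 m2 m3" "\<pi> \<notin> T244 m1 m2 m3" "\<pi> \<notin> T26 m1 m2 m3"
      using ns0 ns1 ns44 by force+
    then show ?thesis using 1 card_pairings_prof2[OF 1] by simp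
  next
    case 2
    then have "\<not> prof2 \<pi>" "\<pi> \<notin> UL24 m1 m2 m3" "\<pi> \<notin> T244 m1 m2 m3" "\<pi> \<notin> T26 m1 m2 m3"
      using ns0 ns1 ns44 x1 x2 by force+
    moreover have "card (pairings \<pi>) = 1" using type_profiles(4)[OF 2] card_pairings_profX by fastforce
    ultimately show ?thesis using 2 by simp
  next
    case 3
    then have "\<not> prof2 \<pi>" "\<pi> \<notin> UC24 m1 m2 m3" "\<pi> \<notin> T244 m1 m2 m3" "\<pi> \<notin> T26 m1 m2 m3"
      using ns0 ns1 ns44 x1 x2 by force+
    moreover have "card (pairings \<pi>) = 2" using type_profiles(3)[OF 3] card_pairings_profX by fastforce
    ultimately show ?thesis using 3 by simp
  next
    case 4
    then have "\<not> prof2 \<pi>" "\<pi> \<notin> UC24 m1 m2 m3" "\<pi> \<notin> UL24 m1 m2 m3" "\<pi> \<notin> T26 m1 m2 m3"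
      using ns0 ns1 ns44 by force+
    moreover have "card (pairings \<pi>) = 1" using type_profiles(2)[OF 4] card_pairings_prof44 by blast
    ultimately show ?thesis using 4 by simp
  next
    case 5
    then have "\<not> prof2 \<pi>" "\<pi> \<notin> UC24 m1 m2 m3" "\<pi> \<notin> UL24 m1 m2 m3" "\<pi> \<notin> T244 m1 m2 m3"
      using ns0 ns1 ns44 x2 by force+
    moreover have "card (pairings \<pi>) = 2" using type_profiles(1)[OF 5] card_pairings_prof6 by blast
    ultimately show ?thesis using 5 by simp
  next
    case 6
    have "pairings \<pi> = {}"
    proof (rule ccontr)
      assume "pairings \<pi> \<noteq> {}"
      then obtain \<sigma> where \<sigma>: "\<sigma> \<in> pairings \<pi>" by blast
      interpret balanced_pairing m1 m2 m3 \<pi> \<sigma> by unfold_locales (rule P, rule \<sigma>, rule mm)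
      show False using pairing_type P 6 by (auto simp: T26_def T244_def UL24_def UC24_def)
    qed
    then show ?thesis using 6 by simp
  qed
qed

lemma card_NC2_types:
  assumes ens: "complex_wigner_ensemble M x"
  shows "card (NC2 m1 m2 m3) = card (DB m1 m2 m3 M x) + card (UC24 m1 m2 m3) + card (T244 m1 m2 m3)
    + 2 * card (UL24 m1 m2 m3) + 2 * card (T26 m1 m2 m3)"
proof -
  have count: "(\<Sum>\<pi>\<in>planar_parts. of_bool (\<pi> \<in> S)) = card S" if "S \<subseteq> planar_parts" for S
    using that finite_planar_parts by (simp add: Int_absorb1)
  have sub: "UC24 m1 m2 m3 \<subseteq> planar_parts" "T244 m1 m2 m3 \<subseteq> planar_parts" "UL24 m1 m2 m3 \<subseteq> planar_parts" "T26 m1 m2 m3 \<subseteq> planar_parts"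
    using type_profiles by blast+
  have DB: "(\<Sum>\<pi>\<in>planar_parts. of_bool (prof2 \<pi>)) = card (DB m1 m2 m3 M x)"
    unfolding DB_eq[OF ens] using finite_planar_parts by (simp add: Int_def)
  have "card (NC2 m1 m2 m3) = (\<Sum>\<pi>\<in>planar_parts. of_bool (prof2 \<pi>) + of_bool (\<pi> \<in> UC24 m1 m2 m3) + of_bool (\<pi> \<in> T244 m1 m2 m3)
    + 2 * of_bool (\<pi> \<in> UL24 m1 m2 m3) + 2 * of_bool (\<pi> \<in> T26 m1 m2 m3))"
    unfolding card_NC2 by (rule sum.cong[OF refl]) (rule pairings_classification)
  then show ?thesis
    unfolding sum.distrib sum_distrib_left[symmetric] DB count[OF sub(1)] count[OF sub(2)] count[OF sub(3)] count[OF sub(4)] .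
qed

end

theorem corollary8p17:
  fixes m1 m2 m3 :: nat
    and M :: "nat \<Rightarrow> 'w measure"
    and x :: "nat \<Rightarrow> nat \<Rightarrow> nat \<Rightarrow> 'w \<Rightarrow> complex"
  assumes "m1 \<ge> 1" and "m2 \<ge> 1" and "m3 \<ge> 1"
    and "complex_wigner_ensemble M x"
  shows "int (card (DB m1 m2 m3 M x)) =
           int (card (NC2 m1 m2 m3)) - int (card (UC24 m1 m2 m3)) - int (card (T244 m1 m2 m3))
           - 2 * int (card (UL24 m1 m2 m3)) - 2 * int (card (T26 m1 m2 m3))"
proof -
  interpret three_cycles m1 m2 m3 using assms(1-3) by unfold_locales
  show ?thesis using card_NC2_types[OF assms(4)] by simp
qed

end
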